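(* Let $I$ be the category with objects $\mathbf n=\{1,\dots,n\}$ for $n\ge 0$ (with $\mathbf 0=\emptyset$) and all injective maps as morphisms, let $\mathbb N\subset I$ be the subcategory with all objects but only the inclusions as morphisms, and let $M$ be the monoid of injective self-maps of $\omega=\{1,2,3,\dots\}$. For every functor $F:I\to\mathcal Ab$ to abelian groups and all $p\ge 0$ there are isomorphisms of abelian groups, natural in $F$, $$\operatorname{colim}^p_I F\ \cong\ \operatorname{Tor}^{\mathbb Z[M]}_p(\mathbb Z,\operatorname{colim}_{\mathbb N}F).$$
   Context: $\operatorname{colim}^p_I$ denotes the $p$-th left derived functor of the functor $\operatorname{colim}_I$ from functors $I\to\mathcal Ab$ to abelian groups. $\mathbb Z$ is the trivial right $\mathbb Z[M]$-module. The left $M$-action on $\operatorname{colim}_{\mathbb N}F$ is defined as follows: for $f\in M$ and a class $[x]$ represented by $x\in F(\mathbf n)$, let $m=\max f(\mathbf n)$ (with $m=0$ if $n=0$), let $f|_{\mathbf n}:\mathbf n\to\mathbf m$ be the restriction of $f$, and put $f\cdot[x]=[F(f|_{\mathbf n})(x)]$. This is well defined. *)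

theory Defs
  imports "HOL-Algebra.Algebra"
begin

section \<open>Abelian groups, quotients and homology\<close>

text \<open>
  As in \<^theory>\<open>HOL-Algebra.Free_Abelian_Groups\<close>, abelian groups are \<^const>\<open>comm_group\<close>s, hence are
  written multiplicatively even where the mathematics is additive.
\<close>

text \<open>The map \<open>G/K \<rightarrow> G'/K'\<close> induced by \<open>h : G \<rightarrow> G'\<close>; only \<open>K'\<close> enters the formula, the
  argument \<open>S\<close> being a coset of \<open>K\<close>.\<close>

definition quot_map :: "('b, 'n) monoid_scheme \<Rightarrow> 'b set \<Rightarrow> ('a \<Rightarrow> 'b) \<Rightarrow> 'a set \<Rightarrow> 'b set"
  where "quot_map G' K' h S = the_elem ((\<lambda>x. K' #>\<^bsub>G'\<^esub> h x) ` S)"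

text \<open>A chain complex is given by groups \<open>G n\<close> and differentials \<open>d n : G (n + 1) \<rightarrow> G n\<close>.\<close>

definition cycles ::
    "(nat \<Rightarrow> ('a, 'm) monoid_scheme) \<Rightarrow> (nat \<Rightarrow> 'a \<Rightarrow> 'a) \<Rightarrow> nat \<Rightarrow> 'a set"
  where "cycles G d p =
    (case p of 0 \<Rightarrow> carrier (G 0) | Suc q \<Rightarrow> kernel (G (Suc q)) (G q) (d q))"

definition boundaries ::
    "(nat \<Rightarrow> ('a, 'm) monoid_scheme) \<Rightarrow> (nat \<Rightarrow> 'a \<Rightarrow> 'a) \<Rightarrow> nat \<Rightarrow> 'a set"
  where "boundaries G d p = d p ` carrier (G (Suc p))"

definition homology ::
    "(nat \<Rightarrow> ('a, 'm) monoid_scheme) \<Rightarrow> (nat \<Rightarrow> 'a \<Rightarrow> 'a) \<Rightarrow> nat \<Rightarrow> 'a set monoid"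
  where "homology G d p = (G p)\<lparr>carrier := cycles G d p\<rparr> Mod boundaries G d p"

definition homology_map ::
    "(nat \<Rightarrow> ('b, 'n) monoid_scheme) \<Rightarrow> (nat \<Rightarrow> 'b \<Rightarrow> 'b) \<Rightarrow> (nat \<Rightarrow> 'a \<Rightarrow> 'b) \<Rightarrow> nat \<Rightarrow> 'a set \<Rightarrow> 'b set"
  where "homology_map G' d' t p = quot_map (G' p) (boundaries G' d' p) (t p)"

definition exact_augmented ::
    "(nat \<Rightarrow> ('b, 'm) monoid_scheme) \<Rightarrow> (nat \<Rightarrow> 'b \<Rightarrow> 'b) \<Rightarrow> ('a, 'n) monoid_scheme \<Rightarrow> ('b \<Rightarrow> 'a) \<Rightarrow> bool"
  where "exact_augmented G d H e \<longleftrightarrow>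
    e ` carrier (G 0) = carrier H \<and>
    kernel (G 0) H e = d 0 ` carrier (G 1) \<and>
    (\<forall>n. kernel (G (Suc n)) (G n) (d n) = d (Suc n) ` carrier (G (Suc (Suc n))))"


section \<open>Small categories, functors to abelian groups and colimits\<close>

record ('o, 'm) cat =
  Ob :: "'o set"
  Ar :: "'m set"
  src :: "'m \<Rightarrow> 'o"
  tgt :: "'m \<Rightarrow> 'o"
  idn :: "'o \<Rightarrow> 'm"
  cmp :: "'m \<Rightarrow> 'm \<Rightarrow> 'm"

definition category :: "('o, 'm) cat \<Rightarrow> bool"
  where "category C \<longleftrightarrow>
    (\<forall>f\<in>Ar C. src C f \<in> Ob C \<and> tgt C f \<in> Ob C) \<and>
    (\<forall>c\<in>Ob C. idn C c \<in> Ar C \<and> src C (idn C c) = c \<and> tgt C (idn C c) = c) \<and>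
    (\<forall>f\<in>Ar C. \<forall>g\<in>Ar C. tgt C f = src C g \<longrightarrow>
      cmp C g f \<in> Ar C \<and> src C (cmp C g f) = src C f \<and> tgt C (cmp C g f) = tgt C g) \<and>
    (\<forall>f\<in>Ar C. cmp C f (idn C (src C f)) = f \<and> cmp C (idn C (tgt C f)) f = f) \<and>
    (\<forall>f\<in>Ar C. \<forall>g\<in>Ar C. \<forall>h\<in>Ar C. tgt C f = src C g \<and> tgt C g = src C h \<longrightarrow>
      cmp C h (cmp C g f) = cmp C (cmp C h g) f)"

record ('o, 'm, 'a) abfun =
  fob :: "'o \<Rightarrow> 'a monoid"
  far :: "'m \<Rightarrow> 'a \<Rightarrow> 'a"

definition ab_functor :: "('o, 'm) cat \<Rightarrow> ('o, 'm, 'a) abfun \<Rightarrow> bool"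
  where "ab_functor C F \<longleftrightarrow>
    (\<forall>c\<in>Ob C. comm_group (fob F c)) \<and>
    (\<forall>f\<in>Ar C. far F f \<in> hom (fob F (src C f)) (fob F (tgt C f))) \<and>
    (\<forall>c\<in>Ob C. \<forall>x\<in>carrier (fob F c). far F (idn C c) x = x) \<and>
    (\<forall>f\<in>Ar C. \<forall>g\<in>Ar C. tgt C f = src C g \<longrightarrow>
      (\<forall>x\<in>carrier (fob F (src C f)). far F (cmp C g f) x = far F g (far F f x)))"

definition nat_trans ::
    "('o, 'm) cat \<Rightarrow> ('o, 'm, 'a) abfun \<Rightarrow> ('o, 'm, 'b) abfun \<Rightarrow> ('o \<Rightarrow> 'a \<Rightarrow> 'b) \<Rightarrow> bool"
  where "nat_trans C F G t \<longleftrightarrow>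
    (\<forall>c\<in>Ob C. t c \<in> hom (fob F c) (fob G c)) \<and>
    (\<forall>f\<in>Ar C. \<forall>x\<in>carrier (fob F (src C f)).
      t (tgt C f) (far F f x) = far G f (t (src C f) x))"

text \<open>\<open>colim\<^sub>C F\<close> is the quotient of \<open>\<Oplus>\<^sub>c F(c)\<close> that identifies \<open>x \<in> F(c)\<close> with \<open>F(f)(x) \<in> F(c')\<close>
  for every \<open>f : c \<rightarrow> c'\<close>.\<close>

definition coprod :: "('o, 'm) cat \<Rightarrow> ('o, 'm, 'a) abfun \<Rightarrow> ('o \<Rightarrow> 'a) monoid"
  where "coprod C F = sum_group (Ob C) (fob F)"

definition coprod_inj :: "('o, 'm) cat \<Rightarrow> ('o, 'm, 'a) abfun \<Rightarrow> 'o \<Rightarrow> 'a \<Rightarrow> ('o \<Rightarrow> 'a)"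
  where "coprod_inj C F c x = (\<lambda>i\<in>Ob C. if i = c then x else \<one>\<^bsub>fob F i\<^esub>)"

definition colim_rel :: "('o, 'm) cat \<Rightarrow> ('o, 'm, 'a) abfun \<Rightarrow> ('o \<Rightarrow> 'a) set"
  where "colim_rel C F = generate (coprod C F)
    {coprod_inj C F (src C f) x \<otimes>\<^bsub>coprod C F\<^esub>
       inv\<^bsub>coprod C F\<^esub> (coprod_inj C F (tgt C f) (far F f x)) | f x.
     f \<in> Ar C \<and> x \<in> carrier (fob F (src C f))}"

definition colim :: "('o, 'm) cat \<Rightarrow> ('o, 'm, 'a) abfun \<Rightarrow> ('o \<Rightarrow> 'a) set monoid"
  where "colim C F = coprod C F Mod colim_rel C F"

definition colim_class :: "('o, 'm) cat \<Rightarrow> ('o, 'm, 'a) abfun \<Rightarrow> 'o \<Rightarrow> 'a \<Rightarrow> ('o \<Rightarrow> 'a) set"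
  where "colim_class C F c x = colim_rel C F #>\<^bsub>coprod C F\<^esub> coprod_inj C F c x"

text \<open>The map \<open>colim\<^sub>C F \<rightarrow> colim\<^sub>C G\<close> induced by a natural transformation \<open>t : F \<rightarrow> G\<close>.\<close>

definition colim_map ::
    "('o, 'm) cat \<Rightarrow> ('o, 'm, 'b) abfun \<Rightarrow> ('o \<Rightarrow> 'a \<Rightarrow> 'b) \<Rightarrow> ('o \<Rightarrow> 'a) set \<Rightarrow> ('o \<Rightarrow> 'b) set"
  where "colim_map C G t = quot_map (coprod C G) (colim_rel C G) (\<lambda>s. \<lambda>i\<in>Ob C. t i (s i))"


section \<open>Derived functors of the colimit\<close>

text \<open>
  Projectivity of \<open>P\<close> is the lifting property against epimorphisms (that is, objectwise surjections)
  \<open>B \<rightarrow> E\<close>. A definition in HOL has to fix the types of the elements of \<open>E\<close> and \<open>B\<close>. The types below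
  accommodate \<open>E = P\<close> and the free functor \<open>B(c) = \<Oplus>\<^bsub>c'\<^esub> \<Oplus>\<^bsub>x \<in> P(c')\<^esub> \<int>[C(c', c)]\<close> that covers it; as
  lifting against this one epimorphism makes \<open>P\<close> a direct summand of a free functor, the lifting
  property for elements of any other types follows.
\<close>

definition proj_functor :: "('o, 'm) cat \<Rightarrow> ('o, 'm, 'b) abfun \<Rightarrow> bool"
  where "proj_functor C P \<longleftrightarrow> ab_functor C P \<and>
    (\<forall>(E :: ('o, 'm, 'b) abfun) (B :: ('o, 'm, ('m \<times> 'b) \<Rightarrow>\<^sub>0 int) abfun) q t.
      ab_functor C E \<and> ab_functor C B \<and>
      nat_trans C B E q \<and> (\<forall>c\<in>Ob C. q c ` carrier (fob B c) = carrier (fob E c)) \<and>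
      nat_trans C P E t \<longrightarrow>
      (\<exists>s. nat_trans C P B s \<and> (\<forall>c\<in>Ob C. \<forall>x\<in>carrier (fob P c). q c (s c x) = t c x)))"

text \<open>A resolution \<open>\<cdots> \<rightarrow> P 1 \<rightarrow> P 0 \<rightarrow> F\<close>, where \<open>'b\<close> is the type of elements of the \<open>P n\<close> and
  \<open>'a\<close> that of \<open>F\<close>.\<close>

record ('o, 'm, 'b, 'a) fun_res =
  fres :: "nat \<Rightarrow> ('o, 'm, 'b) abfun"
  fdiff :: "nat \<Rightarrow> 'o \<Rightarrow> 'b \<Rightarrow> 'b"
  faug :: "'o \<Rightarrow> 'b \<Rightarrow> 'a"

definition proj_resolution ::
    "('o, 'm) cat \<Rightarrow> ('o, 'm, 'a) abfun \<Rightarrow> ('o, 'm, 'b, 'a) fun_res \<Rightarrow> bool"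
  where "proj_resolution C F P \<longleftrightarrow>
    (\<forall>n. proj_functor C (fres P n)) \<and>
    (\<forall>n. nat_trans C (fres P (Suc n)) (fres P n) (fdiff P n)) \<and>
    nat_trans C (fres P 0) F (faug P) \<and>
    (\<forall>c\<in>Ob C. exact_augmented (\<lambda>n. fob (fres P n) c) (\<lambda>n. fdiff P n c) (fob F c) (faug P c))"

text \<open>Chain maps between resolutions of \<open>F\<close> and \<open>G\<close> covering \<open>u : F \<rightarrow> G\<close>.\<close>

definition res_lift ::
    "('o, 'm) cat \<Rightarrow> ('o, 'm, 'a) abfun \<Rightarrow> ('o, 'm, 'b, 'a) fun_res \<Rightarrow> ('o, 'm, 'b, 'a) fun_res \<Rightarrow>
     ('o \<Rightarrow> 'a \<Rightarrow> 'a) \<Rightarrow> (nat \<Rightarrow> 'o \<Rightarrow> 'b \<Rightarrow> 'b) \<Rightarrow> bool"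
  where "res_lift C F P P' u t \<longleftrightarrow>
    (\<forall>n. nat_trans C (fres P n) (fres P' n) (t n)) \<and>
    (\<forall>n. \<forall>c\<in>Ob C. \<forall>x\<in>carrier (fob (fres P (Suc n)) c).
      t n c (fdiff P n c x) = fdiff P' n c (t (Suc n) c x)) \<and>
    (\<forall>c\<in>Ob C. \<forall>x\<in>carrier (fob (fres P 0) c). faug P' c (t 0 c x) = u c (faug P c x))"

text \<open>The \<open>p\<close>-th left derived functor of \<open>colim\<^sub>C\<close> at \<open>F\<close>, computed from a projective resolution \<open>P\<close> of
  \<open>F\<close>, and the map induced by a chain map \<open>t\<close> into a resolution \<open>P'\<close>.\<close>

definition colim_cx :: "('o, 'm) cat \<Rightarrow> ('o, 'm, 'b, 'a) fun_res \<Rightarrow> nat \<Rightarrow> ('o \<Rightarrow> 'b) set monoid"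
  where "colim_cx C P n = colim C (fres P n)"

definition colim_diff ::
    "('o, 'm) cat \<Rightarrow> ('o, 'm, 'b, 'a) fun_res \<Rightarrow> nat \<Rightarrow> ('o \<Rightarrow> 'b) set \<Rightarrow> ('o \<Rightarrow> 'b) set"
  where "colim_diff C P n = colim_map C (fres P n) (fdiff P n)"

definition derived_colim ::
    "('o, 'm) cat \<Rightarrow> ('o, 'm, 'b, 'a) fun_res \<Rightarrow> nat \<Rightarrow> ('o \<Rightarrow> 'b) set set monoid"
  where "derived_colim C P p = homology (colim_cx C P) (colim_diff C P) p"

definition derived_colim_map ::
    "('o, 'm) cat \<Rightarrow> ('o, 'm, 'b, 'a) fun_res \<Rightarrow> (nat \<Rightarrow> 'o \<Rightarrow> 'b \<Rightarrow> 'b) \<Rightarrow> nat \<Rightarrow>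
     ('o \<Rightarrow> 'b) set set \<Rightarrow> ('o \<Rightarrow> 'b) set set"
  where "derived_colim_map C P' t p =
    homology_map (colim_cx C P') (colim_diff C P') (\<lambda>n. colim_map C (fres P' n) (t n)) p"


section \<open>Modules over a not necessarily commutative ring, tensor products and Tor\<close>

text \<open>\<open>act A r x\<close> is \<open>r x\<close> in a left module and \<open>x r\<close> in a right module.\<close>

record ('r, 'a) rmod = "'a monoid" +
  act :: "'r \<Rightarrow> 'a \<Rightarrow> 'a"

locale left_module = ring R + comm_group A
  for R :: "'r ring" (structure) and A :: "('r, 'a) rmod" +
  assumes act_hom: "r \<in> carrier R \<Longrightarrow> act A r \<in> hom A A"
    and act_add: "\<lbrakk>r \<in> carrier R; s \<in> carrier R; x \<in> carrier A\<rbrakk> \<Longrightarrow>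
      act A (r \<oplus> s) x = act A r x \<otimes>\<^bsub>A\<^esub> act A s x"
    and act_mult: "\<lbrakk>r \<in> carrier R; s \<in> carrier R; x \<in> carrier A\<rbrakk> \<Longrightarrow>
      act A (r \<otimes> s) x = act A r (act A s x)"
    and act_one: "x \<in> carrier A \<Longrightarrow> act A \<one> x = x"

locale right_module = ring R + comm_group A
  for R :: "'r ring" (structure) and A :: "('r, 'a) rmod" +
  assumes act_hom: "r \<in> carrier R \<Longrightarrow> act A r \<in> hom A A"
    and act_add: "\<lbrakk>r \<in> carrier R; s \<in> carrier R; x \<in> carrier A\<rbrakk> \<Longrightarrow>
      act A (r \<oplus> s) x = act A r x \<otimes>\<^bsub>A\<^esub> act A s x"
    and act_mult: "\<lbrakk>r \<in> carrier R; s \<in> carrier R; x \<in> carrier A\<rbrakk> \<Longrightarrow>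
      act A (r \<otimes> s) x = act A s (act A r x)"
    and act_one: "x \<in> carrier A \<Longrightarrow> act A \<one> x = x"

definition mod_hom :: "'r ring \<Rightarrow> ('r, 'a) rmod \<Rightarrow> ('r, 'b) rmod \<Rightarrow> ('a \<Rightarrow> 'b) set"
  where "mod_hom R A B =
    {h \<in> hom A B. \<forall>r\<in>carrier R. \<forall>x\<in>carrier A. h (act A r x) = act B r (h x)}"

text \<open>As for functors, the types of \<open>E\<close> and \<open>B\<close> accommodate \<open>E = P\<close> and the free right module on the
  set \<open>P\<close> (finitely supported functions from \<open>P\<close> to \<open>R\<close>).\<close>

definition proj_right_module :: "'r ring \<Rightarrow> ('r, 'b) rmod \<Rightarrow> bool"
  where "proj_right_module R P \<longleftrightarrow> right_module R P \<and>
    (\<forall>(E :: ('r, 'b) rmod) (B :: ('r, 'b \<Rightarrow> 'r) rmod) q t.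
      right_module R E \<and> right_module R B \<and>
      q \<in> mod_hom R B E \<and> q ` carrier B = carrier E \<and> t \<in> mod_hom R P E \<longrightarrow>
      (\<exists>s\<in>mod_hom R P B. \<forall>x\<in>carrier P. q (s x) = t x))"

record ('r, 'b, 'a) mod_res =
  mres :: "nat \<Rightarrow> ('r, 'b) rmod"
  mdiff :: "nat \<Rightarrow> 'b \<Rightarrow> 'b"
  maug :: "'b \<Rightarrow> 'a"

definition proj_right_resolution :: "'r ring \<Rightarrow> ('r, 'a) rmod \<Rightarrow> ('r, 'b, 'a) mod_res \<Rightarrow> bool"
  where "proj_right_resolution R A Q \<longleftrightarrow>
    right_module R A \<and>
    (\<forall>n. proj_right_module R (mres Q n)) \<and>
    (\<forall>n. mdiff Q n \<in> mod_hom R (mres Q (Suc n)) (mres Q n)) \<and>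
    maug Q \<in> mod_hom R (mres Q 0) A \<and>
    exact_augmented (mres Q) (mdiff Q) A (maug Q)"

definition tensor_gens ::
    "('r, 'b) rmod \<Rightarrow> ('r, 'a) rmod \<Rightarrow> ('b \<times> 'a \<Rightarrow>\<^sub>0 int) monoid"
  where "tensor_gens A N = free_Abelian_group (carrier A \<times> carrier N)"

definition tensor_rel ::
    "'r ring \<Rightarrow> ('r, 'b) rmod \<Rightarrow> ('r, 'a) rmod \<Rightarrow> ('b \<times> 'a \<Rightarrow>\<^sub>0 int) set"
  where "tensor_rel R A N = generate (tensor_gens A N)
    ({frag_of (a \<otimes>\<^bsub>A\<^esub> a', x) - frag_of (a, x) - frag_of (a', x) | a a' x.
        a \<in> carrier A \<and> a' \<in> carrier A \<and> x \<in> carrier N} \<union>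
     {frag_of (a, x \<otimes>\<^bsub>N\<^esub> x') - frag_of (a, x) - frag_of (a, x') | a x x'.
        a \<in> carrier A \<and> x \<in> carrier N \<and> x' \<in> carrier N} \<union>
     {frag_of (act A r a, x) - frag_of (a, act N r x) | r a x.
        r \<in> carrier R \<and> a \<in> carrier A \<and> x \<in> carrier N})"

text \<open>\<open>A \<otimes>\<^sub>R N\<close> for a right module \<open>A\<close> and a left module \<open>N\<close>, and the map
  \<open>h \<otimes> k : A \<otimes>\<^sub>R N \<rightarrow> A' \<otimes>\<^sub>R N'\<close>.\<close>

definition tensor :: "'r ring \<Rightarrow> ('r, 'b) rmod \<Rightarrow> ('r, 'a) rmod \<Rightarrow> ('b \<times> 'a \<Rightarrow>\<^sub>0 int) set monoid"
  where "tensor R A N = tensor_gens A N Mod tensor_rel R A N"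

definition tensor_map ::
    "'r ring \<Rightarrow> ('r, 'd) rmod \<Rightarrow> ('r, 'c) rmod \<Rightarrow> ('b \<Rightarrow> 'd) \<Rightarrow> ('a \<Rightarrow> 'c) \<Rightarrow>
     ('b \<times> 'a \<Rightarrow>\<^sub>0 int) set \<Rightarrow> ('d \<times> 'c \<Rightarrow>\<^sub>0 int) set"
  where "tensor_map R A' N' h k = quot_map (tensor_gens A' N') (tensor_rel R A' N')
    (frag_extend (\<lambda>(a, x). frag_of (h a, k x)))"

text \<open>\<open>Tor\<^sup>R\<^sub>p(A, N)\<close> is the \<open>p\<close>-th left derived functor of \<open>_ \<otimes>\<^sub>R N\<close> at \<open>A\<close>, computed from a projective
  resolution \<open>Q\<close> of the right module \<open>A\<close>; \<open>Tor_map\<close> is its functoriality in \<open>N\<close>.\<close>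

definition tensor_cx ::
    "'r ring \<Rightarrow> ('r, 'b, 'c) mod_res \<Rightarrow> ('r, 'a) rmod \<Rightarrow> nat \<Rightarrow> ('b \<times> 'a \<Rightarrow>\<^sub>0 int) set monoid"
  where "tensor_cx R Q N n = tensor R (mres Q n) N"

definition tensor_diff ::
    "'r ring \<Rightarrow> ('r, 'b, 'c) mod_res \<Rightarrow> ('r, 'a) rmod \<Rightarrow> nat \<Rightarrow>
     ('b \<times> 'a \<Rightarrow>\<^sub>0 int) set \<Rightarrow> ('b \<times> 'a \<Rightarrow>\<^sub>0 int) set"
  where "tensor_diff R Q N n = tensor_map R (mres Q n) N (mdiff Q n) (\<lambda>x. x)"

definition Tor ::
    "'r ring \<Rightarrow> ('r, 'b, 'c) mod_res \<Rightarrow> ('r, 'a) rmod \<Rightarrow> nat \<Rightarrow> ('b \<times> 'a \<Rightarrow>\<^sub>0 int) set set monoid"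
  where "Tor R Q N p = homology (tensor_cx R Q N) (tensor_diff R Q N) p"

definition Tor_map ::
    "'r ring \<Rightarrow> ('r, 'b, 'c) mod_res \<Rightarrow> ('r, 'd) rmod \<Rightarrow> ('a \<Rightarrow> 'd) \<Rightarrow> nat \<Rightarrow>
     ('b \<times> 'a \<Rightarrow>\<^sub>0 int) set set \<Rightarrow> ('b \<times> 'd \<Rightarrow>\<^sub>0 int) set set"
  where "Tor_map R Q N' k p =
    homology_map (tensor_cx R Q N') (tensor_diff R Q N')
      (\<lambda>n. tensor_map R (mres Q n) N' (\<lambda>a. a) k) p"


section \<open>Monoid rings\<close>

definition monoid_ring :: "('m, 'n) monoid_scheme \<Rightarrow> ('m \<Rightarrow>\<^sub>0 int) ring"
  where "monoid_ring M =
    \<lparr>carrier = {c. Poly_Mapping.keys c \<subseteq> carrier M},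
     monoid.mult = (\<lambda>a b. frag_extend (\<lambda>f. frag_extend (\<lambda>g. frag_of (f \<otimes>\<^bsub>M\<^esub> g)) b) a),
     one = frag_of \<one>\<^bsub>M\<^esub>, ring.zero = 0, add = (+)\<rparr>"

lemma keys_frag_extend_subset: assumes "Poly_Mapping.keys c \<subseteq> S" 
   "\<And>x. x\<in>S \<Longrightarrow> Poly_Mapping.keys (b x) \<subseteq> T" shows "Poly_Mapping.keys (frag_extend b c) \<subseteq> T"
  using assms(1)
  by (induction c rule: frag_induction) (use assms(2) in \<open>auto simp: frag_extend_diff dest!: subsetD[OF keys_diff]\<close>)

lemma ring_monoid_ring: assumes "Group.monoid M" shows "ring (monoid_ring M)"
proof -
  interpret M: Group.monoid M by fact
  let ?e = "\<lambda>a b. frag_extend (\<lambda>f. frag_extend (\<lambda>g. frag_of (f \<otimes>\<^bsub>M\<^esub> g)) b) a"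
  let ?K = "\<lambda>c. Poly_Mapping.keys c \<subseteq> carrier M"
  have fe: "frag_extend (\<lambda>x. f x + g x) a = frag_extend f a + frag_extend g a" for f g :: "'a \<Rightarrow> 'a \<Rightarrow>\<^sub>0 int" and a
    unfolding frag_extend_def by (simp add: frag_cmul_distrib2 sum.distrib)
  have fd: "frag_extend (\<lambda>x. f x - g x) a = frag_extend f a - frag_extend g a" for f g :: "'a \<Rightarrow> 'a \<Rightarrow>\<^sub>0 int" and a
    using fe[of "\<lambda>x. f x - g x" g a] by (simp)
  have clo: "?K (?e a b)" if "?K a" "?K b" for a b
    using that by (intro keys_frag_extend_subset[OF that(1)] keys_frag_extend_subset[OF that(2)]) auto
  have l1: "?e (frag_of \<one>\<^bsub>M\<^esub>) a = a" if "?K a" for a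
    using that by (induction a rule: frag_induction) (auto simp: frag_extend_diff)
  have r1: "?e a (frag_of \<one>\<^bsub>M\<^esub>) = a" if "?K a" for a
    using that by (induction a rule: frag_induction) (auto simp: frag_extend_diff)
  have dr: "?e (a + b) c = ?e a c + ?e b c" for a b c by (simp add: frag_extend_add)
  have dl: "?e c (a + b) = ?e c a + ?e c b" for a b c by (simp add: frag_extend_add fe)
  have drm: "?e (a - b) c = ?e a c - ?e b c" for a b c by (simp add: frag_extend_diff)
  have dlm: "?e c (a - b) = ?e c a - ?e c b" for a b c by (simp add: frag_extend_diff fd)
  have z: "?e 0 c = 0" "?e c 0 = 0" for c by (simp_all add: frag_extend_def)
  have a3: "?e (?e (frag_of x) (frag_of y)) c = ?e (frag_of x) (?e (frag_of y) c)"
    if "?K c" "x \<in> carrier M" "y \<in> carrier M" for x y c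
    using that(1) apply (induction c rule: frag_induction)
    using that by (auto simp: frag_extend_diff M.m_assoc)
  have a2: "?e (?e (frag_of x) b) c = ?e (frag_of x) (?e b c)"
    if "?K b" "?K c" "x \<in> carrier M" for x b c
    using that(1)
  proof (induction b rule: frag_induction)
    case zero then show ?case by (simp only: z) 
  next case (one y) then show ?case using a3[of c x y] that by blast
  next case (diff a b) then show ?case by (simp only: drm dlm)
  qed
  have a1: "?e (?e a b) c = ?e a (?e b c)" if "?K a" "?K b" "?K c" for a b c
    using that(1)
  proof (induction a rule: frag_induction)
    case zero then show ?case by (simp only: z) 
  next case (one y) then show ?case using a2[of b c y] that by blast
  next case (diff a b) then show ?case by (simp only: drm dlm)
  qed
  show ?thesis
  proof (rule ringI)
    show "abelian_group (monoid_ring M)"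
    proof (rule abelian_groupI)
      fix x assume "x \<in> carrier (monoid_ring M)"
      then show "\<exists>y\<in>carrier (monoid_ring M). y \<oplus>\<^bsub>monoid_ring M\<^esub> x = \<zero>\<^bsub>monoid_ring M\<^esub>"
        by (intro bexI[of _ "-x"]) (auto simp: monoid_ring_def)
    qed (simp_all add: monoid_ring_def add.assoc add.commute order_trans[OF keys_add])
    show "Group.monoid (monoid_ring M)"
      
      apply (rule monoidI) unfolding monoid_ring_def monoid.simps ring.simps partial_object.simps mem_Collect_eq
      subgoal by (rule clo)
      subgoal by simp
      subgoal by (rule a1)
      subgoal by (rule l1)
      subgoal by (rule r1)
      done
    fix x y z
    show "(x \<oplus>\<^bsub>monoid_ring M\<^esub> y) \<otimes>\<^bsub>monoid_ring M\<^esub> z = x \<otimes>\<^bsub>monoid_ring M\<^esub> z \<oplus>\<^bsub>monoid_ring M\<^esub> y \<otimes>\<^bsub>monoid_ring M\<^esub> z"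
      unfolding monoid_ring_def monoid.simps ring.simps partial_object.simps using dr by blast
    show "z \<otimes>\<^bsub>monoid_ring M\<^esub> (x \<oplus>\<^bsub>monoid_ring M\<^esub> y) = z \<otimes>\<^bsub>monoid_ring M\<^esub> x \<oplus>\<^bsub>monoid_ring M\<^esub> z \<otimes>\<^bsub>monoid_ring M\<^esub> y"
      unfolding monoid_ring_def monoid.simps ring.simps partial_object.simps using dl by blast
  qed
qed

text \<open>The \<open>\<int>[M]\<close>-module given by an additive action \<open>a\<close> of \<open>M\<close> on the abelian group \<open>G\<close>:
  \<open>(\<Sum>\<^sub>f n\<^sub>f f) x = \<Sum>\<^sub>f n\<^sub>f (f x)\<close>.\<close>

definition linearize ::
    "('a, 'n) monoid_scheme \<Rightarrow> ('m \<Rightarrow> 'a \<Rightarrow> 'a) \<Rightarrow> ('m \<Rightarrow>\<^sub>0 int, 'a) rmod"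
  where "linearize G a =
    \<lparr>carrier = carrier G, monoid.mult = monoid.mult G, one = one G,
     act = (\<lambda>c x. finprod G (\<lambda>f. a f x [^]\<^bsub>G\<^esub> Poly_Mapping.lookup c f) (Poly_Mapping.keys c))\<rparr>"

definition trivial_module :: "('m \<Rightarrow>\<^sub>0 int, int) rmod"
  where "trivial_module = linearize integer_group (\<lambda>_ x. x)"


section \<open>The categories of finite sets and injections, and of inclusions\<close>

text \<open>The object \<open>{1, \<dots>, n}\<close> is represented by \<open>n\<close>, a map \<open>f : {1, \<dots>, m} \<rightarrow> {1, \<dots>, n}\<close> by
  \<open>(m, f, n)\<close> with \<open>f\<close> extensional.\<close>

type_synonym arrow = "nat \<times> (nat \<Rightarrow> nat) \<times> nat"

definition cat_I :: "(nat, arrow) cat"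
  where "cat_I =
    \<lparr>Ob = UNIV,
     Ar = {(m, f, n) | m f n. f \<in> {1..m} \<rightarrow>\<^sub>E {1..n} \<and> inj_on f {1..m}},
     src = (\<lambda>(m, f, n). m),
     tgt = (\<lambda>(m, f, n). n),
     idn = (\<lambda>n. (n, \<lambda>i\<in>{1..n}. i, n)),
     cmp = (\<lambda>(_, g, k) (m, f, _). (m, compose {1..m} g f, k))\<rparr>"

definition cat_N :: "(nat, arrow) cat"
  where "cat_N = cat_I\<lparr>Ar := {(m, \<lambda>i\<in>{1..m}. i, n) | m n. m \<le> n}\<rparr>"

definition omega :: "nat set"
  where "omega = {1..}"

definition inj_monoid :: "(nat \<Rightarrow> nat) monoid"
  where "inj_monoid =
    \<lparr>carrier = {f \<in> omega \<rightarrow>\<^sub>E omega. inj_on f omega},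
     monoid.mult = compose omega,
     one = (\<lambda>i\<in>omega. i)\<rparr>"

lemma compose_extensional_funcset: "f \<in> A \<rightarrow>\<^sub>E B \<Longrightarrow> g \<in> B \<rightarrow>\<^sub>E C \<Longrightarrow> compose A g f \<in> A \<rightarrow>\<^sub>E C"
  by (auto simp: compose_def)

lemma inj_on_compose_extensional: "f \<in> A \<rightarrow>\<^sub>E B \<Longrightarrow> inj_on f A \<Longrightarrow> inj_on g B \<Longrightarrow> inj_on (compose A g f) A"
  unfolding compose_def inj_on_def by (simp add: PiE_iff)

lemma compose_assoc_extensional: "f \<in> A \<rightarrow>\<^sub>E B \<Longrightarrow> compose A h (compose A g f) = compose A (compose B h g) f"
  unfolding compose_def by (rule restrict_ext) (auto dest: PiE_mem)

lemma compose_id_right: "f \<in> A \<rightarrow>\<^sub>E B \<Longrightarrow> compose A f (\<lambda>i\<in>A. i) = f"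
  unfolding compose_def by (rule ext) (simp add: PiE_iff extensional_def)

lemma compose_id_left: "f \<in> A \<rightarrow>\<^sub>E B \<Longrightarrow> compose A (\<lambda>i\<in>B. i) f = f"
  unfolding compose_def by (rule ext) (simp add: PiE_iff extensional_def)

lemma restrict_id_funcset: "(\<lambda>i\<in>A. i) \<in> A \<rightarrow>\<^sub>E A"  "inj_on (\<lambda>i\<in>A. i) A" by (auto simp: inj_on_def)

lemma Ar_cat_I: "(m, f, n) \<in> Ar cat_I \<longleftrightarrow> f \<in> {1..m} \<rightarrow>\<^sub>E {1..n} \<and> inj_on f {1..m}"
  unfolding cat_I_def cat.simps by blast

lemma Ar_cat_N: "(m, f, n) \<in> Ar cat_N \<longleftrightarrow> f = (\<lambda>i\<in>{1..m}. i) \<and> m \<le> n"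
  unfolding cat_N_def by simp

lemma cat_I_simps: "src cat_I (m, f, n) = m" "tgt cat_I (m, f, n) = n" "idn cat_I n = (n, \<lambda>i\<in>{1..n}. i, n)"
   "cmp cat_I (n', g, k) (m, f, n) = (m, compose {1..m} g f, k)" "Ob cat_I = UNIV"
   "src cat_N = src cat_I" "tgt cat_N = tgt cat_I" "cmp cat_N = cmp cat_I" "idn cat_N = idn cat_I" "Ob cat_N = UNIV"
  by (simp_all add: cat_I_def cat_N_def)

lemma category_cat_I: "category cat_I"
  unfolding category_def split_paired_Ball_Sigma Ball_def split_paired_All cat_I_simps Ar_cat_I
  apply (intro conjI allI impI UNIV_I restrict_id_funcset; (elim conjE)?; (hypsubst_thin)?)
  by (simp_all only: compose_id_right compose_id_left prod.inject compose_extensional_funcset inj_on_compose_extensional compose_assoc_extensional simp_thms)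

lemma category_cat_N: "category cat_N"
  unfolding category_def split_paired_Ball_Sigma Ball_def split_paired_All cat_I_simps Ar_cat_N
  apply (intro conjI allI impI UNIV_I; (elim conjE)?; (hypsubst_thin)?)
  by (auto simp: compose_def restrict_def fun_eq_iff)

lemma cat_N_subset: "Ar cat_N \<subseteq> Ar cat_I"
  unfolding cat_I_def cat_N_def by (auto simp: inj_on_def)

lemma monoid_inj_monoid: "Group.monoid inj_monoid"
  apply (rule monoidI) unfolding inj_monoid_def monoid.simps partial_object.simps mem_Collect_eq
  apply (intro conjI; (elim conjE)?; simp only: compose_extensional_funcset restrict_id_funcset inj_on_compose_extensional)+
  apply (elim conjE, rule compose_assoc_extensional[symmetric], assumption)
  apply (elim conjE, erule compose_id_left)
  apply (elim conjE, erule compose_id_right)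
  done

definition max_image :: "(nat \<Rightarrow> nat) \<Rightarrow> nat \<Rightarrow> nat"
  where "max_image f n = (if n = 0 then 0 else Max (f ` {1..n}))"

text \<open>\<open>f \<cdot> [x] = [F(f|\<^sub>n)(x)]\<close> on \<open>colim\<^sub>N F\<close>, for the restriction of \<open>F : I \<rightarrow> Ab\<close> along \<open>N \<subseteq> I\<close>.
  Since \<^const>\<open>cat_N\<close> has arrows among those of \<^const>\<open>cat_I\<close>, this restriction is \<open>F\<close> itself.\<close>

definition inj_action ::
    "(nat, arrow, 'a) abfun \<Rightarrow> (nat \<Rightarrow> nat) \<Rightarrow> (nat \<Rightarrow> 'a) set \<Rightarrow> (nat \<Rightarrow> 'a) set"
  where "inj_action F f z =
    (THE w. \<exists>n. \<exists>x\<in>carrier (fob F n).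
       z = colim_class cat_N F n x \<and>
       w = colim_class cat_N F (max_image f n)
             (far F (n, restrict f {1..n}, max_image f n) x))"

definition colim_N_module :: "(nat, arrow, 'a) abfun \<Rightarrow> ((nat \<Rightarrow> nat) \<Rightarrow>\<^sub>0 int, (nat \<Rightarrow> 'a) set) rmod"
  where "colim_N_module F = linearize (colim cat_N F) (inj_action F)"

end

theory Submission
  imports Defs
begin

text \<open>
  Let \<open>Q \<rightarrow> \<int>\<close> and \<open>P \<rightarrow> F\<close> be the given resolutions, and consider the bicomplex \<open>Q\<^sub>s \<otimes> colim\<^sub>N P\<^sub>t\<close>.
  Since \<open>colim\<^sub>N\<close> is exact and \<open>Q\<^sub>s\<close> is flat, the rows are resolutions of \<open>Q\<^sub>s \<otimes> colim\<^sub>N F\<close>. The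
  columns are resolutions of \<open>colim\<^sub>I P\<^sub>t\<close>: the chain map \<open>q \<mapsto> \<mu>(q) dbl\<close> of \<open>Q\<close>, where \<open>dbl\<close> is
  multiplication by \<open>2\<close> and \<open>\<mu>\<close> is semilinear along the endomorphism \<open>shift\<close> of \<open>M\<close>, is homotopic
  to the identity, and a section of the free functor covering \<open>P\<^sub>t\<close> makes the map that it induces on the
  column factor through a direct sum of copies of \<open>Q\<close>. In such a bicomplex the ends of a zigzag
  determine each other up to boundaries. This gives the isomorphism, whose naturality is then evident
  because maps of bicomplexes preserve zigzags.
\<close>

section \<open>Homomorphisms and quotients of abelian groups\<close>

text \<open>The crux is that the homology of a column, Tor of the trivial module with
  \<open>colim_N_module P\<close>, vanishes in positive degrees for projective P. For the
  representable functor P = Z[I(k,-)] the colimit along N is Z[Inj({1..k}, omega)] with M acting by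
  composition. This module need not be projective over Z[M]: for k = 0 it is the trivial module, and
  no nonzero element of Z[M] is fixed by all left multiplications. The obstacle is that injections
  of {1..k} into omega do not in general extend equivariantly to elements of M. Twice the injection
  does extend, the odd numbers giving room for the rest, but equivariance then holds only along
  \<open>shift\<close>. So \<open>dbl\<close> acts through a free module, up to this change of
  monoid, and kills positive homology. On the other hand, with M read as a one-object category,
  \<open>dbl\<close> is a natural transformation from the identity to \<open>shift\<close>, and
  natural transformations act as the identity on homology. Both facts together force the
  vanishing.\<close>

lemma hom_div:
  assumes "h \<in> hom G H" "comm_group G" "comm_group H" "x \<in> carrier G" "y \<in> carrier G"
  shows "h (x \<otimes>\<^bsub>G\<^esub> inv\<^bsub>G\<^esub> y) = h x \<otimes>\<^bsub>H\<^esub> inv\<^bsub>H\<^esub> (h y)"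
proof -
  interpret group_hom G H h
    using assms by (simp add: group_hom_def group_hom_axioms_def comm_group.axioms)
  show ?thesis using assms by simp
qed

lemma hom_inv_comm:
  assumes "h \<in> hom G H" "comm_group G" "comm_group H" "x \<in> carrier G"
  shows "h (inv\<^bsub>G\<^esub> x) = inv\<^bsub>H\<^esub> (h x)"
proof -
  interpret group_hom G H h
    using assms by (simp add: group_hom_def group_hom_axioms_def comm_group.axioms)
  show ?thesis using assms by simp
qed

lemma hom_one_comm:
  assumes "h \<in> hom G H" "comm_group G" "comm_group H"
  shows "h \<one>\<^bsub>G\<^esub> = \<one>\<^bsub>H\<^esub>"
  by (rule hom_one[OF assms(1)]) (use assms in \<open>simp_all add: comm_group.axioms\<close>)

lemma (in group) div_eq_one_iff:
  assumes "x \<in> carrier G" "y \<in> carrier G"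
  shows "x \<otimes> inv y = \<one> \<longleftrightarrow> x = y"
  using assms by (metis inv_closed inv_equality inv_inv r_inv)

lemma comm_groupD:
  assumes "comm_group G" shows "group G" "comm_monoid G" "monoid G"
  using assms by (auto simp: comm_group_def group_def)

text \<open>A function that is constant on a coset has a singleton image there, and only then does
  \<open>the_elem\<close> in \<open>quot_map\<close> and in \<open>quotient_universal\<close> carry
  information.\<close>

lemma the_elem_coset:
  assumes "group G" "subgroup K G" "x \<in> carrier G" "\<And>k. k \<in> K \<Longrightarrow> g (k \<otimes>\<^bsub>G\<^esub> x) = g x"
  shows "the_elem (g ` (K #>\<^bsub>G\<^esub> x)) = g x"
proof -
  have "g ` (K #>\<^bsub>G\<^esub> x) = {g x}"
  proof (intro equalityI subsetI)
    fix y assume "y \<in> g ` (K #>\<^bsub>G\<^esub> x)"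
    then obtain k where "k \<in> K" "y = g (k \<otimes>\<^bsub>G\<^esub> x)" unfolding r_coset_def by blast
    then show "y \<in> {g x}" using assms(4) by simp
  next
    fix y assume "y \<in> {g x}"
    then show "y \<in> g ` (K #>\<^bsub>G\<^esub> x)" using group.rcos_self[OF assms(1,3,2)] by simp
  qed
  then show ?thesis by simp
qed

lemma coset_eq_iff:
  assumes "comm_group G" "subgroup K G" "x \<in> carrier G" "y \<in> carrier G"
  shows "K #>\<^bsub>G\<^esub> x = K #>\<^bsub>G\<^esub> y \<longleftrightarrow> x \<otimes>\<^bsub>G\<^esub> inv\<^bsub>G\<^esub> y \<in> K"
proof -
  interpret comm_group G by fact
  have "K #>\<^bsub>G\<^esub> x = K #>\<^bsub>G\<^esub> y \<longleftrightarrow> x \<in> K #>\<^bsub>G\<^esub> y"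
    using assms(2-4) rcos_self[of x K] repr_independence[of x K y] by auto
  also have "\<dots> \<longleftrightarrow> x \<otimes>\<^bsub>G\<^esub> inv\<^bsub>G\<^esub> y \<in> K"
    using assms subgroup.rcos_module[of K G y x] group_axioms by auto
  finally show ?thesis .
qed

lemma comm_group_Mod:
  "comm_group G \<Longrightarrow> subgroup K G \<Longrightarrow> comm_group (G Mod K)"
  by (rule comm_group.abelian_FactGroup)

lemma carrier_Mod: "carrier (G Mod K) = (\<lambda>x. K #>\<^bsub>G\<^esub> x) ` carrier G"
  by (auto simp: FactGroup_def RCOSETS_def)

lemma coset_hom:
  assumes "comm_group G" "subgroup K G"
  shows "(\<lambda>x. K #>\<^bsub>G\<^esub> x) \<in> hom G (G Mod K)"
  by (rule normal.r_coset_hom_Mod) (use assms in \<open>simp add: comm_group.normal_iff_subgroup\<close>)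

lemma one_Mod: "\<one>\<^bsub>G Mod K\<^esub> = K"
  by (simp add: FactGroup_def)

lemma coset_one_iff:
  assumes "comm_group G" "subgroup K G" "x \<in> carrier G"
  shows "K #>\<^bsub>G\<^esub> x = K \<longleftrightarrow> x \<in> K"
proof -
  interpret comm_group G by fact
  show ?thesis using assms(2,3) coset_join1[of K x] coset_join2[of x K] by (auto simp: subgroup.subset)
qed

lemma kernel_subgroup:
  assumes "h \<in> hom G H" "comm_group G" "comm_group H"
  shows "subgroup (kernel G H h) G"
  using assms by (simp add: group_hom.subgroup_kernel group_hom_def group_hom_axioms_def comm_groupD)

lemma image_subgroup:
  assumes "h \<in> hom G H" "comm_group G" "comm_group H"
  shows "subgroup (h ` carrier G) H"
  using assms by (simp add: group_hom.img_is_subgroup group_hom_def group_hom_axioms_def comm_groupD)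

text \<open>A kernel is a subgroup, so a check on generators extends to all that they generate.
  Well-definedness on colimits and tensor products is thereby reduced to their defining
  relations.\<close>

lemma generate_subset_kernel:
  assumes "h \<in> hom G H" "comm_group G" "comm_group H" "S \<subseteq> carrier G" "\<And>s. s \<in> S \<Longrightarrow> h s = \<one>\<^bsub>H\<^esub>"
  shows "generate G S \<subseteq> kernel G H h"
proof (rule group.generate_subgroup_incl)
  show "S \<subseteq> kernel G H h" using assms by (auto simp: kernel_def)
qed (use assms comm_groupD kernel_subgroup in auto)

text \<open>The denominator is kept in the form \<open>generate G S\<close> because
  \<open>colim_rel\<close> and \<open>tensor_rel\<close> are given by generators; the universal
  properties of both constructions are instances.\<close>

lemma quotient_universal:
  assumes G: "comm_group G" and H: "comm_group H" and S: "S \<subseteq> carrier G" and f: "f \<in> hom G H"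
    and fS: "\<And>s. s \<in> S \<Longrightarrow> f s = \<one>\<^bsub>H\<^esub>"
  obtains h where "h \<in> hom (G Mod generate G S) H"
    "\<And>x. x \<in> carrier G \<Longrightarrow> h (generate G S #>\<^bsub>G\<^esub> x) = f x"
proof
  interpret G: comm_group G by fact
  interpret H: comm_group H by fact
  let ?K = "generate G S" and ?h = "\<lambda>W. the_elem (f ` W)"
  have K: "subgroup ?K G" using S by (rule G.generate_is_subgroup)
  have ker: "?K \<subseteq> kernel G H f" using generate_subset_kernel[OF f G H S fS] .
  show val: "?h (?K #>\<^bsub>G\<^esub> x) = f x" if x: "x \<in> carrier G" for x
  proof (rule the_elem_coset[OF G.is_group K x])
    fix k assume "k \<in> ?K"
    then have "k \<in> carrier G" "f k = \<one>\<^bsub>H\<^esub>" using ker by (auto simp: kernel_def)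
    then show "f (k \<otimes>\<^bsub>G\<^esub> x) = f x"
      using x f by (simp add: hom_mult hom_in_carrier)
  qed
  show "?h \<in> hom (G Mod ?K) H"
  proof (rule homI)
    fix u assume "u \<in> carrier (G Mod ?K)"
    then show "?h u \<in> carrier H" using val f by (auto simp: carrier_Mod hom_in_carrier)
  next
    fix u v assume "u \<in> carrier (G Mod ?K)" "v \<in> carrier (G Mod ?K)"
    then obtain x y where xy: "x \<in> carrier G" "y \<in> carrier G" "u = ?K #>\<^bsub>G\<^esub> x" "v = ?K #>\<^bsub>G\<^esub> y"
      by (auto simp: carrier_Mod)
    then have "u \<otimes>\<^bsub>G Mod ?K\<^esub> v = ?K #>\<^bsub>G\<^esub> (x \<otimes>\<^bsub>G\<^esub> y)"
      using hom_mult[OF coset_hom[OF G K]] by auto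
    then show "?h (u \<otimes>\<^bsub>G Mod ?K\<^esub> v) = ?h u \<otimes>\<^bsub>H\<^esub> ?h v"
      using xy f by (simp add: val hom_mult)
  qed
qed

lemma quot_map_coset:
  assumes G: "comm_group G" and G': "comm_group G'" and S: "S \<subseteq> carrier G" and K': "subgroup K' G'"
    and h: "h \<in> hom G G'" and hS: "h ` S \<subseteq> K'" and x: "x \<in> carrier G"
  shows "quot_map G' K' h (generate G S #>\<^bsub>G\<^esub> x) = K' #>\<^bsub>G'\<^esub> h x"
proof -
  interpret G: comm_group G by fact
  interpret G': comm_group G' by fact
  let ?f = "\<lambda>x. K' #>\<^bsub>G'\<^esub> h x"
  have f: "?f \<in> hom G (G' Mod K')"
    using hom_compose[OF h coset_hom[OF G' K']] by (simp add: comp_def)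
  have "?f s = \<one>\<^bsub>G' Mod K'\<^esub>" if "s \<in> S" for s
    using that hS S h K' G' by (simp add: one_Mod coset_one_iff hom_in_carrier image_subset_iff subset_iff)
  then have ker: "generate G S \<subseteq> kernel G (G' Mod K') ?f"
    by (intro generate_subset_kernel f G comm_group_Mod[OF G' K'] S)
  interpret Q: comm_group "G' Mod K'" by (rule comm_group_Mod[OF G' K'])
  show ?thesis
    unfolding quot_map_def
  proof (rule the_elem_coset[OF G.is_group G.generate_is_subgroup[OF S] x])
    fix k assume "k \<in> generate G S"
    then have k: "k \<in> carrier G" "?f k = \<one>\<^bsub>G' Mod K'\<^esub>" using ker by (auto simp: kernel_def)
    show "?f (k \<otimes>\<^bsub>G\<^esub> x) = ?f x"
      using hom_mult[OF f k(1) x] Q.l_one[OF hom_in_carrier[OF f x]] by (simp only: k(2))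
  qed
qed

lemma quotient_map_hom:
  assumes G: "comm_group G" and G': "comm_group G'" and S: "S \<subseteq> carrier G" and K': "subgroup K' G'"
    and h: "h \<in> hom G G'" and hS: "h ` S \<subseteq> K'"
  shows "quot_map G' K' h \<in> hom (G Mod generate G S) (G' Mod K')"
proof -
  interpret G: comm_group G by fact
  have f: "(\<lambda>x. K' #>\<^bsub>G'\<^esub> h x) \<in> hom G (G' Mod K')"
    using hom_compose[OF h coset_hom[OF G' K']] by (simp add: comp_def)
  have "(\<lambda>x. K' #>\<^bsub>G'\<^esub> h x) s = \<one>\<^bsub>G' Mod K'\<^esub>" if "s \<in> S" for s
    using that hS S h K' G' by (simp add: one_Mod coset_one_iff hom_in_carrier image_subset_iff subset_iff)
  then obtain k where k: "k \<in> hom (G Mod generate G S) (G' Mod K')"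
    "\<And>x. x \<in> carrier G \<Longrightarrow> k (generate G S #>\<^bsub>G\<^esub> x) = K' #>\<^bsub>G'\<^esub> h x"
    using quotient_universal[OF G comm_group_Mod[OF G' K'] S f] by metis
  interpret Q: comm_group "G Mod generate G S"
    by (rule comm_group_Mod[OF G G.generate_is_subgroup[OF S]])
  have kz: "quot_map G' K' h z = k z" if "z \<in> carrier (G Mod generate G S)" for z
    using that k(2) quot_map_coset[OF assms] by (auto simp: carrier_Mod)
  show ?thesis
    by (rule homI) (use kz hom_in_carrier[OF k(1)] hom_mult[OF k(1)] Q.m_closed in \<open>simp_all del: mult_FactGroup\<close>)
qed

section \<open>Linear extension to finitely supported integer combinations\<close>

text \<open>The formula is that of the action in \<open>linearize\<close>, so that every result on
  \<open>lin\<close> is also one on this action. The \<open>\<phi> k\<close> are arbitrary elements,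
  with no basis in sight.\<close>

definition lin :: "('a, 'm) monoid_scheme \<Rightarrow> ('k \<Rightarrow> 'a) \<Rightarrow> ('k \<Rightarrow>\<^sub>0 int) \<Rightarrow> 'a"
  where "lin G \<phi> c = finprod G (\<lambda>k. \<phi> k [^]\<^bsub>G\<^esub> Poly_Mapping.lookup c k) (Poly_Mapping.keys c)"

context comm_group
begin

text \<open>Outside the support the exponent is 0 and the factor neutral. A common index set is what
  makes combinations with different supports comparable.\<close>

lemma lin_superset:
  assumes "finite T" "Poly_Mapping.keys c \<subseteq> T" "\<And>k. k \<in> T \<Longrightarrow> \<phi> k \<in> carrier G"
  shows "lin G \<phi> c = finprod G (\<lambda>k. \<phi> k [^] Poly_Mapping.lookup c k) T"
  unfolding lin_def
  by (rule finprod_mono_neutral_cong_left) (use assms in \<open>auto simp: in_keys_iff\<close>)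

lemma lin_closed:
  "(\<And>k. k \<in> Poly_Mapping.keys c \<Longrightarrow> \<phi> k \<in> carrier G) \<Longrightarrow> lin G \<phi> c \<in> carrier G"
  unfolding lin_def by (rule finprod_closed) auto

lemma lin_zero [simp]: "lin G \<phi> 0 = \<one>"
  by (simp add: lin_def)

lemma lin_frag_of [simp]: "\<phi> k \<in> carrier G \<Longrightarrow> lin G \<phi> (frag_of k) = \<phi> k"
  by (simp add: lin_def)

lemma lin_add:
  assumes "\<And>k. k \<in> Poly_Mapping.keys c \<union> Poly_Mapping.keys d \<Longrightarrow> \<phi> k \<in> carrier G"
  shows "lin G \<phi> (c + d) = lin G \<phi> c \<otimes> lin G \<phi> d"
proof -
  let ?T = "Poly_Mapping.keys c \<union> Poly_Mapping.keys d"
  have s: "lin G \<phi> u = finprod G (\<lambda>k. \<phi> k [^] Poly_Mapping.lookup u k) ?T" if "Poly_Mapping.keys u \<subseteq> ?T" for u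
    by (rule lin_superset) (use that assms in auto)
  have "lin G \<phi> (c + d) = finprod G (\<lambda>k. \<phi> k [^] Poly_Mapping.lookup c k \<otimes> \<phi> k [^] Poly_Mapping.lookup d k) ?T"
    unfolding s[OF keys_add]
    by (rule finprod_cong') (use assms in \<open>auto simp: lookup_add int_pow_mult\<close>)
  also have "\<dots> = lin G \<phi> c \<otimes> lin G \<phi> d"
    unfolding s[OF Un_upper1] s[OF Un_upper2]
    by (rule finprod_multf) (use assms in auto)
  finally show ?thesis .
qed

lemma lin_diff:
  assumes "\<And>k. k \<in> Poly_Mapping.keys c \<union> Poly_Mapping.keys d \<Longrightarrow> \<phi> k \<in> carrier G"
  shows "lin G \<phi> (c - d) = lin G \<phi> c \<otimes> inv (lin G \<phi> d)"
proof -
  have "lin G \<phi> c = lin G \<phi> (c - d) \<otimes> lin G \<phi> d"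
    using lin_add[of "c - d" d \<phi>] assms keys_diff[of c d] by auto
  moreover have "lin G \<phi> (c - d) \<in> carrier G" "lin G \<phi> d \<in> carrier G"
    using assms keys_diff[of c d] by (auto intro!: lin_closed)
  ultimately show ?thesis by (simp add: m_assoc)
qed

lemma lin_hom:
  "(\<And>k. k \<in> S \<Longrightarrow> \<phi> k \<in> carrier G) \<Longrightarrow> lin G \<phi> \<in> hom (free_Abelian_group S) G"
  by (rule homI) (auto intro!: lin_closed lin_add)

lemma lin_cong:
  "(\<And>k. k \<in> Poly_Mapping.keys c \<Longrightarrow> \<phi> k \<in> carrier G) \<Longrightarrow>
   (\<And>k. k \<in> Poly_Mapping.keys c \<Longrightarrow> \<phi> k = \<psi> k) \<Longrightarrow> lin G \<phi> c = lin G \<psi> c"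
  unfolding lin_def by (rule finprod_cong') auto

lemma lin_mult:
  assumes "\<And>k. k \<in> Poly_Mapping.keys c \<Longrightarrow> \<phi> k \<in> carrier G"
    and "\<And>k. k \<in> Poly_Mapping.keys c \<Longrightarrow> \<psi> k \<in> carrier G"
  shows "lin G (\<lambda>k. \<phi> k \<otimes> \<psi> k) c = lin G \<phi> c \<otimes> lin G \<psi> c"
proof -
  have "lin G (\<lambda>k. \<phi> k \<otimes> \<psi> k) c = finprod G (\<lambda>k. \<phi> k [^] Poly_Mapping.lookup c k \<otimes> \<psi> k [^] Poly_Mapping.lookup c k) (Poly_Mapping.keys c)"
    unfolding lin_def by (rule finprod_cong) (use assms in \<open>auto simp: int_pow_mult_distrib m_comm\<close>)
  also have "\<dots> = lin G \<phi> c \<otimes> lin G \<psi> c"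
    unfolding lin_def by (rule finprod_multf) (use assms in auto)
  finally show ?thesis .
qed

lemma hom_finprod:
  assumes h: "h \<in> hom G H" and H: "comm_group H" and f: "f \<in> A \<rightarrow> carrier G"
  shows "h (finprod G f A) = finprod H (\<lambda>x. h (f x)) A"
proof -
  interpret H: comm_group H by fact
  show ?thesis
    using f
  proof (induction A rule: infinite_finite_induct)
    case (insert a A)
    then have "f a \<in> carrier G" "f \<in> A \<rightarrow> carrier G" by auto
    moreover have "(\<lambda>x. h (f x)) \<in> A \<rightarrow> carrier H" "h (f a) \<in> carrier H"
      using insert.prems h by (auto simp: hom_def)
    ultimately show ?case using insert.hyps insert.IH h by (simp add: hom_mult)
  qed (use hom_one_comm[OF h comm_group_axioms H] in simp_all)
qed

lemma hom_lin:
  assumes h: "h \<in> hom G H" and H: "comm_group H" and \<phi>: "\<And>k. k \<in> Poly_Mapping.keys c \<Longrightarrow> \<phi> k \<in> carrier G"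
  shows "h (lin G \<phi> c) = lin H (\<lambda>k. h (\<phi> k)) c"
proof -
  interpret H: comm_group H by fact
  have "h (lin G \<phi> c) = finprod H (\<lambda>k. h (\<phi> k [^] Poly_Mapping.lookup c k)) (Poly_Mapping.keys c)"
    unfolding lin_def by (rule hom_finprod[OF h H]) (use \<phi> in auto)
  also have "\<dots> = lin H (\<lambda>k. h (\<phi> k)) c"
    unfolding lin_def
    by (rule H.finprod_cong') (use \<phi> h in \<open>auto simp: hom_int_pow[OF h _ is_group H.is_group] hom_in_carrier\<close>)
  finally show ?thesis .
qed

text \<open>A homomorphism on a free abelian group is determined by its values on the generators.
  Its main use is \<open>monoid_ring_act_lin\<close>, where an abstract action of Z[M] is recovered
  from that of M.\<close>

lemma lin_eqI:
  assumes "h \<in> hom (free_Abelian_group S) G" "Poly_Mapping.keys c \<subseteq> S"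
    "\<And>k. k \<in> S \<Longrightarrow> h (frag_of k) = \<phi> k"
  shows "h c = lin G \<phi> c"
proof -
  have \<phi>: "\<phi> k \<in> carrier G" if "k \<in> S" for k
    using that assms(3)[OF that] hom_in_carrier[OF assms(1), of "frag_of k"] by simp
  show ?thesis
    using assms(2)
  proof (induction c rule: free_Abelian_group_induct[consumes 1, case_names zero diff one])
    case zero
    show ?case using hom_one_comm[OF assms(1) abelian_free_Abelian_group comm_group_axioms] by simp
  next
    case (diff x y)
    then have "h (x - y) = h x \<otimes> inv (h y)"
      using hom_div[OF assms(1) abelian_free_Abelian_group comm_group_axioms, of x y] by simp
    also have "\<dots> = lin G \<phi> (x - y)" using diff \<phi> by (subst lin_diff) auto
    finally show ?case .
  next
    case (one a)
    then show ?case using assms(3) \<phi> by simp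
  qed
qed

text \<open>Both sides are additive in \<open>c\<close> and agree on generators. This is what yields
  the associativity of the action of Z[M] and the naturality of \<open>free_eval\<close>.\<close>

lemma lin_frag_extend:
  assumes "\<And>k. k \<in> Poly_Mapping.keys c \<Longrightarrow> Poly_Mapping.keys (b k) \<subseteq> T" "\<And>l. l \<in> T \<Longrightarrow> \<phi> l \<in> carrier G"
  shows "lin G \<phi> (frag_extend b c) = lin G (\<lambda>k. lin G \<phi> (b k)) c"
proof (rule lin_eqI[where S = "Poly_Mapping.keys c" and h = "\<lambda>c. lin G \<phi> (frag_extend b c)"])
  have sub: "Poly_Mapping.keys (frag_extend b x) \<subseteq> T" if "Poly_Mapping.keys x \<subseteq> Poly_Mapping.keys c" for x
    by (rule keys_frag_extend_subset[OF that assms(1)])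
  show "(\<lambda>c. lin G \<phi> (frag_extend b c)) \<in> hom (free_Abelian_group (Poly_Mapping.keys c)) G"
  proof (rule homI)
    fix x assume "x \<in> carrier (free_Abelian_group (Poly_Mapping.keys c))"
    then show "lin G \<phi> (frag_extend b x) \<in> carrier G" using sub[of x] assms(2) by (intro lin_closed) auto
  next
    fix x y assume "x \<in> carrier (free_Abelian_group (Poly_Mapping.keys c))" "y \<in> carrier (free_Abelian_group (Poly_Mapping.keys c))"
    then have "Poly_Mapping.keys (frag_extend b x) \<subseteq> T" "Poly_Mapping.keys (frag_extend b y) \<subseteq> T"
      using sub by auto
    then show "lin G \<phi> (frag_extend b (x \<otimes>\<^bsub>free_Abelian_group (Poly_Mapping.keys c)\<^esub> y)) =
       lin G \<phi> (frag_extend b x) \<otimes> lin G \<phi> (frag_extend b y)"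
      using assms(2) by (simp add: frag_extend_add) (rule lin_add, auto)
  qed
qed simp_all

end

section \<open>Isomorphisms of quotients from additive relations\<close>

text \<open>The choice by SOME is immaterial under the assumptions of
  \<open>additive_relation\<close>, where all eligible \<open>w\<close> coincide.\<close>

definition rel_map ::
    "('a, 'm) monoid_scheme \<Rightarrow> 'a set \<Rightarrow> ('b, 'n) monoid_scheme \<Rightarrow> 'b set \<Rightarrow> ('a \<Rightarrow> 'b \<Rightarrow> bool) \<Rightarrow> 'a set \<Rightarrow> 'b set"
  where "rel_map G K H L \<rho> z = (SOME w. \<exists>x y. \<rho> x y \<and> z = K #>\<^bsub>G\<^esub> x \<and> w = L #>\<^bsub>H\<^esub> y)"

text \<open>The start of a zigzag does not determine its end, so the comparison of cycles is a
  correspondence and not a map. The two directions of \<open>rel_iff\<close> make it descend to the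
  quotients as a single-valued and injective map.\<close>

locale additive_relation = G: comm_group G + H: comm_group H
  for G :: "('a, 'm) monoid_scheme" and H :: "('b, 'n) monoid_scheme" +
  fixes K L \<rho>
  assumes K: "subgroup K G" and L: "subgroup L H"
    and rel_carrier: "\<rho> x y \<Longrightarrow> x \<in> carrier G \<and> y \<in> carrier H"
    and rel_mult: "\<rho> x y \<Longrightarrow> \<rho> x' y' \<Longrightarrow> \<rho> (x \<otimes>\<^bsub>G\<^esub> x') (y \<otimes>\<^bsub>H\<^esub> y')"
    and rel_total: "x \<in> carrier G \<Longrightarrow> \<exists>y. \<rho> x y"
    and rel_onto: "y \<in> carrier H \<Longrightarrow> \<exists>x. \<rho> x y"
    and rel_iff: "\<rho> x y \<Longrightarrow> x \<in> K \<longleftrightarrow> y \<in> L"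
begin

lemma rel_coset_iff:
  assumes "\<rho> x y" "\<rho> x' y'"
  shows "K #>\<^bsub>G\<^esub> x = K #>\<^bsub>G\<^esub> x' \<longleftrightarrow> L #>\<^bsub>H\<^esub> y = L #>\<^bsub>H\<^esub> y'"
proof -
  note c = rel_carrier[OF assms(1)] rel_carrier[OF assms(2)]
  \<comment> \<open>Only closure under products is at hand, so a partner \<open>v\<close> of the
    inverse of \<open>x'\<close> stands in for the inverse of \<open>y'\<close>. The two differ by
    an element of \<open>L\<close>, because the product of \<open>x'\<close> and its inverse lies in
    \<open>K\<close>.\<close>
  obtain v where v: "\<rho> (inv\<^bsub>G\<^esub> x') v" using rel_total c by blast
  have vc: "v \<in> carrier H" using rel_carrier[OF v] by simp
  have "\<rho> (x' \<otimes>\<^bsub>G\<^esub> inv\<^bsub>G\<^esub> x') (y' \<otimes>\<^bsub>H\<^esub> v)" by (rule rel_mult[OF assms(2) v])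
  then have vL: "y' \<otimes>\<^bsub>H\<^esub> v \<in> L"
    using rel_iff c subgroup.one_closed[OF K] by fastforce
  have "x \<otimes>\<^bsub>G\<^esub> inv\<^bsub>G\<^esub> x' \<in> K \<longleftrightarrow> y \<otimes>\<^bsub>H\<^esub> v \<in> L"
    using rel_iff[OF rel_mult[OF assms(1) v]] .
  also have "\<dots> \<longleftrightarrow> y \<otimes>\<^bsub>H\<^esub> inv\<^bsub>H\<^esub> y' \<in> L"
  proof -
    have e: "y \<otimes>\<^bsub>H\<^esub> v = (y \<otimes>\<^bsub>H\<^esub> inv\<^bsub>H\<^esub> y') \<otimes>\<^bsub>H\<^esub> (y' \<otimes>\<^bsub>H\<^esub> v)"
      using c vc by (simp add: H.m_assoc) (simp add: H.m_assoc[symmetric])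
    have e': "y \<otimes>\<^bsub>H\<^esub> inv\<^bsub>H\<^esub> y' = (y \<otimes>\<^bsub>H\<^esub> v) \<otimes>\<^bsub>H\<^esub> inv\<^bsub>H\<^esub> (y' \<otimes>\<^bsub>H\<^esub> v)"
      using c vc e by (simp add: H.inv_solve_right)
    show ?thesis
      using e e' vL subgroup.m_closed[OF L] subgroup.m_inv_closed[OF L] by metis
  qed
  finally show ?thesis
    using c by (simp add: coset_eq_iff K L G.comm_group_axioms H.comm_group_axioms)
qed

lemma rel_map_eq:
  assumes "\<rho> x y"
  shows "rel_map G K H L \<rho> (K #>\<^bsub>G\<^esub> x) = L #>\<^bsub>H\<^esub> y"
  unfolding rel_map_def
  by (rule some_equality) (use assms rel_coset_iff in blast)+

lemma rel_map_iso: "rel_map G K H L \<rho> \<in> iso (G Mod K) (H Mod L)"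
proof (rule isoI)
  let ?t = "rel_map G K H L \<rho>"
  have rep: "\<exists>x y. \<rho> x y \<and> z = K #>\<^bsub>G\<^esub> x \<and> ?t z = L #>\<^bsub>H\<^esub> y" if "z \<in> carrier (G Mod K)" for z
    using that rel_total rel_map_eq by (fastforce simp: carrier_Mod)
  show "?t \<in> hom (G Mod K) (H Mod L)"
  proof (rule homI)
    fix z assume "z \<in> carrier (G Mod K)"
    from rep[OF this] rel_carrier show "?t z \<in> carrier (H Mod L)" by (auto simp: carrier_Mod)
  next
    fix z w assume "z \<in> carrier (G Mod K)" "w \<in> carrier (G Mod K)"
    with rep obtain x y x' y' where r: "\<rho> x y" "z = K #>\<^bsub>G\<^esub> x" "?t z = L #>\<^bsub>H\<^esub> y"
      "\<rho> x' y'" "w = K #>\<^bsub>G\<^esub> x'" "?t w = L #>\<^bsub>H\<^esub> y'" by metis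
    have "z \<otimes>\<^bsub>G Mod K\<^esub> w = K #>\<^bsub>G\<^esub> (x \<otimes>\<^bsub>G\<^esub> x')"
      using r rel_carrier hom_mult[OF coset_hom[OF G.comm_group_axioms K]] by metis
    then have "?t (z \<otimes>\<^bsub>G Mod K\<^esub> w) = L #>\<^bsub>H\<^esub> (y \<otimes>\<^bsub>H\<^esub> y')"
      using rel_map_eq[OF rel_mult[OF r(1,4)]] by simp
    also have "\<dots> = ?t z \<otimes>\<^bsub>H Mod L\<^esub> ?t w"
      using r rel_carrier hom_mult[OF coset_hom[OF H.comm_group_axioms L]] by metis
    finally show "?t (z \<otimes>\<^bsub>G Mod K\<^esub> w) = ?t z \<otimes>\<^bsub>H Mod L\<^esub> ?t w" .
  qed
  show "bij_betw ?t (carrier (G Mod K)) (carrier (H Mod L))"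
    unfolding bij_betw_def
  proof (intro conjI inj_onI)
    fix z w assume zw: "z \<in> carrier (G Mod K)" "w \<in> carrier (G Mod K)" "?t z = ?t w"
    obtain x y where 1: "\<rho> x y" "z = K #>\<^bsub>G\<^esub> x" "?t z = L #>\<^bsub>H\<^esub> y" using rep[OF zw(1)] by auto
    obtain x' y' where 2: "\<rho> x' y'" "w = K #>\<^bsub>G\<^esub> x'" "?t w = L #>\<^bsub>H\<^esub> y'" using rep[OF zw(2)] by auto
    show "z = w" using rel_coset_iff[OF 1(1) 2(1)] 1 2 zw(3) by simp
  next
    show "?t ` carrier (G Mod K) = carrier (H Mod L)"
    proof (intro equalityI subsetI)
      fix w assume "w \<in> ?t ` carrier (G Mod K)"
      then show "w \<in> carrier (H Mod L)" using rep rel_carrier by (fastforce simp: carrier_Mod)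
    next
      fix w assume "w \<in> carrier (H Mod L)"
      then obtain y where y: "y \<in> carrier H" "w = L #>\<^bsub>H\<^esub> y" by (auto simp: carrier_Mod)
      obtain x where "\<rho> x y" using rel_onto[OF y(1)] by auto
      then show "w \<in> ?t ` carrier (G Mod K)"
        using rel_map_eq rel_carrier y by (force simp: carrier_Mod)
    qed
  qed
qed

end

section \<open>Homology\<close>

locale chain_complex =
  fixes G :: "nat \<Rightarrow> ('a, 'm) monoid_scheme" and d
  assumes grp: "\<And>n. comm_group (G n)"
    and diff_hom: "\<And>n. d n \<in> hom (G (Suc n)) (G n)"
    and diff_diff: "\<And>n x. x \<in> carrier (G (Suc (Suc n))) \<Longrightarrow> d n (d (Suc n) x) = \<one>\<^bsub>G n\<^esub>"
begin

lemma mem_cycles_0 [simp]: "x \<in> cycles G d 0 \<longleftrightarrow> x \<in> carrier (G 0)"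
  by (simp add: cycles_def)

lemma mem_cycles_Suc [simp]:
  "x \<in> cycles G d (Suc q) \<longleftrightarrow> x \<in> carrier (G (Suc q)) \<and> d q x = \<one>\<^bsub>G q\<^esub>"
  by (simp add: cycles_def kernel_def)

lemma subgroup_cycles: "subgroup (cycles G d p) (G p)"
  by (cases p) (simp_all add: cycles_def group.subgroup_self comm_groupD grp kernel_subgroup diff_hom)

lemma subgroup_boundaries: "subgroup (boundaries G d p) (G p)"
  unfolding boundaries_def by (rule image_subgroup[OF diff_hom grp grp])

lemma boundaries_subset_cycles: "boundaries G d p \<subseteq> cycles G d p"
  by (cases p) (auto simp: boundaries_def diff_diff hom_in_carrier[OF diff_hom])

lemma comm_group_cycles: "comm_group ((G p)\<lparr>carrier := cycles G d p\<rparr>)"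
proof -
  interpret comm_group "G p" by (rule grp)
  show ?thesis
    by (rule group.group_comm_groupI[OF subgroup.subgroup_is_group[OF subgroup_cycles is_group]])
      (use subgroup.mem_carrier[OF subgroup_cycles[of p]] m_comm in auto)
qed

lemma subgroup_boundaries_cycles: "subgroup (boundaries G d p) ((G p)\<lparr>carrier := cycles G d p\<rparr>)"
  by (rule group.subgroup_incl[OF comm_groupD(1)[OF grp] subgroup_boundaries subgroup_cycles
      boundaries_subset_cycles])

lemma carrier_homology:
  "carrier (homology G d p) = (\<lambda>x. boundaries G d p #>\<^bsub>G p\<^esub> x) ` cycles G d p"
  by (simp add: homology_def carrier_Mod r_coset_def)

end

text \<open>Cosets and \<open>rel_map\<close> look at the multiplication only, so the passage from
  the groups to their subgroups of cycles does not change the map.\<close>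

lemma rel_map_restrict:
  "rel_map (G\<lparr>carrier := A\<rparr>) K (H\<lparr>carrier := B\<rparr>) L \<rho> = rel_map G K H L \<rho>"
  by (rule ext) (simp add: rel_map_def r_coset_def)

text \<open>The formula for the induced map on cosets rests on one fact: a chain map carries
  boundaries to boundaries.\<close>

lemma homology_map_coset:
  assumes "chain_complex G d" "chain_complex G' d'"
    and t: "\<And>n. t n \<in> hom (G n) (G' n)"
    and comm: "\<And>n x. x \<in> carrier (G (Suc n)) \<Longrightarrow> t n (d n x) = d' n (t (Suc n) x)"
    and x: "x \<in> carrier (G p)"
  shows "homology_map G' d' t p (boundaries G d p #>\<^bsub>G p\<^esub> x) = boundaries G' d' p #>\<^bsub>G' p\<^esub> t p x"
proof -
  interpret C: chain_complex G d by fact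
  interpret C': chain_complex G' d' by fact
  interpret comm_group "G p" by (rule C.grp)
  \<comment> \<open>The boundaries are rewritten as the subgroup that they generate, to fit the form
    of denominator in \<open>quot_map_coset\<close>.\<close>
  have "generate (G p) (boundaries G d p) = boundaries G d p"
    using generate_subgroup_incl[OF subset_refl C.subgroup_boundaries] by (auto intro: generate.incl)
  moreover have "t p ` boundaries G d p \<subseteq> boundaries G' d' p"
    using comm hom_in_carrier[OF t] by (fastforce simp: boundaries_def)
  ultimately show ?thesis
    unfolding homology_map_def
    using quot_map_coset[OF C.grp C'.grp subgroup.subset[OF C.subgroup_boundaries] C'.subgroup_boundaries t _ x]
    by metis
qed

section \<open>First quadrant bicomplexes with exact augmented rows and columns\<close>

text \<open>\<open>dv\<close> lowers the first index and \<open>dh\<close> the second;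
  \<open>e\<close> augments the columns (second index fixed) and \<open>f\<close> the rows. The
  squares commute and do not anticommute. Exactness is stated elementwise, so that each move of a
  diagram chase is one application of an assumption.\<close>

locale bicomplex =
  L: chain_complex "L :: nat \<Rightarrow> 'x monoid" dX + M: chain_complex "M :: nat \<Rightarrow> 'y monoid" dY for L dX M dY +
  fixes C :: "nat \<Rightarrow> nat \<Rightarrow> 'c monoid" and dv dh e f
  assumes grp: "\<And>s t. comm_group (C s t)"
    and dv_hom: "\<And>s t. dv s t \<in> hom (C (Suc s) t) (C s t)"
    and dh_hom: "\<And>s t. dh s t \<in> hom (C s (Suc t)) (C s t)"
    and e_hom: "\<And>t. e t \<in> hom (C 0 t) (L t)"
    and f_hom: "\<And>s. f s \<in> hom (C s 0) (M s)"
    and comm: "\<And>s t z. z \<in> carrier (C (Suc s) (Suc t)) \<Longrightarrow> dv s t (dh (Suc s) t z) = dh s t (dv s (Suc t) z)"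
    and e_dh: "\<And>t z. z \<in> carrier (C 0 (Suc t)) \<Longrightarrow> e t (dh 0 t z) = dX t (e (Suc t) z)"
    and f_dv: "\<And>s z. z \<in> carrier (C (Suc s) 0) \<Longrightarrow> f s (dv s 0 z) = dY s (f (Suc s) z)"
    and dv_dv: "\<And>s t z. z \<in> carrier (C (Suc (Suc s)) t) \<Longrightarrow> dv s t (dv (Suc s) t z) = \<one>\<^bsub>C s t\<^esub>"
    and dh_dh: "\<And>s t z. z \<in> carrier (C s (Suc (Suc t))) \<Longrightarrow> dh s t (dh s (Suc t) z) = \<one>\<^bsub>C s t\<^esub>"
    and e_dv: "\<And>t z. z \<in> carrier (C (Suc 0) t) \<Longrightarrow> e t (dv 0 t z) = \<one>\<^bsub>L t\<^esub>"
    and f_dh: "\<And>s z. z \<in> carrier (C s (Suc 0)) \<Longrightarrow> f s (dh s 0 z) = \<one>\<^bsub>M s\<^esub>"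
    and e_surj: "\<And>t x. x \<in> carrier (L t) \<Longrightarrow> \<exists>z\<in>carrier (C 0 t). e t z = x"
    and f_surj: "\<And>s y. y \<in> carrier (M s) \<Longrightarrow> \<exists>z\<in>carrier (C s 0). f s z = y"
    and col_0: "\<And>t z. z \<in> carrier (C 0 t) \<Longrightarrow> e t z = \<one>\<^bsub>L t\<^esub> \<Longrightarrow> \<exists>w\<in>carrier (C (Suc 0) t). dv 0 t w = z"
    and row_0: "\<And>s z. z \<in> carrier (C s 0) \<Longrightarrow> f s z = \<one>\<^bsub>M s\<^esub> \<Longrightarrow> \<exists>w\<in>carrier (C s (Suc 0)). dh s 0 w = z"
    and col: "\<And>s t z. z \<in> carrier (C (Suc s) t) \<Longrightarrow> dv s t z = \<one>\<^bsub>C s t\<^esub> \<Longrightarrow>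
        \<exists>w\<in>carrier (C (Suc (Suc s)) t). dv (Suc s) t w = z"
    and row: "\<And>s t z. z \<in> carrier (C s (Suc t)) \<Longrightarrow> dh s t z = \<one>\<^bsub>C s t\<^esub> \<Longrightarrow>
        \<exists>w\<in>carrier (C s (Suc (Suc t))). dh s (Suc t) w = z"
begin

text \<open>Exchanging the two indices permutes the assumptions among themselves. Hence whatever is
  shown about the start of a zigzag holds for its end as well.\<close>

lemma transposed: "bicomplex M dY L dX (\<lambda>s t. C t s) (\<lambda>s t. dh t s) (\<lambda>s t. dv t s) f e"
proof -
  have "bicomplex_axioms M dY L dX (\<lambda>s t. C t s) (\<lambda>s t. dh t s) (\<lambda>s t. dv t s) f e"
    by (rule bicomplex_axioms.intro) (simp_all add: grp dv_hom dh_hom e_hom f_hom comm e_dh f_dv dv_dv dh_dh e_dv f_dh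
        e_surj f_surj col_0 row_0 col row)
  then show ?thesis by (simp add: bicomplex_def L.chain_complex_axioms M.chain_complex_axioms)
qed

text \<open>A zigzag is a cycle of total degree \<open>p\<close>; requiring \<open>dh a = dv a'\<close> rather than \<open>dh a = - dv a'\<close>
  avoids the usual signs.\<close>

definition zig :: "nat \<Rightarrow> (nat \<Rightarrow> 'c) \<Rightarrow> bool"
  where "zig p a \<longleftrightarrow> (\<forall>i\<le>p. a i \<in> carrier (C i (p - i))) \<and>
    (\<forall>i<p. dh i (p - Suc i) (a i) = dv i (p - Suc i) (a (Suc i)))"

lemma zig_mem: "zig p a \<Longrightarrow> i \<le> p \<Longrightarrow> a i \<in> carrier (C i (p - i))"
  by (simp add: zig_def)

lemma zig_eq: "zig p a \<Longrightarrow> i < p \<Longrightarrow> dh i (p - Suc i) (a i) = dv i (p - Suc i) (a (Suc i))"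
  by (simp add: zig_def)

lemma zig_reverse:
  assumes "zig p a"
  shows "bicomplex.zig (\<lambda>s t. C t s) (\<lambda>s t. dh t s) (\<lambda>s t. dv t s) p (\<lambda>i. a (p - i))"
proof -
  interpret T: bicomplex M dY L dX "\<lambda>s t. C t s" "\<lambda>s t. dh t s" "\<lambda>s t. dv t s" f e by (rule transposed)
  show ?thesis
    unfolding T.zig_def
  proof (intro conjI allI impI)
    fix i assume "i \<le> p"
    then show "a (p - i) \<in> carrier (C (p - i) i)" using zig_mem[OF assms, of "p - i"] by simp
  next
    fix i assume "i < p"
    then show "dv (p - Suc i) i (a (p - i)) = dh (p - Suc i) i (a (p - Suc i))"
      using zig_eq[OF assms, of "p - Suc i"] by (simp add: Suc_diff_Suc)
  qed
qed

text \<open>The differential of \<open>e p (a 0)\<close> is \<open>e\<close> applied to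
  \<open>dh\<close> of \<open>a 0\<close>, which equals \<open>dv\<close> of \<open>a 1\<close> and
  dies under \<open>e\<close>. In degree 0 every element is a cycle.\<close>

lemma zig_start_cycle:
  assumes "zig p a"
  shows "e p (a 0) \<in> cycles L dX p"
proof (cases p)
  case 0
  then show ?thesis using zig_mem[OF assms, of 0] by (simp add: hom_in_carrier[OF e_hom])
next
  case (Suc q)
  then show ?thesis
    using zig_mem[OF assms, of 0] zig_mem[OF assms, of 1] zig_eq[OF assms, of 0]
    by (simp add: hom_in_carrier[OF e_hom] e_dh[symmetric] e_dv)
qed

text \<open>The zigzag is built from its start, one entry at a time, by exactness of the
  columns.\<close>

lemma zig_exists:
  assumes "x \<in> cycles L dX p"
  shows "\<exists>a. zig p a \<and> e p (a 0) = x"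
proof -
  have xp: "x \<in> carrier (L p)" using assms subgroup.subset[OF L.subgroup_cycles] by blast
  have "\<exists>a. (\<forall>i\<le>k. a i \<in> carrier (C i (p - i))) \<and>
    (\<forall>i<k. dh i (p - Suc i) (a i) = dv i (p - Suc i) (a (Suc i))) \<and> e p (a 0) = x" if "k \<le> p" for k
    using that
  proof (induction k)
    case 0
    obtain z where "z \<in> carrier (C 0 p)" "e p z = x" using e_surj[OF xp] by blast
    then show ?case by (intro exI[of _ "\<lambda>_. z"]) simp
  next
    case (Suc k)
    then obtain a where a: "\<And>i. i \<le> k \<Longrightarrow> a i \<in> carrier (C i (p - i))"
      "\<And>i. i < k \<Longrightarrow> dh i (p - Suc i) (a i) = dv i (p - Suc i) (a (Suc i))" "e p (a 0) = x"
      by auto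
    define q where "q = p - Suc k"
    have q: "p - k = Suc q" "p - Suc k = q" using Suc.prems by (auto simp: q_def)
    have ak: "a k \<in> carrier (C k (Suc q))" using a(1)[of k] q by simp
    \<comment> \<open>The next entry is a preimage of \<open>dh k q (a k)\<close> under
      \<open>dv\<close>. For \<open>k = 0\<close> the obstruction is the image under
      \<open>e\<close>, the differential of the cycle \<open>x\<close>. For \<open>k = Suc j\<close>
      it is \<open>dv dh (a k) = dh dv (a k) = dh dh (a j)\<close>, which is neutral.\<close>
    have "\<exists>w\<in>carrier (C (Suc k) q). dv k q w = dh k q (a k)"
    proof (cases k)
      case 0
      have "dX q x = \<one>\<^bsub>L q\<^esub>" using assms q 0 by simp
      then have "e q (dh 0 q (a 0)) = \<one>\<^bsub>L q\<^esub>" using e_dh[of "a 0" q] ak a(3) q 0 by simp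
      then show ?thesis using col_0[of "dh 0 q (a 0)" q] ak 0 hom_in_carrier[OF dh_hom] by auto
    next
      case k: (Suc j)
      have pj: "p - j = Suc (Suc q)" "p - k = Suc q" using Suc.prems k q by auto
      have aj: "a j \<in> carrier (C j (Suc (Suc q)))" using a(1)[of j] k pj by simp
      have "dh j (Suc q) (a j) = dv j (Suc q) (a k)" using a(2)[of j] k pj by simp
      then have "dv j q (dh k q (a k)) = \<one>\<^bsub>C j q\<^esub>"
        using comm[of "a k" j q] ak aj k dh_dh[of "a j" j q] by simp
      then show ?thesis using col[of "dh k q (a k)" j q] ak k hom_in_carrier[OF dh_hom] by auto
    qed
    then obtain w where w: "w \<in> carrier (C (Suc k) q)" "dv k q w = dh k q (a k)" by blast
    show ?case
      by (rule exI[of _ "a(Suc k := w)"]) (use a w q in \<open>auto simp: le_Suc_eq less_Suc_eq\<close>)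
  qed
  from this[of p] show ?thesis by (auto simp: zig_def)
qed

text \<open>The zigzag is written as a total boundary, \<open>a i\<close> being the product of
  \<open>dh\<close> of \<open>b i\<close> and \<open>dv\<close> of \<open>b (Suc i)\<close>, with
  \<open>b 0\<close> lifting the given bounding element. No signs are needed: \<open>dh\<close> of
  \<open>a i\<close> and \<open>dv\<close> of \<open>a (Suc i)\<close> are then the two ways around
  the square from \<open>b (Suc i)\<close>. Under \<open>f\<close> only the last \<open>dv\<close>
  term of \<open>a p\<close> survives.\<close>

lemma zig_boundary:
  assumes z: "zig p a" and b: "e p (a 0) \<in> boundaries L dX p"
  shows "f p (a p) \<in> boundaries M dY p"
proof -
  obtain x' where x': "x' \<in> carrier (L (Suc p))" "e p (a 0) = dX p x'"
    using b by (auto simp: boundaries_def)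
  have "\<exists>b. (\<forall>i\<le>k. b i \<in> carrier (C i (Suc p - i))) \<and> e (Suc p) (b 0) = x' \<and>
    (\<forall>i<k. a i = dh i (p - i) (b i) \<otimes>\<^bsub>C i (p - i)\<^esub> dv i (p - i) (b (Suc i)))" if "k \<le> Suc p" for k
    using that
  proof (induction k)
    case 0
    obtain z where "z \<in> carrier (C 0 (Suc p))" "e (Suc p) z = x'" using e_surj[OF x'(1)] by blast
    then show ?case by (intro exI[of _ "\<lambda>_. z"]) simp
  next
    case (Suc k)
    then obtain b where b: "\<And>i. i \<le> k \<Longrightarrow> b i \<in> carrier (C i (Suc p - i))" "e (Suc p) (b 0) = x'"
      "\<And>i. i < k \<Longrightarrow> a i = dh i (p - i) (b i) \<otimes>\<^bsub>C i (p - i)\<^esub> dv i (p - i) (b (Suc i))"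
      by auto
    define q where "q = p - k"
    have q: "p - k = q" "Suc p - k = Suc q" "Suc p - Suc k = q" using Suc.prems by (auto simp: q_def)
    interpret D: comm_group "C k q" by (rule grp)
    have bk: "b k \<in> carrier (C k (Suc q))" and ak: "a k \<in> carrier (C k q)"
      using b(1)[of k] zig_mem[OF z, of k] q Suc.prems by auto
    \<comment> \<open>\<open>u\<close> is the defect that \<open>dv\<close> of the next entry
      \<open>b (Suc k)\<close> has to make up for; it must be shown to be vertically exact.\<close>
    define u where "u = a k \<otimes>\<^bsub>C k q\<^esub> inv\<^bsub>C k q\<^esub> (dh k q (b k))"
    have dbk: "dh k q (b k) \<in> carrier (C k q)" using bk hom_in_carrier[OF dh_hom] by blast
    have u: "u \<in> carrier (C k q)" using ak dbk by (simp add: u_def)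
    have "\<exists>w\<in>carrier (C (Suc k) q). dv k q w = u"
    proof (cases k)
      case 0
      interpret E: comm_group "L q" by (rule L.grp)
      have "e q (a 0) = e q (dh 0 q (b 0))" using e_dh[of "b 0" q] bk 0 q x' b(2) by simp
      then have "e q u = \<one>\<^bsub>L q\<^esub>"
        using 0 u ak dbk hom_div[OF e_hom grp L.grp, of "a 0" q "dh 0 q (b 0)"]
        by (simp add: u_def hom_in_carrier[OF e_hom] E.div_eq_one_iff)
      then show ?thesis using col_0[of u q] u 0 by simp
    next
      case k: (Suc j)
      interpret E: comm_group "C j q" by (rule grp)
      have pj: "p - j = Suc q" "p - Suc j = q" "Suc p - j = Suc (Suc q)" using Suc.prems k q by auto
      have bj: "b j \<in> carrier (C j (Suc (Suc q)))" using b(1)[of j] k pj by simp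
      have aj: "a j = dh j (Suc q) (b j) \<otimes>\<^bsub>C j (Suc q)\<^esub> dv j (Suc q) (b k)" using b(3)[of j] k pj by simp
      have c1: "dh j (Suc q) (b j) \<in> carrier (C j (Suc q))" "dv j (Suc q) (b k) \<in> carrier (C j (Suc q))"
        using bj bk k hom_in_carrier[OF dh_hom] hom_in_carrier[OF dv_hom] by auto
      \<comment> \<open>Here the zigzag condition meets the previous stage of the construction: in
        \<open>dh\<close> of \<open>a j\<close> the summand from \<open>b j\<close> dies because
        \<open>dh dh\<close> is neutral, and what remains commutes past \<open>dv\<close>.\<close>
      have "dv j q (a k) = dh j q (a j)" using zig_eq[OF z, of j] Suc.prems k pj by simp
      also have "\<dots> = dh j q (dv j (Suc q) (b k))"
        unfolding aj using c1 bj hom_in_carrier[OF dh_hom] by (simp add: hom_mult[OF dh_hom] dh_dh)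
      also have "\<dots> = dv j q (dh k q (b k))" using comm[of "b k" j q] bk k by simp
      finally have "dv j q (a k) = dv j q (dh k q (b k))" .
      then have "dv j q u = \<one>\<^bsub>C j q\<^esub>"
        using ak dbk k hom_div[OF dv_hom grp grp, of "a k" j q "dh k q (b k)"]
        by (simp add: u_def hom_in_carrier[OF dv_hom] E.div_eq_one_iff)
      then show ?thesis using col[of u j q] u k by simp
    qed
    then obtain w where w: "w \<in> carrier (C (Suc k) q)" "dv k q w = u" by blast
    have "a k = dh k q (b k) \<otimes>\<^bsub>C k q\<^esub> u"
      using ak dbk by (simp add: u_def D.m_lcomm)
    then show ?case
      by (intro exI[of _ "b(Suc k := w)"]) (use b w q in \<open>auto simp: le_Suc_eq less_Suc_eq\<close>)
  qed
  from this[of "Suc p"] obtain b where b: "\<And>i. i \<le> Suc p \<Longrightarrow> b i \<in> carrier (C i (Suc p - i))"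
    "\<And>i. i \<le> p \<Longrightarrow> a i = dh i (p - i) (b i) \<otimes>\<^bsub>C i (p - i)\<^esub> dv i (p - i) (b (Suc i))"
    by (auto simp: less_Suc_eq_le)
  interpret E: comm_group "M p" by (rule M.grp)
  have bp: "b p \<in> carrier (C p (Suc 0))" "b (Suc p) \<in> carrier (C (Suc p) 0)"
    using b(1)[of p] b(1)[of "Suc p"] by auto
  have "f p (a p) = f p (dv p 0 (b (Suc p)))"
    using b(2)[of p] bp hom_in_carrier[OF dh_hom bp(1)] hom_in_carrier[OF dv_hom bp(2)] hom_in_carrier[OF f_hom]
    by (simp add: hom_mult[OF f_hom] f_dh)
  also have "\<dots> = dY p (f (Suc p) (b (Suc p)))" using f_dv bp by simp
  finally show ?thesis using bp hom_in_carrier[OF f_hom] by (auto simp: boundaries_def)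
qed

definition zigzag :: "nat \<Rightarrow> 'x \<Rightarrow> 'y \<Rightarrow> bool"
  where "zigzag p x y \<longleftrightarrow> (\<exists>a. zig p a \<and> x = e p (a 0) \<and> y = f p (a p))"

lemma zigzag_sym:
  assumes "zigzag p x y"
  shows "bicomplex.zigzag (\<lambda>s t. C t s) (\<lambda>s t. dh t s) (\<lambda>s t. dv t s) f e p y x"
proof -
  interpret T: bicomplex M dY L dX "\<lambda>s t. C t s" "\<lambda>s t. dh t s" "\<lambda>s t. dv t s" f e by (rule transposed)
  obtain a where a: "zig p a" "x = e p (a 0)" "y = f p (a p)" using assms by (auto simp: zigzag_def)
  show ?thesis
    unfolding T.zigzag_def
    by (rule exI[of _ "\<lambda>i. a (p - i)"]) (use a zig_reverse in simp)
qed

lemma zig_mult: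
  assumes "zig p a" "zig p b"
  shows "zig p (\<lambda>i. a i \<otimes>\<^bsub>C i (p - i)\<^esub> b i)"
  unfolding zig_def
proof (intro conjI allI impI)
  fix i assume "i \<le> p"
  then show "a i \<otimes>\<^bsub>C i (p - i)\<^esub> b i \<in> carrier (C i (p - i))"
    using assms by (simp add: zig_mem grp comm_groupD monoid.m_closed)
next
  fix i assume i: "i < p"
  define q where "q = p - Suc i"
  have q: "p - i = Suc q" "p - Suc i = q" using i by (auto simp: q_def)
  have m: "a i \<in> carrier (C i (Suc q))" "b i \<in> carrier (C i (Suc q))"
    "a (Suc i) \<in> carrier (C (Suc i) q)" "b (Suc i) \<in> carrier (C (Suc i) q)"
    using zig_mem[OF assms(1), of i] zig_mem[OF assms(2), of i]
      zig_mem[OF assms(1), of "Suc i"] zig_mem[OF assms(2), of "Suc i"] i q by auto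
  then show "dh i (p - Suc i) (a i \<otimes>\<^bsub>C i (p - i)\<^esub> b i) =
       dv i (p - Suc i) (a (Suc i) \<otimes>\<^bsub>C (Suc i) (p - Suc i)\<^esub> b (Suc i))"
    using zig_eq[OF assms(1) i] zig_eq[OF assms(2) i] unfolding q
    by (simp add: hom_mult[OF dh_hom] hom_mult[OF dv_hom])
qed

text \<open>Totality and the passage of boundaries from start to end are proved directly.
  Surjectivity and the converse passage are the same statements in the transposed bicomplex.\<close>

sublocale zigzag: additive_relation "(L p)\<lparr>carrier := cycles L dX p\<rparr>" "(M p)\<lparr>carrier := cycles M dY p\<rparr>"
  "boundaries L dX p" "boundaries M dY p" "zigzag p" for p
proof -
  interpret T: bicomplex M dY L dX "\<lambda>s t. C t s" "\<lambda>s t. dh t s" "\<lambda>s t. dv t s" f e by (rule transposed)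
  interpret G: comm_group "(L p)\<lparr>carrier := cycles L dX p\<rparr>" by (rule L.comm_group_cycles)
  interpret H: comm_group "(M p)\<lparr>carrier := cycles M dY p\<rparr>" by (rule M.comm_group_cycles)
  have sym: "T.zigzag p y x \<Longrightarrow> zigzag p x y" for x y
    using T.zigzag_sym by simp
  show "additive_relation ((L p)\<lparr>carrier := cycles L dX p\<rparr>) ((M p)\<lparr>carrier := cycles M dY p\<rparr>)
    (boundaries L dX p) (boundaries M dY p) (zigzag p)"
  proof (intro additive_relation.intro additive_relation_axioms.intro G.comm_group_axioms H.comm_group_axioms)
    show "subgroup (boundaries L dX p) ((L p)\<lparr>carrier := cycles L dX p\<rparr>)"
      "subgroup (boundaries M dY p) ((M p)\<lparr>carrier := cycles M dY p\<rparr>)"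
      by (rule L.subgroup_boundaries_cycles M.subgroup_boundaries_cycles)+
  next
    fix x y assume z: "zigzag p x y"
    from z have "x \<in> cycles L dX p" using zig_start_cycle by (auto simp: zigzag_def)
    moreover from zigzag_sym[OF z] have "y \<in> cycles M dY p"
      using T.zig_start_cycle by (auto simp: T.zigzag_def)
    ultimately show "x \<in> carrier ((L p)\<lparr>carrier := cycles L dX p\<rparr>) \<and> y \<in> carrier ((M p)\<lparr>carrier := cycles M dY p\<rparr>)"
      by simp
    from z have "x \<in> boundaries L dX p \<Longrightarrow> y \<in> boundaries M dY p"
      using zig_boundary by (auto simp: zigzag_def)
    moreover from zigzag_sym[OF z] have "y \<in> boundaries M dY p \<Longrightarrow> x \<in> boundaries L dX p"
      using T.zig_boundary by (auto simp: T.zigzag_def)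
    ultimately show "x \<in> boundaries L dX p \<longleftrightarrow> y \<in> boundaries M dY p" by blast
  next
    fix x y x' y' assume "zigzag p x y" "zigzag p x' y'"
    then obtain a b where ab: "zig p a" "x = e p (a 0)" "y = f p (a p)" "zig p b" "x' = e p (b 0)" "y' = f p (b p)"
      by (auto simp: zigzag_def)
    have "zigzag p (x \<otimes>\<^bsub>L p\<^esub> x') (y \<otimes>\<^bsub>M p\<^esub> y')"
      unfolding zigzag_def
      by (rule exI[of _ "\<lambda>i. a i \<otimes>\<^bsub>C i (p - i)\<^esub> b i"])
        (use ab zig_mult zig_mem[OF ab(1), of 0] zig_mem[OF ab(1), of p] zig_mem[OF ab(4), of 0] zig_mem[OF ab(4), of p]
          in \<open>auto simp: hom_mult[OF e_hom] hom_mult[OF f_hom]\<close>)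
    then show "zigzag p (x \<otimes>\<^bsub>(L p)\<lparr>carrier := cycles L dX p\<rparr>\<^esub> x') (y \<otimes>\<^bsub>(M p)\<lparr>carrier := cycles M dY p\<rparr>\<^esub> y')" by simp
  next
    fix x assume "x \<in> carrier ((L p)\<lparr>carrier := cycles L dX p\<rparr>)"
    then show "\<exists>y. zigzag p x y" using zig_exists[of x p] by (auto simp: zigzag_def)
  next
    fix y assume "y \<in> carrier ((M p)\<lparr>carrier := cycles M dY p\<rparr>)"
    then have "\<exists>x. T.zigzag p y x" using T.zig_exists[of y p] by (auto simp: T.zigzag_def)
    then show "\<exists>x. zigzag p x y" using sym by blast
  qed
qed

definition zigzag_map :: "nat \<Rightarrow> 'x set \<Rightarrow> 'y set"
  where "zigzag_map p = rel_map (L p) (boundaries L dX p) (M p) (boundaries M dY p) (zigzag p)"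

lemma zigzag_map_eq:
  "zigzag p x y \<Longrightarrow> zigzag_map p (boundaries L dX p #>\<^bsub>L p\<^esub> x) = boundaries M dY p #>\<^bsub>M p\<^esub> y"
  using zigzag.rel_map_eq[of p x y] by (simp add: zigzag_map_def rel_map_restrict r_coset_def)

lemma zigzag_map_iso: "zigzag_map p \<in> iso (homology L dX p) (homology M dY p)"
  using zigzag.rel_map_iso[of p] by (simp add: zigzag_map_def homology_def rel_map_restrict)

end

lemma zigzag_natural:
  assumes B: "bicomplex L dX M dY C dv dh e f" and B': "bicomplex L' dX' M' dY' C' dv' dh' e' f'"
    and T: "\<And>s t z. z \<in> carrier (C s t) \<Longrightarrow> T s t z \<in> carrier (C' s t)"
    and Tdv: "\<And>s t z. z \<in> carrier (C (Suc s) t) \<Longrightarrow> T s t (dv s t z) = dv' s t (T (Suc s) t z)"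
    and Tdh: "\<And>s t z. z \<in> carrier (C s (Suc t)) \<Longrightarrow> T s t (dh s t z) = dh' s t (T s (Suc t) z)"
    and Te: "\<And>t z. z \<in> carrier (C 0 t) \<Longrightarrow> U t (e t z) = e' t (T 0 t z)"
    and Tf: "\<And>s z. z \<in> carrier (C s 0) \<Longrightarrow> V s (f s z) = f' s (T s 0 z)"
    and z: "bicomplex.zigzag C dv dh e f p x y"
  shows "bicomplex.zigzag C' dv' dh' e' f' p (U p x) (V p y)"
proof -
  interpret B: bicomplex L dX M dY C dv dh e f by fact
  interpret B': bicomplex L' dX' M' dY' C' dv' dh' e' f' by fact
  obtain a where a: "B.zig p a" "x = e p (a 0)" "y = f p (a p)" using z by (auto simp: B.zigzag_def)
  have "B'.zig p (\<lambda>i. T i (p - i) (a i))"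
    unfolding B'.zig_def
  proof (intro conjI allI impI)
    fix i assume "i \<le> p" then show "T i (p - i) (a i) \<in> carrier (C' i (p - i))"
      using T B.zig_mem[OF a(1)] by blast
  next
    fix i assume i: "i < p"
    define q where "q = p - Suc i"
    have q: "p - i = Suc q" "p - Suc i = q" using i by (auto simp: q_def)
    show "dh' i (p - Suc i) (T i (p - i) (a i)) = dv' i (p - Suc i) (T (Suc i) (p - Suc i) (a (Suc i)))"
      using B.zig_mem[OF a(1), of i] B.zig_mem[OF a(1), of "Suc i"] B.zig_eq[OF a(1) i] i unfolding q
      by (metis Suc_leI Tdh Tdv less_imp_le q)
  qed
  moreover have "U p x = e' p (T 0 p (a 0))" "V p y = f' p (T p 0 (a p))"
    using a B.zig_mem[OF a(1), of 0] B.zig_mem[OF a(1), of p] Te Tf by auto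
  ultimately show ?thesis unfolding B'.zigzag_def by (intro exI[of _ "\<lambda>i. T i (p - i) (a i)"]) simp
qed

text \<open>A single zigzag from a representing cycle suffices: its image under \<open>T\<close>
  runs from \<open>U p x\<close> to \<open>V p y\<close> and computes both sides.\<close>

lemma zigzag_map_natural:
  assumes B: "bicomplex L dX M dY C dv dh e f" and B': "bicomplex L' dX' M' dY' C' dv' dh' e' f'"
    and T: "\<And>s t z. z \<in> carrier (C s t) \<Longrightarrow> T s t z \<in> carrier (C' s t)"
    and Tdv: "\<And>s t z. z \<in> carrier (C (Suc s) t) \<Longrightarrow> T s t (dv s t z) = dv' s t (T (Suc s) t z)"
    and Tdh: "\<And>s t z. z \<in> carrier (C s (Suc t)) \<Longrightarrow> T s t (dh s t z) = dh' s t (T s (Suc t) z)"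
    and Te: "\<And>t z. z \<in> carrier (C 0 t) \<Longrightarrow> U t (e t z) = e' t (T 0 t z)"
    and Tf: "\<And>s z. z \<in> carrier (C s 0) \<Longrightarrow> V s (f s z) = f' s (T s 0 z)"
    and U: "\<And>n. U n \<in> hom (L n) (L' n)" "\<And>n x. x \<in> carrier (L (Suc n)) \<Longrightarrow> U n (dX n x) = dX' n (U (Suc n) x)"
    and V: "\<And>n. V n \<in> hom (M n) (M' n)" "\<And>n x. x \<in> carrier (M (Suc n)) \<Longrightarrow> V n (dY n x) = dY' n (V (Suc n) x)"
    and z: "z \<in> carrier (homology L dX p)"
  shows "bicomplex.zigzag_map L' dX' M' dY' C' dv' dh' e' f' p (homology_map L' dX' U p z) =
     homology_map M' dY' V p (bicomplex.zigzag_map L dX M dY C dv dh e f p z)"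
proof -
  interpret B: bicomplex L dX M dY C dv dh e f by fact
  interpret B': bicomplex L' dX' M' dY' C' dv' dh' e' f' by fact
  obtain x where x: "x \<in> cycles L dX p" "z = boundaries L dX p #>\<^bsub>L p\<^esub> x"
    using z by (auto simp: B.L.carrier_homology)
  obtain y where xy: "B.zigzag p x y" using B.zigzag.rel_total[of x p] x by auto
  have c: "x \<in> carrier (L p)" "y \<in> carrier (M p)"
    using B.zigzag.rel_carrier[OF xy] subgroup.subset[OF B.L.subgroup_cycles] subgroup.subset[OF B.M.subgroup_cycles]
    by auto
  have "B'.zigzag p (U p x) (V p y)"
    by (rule zigzag_natural[OF B B' T Tdv Tdh Te Tf xy])
  note 1 = B'.zigzag_map_eq[OF this]
  note 2 = homology_map_coset[where p = p, OF B.L.chain_complex_axioms B'.L.chain_complex_axioms U c(1)]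
  note 3 = homology_map_coset[where p = p, OF B.M.chain_complex_axioms B'.M.chain_complex_axioms V c(2)]
  show "B'.zigzag_map p (homology_map L' dX' U p z) = homology_map M' dY' V p (B.zigzag_map p z)"
    by (simp only: x(2) 1 2 3 B.zigzag_map_eq[OF xy])
qed

section \<open>Colimits of abelian groups\<close>

lemma comm_group_product_group:
  assumes "\<And>i. i \<in> I \<Longrightarrow> comm_group (A i)" shows "comm_group (product_group I A)"
proof (rule group.group_comm_groupI)
  show "group (product_group I A)" by (simp add: assms comm_groupD)
  fix x y assume "x \<in> carrier (product_group I A)" "y \<in> carrier (product_group I A)"
  then show "x \<otimes>\<^bsub>product_group I A\<^esub> y = y \<otimes>\<^bsub>product_group I A\<^esub> x"
    using assms by (auto simp: PiE_iff intro!: restrict_ext comm_monoid.m_comm comm_groupD(2))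
qed

lemma comm_group_sum_group:
  assumes "\<And>i. i \<in> I \<Longrightarrow> comm_group (A i)" shows "comm_group (sum_group I A)"
proof (rule group.group_comm_groupI)
  show "group (sum_group I A)" by (simp add: assms comm_groupD)
  fix x y assume "x \<in> carrier (sum_group I A)" "y \<in> carrier (sum_group I A)"
  then show "x \<otimes>\<^bsub>sum_group I A\<^esub> y = y \<otimes>\<^bsub>sum_group I A\<^esub> x"
    using carrier_sum_group[of I A, OF comm_groupD(1)[OF assms]] assms
    by (auto simp: PiE_iff intro!: restrict_ext comm_monoid.m_comm comm_groupD(2))
qed

locale colim_functor =
  fixes C :: "('o, 'm) cat" and F :: "('o, 'm, 'a) abfun"
  assumes cat: "category C" and fctr: "ab_functor C F"
begin

lemma fob_comm_group: "c \<in> Ob C \<Longrightarrow> comm_group (fob F c)"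
  using fctr by (simp add: ab_functor_def)

lemma far_hom: "g \<in> Ar C \<Longrightarrow> far F g \<in> hom (fob F (src C g)) (fob F (tgt C g))"
  using fctr by (simp add: ab_functor_def)

lemma far_closed: "g \<in> Ar C \<Longrightarrow> x \<in> carrier (fob F (src C g)) \<Longrightarrow> far F g x \<in> carrier (fob F (tgt C g))"
  by (rule hom_in_carrier[OF far_hom])

lemma far_idn: "c \<in> Ob C \<Longrightarrow> x \<in> carrier (fob F c) \<Longrightarrow> far F (idn C c) x = x"
  using fctr by (simp add: ab_functor_def)

lemma far_cmp:
  "f \<in> Ar C \<Longrightarrow> g \<in> Ar C \<Longrightarrow> tgt C f = src C g \<Longrightarrow> x \<in> carrier (fob F (src C f)) \<Longrightarrow>
   far F (cmp C g f) x = far F g (far F f x)"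
  using fctr by (simp add: ab_functor_def)

lemma src_Ob: "g \<in> Ar C \<Longrightarrow> src C g \<in> Ob C" and tgt_Ob: "g \<in> Ar C \<Longrightarrow> tgt C g \<in> Ob C"
  using cat by (simp_all add: category_def)

lemma fob_group: "c \<in> Ob C \<Longrightarrow> group (fob F c)"
  by (rule comm_groupD(1)[OF fob_comm_group])

lemma comm_group_coprod: "comm_group (coprod C F)"
  unfolding coprod_def by (rule comm_group_sum_group) (rule fob_comm_group)

lemma carrier_coprod:
  "carrier (coprod C F) = {x \<in> \<Pi>\<^sub>E i\<in>Ob C. carrier (fob F i). finite {i \<in> Ob C. x i \<noteq> \<one>\<^bsub>fob F i\<^esub>}}"
  unfolding coprod_def by (rule carrier_sum_group) (rule fob_group)

lemma coprod_inj_closed: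
  assumes "c \<in> Ob C" "x \<in> carrier (fob F c)"
  shows "coprod_inj C F c x \<in> carrier (coprod C F)"
proof -
  have "finite {i \<in> Ob C. coprod_inj C F c x i \<noteq> \<one>\<^bsub>fob F i\<^esub>}"
    by (rule finite_subset[of _ "{c}"]) (auto simp: coprod_inj_def)
  then show ?thesis
    using assms fob_group by (auto simp: carrier_coprod coprod_inj_def group.is_monoid monoid.one_closed)
qed

lemma coprod_inj_hom: "c \<in> Ob C \<Longrightarrow> coprod_inj C F c \<in> hom (fob F c) (coprod C F)"
  by (rule homI, rule coprod_inj_closed)
    (use fob_group in \<open>auto simp: coprod_inj_def coprod_def group.is_monoid intro!: restrict_ext\<close>)

text \<open>Elements of a direct sum have finite support, so splitting off one coordinate after
  another ends at the neutral element.\<close>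

lemma coprod_induct:
  assumes s: "s \<in> carrier (coprod C F)"
    and one: "P \<one>\<^bsub>coprod C F\<^esub>"
    and inj: "\<And>c x. c \<in> Ob C \<Longrightarrow> x \<in> carrier (fob F c) \<Longrightarrow> P (coprod_inj C F c x)"
    and mult: "\<And>u v. u \<in> carrier (coprod C F) \<Longrightarrow> v \<in> carrier (coprod C F) \<Longrightarrow> P u \<Longrightarrow> P v \<Longrightarrow> P (u \<otimes>\<^bsub>coprod C F\<^esub> v)"
  shows "P s"
proof -
  have "finite T \<Longrightarrow> s \<in> carrier (coprod C F) \<Longrightarrow> {i \<in> Ob C. s i \<noteq> \<one>\<^bsub>fob F i\<^esub>} \<subseteq> T \<Longrightarrow> P s" for T s
  proof (induction T arbitrary: s rule: finite_induct)
    case empty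
    then have "s = \<one>\<^bsub>coprod C F\<^esub>"
      by (auto simp: coprod_def carrier_coprod[unfolded coprod_def] PiE_iff extensional_def)
    then show ?case using one by simp
  next
    case (insert a T)
    show ?case
    proof (cases "a \<in> Ob C")
      case False
      then show ?thesis using insert by blast
    next
      case a: True
      \<comment> \<open>The coordinate at \<open>a\<close> is erased, which leaves a support
        contained in \<open>T\<close>.\<close>
      define s' where "s' = s(a := \<one>\<^bsub>fob F a\<^esub>)"
      have "finite {i \<in> Ob C. s' i \<noteq> \<one>\<^bsub>fob F i\<^esub>}"
        by (rule finite_subset[OF _ insert.hyps(1)]) (use insert.prems in \<open>auto simp: s'_def\<close>)
      then have s': "s' \<in> carrier (coprod C F)"
        using insert.prems a fob_group
        by (auto simp: carrier_coprod s'_def PiE_iff extensional_def group.is_monoid monoid.one_closed)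
      have "P s'" by (rule insert.IH[OF s']) (use insert.prems in \<open>auto simp: s'_def\<close>)
      moreover have sa: "s a \<in> carrier (fob F a)" using insert.prems a by (auto simp: carrier_coprod)
      moreover have "s = coprod_inj C F a (s a) \<otimes>\<^bsub>coprod C F\<^esub> s'"
        using insert.prems(1) a fob_group
        by (intro ext) (auto simp: coprod_def carrier_coprod[unfolded coprod_def] coprod_inj_def s'_def PiE_iff
            extensional_def group.is_monoid)
      ultimately show ?thesis using mult[OF coprod_inj_closed[OF a sa] s'] inj[OF a sa] by simp
    qed
  qed
  moreover have "finite {i \<in> Ob C. s i \<noteq> \<one>\<^bsub>fob F i\<^esub>}" using s by (simp add: carrier_coprod)
  ultimately show ?thesis using s by blast
qed

definition colim_gens :: "('o \<Rightarrow> 'a) set"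
  where "colim_gens = {coprod_inj C F (src C f) x \<otimes>\<^bsub>coprod C F\<^esub>
       inv\<^bsub>coprod C F\<^esub> (coprod_inj C F (tgt C f) (far F f x)) | f x.
     f \<in> Ar C \<and> x \<in> carrier (fob F (src C f))}"

lemma colim_rel_gens: "colim_rel C F = generate (coprod C F) colim_gens"
  by (simp add: colim_rel_def colim_gens_def)

lemma colim_gens_closed: "colim_gens \<subseteq> carrier (coprod C F)"
proof -
  interpret comm_group "coprod C F" by (rule comm_group_coprod)
  show ?thesis
    by (auto simp: colim_gens_def intro!: m_closed inv_closed coprod_inj_closed src_Ob tgt_Ob far_closed)
qed

lemma subgroup_colim_rel: "subgroup (colim_rel C F) (coprod C F)"
  unfolding colim_rel_gens
  by (rule group.generate_is_subgroup[OF comm_groupD(1)[OF comm_group_coprod] colim_gens_closed])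

lemma comm_group_colim: "comm_group (colim C F)"
  unfolding colim_def by (rule comm_group_Mod[OF comm_group_coprod subgroup_colim_rel])

lemma colim_class_hom: "c \<in> Ob C \<Longrightarrow> colim_class C F c \<in> hom (fob F c) (colim C F)"
  using hom_compose[OF coprod_inj_hom coset_hom[OF comm_group_coprod subgroup_colim_rel]]
  by (simp add: comp_def colim_class_def[abs_def] colim_def)

lemma colim_class_closed: "c \<in> Ob C \<Longrightarrow> x \<in> carrier (fob F c) \<Longrightarrow> colim_class C F c x \<in> carrier (colim C F)"
  by (rule hom_in_carrier[OF colim_class_hom])

lemma colim_class_far:
  assumes "g \<in> Ar C" "x \<in> carrier (fob F (src C g))"
  shows "colim_class C F (tgt C g) (far F g x) = colim_class C F (src C g) x"
proof -
  have "coprod_inj C F (src C g) x \<otimes>\<^bsub>coprod C F\<^esub> inv\<^bsub>coprod C F\<^esub> (coprod_inj C F (tgt C g) (far F g x)) \<in> colim_rel C F"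
    unfolding colim_rel_gens by (rule generate.incl) (use assms in \<open>auto simp: colim_gens_def\<close>)
  then show ?thesis
    unfolding colim_class_def
    by (subst eq_commute, subst coset_eq_iff[OF comm_group_coprod subgroup_colim_rel])
      (use assms in \<open>auto intro!: coprod_inj_closed src_Ob tgt_Ob far_closed\<close>)
qed

lemma colim_induct [consumes 1, case_names cls mult]:
  assumes z: "z \<in> carrier (colim C F)"
    and cls: "\<And>c x. c \<in> Ob C \<Longrightarrow> x \<in> carrier (fob F c) \<Longrightarrow> P (colim_class C F c x)"
    and mult: "\<And>u v. u \<in> carrier (colim C F) \<Longrightarrow> v \<in> carrier (colim C F) \<Longrightarrow> P u \<Longrightarrow> P v \<Longrightarrow> P (u \<otimes>\<^bsub>colim C F\<^esub> v)"
    and ne: "Ob C \<noteq> {}"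
  shows "P z"
proof -
  note q = coset_hom[OF comm_group_coprod subgroup_colim_rel, folded colim_def]
  interpret comm_group "coprod C F" by (rule comm_group_coprod)
  obtain s where s: "s \<in> carrier (coprod C F)" "z = colim_rel C F #>\<^bsub>coprod C F\<^esub> s"
    using z by (auto simp: colim_def carrier_Mod)
  have "P (colim_rel C F #>\<^bsub>coprod C F\<^esub> s)"
    using s(1)
  proof (rule coprod_induct)
    \<comment> \<open>An object is needed in order to write the neutral element as a class; this
      spares users of the induction a case for it.\<close>
    obtain c where c: "c \<in> Ob C" using ne by blast
    have "coprod_inj C F c \<one>\<^bsub>fob F c\<^esub> = \<one>\<^bsub>coprod C F\<^esub>"
      by (rule hom_one_comm[OF coprod_inj_hom[OF c] fob_comm_group[OF c] comm_group_coprod])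
    then show "P (colim_rel C F #>\<^bsub>coprod C F\<^esub> \<one>\<^bsub>coprod C F\<^esub>)"
      using cls[OF c monoid.one_closed[OF comm_groupD(3)[OF fob_comm_group[OF c]]]] by (simp add: colim_class_def)
  next
    fix c x assume "c \<in> Ob C" "x \<in> carrier (fob F c)"
    then show "P (colim_rel C F #>\<^bsub>coprod C F\<^esub> coprod_inj C F c x)" using cls by (simp add: colim_class_def)
  next
    fix u v assume uv: "u \<in> carrier (coprod C F)" "v \<in> carrier (coprod C F)"
      "P (colim_rel C F #>\<^bsub>coprod C F\<^esub> u)" "P (colim_rel C F #>\<^bsub>coprod C F\<^esub> v)"
    then show "P (colim_rel C F #>\<^bsub>coprod C F\<^esub> (u \<otimes>\<^bsub>coprod C F\<^esub> v))"
      unfolding hom_mult[OF q uv(1,2)] by (intro mult hom_in_carrier[OF q])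
  qed
  then show ?thesis using s by simp
qed

lemma colim_universal:
  assumes H: "comm_group H" and k: "\<And>c. c \<in> Ob C \<Longrightarrow> k c \<in> hom (fob F c) H"
    and cocone: "\<And>g x. g \<in> Ar C \<Longrightarrow> x \<in> carrier (fob F (src C g)) \<Longrightarrow> k (tgt C g) (far F g x) = k (src C g) x"
  obtains h where "h \<in> hom (colim C F) H"
    "\<And>c x. c \<in> Ob C \<Longrightarrow> x \<in> carrier (fob F c) \<Longrightarrow> h (colim_class C F c x) = k c x"
proof -
  interpret H: comm_group H by fact
  \<comment> \<open>\<open>gfinprod\<close> multiplies over the coordinates with non-neutral factor.
    These are finitely many on the direct sum, although there may be infinitely many
    objects.\<close>
  define f where "f = (\<lambda>s. gfinprod H (\<lambda>i. k i (s i)) (Ob C))"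
  have f: "f \<in> hom (coprod C F) H"
    unfolding f_def coprod_def by (rule H.hom_group_sum[OF k fob_group])
  have f_inj: "f (coprod_inj C F c x) = k c x" if c: "c \<in> Ob C" "x \<in> carrier (fob F c)" for c x
  proof -
    have kc: "k c x \<in> carrier H" by (rule hom_in_carrier[OF k[OF c(1)] c(2)])
    have one: "k i \<one>\<^bsub>fob F i\<^esub> = \<one>\<^bsub>H\<^esub>" if "i \<in> Ob C" for i
      by (rule hom_one_comm[OF k[OF that] fob_comm_group[OF that] H])
    have "f (coprod_inj C F c x) = gfinprod H (\<lambda>i. if i = c then k c x else \<one>\<^bsub>H\<^esub>) (Ob C)"
      unfolding f_def by (rule H.gfinprod_cong) (use c kc one in \<open>auto simp: coprod_inj_def simp_implies_def\<close>)
    also have "\<dots> = k c x"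
    proof (cases "k c x = \<one>\<^bsub>H\<^esub>")
      case True
      then show ?thesis by (simp add: gfinprod_def cong: if_cong)
    next
      case False
      then have e: "{i \<in> Ob C. (if i = c then k c x else \<one>\<^bsub>H\<^esub>) \<noteq> \<one>\<^bsub>H\<^esub>} = {c}" using c by auto
      show ?thesis unfolding gfinprod_def e using kc by simp
    qed
    finally show ?thesis .
  qed
  have "f s = \<one>\<^bsub>H\<^esub>" if s: "s \<in> colim_gens" for s
  proof -
    obtain g x where g: "g \<in> Ar C" "x \<in> carrier (fob F (src C g))"
      "s = coprod_inj C F (src C g) x \<otimes>\<^bsub>coprod C F\<^esub> inv\<^bsub>coprod C F\<^esub> (coprod_inj C F (tgt C g) (far F g x))"
      using s by (auto simp: colim_gens_def)
    have kc: "k (src C g) x \<in> carrier H" by (rule hom_in_carrier[OF k[OF src_Ob[OF g(1)]] g(2)])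
    show ?thesis
      unfolding g(3)
      by (subst hom_div[OF f comm_group_coprod H])
        (use g kc in \<open>auto simp: f_inj src_Ob tgt_Ob far_closed cocone intro!: coprod_inj_closed\<close>)
  qed
  then obtain h where h: "h \<in> hom (coprod C F Mod generate (coprod C F) colim_gens) H"
    "\<And>s. s \<in> carrier (coprod C F) \<Longrightarrow> h (generate (coprod C F) colim_gens #>\<^bsub>coprod C F\<^esub> s) = f s"
    using quotient_universal[OF comm_group_coprod H colim_gens_closed f] by blast
  show ?thesis
  proof
    show "h \<in> hom (colim C F) H" using h(1) by (simp add: colim_def colim_rel_gens)
    fix c x assume "c \<in> Ob C" "x \<in> carrier (fob F c)"
    then show "h (colim_class C F c x) = k c x"
      using h(2) f_inj by (simp add: colim_class_def colim_rel_gens coprod_inj_closed)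
  qed
qed

lemma colim_hom_eq:
  assumes h: "h \<in> hom (colim C F) H" and k: "k \<in> hom (colim C F) H" and ne: "Ob C \<noteq> {}"
    and eq: "\<And>c x. c \<in> Ob C \<Longrightarrow> x \<in> carrier (fob F c) \<Longrightarrow> h (colim_class C F c x) = k (colim_class C F c x)"
    and z: "z \<in> carrier (colim C F)"
  shows "h z = k z"
  using z by (induction rule: colim_induct) (use eq ne in \<open>auto simp: hom_mult[OF h] hom_mult[OF k]\<close>)

end

text \<open>The coordinatewise map keeps supports finite because each \<open>t c\<close> preserves
  the neutral element. By naturality it takes the relation at \<open>(g, x)\<close> to the relation
  at \<open>g\<close> and the image of \<open>x\<close>.\<close>

lemma colim_map:
  assumes "category C" "ab_functor C F" "ab_functor C G" and t: "nat_trans C F G t"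
  shows colim_map_hom: "colim_map C G t \<in> hom (colim C F) (colim C G)"
    and colim_map_class: "\<And>c x. c \<in> Ob C \<Longrightarrow> x \<in> carrier (fob F c) \<Longrightarrow>
      colim_map C G t (colim_class C F c x) = colim_class C G c (t c x)"
proof -
  interpret F: colim_functor C F using assms by unfold_locales
  interpret G: colim_functor C G using assms by unfold_locales
  have th: "t c \<in> hom (fob F c) (fob G c)" if "c \<in> Ob C" for c using t that by (simp add: nat_trans_def)
  have tcl: "t c x \<in> carrier (fob G c)" if "c \<in> Ob C" "x \<in> carrier (fob F c)" for c x
    by (rule hom_in_carrier[OF th[OF that(1)] that(2)])
  have t1: "t c \<one>\<^bsub>fob F c\<^esub> = \<one>\<^bsub>fob G c\<^esub>" if "c \<in> Ob C" for c
    by (rule hom_one_comm[OF th[OF that] F.fob_comm_group[OF that] G.fob_comm_group[OF that]])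
  define T where "T = (\<lambda>s. \<lambda>i\<in>Ob C. t i (s i))"
  have T: "T \<in> hom (coprod C F) (coprod C G)"
  proof (rule homI)
    fix s assume s: "s \<in> carrier (coprod C F)"
    then have "finite {i \<in> Ob C. T s i \<noteq> \<one>\<^bsub>fob G i\<^esub>}"
      by (rule_tac finite_subset[of _ "{i \<in> Ob C. s i \<noteq> \<one>\<^bsub>fob F i\<^esub>}"]) (auto simp: F.carrier_coprod T_def t1)
    then show "T s \<in> carrier (coprod C G)"
      using s tcl by (auto simp: F.carrier_coprod G.carrier_coprod T_def)
  next
    fix s s' assume "s \<in> carrier (coprod C F)" "s' \<in> carrier (coprod C F)"
    then show "T (s \<otimes>\<^bsub>coprod C F\<^esub> s') = T s \<otimes>\<^bsub>coprod C G\<^esub> T s'"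
      unfolding F.carrier_coprod by (auto simp: T_def coprod_def PiE_iff hom_mult[OF th] intro!: restrict_ext)
  qed
  have Tinj: "T (coprod_inj C F c x) = coprod_inj C G c (t c x)" if "c \<in> Ob C" "x \<in> carrier (fob F c)" for c x
    using that by (auto simp: T_def coprod_inj_def t1 intro!: restrict_ext)
  have "T ` F.colim_gens \<subseteq> colim_rel C G"
  proof
    fix w assume "w \<in> T ` F.colim_gens"
    then obtain g x where g: "g \<in> Ar C" "x \<in> carrier (fob F (src C g))"
      "w = T (coprod_inj C F (src C g) x \<otimes>\<^bsub>coprod C F\<^esub> inv\<^bsub>coprod C F\<^esub> (coprod_inj C F (tgt C g) (far F g x)))"
      by (auto simp: F.colim_gens_def)
    have "w = coprod_inj C G (src C g) (t (src C g) x) \<otimes>\<^bsub>coprod C G\<^esub> inv\<^bsub>coprod C G\<^esub> (coprod_inj C G (tgt C g) (far G g (t (src C g) x)))"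
      unfolding g(3) using g t
      by (subst hom_div[OF T F.comm_group_coprod G.comm_group_coprod])
        (auto simp: Tinj F.src_Ob F.tgt_Ob F.far_closed nat_trans_def intro!: F.coprod_inj_closed)
    then have "w \<in> G.colim_gens" unfolding G.colim_gens_def using g tcl F.src_Ob by blast
    then show "w \<in> colim_rel C G" unfolding G.colim_rel_gens by (rule generate.incl)
  qed
  note q = quotient_map_hom[OF F.comm_group_coprod G.comm_group_coprod F.colim_gens_closed G.subgroup_colim_rel T this]
    quot_map_coset[OF F.comm_group_coprod G.comm_group_coprod F.colim_gens_closed G.subgroup_colim_rel T this]
  have e: "colim_map C G t = quot_map (coprod C G) (colim_rel C G) T"
    by (simp add: colim_map_def[abs_def] T_def fun_eq_iff)
  show "colim_map C G t \<in> hom (colim C F) (colim C G)"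
    using q(1) unfolding e colim_def F.colim_rel_gens .
  show "colim_map C G t (colim_class C F c x) = colim_class C G c (t c x)" if "c \<in> Ob C" "x \<in> carrier (fob F c)" for c x
    using q(2)[OF F.coprod_inj_closed[OF that]] unfolding e colim_class_def F.colim_rel_gens Tinj[OF that] .
qed


section \<open>Colimits along the inclusions and the action of injections\<close>

lemma ab_functor_cat_N: "ab_functor cat_I F \<Longrightarrow> ab_functor cat_N F"
  using cat_N_subset unfolding ab_functor_def cat_I_simps by blast

lemma nat_trans_cat_N: "nat_trans cat_I F G t \<Longrightarrow> nat_trans cat_N F G t"
  using cat_N_subset unfolding nat_trans_def cat_I_simps by blast

definition inc :: "nat \<Rightarrow> nat \<Rightarrow> arrow"
  where "inc m n = (m, \<lambda>i\<in>{1..m}. i, n)"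

lemma inc_simps [simp]: "src cat_I (inc m n) = m" "tgt cat_I (inc m n) = n"
  by (simp_all add: inc_def cat_I_simps)

lemma inc_Ar_N: "m \<le> n \<Longrightarrow> inc m n \<in> Ar cat_N"
  by (simp add: inc_def Ar_cat_N)

lemma inc_Ar_I: "m \<le> n \<Longrightarrow> inc m n \<in> Ar cat_I"
  using inc_Ar_N cat_N_subset by blast

lemma Ar_N_inc: "g \<in> Ar cat_N \<Longrightarrow> \<exists>m n. m \<le> n \<and> g = inc m n"
  by (cases g) (auto simp: inc_def Ar_cat_N)

lemma idn_inc: "idn cat_I n = inc n n"
  by (simp add: inc_def cat_I_simps)

lemma cmp_inc_inc: "l \<le> m \<Longrightarrow> cmp cat_I (inc m n) (inc l m) = inc l n"
  by (auto simp: inc_def cat_I_simps compose_def intro!: restrict_ext)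

text \<open>The target \<open>m\<close> is a free parameter instead of \<open>max_image f n\<close>,
  so that restrictions of different maps, and composites, can be compared at a common stage.\<close>

definition rst :: "(nat \<Rightarrow> nat) \<Rightarrow> nat \<Rightarrow> nat \<Rightarrow> arrow"
  where "rst f n m = (n, restrict f {1..n}, m)"

lemma rst_simps [simp]: "src cat_I (rst f n m) = n" "tgt cat_I (rst f n m) = m"
  by (simp_all add: rst_def cat_I_simps)

lemma max_image_ge: "i \<in> {1..n} \<Longrightarrow> f i \<le> max_image f n"
  by (auto simp: max_image_def)

lemma max_image_le: "(\<And>i. i \<in> {1..n} \<Longrightarrow> f i \<le> k) \<Longrightarrow> max_image f n \<le> k"
  by (auto simp: max_image_def)

lemma max_image_mono: "n \<le> n' \<Longrightarrow> max_image f n \<le> max_image f n'"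
  by (rule max_image_le) (rule max_image_ge, simp)

lemma carrier_inj_monoid: "f \<in> carrier inj_monoid \<longleftrightarrow> f \<in> omega \<rightarrow>\<^sub>E omega \<and> inj_on f omega"
  by (simp add: inj_monoid_def)

lemma inj_monoid_ge_1: "f \<in> carrier inj_monoid \<Longrightarrow> 1 \<le> i \<Longrightarrow> 1 \<le> f i"
  by (auto simp: carrier_inj_monoid omega_def PiE_iff)

lemma rst_Ar:
  assumes f: "f \<in> carrier inj_monoid" and m: "max_image f n \<le> m"
  shows "rst f n m \<in> Ar cat_I"
proof -
  have "inj_on f {1..n}"
    by (rule inj_on_subset[of f omega]) (use f in \<open>auto simp: carrier_inj_monoid omega_def\<close>)
  then have "inj_on (restrict f {1..n}) {1..n}" by (simp add: inj_on_restrict_eq)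
  moreover have "f i \<in> {1..m}" if "i \<in> {1..n}" for i
    using that max_image_ge[OF that, of f] inj_monoid_ge_1[OF f, of i] m by simp
  then have "restrict f {1..n} \<in> {1..n} \<rightarrow>\<^sub>E {1..m}" by (simp only: restrict_PiE_iff) blast
  ultimately show ?thesis unfolding rst_def Ar_cat_I by blast
qed

lemma cmp_inc_rst:
  assumes f: "f \<in> carrier inj_monoid" and m: "max_image f n \<le> m"
  shows "cmp cat_I (inc m m') (rst f n m) = rst f n m'"
proof -
  have "f i \<in> {1..m}" if "i \<in> {1..n}" for i
    using that m max_image_ge[OF that, of f] inj_monoid_ge_1[OF f, of i] by simp
  then show ?thesis by (auto simp: inc_def rst_def cat_I_simps compose_def intro!: restrict_ext)
qed

lemma cmp_rst_inc: "cmp cat_I (rst f n' m) (inc n n') = rst f n m" if "n \<le> n'"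
  using that by (auto simp: inc_def rst_def cat_I_simps compose_def intro!: restrict_ext)

lemma cmp_rst_rst:
  assumes f: "f \<in> carrier inj_monoid" and g: "g \<in> carrier inj_monoid" and m: "max_image f n \<le> m"
  shows "cmp cat_I (rst g m k) (rst f n m) = rst (g \<otimes>\<^bsub>inj_monoid\<^esub> f) n k"
proof -
  have "f i \<in> {1..m}" if "i \<in> {1..n}" for i
    using that m max_image_ge[OF that, of f] inj_monoid_ge_1[OF f, of i] by simp
  then show ?thesis
    by (auto simp: rst_def cat_I_simps compose_def inj_monoid_def omega_def intro!: restrict_ext)
qed

lemma max_image_mult:
  assumes f: "f \<in> carrier inj_monoid" and m: "max_image f n \<le> m"
  shows "max_image (g \<otimes>\<^bsub>inj_monoid\<^esub> f) n \<le> max_image g m"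
proof (rule max_image_le)
  fix i assume i: "i \<in> {1..n}"
  then have "f i \<in> {1..m}"
    using m max_image_ge[OF i, of f] inj_monoid_ge_1[OF f, of i] by simp
  then show "(g \<otimes>\<^bsub>inj_monoid\<^esub> f) i \<le> max_image g m"
    using i max_image_ge[of "f i" m g] by (simp add: inj_monoid_def compose_def omega_def)
qed

section \<open>The colimit along the inclusions and its action of the injection monoid\<close>

locale I_functor =
  fixes F :: "(nat, arrow, 'a) abfun"
  assumes fctr_I: "ab_functor cat_I F"
begin

sublocale I: colim_functor cat_I F
  by unfold_locales (rule category_cat_I fctr_I)+

sublocale N: colim_functor cat_N F
  by unfold_locales (rule category_cat_N ab_functor_cat_N fctr_I)+

abbreviation cls :: "nat \<Rightarrow> 'a \<Rightarrow> (nat \<Rightarrow> 'a) set"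
  where "cls \<equiv> colim_class cat_N F"

abbreviation colimN :: "(nat \<Rightarrow> 'a) set monoid"
  where "colimN \<equiv> colim cat_N F"

lemma grp: "comm_group (fob F n)"
  by (rule I.fob_comm_group) (simp add: cat_I_simps)

lemma cls_hom: "cls n \<in> hom (fob F n) colimN"
  by (rule N.colim_class_hom) (simp add: cat_I_simps)

lemma cls_closed: "x \<in> carrier (fob F n) \<Longrightarrow> cls n x \<in> carrier colimN"
  by (rule hom_in_carrier[OF cls_hom])

lemma inc_hom: "m \<le> n \<Longrightarrow> far F (inc m n) \<in> hom (fob F m) (fob F n)"
  using I.far_hom[OF inc_Ar_I] by simp

lemma inc_closed: "m \<le> n \<Longrightarrow> x \<in> carrier (fob F m) \<Longrightarrow> far F (inc m n) x \<in> carrier (fob F n)"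
  by (rule hom_in_carrier[OF inc_hom])

lemma cls_inc: "m \<le> n \<Longrightarrow> x \<in> carrier (fob F m) \<Longrightarrow> cls n (far F (inc m n) x) = cls m x"
  using N.colim_class_far[OF inc_Ar_N, of m n x] by (simp add: cat_I_simps)

lemma inc_inc:
  "l \<le> m \<Longrightarrow> m \<le> n \<Longrightarrow> x \<in> carrier (fob F l) \<Longrightarrow> far F (inc m n) (far F (inc l m) x) = far F (inc l n) x"
  using I.far_cmp[OF inc_Ar_I inc_Ar_I, of l m m n x] by (simp add: cmp_inc_inc)

lemma colimN_universal:
  assumes H: "comm_group H" and k: "\<And>n. k n \<in> hom (fob F n) H"
    and cocone: "\<And>m n x. m \<le> n \<Longrightarrow> x \<in> carrier (fob F m) \<Longrightarrow> k n (far F (inc m n) x) = k m x"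
  obtains h where "h \<in> hom colimN H" "\<And>n x. x \<in> carrier (fob F n) \<Longrightarrow> h (cls n x) = k n x"
proof (rule N.colim_universal[OF H])
  show "k c \<in> hom (fob F c) H" for c by (rule k)
  show "k (tgt cat_N g) (far F g x) = k (src cat_N g) x" if "g \<in> Ar cat_N" "x \<in> carrier (fob F (src cat_N g))" for g x
    using Ar_N_inc[OF that(1)] that(2) cocone by (auto simp: cat_I_simps)
qed (use that in \<open>simp add: cat_I_simps\<close>)

text \<open>N is directed: classes from stages \<open>m\<close> and \<open>n\<close> can be moved to
  stage \<open>max m n\<close> and multiplied there.\<close>

lemma colimN_rep:
  assumes "z \<in> carrier colimN"
  obtains n x where "x \<in> carrier (fob F n)" "z = cls n x"
proof -
  from assms have "\<exists>n x. x \<in> carrier (fob F n) \<and> z = cls n x"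
  proof (induction rule: N.colim_induct)
    case (mult u v)
    then obtain m n x y where xy: "x \<in> carrier (fob F m)" "u = cls m x" "y \<in> carrier (fob F n)" "v = cls n y"
      by blast
    let ?k = "max m n"
    interpret K: comm_group "fob F ?k" by (rule grp)
    have "u = cls ?k (far F (inc m ?k) x)" "v = cls ?k (far F (inc n ?k) y)"
      using xy cls_inc by simp_all
    then have "u \<otimes>\<^bsub>colimN\<^esub> v = cls ?k (far F (inc m ?k) x \<otimes>\<^bsub>fob F ?k\<^esub> far F (inc n ?k) y)"
      using xy by (simp add: hom_mult[OF cls_hom] inc_closed)
    moreover have "far F (inc m ?k) x \<otimes>\<^bsub>fob F ?k\<^esub> far F (inc n ?k) y \<in> carrier (fob F ?k)"
      using xy by (simp add: inc_closed)
    ultimately show ?case by blast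
  qed (auto simp: cat_I_simps)
  then show ?thesis using that by blast
qed

text \<open>The class of \<open>x\<close> is detected in the quotient of \<open>\<Prod>\<^sub>i F(i)\<close> by \<open>\<Oplus>\<^sub>i F(i)\<close>, to which \<open>F(n)\<close> maps by
  \<open>x \<mapsto> (F(n \<subseteq> i)(x))\<^bsub>i \<ge> n\<^esub>\<close>.\<close>

lemma cls_eq_one:
  assumes x: "x \<in> carrier (fob F n)" and one: "cls n x = \<one>\<^bsub>colimN\<^esub>"
  shows "\<exists>k\<ge>n. far F (inc n k) x = \<one>\<^bsub>fob F k\<^esub>"
proof -
  let ?P = "product_group UNIV (fob F)" and ?S = "carrier (sum_group UNIV (fob F))"
  note g = comm_groupD(1)[OF grp]
  have P: "comm_group ?P" by (rule comm_group_product_group) (rule grp)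
  have carS: "?S = {x \<in> \<Pi>\<^sub>E i\<in>UNIV. carrier (fob F i). finite {i \<in> UNIV. x i \<noteq> \<one>\<^bsub>fob F i\<^esub>}}"
    by (rule carrier_sum_group) (rule g)
  have S: "subgroup ?S ?P"
    unfolding carS by (rule subgroup_sum_group) (rule g)
  define v where "v = (\<lambda>n x i. if n \<le> i then far F (inc n i) x else \<one>\<^bsub>fob F i\<^esub>)"
  have v: "v n \<in> hom (fob F n) ?P" for n
  proof (rule homI)
    fix x assume "x \<in> carrier (fob F n)"
    then show "v n x \<in> carrier ?P"
      using inc_closed g by (auto simp: v_def group.is_monoid monoid.one_closed)
  next
    fix x y assume "x \<in> carrier (fob F n)" "y \<in> carrier (fob F n)"
    then show "v n (x \<otimes>\<^bsub>fob F n\<^esub> y) = v n x \<otimes>\<^bsub>?P\<^esub> v n y"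
      using g by (auto simp: v_def hom_mult[OF inc_hom] group.is_monoid monoid.one_closed)
  qed
  have vS: "?S #>\<^bsub>?P\<^esub> v n (far F (inc m n) x) = ?S #>\<^bsub>?P\<^esub> v m x"
    if "m \<le> n" "x \<in> carrier (fob F m)" for m n x
  proof -
    have mem: "v n (far F (inc m n) x) \<in> carrier ?P" "v m x \<in> carrier ?P"
      using hom_in_carrier[OF v] that inc_closed by blast+
    have vi: "v m x i \<in> carrier (fob F i)" "v n (far F (inc m n) x) i \<in> carrier (fob F i)" for i
      using mem by auto
    have e: "v n (far F (inc m n) x) \<otimes>\<^bsub>?P\<^esub> inv\<^bsub>?P\<^esub> (v m x) =
        (\<lambda>i. v n (far F (inc m n) x) i \<otimes>\<^bsub>fob F i\<^esub> inv\<^bsub>fob F i\<^esub> (v m x i))"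
      using mem g by (subst inv_product_group) auto
    \<comment> \<open>From stage \<open>n\<close> on both sequences consist of the images of
      \<open>x\<close>. They can differ only where the one starting at \<open>n\<close> still has
      its neutral default entries.\<close>
    have "{i. v n (far F (inc m n) x) i \<otimes>\<^bsub>fob F i\<^esub> inv\<^bsub>fob F i\<^esub> (v m x i) \<noteq> \<one>\<^bsub>fob F i\<^esub>} \<subseteq> {..n}"
    proof (rule subsetI, rule ccontr)
      fix i assume i: "i \<in> {i. v n (far F (inc m n) x) i \<otimes>\<^bsub>fob F i\<^esub> inv\<^bsub>fob F i\<^esub> (v m x i) \<noteq> \<one>\<^bsub>fob F i\<^esub>}" "i \<notin> {..n}"
      then have "v n (far F (inc m n) x) i = v m x i" using that inc_inc by (simp add: v_def)
      then show False using i(1) vi group.r_inv[OF g] by simp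
    qed
    then have "finite {i. v n (far F (inc m n) x) i \<otimes>\<^bsub>fob F i\<^esub> inv\<^bsub>fob F i\<^esub> (v m x i) \<noteq> \<one>\<^bsub>fob F i\<^esub>}"
      by (rule finite_subset) simp
    then have "v n (far F (inc m n) x) \<otimes>\<^bsub>?P\<^esub> inv\<^bsub>?P\<^esub> (v m x) \<in> ?S"
      unfolding e carS using monoid.m_closed[OF group.is_monoid[OF g] vi(2) group.inv_closed[OF g vi(1)]] by (simp add: PiE_UNIV_domain)
    then show ?thesis by (simp only: coset_eq_iff[OF P S mem])
  qed
  obtain h where h: "h \<in> hom colimN (?P Mod ?S)" "\<And>n x. x \<in> carrier (fob F n) \<Longrightarrow> h (cls n x) = ?S #>\<^bsub>?P\<^esub> v n x"
  proof (rule colimN_universal[OF comm_group_Mod[OF P S]])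
    show "(\<lambda>x. ?S #>\<^bsub>?P\<^esub> v n x) \<in> hom (fob F n) (?P Mod ?S)" for n
      using hom_compose[OF v coset_hom[OF P S]] by (simp add: comp_def)
  qed (use vS in blast)+
  have "?S #>\<^bsub>?P\<^esub> v n x = ?S"
    using h(2)[OF x] one hom_one_comm[OF h(1) N.comm_group_colim comm_group_Mod[OF P S]] by (simp add: one_Mod)
  then have "v n x \<in> ?S"
    using coset_one_iff[OF P S hom_in_carrier[OF v x]] by simp
  then have "finite {i. v n x i \<noteq> \<one>\<^bsub>fob F i\<^esub>}" unfolding carS by simp
  then have "\<exists>k. k \<notin> {i. v n x i \<noteq> \<one>\<^bsub>fob F i\<^esub>} \<union> {..n}" by (intro ex_new_if_finite) (auto simp: infinite_UNIV_nat)
  then show ?thesis by (auto simp: v_def) (metis less_imp_le not_le)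
qed

lemma rst_closed:
  "f \<in> carrier inj_monoid \<Longrightarrow> max_image f n \<le> m \<Longrightarrow> x \<in> carrier (fob F n) \<Longrightarrow> far F (rst f n m) x \<in> carrier (fob F m)"
  using I.far_closed[OF rst_Ar, of f n m x] by simp

text \<open>\<open>inj_action\<close> is a definite description over all representatives of a class.
  It is meaningful because the universal property provides one homomorphism \<open>h\<close> whose
  value every admissible \<open>w\<close> must be.\<close>

lemma inj_action:
  assumes f: "f \<in> carrier inj_monoid"
  shows inj_action_hom: "inj_action F f \<in> hom colimN colimN"
    and inj_action_cls: "\<And>n m x. x \<in> carrier (fob F n) \<Longrightarrow> max_image f n \<le> m \<Longrightarrow>
      inj_action F f (cls n x) = cls m (far F (rst f n m) x)"
proof -
  define k where "k = (\<lambda>n x. cls (max_image f n) (far F (rst f n (max_image f n)) x))"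
  \<comment> \<open>Any stage beyond the maximum of \<open>f\<close> gives the same class. The
    cocone condition needs this because the maximum grows with the stage of the
    representative.\<close>
  have rst_inc: "cls m (far F (rst f n m) x) = k n x" if "max_image f n \<le> m" "x \<in> carrier (fob F n)" for n m x
  proof -
    have "far F (rst f n m) x = far F (inc (max_image f n) m) (far F (rst f n (max_image f n)) x)"
      using I.far_cmp[OF rst_Ar[OF f order_refl] inc_Ar_I[OF that(1)], where x = x] that f
      by (simp add: cmp_inc_rst)
    then show ?thesis using cls_inc[OF that(1) rst_closed[OF f order_refl that(2)]] by (simp add: k_def)
  qed
  obtain h where h: "h \<in> hom colimN colimN" "\<And>n x. x \<in> carrier (fob F n) \<Longrightarrow> h (cls n x) = k n x"
  proof (rule colimN_universal[OF N.comm_group_colim])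
    fix n
    have "far F (rst f n (max_image f n)) \<in> hom (fob F n) (fob F (max_image f n))"
      using I.far_hom[OF rst_Ar[OF f order_refl], of n] by simp
    from hom_compose[OF this cls_hom] show "k n \<in> hom (fob F n) colimN" by (simp add: comp_def k_def)
  next
    fix m n x assume mn: "m \<le> n" "x \<in> carrier (fob F m)"
    have "k n (far F (inc m n) x) = cls (max_image f n) (far F (rst f m (max_image f n)) x)"
      using I.far_cmp[OF inc_Ar_I[OF mn(1)] rst_Ar[OF f order_refl], where x = x] mn by (simp add: k_def cmp_rst_inc)
    then show "k n (far F (inc m n) x) = k m x" using rst_inc[OF max_image_mono[OF mn(1)] mn(2)] by simp
  qed blast
  have act: "inj_action F f z = h z" if z: "z \<in> carrier colimN" for z
  proof -
    have *: "w = h z" if "\<exists>n. \<exists>x\<in>carrier (fob F n). z = cls n x \<and>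
       w = cls (max_image f n) (far F (n, restrict f {1..n}, max_image f n) x)" for w
      using that h(2) by (auto simp: k_def rst_def)
    obtain n x where "x \<in> carrier (fob F n)" "z = cls n x" by (rule colimN_rep[OF z])
    then have "\<exists>n. \<exists>x\<in>carrier (fob F n). z = cls n x \<and>
       h z = cls (max_image f n) (far F (n, restrict f {1..n}, max_image f n) x)"
      using h(2) by (auto simp: k_def rst_def)
    then show ?thesis unfolding inj_action_def by (rule the_equality) (rule *)
  qed
  interpret L: comm_group colimN by (rule N.comm_group_colim)
  show "inj_action F f \<in> hom colimN colimN"
    by (rule homI) (simp_all add: act hom_in_carrier[OF h(1)] hom_mult[OF h(1)])
  show "inj_action F f (cls n x) = cls m (far F (rst f n m) x)"
    if "x \<in> carrier (fob F n)" "max_image f n \<le> m" for n m x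
    using act[OF cls_closed[OF that(1)]] h(2)[OF that(1)] rst_inc[OF that(2,1)] by simp
qed

lemma inj_action_one:
  assumes "z \<in> carrier colimN" shows "inj_action F \<one>\<^bsub>inj_monoid\<^esub> z = z"
proof -
  obtain n x where x: "x \<in> carrier (fob F n)" "z = cls n x" by (rule colimN_rep[OF assms])
  have r: "rst \<one>\<^bsub>inj_monoid\<^esub> n n = idn cat_I n"
    by (auto simp: rst_def inj_monoid_def idn_inc inc_def omega_def intro!: restrict_ext)
  have "inj_action F \<one>\<^bsub>inj_monoid\<^esub> z = cls n (far F (rst \<one>\<^bsub>inj_monoid\<^esub> n n) x)"
    unfolding x(2) by (rule inj_action_cls[OF monoid.one_closed[OF monoid_inj_monoid] x(1)])
      (auto intro!: max_image_le simp: inj_monoid_def omega_def)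
  then show ?thesis using x I.far_idn by (simp add: r cat_I_simps)
qed

lemma inj_action_mult:
  assumes f: "f \<in> carrier inj_monoid" and g: "g \<in> carrier inj_monoid" and z: "z \<in> carrier colimN"
  shows "inj_action F (g \<otimes>\<^bsub>inj_monoid\<^esub> f) z = inj_action F g (inj_action F f z)"
proof -
  obtain n x where x: "x \<in> carrier (fob F n)" "z = cls n x" by (rule colimN_rep[OF z])
  define m where "m = max_image f n"
  define k where "k = max_image g m"
  have m: "max_image f n \<le> m" and k: "max_image g m \<le> k" by (simp_all add: m_def k_def)
  have gf: "g \<otimes>\<^bsub>inj_monoid\<^esub> f \<in> carrier inj_monoid" by (rule monoid.m_closed[OF monoid_inj_monoid g f])
  have "inj_action F g (inj_action F f z) = cls k (far F (rst g m k) (far F (rst f n m) x))"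
    unfolding x(2) inj_action_cls[OF f x(1) m] by (rule inj_action_cls[OF g rst_closed[OF f m x(1)] k])
  also have "\<dots> = cls k (far F (rst (g \<otimes>\<^bsub>inj_monoid\<^esub> f) n k) x)"
    using I.far_cmp[OF rst_Ar[OF f, of n m] rst_Ar[OF g, of m k], where x = x] x f g by (simp add: cmp_rst_rst m_def k_def)
  \<comment> \<open>The stage \<open>k\<close> may exceed the maximum of the composite on
    \<open>{1..n}\<close>, which is why \<open>inj_action_cls\<close> admits every larger
    stage.\<close>
  also have "\<dots> = inj_action F (g \<otimes>\<^bsub>inj_monoid\<^esub> f) z"
    unfolding x(2) by (rule inj_action_cls[OF gf x(1), symmetric]) (simp add: k_def m_def max_image_mult f)
  finally show ?thesis by simp
qed

end

text \<open>By \<open>cls_eq_one\<close>, a class that dies in the colimit of \<open>D\<close> is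
  represented by an element that dies at some finite stage \<open>k\<close>, and there pointwise
  exactness applies. This is the exactness of sequential colimits.\<close>

lemma colimN_exact:
  assumes A: "I_functor A" and B: "I_functor B" and D: "I_functor D"
    and s: "nat_trans cat_I A B s" and t: "nat_trans cat_I B D t"
    and ex: "\<And>n x. x \<in> carrier (fob B n) \<Longrightarrow> t n x = \<one>\<^bsub>fob D n\<^esub> \<Longrightarrow> \<exists>y\<in>carrier (fob A n). s n y = x"
    and z: "z \<in> carrier (colim cat_N B)" "colim_map cat_N D t z = \<one>\<^bsub>colim cat_N D\<^esub>"
  shows "\<exists>w\<in>carrier (colim cat_N A). colim_map cat_N B s w = z"
proof -
  interpret A: I_functor A by fact
  interpret B: I_functor B by fact
  interpret D: I_functor D by fact
  have tc: "t n x \<in> carrier (fob D n)" if "x \<in> carrier (fob B n)" for n x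
    using t that by (auto simp: nat_trans_def cat_I_simps intro: hom_in_carrier)
  obtain n x where x: "x \<in> carrier (fob B n)" "z = B.cls n x" by (rule B.colimN_rep[OF z(1)])
  have "D.cls n (t n x) = \<one>\<^bsub>colim cat_N D\<^esub>"
    using z(2) colim_map_class[OF category_cat_N B.N.fctr D.N.fctr nat_trans_cat_N[OF t], of n x] x
    by (simp add: cat_I_simps)
  then obtain k where k: "k \<ge> n" "far D (inc n k) (t n x) = \<one>\<^bsub>fob D k\<^esub>"
    using D.cls_eq_one[OF tc[OF x(1)]] by blast
  have "t k (far B (inc n k) x) = \<one>\<^bsub>fob D k\<^esub>"
    using t k x inc_Ar_I[OF k(1)] by (auto simp: nat_trans_def) 
  then obtain y where y: "y \<in> carrier (fob A k)" "s k y = far B (inc n k) x"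
    using ex[OF B.inc_closed[OF k(1) x(1)]] by blast
  have "colim_map cat_N B s (A.cls k y) = z"
    using colim_map_class[OF category_cat_N A.N.fctr B.N.fctr nat_trans_cat_N[OF s], of k y] y x k
    by (simp add: cat_I_simps B.cls_inc)
  then show ?thesis using A.cls_closed[OF y(1)] by blast
qed

lemma colimN_surj:
  assumes A: "I_functor A" and B: "I_functor B"
    and s: "nat_trans cat_I A B s"
    and sur: "\<And>n x. x \<in> carrier (fob B n) \<Longrightarrow> \<exists>y\<in>carrier (fob A n). s n y = x"
    and z: "z \<in> carrier (colim cat_N B)"
  shows "\<exists>w\<in>carrier (colim cat_N A). colim_map cat_N B s w = z"
proof -
  interpret A: I_functor A by fact
  interpret B: I_functor B by fact
  obtain n x where x: "x \<in> carrier (fob B n)" "z = B.cls n x" by (rule B.colimN_rep[OF z])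
  obtain y where y: "y \<in> carrier (fob A n)" "s n y = x" using sur[OF x(1)] by blast
  have "colim_map cat_N B s (A.cls n y) = z"
    using colim_map_class[OF category_cat_N A.N.fctr B.N.fctr nat_trans_cat_N[OF s], of n y] y x
    by (simp add: cat_I_simps)
  then show ?thesis using A.cls_closed[OF y(1)] by blast
qed

lemma colim_map_inj_action:
  assumes A: "I_functor A" and B: "I_functor B" and s: "nat_trans cat_I A B s"
    and f: "f \<in> carrier inj_monoid" and z: "z \<in> carrier (colim cat_N A)"
  shows "colim_map cat_N B s (inj_action A f z) = inj_action B f (colim_map cat_N B s z)"
proof -
  interpret A: I_functor A by fact
  interpret B: I_functor B by fact
  obtain n x where x: "x \<in> carrier (fob A n)" "z = A.cls n x" by (rule A.colimN_rep[OF z])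
  define m where "m = max_image f n"
  have m: "max_image f n \<le> m" by (simp add: m_def)
  have sx: "s n x \<in> carrier (fob B n)"
    using s x by (auto simp: nat_trans_def cat_I_simps intro: hom_in_carrier)
  have rA: "far A (rst f n m) x \<in> carrier (fob A m)" by (rule A.rst_closed[OF f _ x(1)]) (simp add: m_def)
  have nat: "s m (far A (rst f n m) x) = far B (rst f n m) (s n x)"
    using s x rst_Ar[OF f, of n m] by (auto simp: nat_trans_def m_def)
  note c = colim_map_class[OF category_cat_N A.N.fctr B.N.fctr nat_trans_cat_N[OF s]]
  show ?thesis
    unfolding x(2) using c[of n x] c[of m "far A (rst f n m) x"] x rA sx
    by (simp add: cat_I_simps A.inj_action_cls[OF f x(1) m] B.inj_action_cls[OF f sx m] nat)
qed

section \<open>Modules and tensor products\<close>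

lemma right_module_comm_group: "right_module R A \<Longrightarrow> comm_group A"
  and right_module_ring: "right_module R A \<Longrightarrow> ring R"
  by (simp_all add: right_module_def)

lemma left_module_comm_group: "left_module R A \<Longrightarrow> comm_group A"
  by (simp add: left_module_def)

lemma right_act_closed:
  "right_module R A \<Longrightarrow> r \<in> carrier R \<Longrightarrow> x \<in> carrier A \<Longrightarrow> act A r x \<in> carrier A"
  by (rule hom_in_carrier[OF right_module.act_hom])

lemma left_act_closed:
  "left_module R A \<Longrightarrow> r \<in> carrier R \<Longrightarrow> x \<in> carrier A \<Longrightarrow> act A r x \<in> carrier A"
  by (rule hom_in_carrier[OF left_module.act_hom])

lemma right_act_zero:
  assumes "right_module R A" "x \<in> carrier A" shows "act A \<zero>\<^bsub>R\<^esub> x = \<one>\<^bsub>A\<^esub>"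
proof -
  interpret right_module R A by fact
  have "act A \<zero>\<^bsub>R\<^esub> x \<otimes>\<^bsub>A\<^esub> act A \<zero>\<^bsub>R\<^esub> x = act A \<zero>\<^bsub>R\<^esub> x"
    using act_add[OF zero_closed zero_closed assms(2)] by simp
  then show ?thesis
    using right_act_closed[OF assms(1) zero_closed assms(2)] by (simp add: group.l_cancel_one comm_group_axioms comm_groupD)
qed

lemma mod_hom_hom: "h \<in> mod_hom R A B \<Longrightarrow> h \<in> hom A B"
  by (simp add: mod_hom_def)

lemma mod_hom_act: "h \<in> mod_hom R A B \<Longrightarrow> r \<in> carrier R \<Longrightarrow> x \<in> carrier A \<Longrightarrow> h (act A r x) = act B r (h x)"
  by (simp add: mod_hom_def)

lemma mod_hom_closed: "h \<in> mod_hom R A B \<Longrightarrow> x \<in> carrier A \<Longrightarrow> h x \<in> carrier B"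
  by (rule hom_in_carrier[OF mod_hom_hom])

lemma mod_hom_id: "(\<lambda>x. x) \<in> mod_hom R A A"
  by (simp add: mod_hom_def hom_def)

locale tensor_product =
  fixes R :: "'r ring" and A :: "('r, 'b) rmod" and N :: "('r, 'a) rmod"
  assumes A: "right_module R A" and N: "left_module R N"
begin

definition tens :: "'b \<Rightarrow> 'a \<Rightarrow> ('b \<times> 'a \<Rightarrow>\<^sub>0 int) set"
  where "tens a x = tensor_rel R A N #>\<^bsub>tensor_gens A N\<^esub> frag_of (a, x)"

definition rels :: "('b \<times> 'a \<Rightarrow>\<^sub>0 int) set"
  where "rels = {frag_of (a \<otimes>\<^bsub>A\<^esub> a', x) - frag_of (a, x) - frag_of (a', x) | a a' x.
        a \<in> carrier A \<and> a' \<in> carrier A \<and> x \<in> carrier N} \<union>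
     {frag_of (a, x \<otimes>\<^bsub>N\<^esub> x') - frag_of (a, x) - frag_of (a, x') | a x x'.
        a \<in> carrier A \<and> x \<in> carrier N \<and> x' \<in> carrier N} \<union>
     {frag_of (act A r a, x) - frag_of (a, act N r x) | r a x.
        r \<in> carrier R \<and> a \<in> carrier A \<and> x \<in> carrier N}"

lemma tensor_rel_rels: "tensor_rel R A N = generate (tensor_gens A N) rels"
  by (simp add: tensor_rel_def rels_def)

lemma A_group: "comm_group A" and N_group: "comm_group N"
  using A N by (simp_all add: right_module_comm_group left_module_comm_group)

lemma gens_group: "comm_group (tensor_gens A N)"
  by (simp add: tensor_gens_def abelian_free_Abelian_group)

lemma frag_gens: "a \<in> carrier A \<Longrightarrow> x \<in> carrier N \<Longrightarrow> frag_of (a, x) \<in> carrier (tensor_gens A N)"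
  by (simp add: tensor_gens_def)

lemma gens_diff:
  "u \<in> carrier (tensor_gens A N) \<Longrightarrow> v \<in> carrier (tensor_gens A N) \<Longrightarrow> u - v \<in> carrier (tensor_gens A N)"
  using keys_diff[of u v] by (auto simp: tensor_gens_def)

lemma A_mult: "a \<in> carrier A \<Longrightarrow> a' \<in> carrier A \<Longrightarrow> a \<otimes>\<^bsub>A\<^esub> a' \<in> carrier A"
  and N_mult: "x \<in> carrier N \<Longrightarrow> x' \<in> carrier N \<Longrightarrow> x \<otimes>\<^bsub>N\<^esub> x' \<in> carrier N"
  by (simp_all add: A_group N_group comm_groupD monoid.m_closed)

lemma rels_closed: "rels \<subseteq> carrier (tensor_gens A N)"
  unfolding rels_def
  by (auto intro!: gens_diff frag_gens A_mult N_mult right_act_closed[OF A] left_act_closed[OF N])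

lemma rel_subgroup: "subgroup (tensor_rel R A N) (tensor_gens A N)"
  unfolding tensor_rel_rels
  by (rule group.generate_is_subgroup[OF comm_groupD(1)[OF gens_group] rels_closed])

lemma comm_group_tensor: "comm_group (tensor R A N)"
  unfolding tensor_def by (rule comm_group_Mod[OF gens_group rel_subgroup])

lemma tens_closed: "a \<in> carrier A \<Longrightarrow> x \<in> carrier N \<Longrightarrow> tens a x \<in> carrier (tensor R A N)"
  by (auto simp: tens_def tensor_def carrier_Mod intro: frag_gens)

lemma coset_rel:
  assumes u: "u \<in> carrier (tensor_gens A N)" and v: "v \<in> carrier (tensor_gens A N)" and uv: "u - v \<in> rels"
  shows "tensor_rel R A N #>\<^bsub>tensor_gens A N\<^esub> u = tensor_rel R A N #>\<^bsub>tensor_gens A N\<^esub> v"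
proof -
  have "u \<otimes>\<^bsub>tensor_gens A N\<^esub> inv\<^bsub>tensor_gens A N\<^esub> v = u - v"
    using v by (simp add: tensor_gens_def)
  also have "\<dots> \<in> tensor_rel R A N" unfolding tensor_rel_rels by (rule generate.incl[OF uv])
  finally show ?thesis by (simp only: coset_eq_iff[OF gens_group rel_subgroup u v])
qed

lemma coset_add:
  assumes "u \<in> carrier (tensor_gens A N)" "v \<in> carrier (tensor_gens A N)"
  shows "tensor_rel R A N #>\<^bsub>tensor_gens A N\<^esub> (u + v) =
    (tensor_rel R A N #>\<^bsub>tensor_gens A N\<^esub> u) \<otimes>\<^bsub>tensor R A N\<^esub> (tensor_rel R A N #>\<^bsub>tensor_gens A N\<^esub> v)"
  using hom_mult[OF coset_hom[OF gens_group rel_subgroup] assms] by (simp only: tensor_gens_def mult_free_Abelian_group tensor_def)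

lemma gens_add:
  "u \<in> carrier (tensor_gens A N) \<Longrightarrow> v \<in> carrier (tensor_gens A N) \<Longrightarrow> u + v \<in> carrier (tensor_gens A N)"
  using keys_add[of u v] by (auto simp: tensor_gens_def)

lemma tens_mult_left:
  assumes "a \<in> carrier A" "a' \<in> carrier A" "x \<in> carrier N"
  shows "tens (a \<otimes>\<^bsub>A\<^esub> a') x = tens a x \<otimes>\<^bsub>tensor R A N\<^esub> tens a' x"
proof -
  have "frag_of (a \<otimes>\<^bsub>A\<^esub> a', x) - (frag_of (a, x) + frag_of (a', x)) \<in> rels"
    using assms unfolding rels_def by (auto simp: diff_diff_eq)
  then have "tens (a \<otimes>\<^bsub>A\<^esub> a') x = tensor_rel R A N #>\<^bsub>tensor_gens A N\<^esub> (frag_of (a, x) + frag_of (a', x))"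
    unfolding tens_def by (intro coset_rel frag_gens gens_add A_mult assms)
  then show ?thesis using assms by (simp add: coset_add frag_gens tens_def)
qed

lemma tens_mult_right:
  assumes "a \<in> carrier A" "x \<in> carrier N" "x' \<in> carrier N"
  shows "tens a (x \<otimes>\<^bsub>N\<^esub> x') = tens a x \<otimes>\<^bsub>tensor R A N\<^esub> tens a x'"
proof -
  have "frag_of (a, x \<otimes>\<^bsub>N\<^esub> x') - (frag_of (a, x) + frag_of (a, x')) \<in> rels"
    using assms unfolding rels_def by (auto simp: diff_diff_eq)
  then have "tens a (x \<otimes>\<^bsub>N\<^esub> x') = tensor_rel R A N #>\<^bsub>tensor_gens A N\<^esub> (frag_of (a, x) + frag_of (a, x'))"
    unfolding tens_def by (intro coset_rel frag_gens gens_add N_mult assms)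
  then show ?thesis using assms by (simp add: coset_add frag_gens tens_def)
qed

lemma tens_act:
  assumes "r \<in> carrier R" "a \<in> carrier A" "x \<in> carrier N"
  shows "tens (act A r a) x = tens a (act N r x)"
  unfolding tens_def
  by (rule coset_rel) (use assms in \<open>auto intro!: frag_gens right_act_closed[OF A] left_act_closed[OF N] simp: rels_def\<close>)

lemma tens_hom_left: "x \<in> carrier N \<Longrightarrow> (\<lambda>a. tens a x) \<in> hom A (tensor R A N)"
  by (rule homI) (simp_all add: tens_closed tens_mult_left)

lemma tens_hom_right: "a \<in> carrier A \<Longrightarrow> tens a \<in> hom N (tensor R A N)"
  by (rule homI) (simp_all add: tens_closed tens_mult_right)

text \<open>There are no cases for the neutral element and for inverses, since both are covered by
  pure tensors: the inverse of a pure tensor is the pure tensor with the first factor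
  inverted.\<close>

lemma tensor_induct [consumes 1, case_names tens mult]:
  assumes z: "z \<in> carrier (tensor R A N)"
    and tens: "\<And>a x. a \<in> carrier A \<Longrightarrow> x \<in> carrier N \<Longrightarrow> P (tens a x)"
    and mult: "\<And>u v. u \<in> carrier (tensor R A N) \<Longrightarrow> v \<in> carrier (tensor R A N) \<Longrightarrow> P u \<Longrightarrow> P v \<Longrightarrow>
        P (u \<otimes>\<^bsub>tensor R A N\<^esub> v)"
  shows "P z"
proof -
  interpret T: comm_group "tensor R A N" by (rule comm_group_tensor)
  interpret A: comm_group A by (rule A_group)
  interpret N: comm_group N by (rule N_group)
  let ?q = "\<lambda>c. tensor_rel R A N #>\<^bsub>tensor_gens A N\<^esub> c"
  note q = coset_hom[OF gens_group rel_subgroup, folded tensor_def]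
  have inv: "inv\<^bsub>tensor R A N\<^esub> (tens a x) = tens (inv\<^bsub>A\<^esub> a) x" if "a \<in> carrier A" "x \<in> carrier N" for a x
    using hom_inv_comm[OF tens_hom_left A_group comm_group_tensor] that by simp
  have one: "\<one>\<^bsub>tensor R A N\<^esub> = tens \<one>\<^bsub>A\<^esub> \<one>\<^bsub>N\<^esub>"
    using hom_one_comm[OF tens_hom_left A_group comm_group_tensor] by simp
  \<comment> \<open>The induction on the free abelian group proceeds by differences, so the claim is
    carried along for the inverse as well.\<close>
  have "P (?q c) \<and> P (inv\<^bsub>tensor R A N\<^esub> (?q c))" if "Poly_Mapping.keys c \<subseteq> carrier A \<times> carrier N" for c
    using that
  proof (induction c rule: free_Abelian_group_induct[consumes 1, case_names zero diff one])
    case zero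
    have "?q 0 = \<one>\<^bsub>tensor R A N\<^esub>"
      using hom_one_comm[OF q gens_group comm_group_tensor] by (simp add: tensor_gens_def)
    then show ?case using tens[of "\<one>\<^bsub>A\<^esub>" "\<one>\<^bsub>N\<^esub>"] one T.inv_one by simp
  next
    case (diff c d)
    have cd: "c \<in> carrier (tensor_gens A N)" "d \<in> carrier (tensor_gens A N)"
      using diff by (simp_all add: tensor_gens_def)
    note qc = hom_in_carrier[OF q cd(1)] hom_in_carrier[OF q cd(2)]
    have "?q (c - d) = ?q c \<otimes>\<^bsub>tensor R A N\<^esub> inv\<^bsub>tensor R A N\<^esub> (?q d)"
      using hom_div[OF q gens_group comm_group_tensor cd] diff by (simp add: tensor_gens_def)
    moreover have "inv\<^bsub>tensor R A N\<^esub> (?q c \<otimes>\<^bsub>tensor R A N\<^esub> inv\<^bsub>tensor R A N\<^esub> (?q d)) =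
        inv\<^bsub>tensor R A N\<^esub> (?q c) \<otimes>\<^bsub>tensor R A N\<^esub> ?q d"
      using qc by (simp only: T.inv_mult T.inv_closed T.inv_inv)
    ultimately show ?case
      using mult[OF qc(1) T.inv_closed[OF qc(2)]] mult[OF T.inv_closed[OF qc(1)] qc(2)] diff by simp
  next
    case (one k)
    obtain a x where k: "k = (a, x)" "a \<in> carrier A" "x \<in> carrier N" using one by blast
    then show ?case
      using tens[of a x] tens[of "inv\<^bsub>A\<^esub> a" x] inv[of a x] by (simp add: tens_def)
  qed
  moreover obtain c where "Poly_Mapping.keys c \<subseteq> carrier A \<times> carrier N" "z = ?q c"
    using z by (auto simp: tensor_def carrier_Mod tensor_gens_def)
  ultimately show ?thesis by simp
qed

lemma tensor_hom_eq:
  assumes h: "h \<in> hom (tensor R A N) H" and k: "k \<in> hom (tensor R A N) H"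
    and eq: "\<And>a x. a \<in> carrier A \<Longrightarrow> x \<in> carrier N \<Longrightarrow> h (tens a x) = k (tens a x)"
    and z: "z \<in> carrier (tensor R A N)"
  shows "h z = k z"
  using z by (induction rule: tensor_induct) (simp_all add: eq hom_mult[OF h] hom_mult[OF k])

lemma tensor_universal:
  assumes H: "comm_group H"
    and cl: "\<And>a x. a \<in> carrier A \<Longrightarrow> x \<in> carrier N \<Longrightarrow> \<beta> a x \<in> carrier H"
    and l: "\<And>a a' x. a \<in> carrier A \<Longrightarrow> a' \<in> carrier A \<Longrightarrow> x \<in> carrier N \<Longrightarrow> \<beta> (a \<otimes>\<^bsub>A\<^esub> a') x = \<beta> a x \<otimes>\<^bsub>H\<^esub> \<beta> a' x"
    and r: "\<And>a x x'. a \<in> carrier A \<Longrightarrow> x \<in> carrier N \<Longrightarrow> x' \<in> carrier N \<Longrightarrow> \<beta> a (x \<otimes>\<^bsub>N\<^esub> x') = \<beta> a x \<otimes>\<^bsub>H\<^esub> \<beta> a x'"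
    and b: "\<And>r a x. r \<in> carrier R \<Longrightarrow> a \<in> carrier A \<Longrightarrow> x \<in> carrier N \<Longrightarrow> \<beta> (act A r a) x = \<beta> a (act N r x)"
  obtains h where "h \<in> hom (tensor R A N) H"
    "\<And>a x. a \<in> carrier A \<Longrightarrow> x \<in> carrier N \<Longrightarrow> h (tens a x) = \<beta> a x"
proof -
  interpret H: comm_group H by fact
  define f where "f = lin H (\<lambda>(a, x). \<beta> a x)"
  have f: "f \<in> hom (tensor_gens A N) H"
    unfolding f_def tensor_gens_def by (rule H.lin_hom) (auto intro: cl)
  have ff: "f (frag_of (a, x)) = \<beta> a x" if "a \<in> carrier A" "x \<in> carrier N" for a x
    using cl[OF that] by (simp add: f_def)
  have fd: "f (u - v) = f u \<otimes>\<^bsub>H\<^esub> inv\<^bsub>H\<^esub> (f v)" if "u \<in> carrier (tensor_gens A N)" "v \<in> carrier (tensor_gens A N)" for u v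
    using hom_div[OF f gens_group H that] that by (simp add: tensor_gens_def)
  have "f s = \<one>\<^bsub>H\<^esub>" if s: "s \<in> rels" for s
  proof -
    from s consider (1) a a' x where "a \<in> carrier A" "a' \<in> carrier A" "x \<in> carrier N"
        "s = frag_of (a \<otimes>\<^bsub>A\<^esub> a', x) - frag_of (a, x) - frag_of (a', x)"
      | (2) a x x' where "a \<in> carrier A" "x \<in> carrier N" "x' \<in> carrier N"
        "s = frag_of (a, x \<otimes>\<^bsub>N\<^esub> x') - frag_of (a, x) - frag_of (a, x')"
      | (3) r a x where "r \<in> carrier R" "a \<in> carrier A" "x \<in> carrier N"
        "s = frag_of (act A r a, x) - frag_of (a, act N r x)"
      unfolding rels_def by blast
    then show ?thesis
    proof cases
      case 1
      then show ?thesis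
        using cl[of a x] cl[of a' x]
        by (simp add: fd ff frag_gens gens_diff A_mult l H.m_comm[of "\<beta> a x"] H.m_assoc)
    next
      case 2
      then show ?thesis
        using cl[of a x] cl[of a x']
        by (simp add: fd ff frag_gens gens_diff N_mult r H.m_comm[of "\<beta> a x"] H.m_assoc)
    next
      case 3
      then show ?thesis
        using cl[of "act A r a" x] b[of r a x]
        by (simp add: fd ff frag_gens right_act_closed[OF A] left_act_closed[OF N])
    qed
  qed
  then obtain h where h: "h \<in> hom (tensor_gens A N Mod generate (tensor_gens A N) rels) H"
    "\<And>c. c \<in> carrier (tensor_gens A N) \<Longrightarrow> h (generate (tensor_gens A N) rels #>\<^bsub>tensor_gens A N\<^esub> c) = f c"
    using quotient_universal[OF gens_group H rels_closed f] by blast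
  show ?thesis
  proof
    show "h \<in> hom (tensor R A N) H" using h(1) by (simp add: tensor_def tensor_rel_rels)
    show "h (tens a x) = \<beta> a x" if "a \<in> carrier A" "x \<in> carrier N" for a x
      using h(2)[OF frag_gens[OF that]] ff[OF that] by (simp add: tens_def tensor_rel_rels)
  qed
qed

end

lemma tensor_map:
  assumes T: "tensor_product R A N" and T': "tensor_product R A' N'"
    and h: "h \<in> mod_hom R A A'" and k: "k \<in> mod_hom R N N'"
  shows tensor_map_hom: "tensor_map R A' N' h k \<in> hom (tensor R A N) (tensor R A' N')"
    and tensor_map_tens: "\<And>a x. a \<in> carrier A \<Longrightarrow> x \<in> carrier N \<Longrightarrow>
      tensor_map R A' N' h k (tensor_product.tens R A N a x) = tensor_product.tens R A' N' (h a) (k x)"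
proof -
  interpret T: tensor_product R A N by fact
  interpret T': tensor_product R A' N' by fact
  let ?e = "frag_extend (\<lambda>(a, x). frag_of (h a, k x))"
  have e: "?e \<in> hom (tensor_gens A N) (tensor_gens A' N')"
  proof (rule homI)
    fix c assume "c \<in> carrier (tensor_gens A N)"
    then have c: "Poly_Mapping.keys c \<subseteq> carrier A \<times> carrier N" by (simp add: tensor_gens_def)
    have "Poly_Mapping.keys (?e c) \<subseteq> carrier A' \<times> carrier N'"
      by (rule keys_frag_extend_subset[OF c]) (auto simp: mod_hom_closed[OF h] mod_hom_closed[OF k])
    then show "?e c \<in> carrier (tensor_gens A' N')" by (simp add: tensor_gens_def)
  qed (simp add: tensor_gens_def frag_extend_add)
  have sub: "?e ` T.rels \<subseteq> tensor_rel R A' N'"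
  proof
    fix w assume "w \<in> ?e ` T.rels"
    then obtain s where s: "s \<in> T.rels" "w = ?e s" by blast
    from s(1) have "?e s \<in> T'.rels"
      unfolding T.rels_def
    proof (elim UnE)
      assume "s \<in> {frag_of (a \<otimes>\<^bsub>A\<^esub> a', x) - frag_of (a, x) - frag_of (a', x) | a a' x.
        a \<in> carrier A \<and> a' \<in> carrier A \<and> x \<in> carrier N}"
      then obtain a a' x where a: "a \<in> carrier A" "a' \<in> carrier A" "x \<in> carrier N"
        "s = frag_of (a \<otimes>\<^bsub>A\<^esub> a', x) - frag_of (a, x) - frag_of (a', x)" by blast
      then have "?e s = frag_of (h a \<otimes>\<^bsub>A'\<^esub> h a', k x) - frag_of (h a, k x) - frag_of (h a', k x)"
        by (simp add: frag_extend_diff hom_mult[OF mod_hom_hom[OF h]])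
      then show ?thesis using mod_hom_closed[OF h] mod_hom_closed[OF k] a unfolding T'.rels_def by blast
    next
      assume "s \<in> {frag_of (a, x \<otimes>\<^bsub>N\<^esub> x') - frag_of (a, x) - frag_of (a, x') | a x x'.
        a \<in> carrier A \<and> x \<in> carrier N \<and> x' \<in> carrier N}"
      then obtain a x x' where a: "a \<in> carrier A" "x \<in> carrier N" "x' \<in> carrier N"
        "s = frag_of (a, x \<otimes>\<^bsub>N\<^esub> x') - frag_of (a, x) - frag_of (a, x')" by blast
      then have "?e s = frag_of (h a, k x \<otimes>\<^bsub>N'\<^esub> k x') - frag_of (h a, k x) - frag_of (h a, k x')"
        by (simp add: frag_extend_diff hom_mult[OF mod_hom_hom[OF k]])
      then show ?thesis using mod_hom_closed[OF h] mod_hom_closed[OF k] a unfolding T'.rels_def by blast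
    next
      assume "s \<in> {frag_of (act A r a, x) - frag_of (a, act N r x) | r a x.
        r \<in> carrier R \<and> a \<in> carrier A \<and> x \<in> carrier N}"
      then obtain r a x where a: "r \<in> carrier R" "a \<in> carrier A" "x \<in> carrier N"
        "s = frag_of (act A r a, x) - frag_of (a, act N r x)" by blast
      then have "?e s = frag_of (act A' r (h a), k x) - frag_of (h a, act N' r (k x))"
        by (simp add: frag_extend_diff mod_hom_act[OF h] mod_hom_act[OF k])
      then show ?thesis using mod_hom_closed[OF h] mod_hom_closed[OF k] a unfolding T'.rels_def by blast
    qed
    then show "w \<in> tensor_rel R A' N'" unfolding T'.tensor_rel_rels s(2) by (rule generate.incl)
  qed
  show "tensor_map R A' N' h k \<in> hom (tensor R A N) (tensor R A' N')"
    using quotient_map_hom[OF T.gens_group T'.gens_group T.rels_closed T'.rel_subgroup e sub]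
    unfolding tensor_map_def[abs_def] tensor_def T.tensor_rel_rels .
  show "tensor_map R A' N' h k (T.tens a x) = T'.tens (h a) (k x)" if "a \<in> carrier A" "x \<in> carrier N" for a x
    using quot_map_coset[OF T.gens_group T'.gens_group T.rels_closed T'.rel_subgroup e sub T.frag_gens[OF that]]
    unfolding tensor_map_def T.tens_def T'.tens_def T.tensor_rel_rels by simp
qed

section \<open>Modules over monoid rings\<close>

lemma linearize_simps [simp]:
  "carrier (linearize G a) = carrier G" "monoid.mult (linearize G a) = monoid.mult G" "one (linearize G a) = one G"
  by (simp_all add: linearize_def)

lemma act_linearize: "act (linearize G a) c x = lin G (\<lambda>f. a f x) c"
  by (simp add: linearize_def lin_def)

lemma comm_group_linearize: "comm_group G \<Longrightarrow> comm_group (linearize G a)"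
proof -
  assume "comm_group G"
  then interpret comm_group G .
  show ?thesis
  proof (rule comm_groupI)
    fix x assume "x \<in> carrier (linearize G a)"
    then show "\<exists>y\<in>carrier (linearize G a). y \<otimes>\<^bsub>linearize G a\<^esub> x = \<one>\<^bsub>linearize G a\<^esub>"
      by (intro bexI[of _ "m_inv G x"]) simp_all
  qed (simp_all add: m_ac)
qed

lemma carrier_monoid_ring: "c \<in> carrier (monoid_ring M) \<longleftrightarrow> Poly_Mapping.keys c \<subseteq> carrier M"
  and one_monoid_ring: "\<one>\<^bsub>monoid_ring M\<^esub> = frag_of \<one>\<^bsub>M\<^esub>"
  and add_monoid_ring: "c \<oplus>\<^bsub>monoid_ring M\<^esub> d = c + d"
  and mult_monoid_ring: "c \<otimes>\<^bsub>monoid_ring M\<^esub> d = frag_extend (\<lambda>f. frag_extend (\<lambda>g. frag_of (f \<otimes>\<^bsub>M\<^esub> g)) d) c"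
  by (simp_all add: monoid_ring_def)

lemma left_module_linearize:
  assumes M: "Group.monoid M" and G: "comm_group G"
    and a: "\<And>f. f \<in> carrier M \<Longrightarrow> a f \<in> hom G G"
    and mult: "\<And>f g x. f \<in> carrier M \<Longrightarrow> g \<in> carrier M \<Longrightarrow> x \<in> carrier G \<Longrightarrow> a (f \<otimes>\<^bsub>M\<^esub> g) x = a f (a g x)"
    and one: "\<And>x. x \<in> carrier G \<Longrightarrow> a \<one>\<^bsub>M\<^esub> x = x"
  shows "left_module (monoid_ring M) (linearize G a)"
proof -
  interpret M: Group.monoid M by fact
  interpret G: comm_group G by fact
  have cl: "a f x \<in> carrier G" if "f \<in> carrier M" "x \<in> carrier G" for f x
    by (rule hom_in_carrier[OF a[OF that(1)] that(2)])
  have "left_module_axioms (monoid_ring M) (linearize G a)"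
  proof (rule left_module_axioms.intro)
    fix c assume "c \<in> carrier (monoid_ring M)"
    then have c: "f \<in> carrier M" if "f \<in> Poly_Mapping.keys c" for f using that by (auto simp: carrier_monoid_ring)
    show "act (linearize G a) c \<in> hom (linearize G a) (linearize G a)"
    proof (rule homI)
      fix x y assume "x \<in> carrier (linearize G a)" "y \<in> carrier (linearize G a)"
      then have xy: "x \<in> carrier G" "y \<in> carrier G" by simp_all
      have "lin G (\<lambda>f. a f (x \<otimes>\<^bsub>G\<^esub> y)) c = lin G (\<lambda>f. a f x \<otimes>\<^bsub>G\<^esub> a f y) c"
        by (rule G.lin_cong) (simp_all add: c cl xy hom_mult[OF a])
      also have "\<dots> = lin G (\<lambda>f. a f x) c \<otimes>\<^bsub>G\<^esub> lin G (\<lambda>f. a f y) c"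
        by (rule G.lin_mult) (simp_all add: c cl xy)
      finally show "act (linearize G a) c (x \<otimes>\<^bsub>linearize G a\<^esub> y) =
         act (linearize G a) c x \<otimes>\<^bsub>linearize G a\<^esub> act (linearize G a) c y"
        by (simp add: act_linearize)
    qed (auto simp: act_linearize intro!: G.lin_closed cl c)
  next
    fix c d x assume "c \<in> carrier (monoid_ring M)" "d \<in> carrier (monoid_ring M)" "x \<in> carrier (linearize G a)"
    then have c: "Poly_Mapping.keys c \<subseteq> carrier M" "Poly_Mapping.keys d \<subseteq> carrier M" "x \<in> carrier G"
      by (auto simp: carrier_monoid_ring)
    show "act (linearize G a) (c \<oplus>\<^bsub>monoid_ring M\<^esub> d) x = act (linearize G a) c x \<otimes>\<^bsub>linearize G a\<^esub> act (linearize G a) d x"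
      unfolding act_linearize add_monoid_ring linearize_simps
      by (rule G.lin_add) (use c cl in auto)
    have ld: "lin G (\<lambda>g. a g x) d \<in> carrier G" by (rule G.lin_closed) (use c cl in auto)
    have sub: "Poly_Mapping.keys (frag_extend (\<lambda>g. frag_of (f \<otimes>\<^bsub>M\<^esub> g)) d) \<subseteq> carrier M" if "f \<in> carrier M" for f
      by (rule keys_frag_extend_subset[OF c(2)]) (simp add: that)
    \<comment> \<open>A product in Z[M] is a double combination. Expanding it over \<open>c\<close>
      first leaves, for each \<open>f\<close>, a combination over \<open>d\<close> out of which the
      homomorphism \<open>a f\<close> can be pulled.\<close>
    have "lin G (\<lambda>f. a f x) (frag_extend (\<lambda>f. frag_extend (\<lambda>g. frag_of (f \<otimes>\<^bsub>M\<^esub> g)) d) c) =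
        lin G (\<lambda>f. lin G (\<lambda>f. a f x) (frag_extend (\<lambda>g. frag_of (f \<otimes>\<^bsub>M\<^esub> g)) d)) c"
      by (rule G.lin_frag_extend[where T = "carrier M"])
        (use subsetD[OF c(1)] sub cl[OF _ c(3)] in simp_all)
    also have "\<dots> = lin G (\<lambda>f. a f (lin G (\<lambda>g. a g x) d)) c"
    proof (rule G.lin_cong)
      fix f assume "f \<in> Poly_Mapping.keys c"
      then have f: "f \<in> carrier M" using c by auto
      have "lin G (\<lambda>f. a f x) (frag_extend (\<lambda>g. frag_of (f \<otimes>\<^bsub>M\<^esub> g)) d) = lin G (\<lambda>g. lin G (\<lambda>f. a f x) (frag_of (f \<otimes>\<^bsub>M\<^esub> g))) d"
        by (rule G.lin_frag_extend[where T = "carrier M"]) (use c f cl in auto)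
      also have "\<dots> = lin G (\<lambda>g. a f (a g x)) d"
        by (rule G.lin_cong) (use c f cl in \<open>auto simp: mult subset_iff\<close>)
      also have "\<dots> = a f (lin G (\<lambda>g. a g x) d)"
        by (rule G.hom_lin[OF a[OF f] G, symmetric]) (use c cl in auto)
      finally show e: "lin G (\<lambda>f. a f x) (frag_extend (\<lambda>g. frag_of (f \<otimes>\<^bsub>M\<^esub> g)) d) = a f (lin G (\<lambda>g. a g x) d)" .
      show "lin G (\<lambda>f. a f x) (frag_extend (\<lambda>g. frag_of (f \<otimes>\<^bsub>M\<^esub> g)) d) \<in> carrier G"
        unfolding e by (rule cl[OF f ld])
    qed
    finally show "act (linearize G a) (c \<otimes>\<^bsub>monoid_ring M\<^esub> d) x = act (linearize G a) c (act (linearize G a) d x)"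
      by (simp add: act_linearize mult_monoid_ring)
  next
    fix x assume "x \<in> carrier (linearize G a)"
    then show "act (linearize G a) \<one>\<^bsub>monoid_ring M\<^esub> x = x"
      using one cl[OF M.one_closed, of x] by (simp add: act_linearize one_monoid_ring)
  qed
  then show ?thesis
    using ring_monoid_ring[OF M] comm_group_linearize[OF G] by (simp add: left_module_def)
qed

lemma frag_of_monoid_ring: "f \<in> carrier M \<Longrightarrow> frag_of f \<in> carrier (monoid_ring M)"
  by (simp add: carrier_monoid_ring)

text \<open>The action is additive in the ring element and Z[M] is free on M. So even in a module
  not built by \<open>linearize\<close> the monoid elements determine everything.\<close>

lemma monoid_ring_act_lin:
  assumes A: "right_module (monoid_ring M) A" and c: "c \<in> carrier (monoid_ring M)" and x: "x \<in> carrier A"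
  shows "act A c x = lin A (\<lambda>f. act A (frag_of f) x) c"
proof -
  interpret A: right_module "monoid_ring M" A by fact
  show ?thesis
  proof (rule A.lin_eqI[where S = "carrier M" and h = "\<lambda>c. act A c x"])
    show "(\<lambda>c. act A c x) \<in> hom (free_Abelian_group (carrier M)) A"
      by (rule homI) (use A.act_add x right_act_closed[OF A] in \<open>auto simp: carrier_monoid_ring add_monoid_ring\<close>)
  qed (use c in \<open>auto simp: carrier_monoid_ring\<close>)
qed

section \<open>Projective right modules\<close>

text \<open>The elements are functions from the basis to \<open>R\<close>, the type for which
  \<open>proj_right_module\<close> postulates lifting, so its definition can be applied to this
  module.\<close>

definition free_right :: "'r ring \<Rightarrow> 'b set \<Rightarrow> ('r, 'b \<Rightarrow> 'r) rmod"
  where "free_right R S =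
    \<lparr>carrier = {v. (\<forall>b. v b \<in> carrier R) \<and> finite {b. v b \<noteq> \<zero>\<^bsub>R\<^esub>} \<and> {b. v b \<noteq> \<zero>\<^bsub>R\<^esub>} \<subseteq> S},
     monoid.mult = (\<lambda>v w b. v b \<oplus>\<^bsub>R\<^esub> w b), one = (\<lambda>_. \<zero>\<^bsub>R\<^esub>), act = (\<lambda>r v b. v b \<otimes>\<^bsub>R\<^esub> r)\<rparr>"

lemma carrier_free_right:
  "v \<in> carrier (free_right R S) \<longleftrightarrow>
    (\<forall>b. v b \<in> carrier R) \<and> finite {b. v b \<noteq> \<zero>\<^bsub>R\<^esub>} \<and> {b. v b \<noteq> \<zero>\<^bsub>R\<^esub>} \<subseteq> S"
  and mult_free_right: "v \<otimes>\<^bsub>free_right R S\<^esub> w = (\<lambda>b. v b \<oplus>\<^bsub>R\<^esub> w b)"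
  and one_free_right: "\<one>\<^bsub>free_right R S\<^esub> = (\<lambda>_. \<zero>\<^bsub>R\<^esub>)"
  and act_free_right: "act (free_right R S) r v = (\<lambda>b. v b \<otimes>\<^bsub>R\<^esub> r)"
  by (simp_all add: free_right_def)

lemma free_right_closed:
  assumes "\<And>b. v b \<in> carrier R" "finite T" "\<And>b. b \<notin> T \<Longrightarrow> v b = \<zero>\<^bsub>R\<^esub>" "T \<subseteq> S"
  shows "v \<in> carrier (free_right R S)"
proof -
  have "{b. v b \<noteq> \<zero>\<^bsub>R\<^esub>} \<subseteq> T" using assms(3) by blast
  then show ?thesis using assms finite_subset[of _ T] by (auto simp: carrier_free_right)
qed

lemma right_module_free_right:
  assumes "ring R" shows "right_module R (free_right R S)"
proof -
  interpret R: ring R by fact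
  let ?F = "free_right R S"
  let ?supp = "\<lambda>v. {b. v b \<noteq> \<zero>\<^bsub>R\<^esub>}"
  have mem: "v b \<in> carrier R" "finite (?supp v)" "?supp v \<subseteq> S" if "v \<in> carrier ?F" for v b
    using that by (simp_all add: carrier_free_right)
  have m: "v \<otimes>\<^bsub>?F\<^esub> w \<in> carrier ?F" if "v \<in> carrier ?F" "w \<in> carrier ?F" for v w
    by (rule free_right_closed[of _ _ "?supp v \<union> ?supp w"])
      (use mem[OF that(1)] mem[OF that(2)] in \<open>auto simp: mult_free_right\<close>)
  have a: "act ?F r v \<in> carrier ?F" if "v \<in> carrier ?F" "r \<in> carrier R" for v r
    by (rule free_right_closed[of _ _ "?supp v"])
      (use mem[OF that(1)] that in \<open>auto simp: act_free_right\<close>)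
  have "comm_group ?F"
  proof (rule comm_groupI)
    fix v assume v: "v \<in> carrier ?F"
    have "(\<lambda>b. \<ominus>\<^bsub>R\<^esub> v b) \<in> carrier ?F"
      by (rule free_right_closed[of _ _ "?supp v"]) (use mem[OF v] in auto)
    moreover have "(\<lambda>b. \<ominus>\<^bsub>R\<^esub> v b) \<otimes>\<^bsub>?F\<^esub> v = \<one>\<^bsub>?F\<^esub>"
      using mem(1)[OF v] by (simp add: mult_free_right one_free_right R.l_neg)
    ultimately show "\<exists>w\<in>carrier ?F. w \<otimes>\<^bsub>?F\<^esub> v = \<one>\<^bsub>?F\<^esub>" by blast
  next
    show "\<one>\<^bsub>?F\<^esub> \<in> carrier ?F" by (simp add: carrier_free_right one_free_right)
  qed (use m mem(1) in \<open>simp_all add: mult_free_right one_free_right R.a_ac\<close>)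
  moreover have "right_module_axioms R ?F"
    by (rule right_module_axioms.intro)
      (use m a mem(1) in \<open>auto intro!: homI simp: mult_free_right act_free_right R.l_distr R.r_distr R.m_assoc\<close>)
  ultimately show ?thesis using assms by (simp add: right_module_def)
qed

text \<open>The linear map out of the free module that sends the basis vector at \<open>b\<close> to
  \<open>w b\<close>.\<close>

definition comb :: "'r ring \<Rightarrow> ('r, 'e) rmod \<Rightarrow> ('b \<Rightarrow> 'e) \<Rightarrow> ('b \<Rightarrow> 'r) \<Rightarrow> 'e"
  where "comb R E w v = finprod E (\<lambda>b. act E (v b) (w b)) {b. v b \<noteq> \<zero>\<^bsub>R\<^esub>}"

lemma comb_superset:
  assumes E: "right_module R E" and w: "\<And>b. b \<in> S \<Longrightarrow> w b \<in> carrier E"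
    and v: "v \<in> carrier (free_right R S)" and T: "finite T" "{b. v b \<noteq> \<zero>\<^bsub>R\<^esub>} \<subseteq> T" "T \<subseteq> S"
  shows "comb R E w v = finprod E (\<lambda>b. act E (v b) (w b)) T"
proof -
  interpret E: comm_group E by (rule right_module_comm_group[OF E])
  show ?thesis
    unfolding comb_def
    by (rule E.finprod_mono_neutral_cong_left)
      (use T v w in \<open>auto simp: carrier_free_right right_act_zero[OF E] subset_iff intro!: right_act_closed[OF E]\<close>)
qed

lemma comb_mod_hom:
  assumes E: "right_module R E" and w: "\<And>b. b \<in> S \<Longrightarrow> w b \<in> carrier E"
  shows "comb R E w \<in> mod_hom R (free_right R S) E"
proof -
  interpret E: right_module R E by fact
  note F = right_module_free_right[OF right_module_ring[OF E], of S]
  let ?supp = "\<lambda>v. {b. v b \<noteq> \<zero>\<^bsub>R\<^esub>}"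
  have mem: "v b \<in> carrier R" "finite (?supp v)" "?supp v \<subseteq> S" if "v \<in> carrier (free_right R S)" for v b
    using that by (simp_all add: carrier_free_right)
  have cl: "act E (v b) (w b) \<in> carrier E" if "v \<in> carrier (free_right R S)" "b \<in> S" for v b
    by (rule right_act_closed[OF E mem(1)[OF that(1)] w[OF that(2)]])
  have "comb R E w \<in> hom (free_right R S) E"
  proof (rule homI)
    fix v assume v: "v \<in> carrier (free_right R S)"
    show "comb R E w v \<in> carrier E"
      unfolding comb_def by (rule E.finprod_closed) (use mem[OF v] cl[OF v] in blast)
  next
    fix v v' assume v: "v \<in> carrier (free_right R S)" "v' \<in> carrier (free_right R S)"
    let ?T = "?supp v \<union> ?supp v'"
    have T: "finite ?T" "?T \<subseteq> S" using mem[OF v(1)] mem[OF v(2)] by auto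
    have vv: "v \<otimes>\<^bsub>free_right R S\<^esub> v' \<in> carrier (free_right R S)"
      using v F by (simp add: right_module_comm_group comm_groupD monoid.m_closed)
    have "comb R E w (v \<otimes>\<^bsub>free_right R S\<^esub> v') = finprod E (\<lambda>b. act E (v b \<oplus>\<^bsub>R\<^esub> v' b) (w b)) ?T"
      by (subst comb_superset[OF E w vv T(1) _ T(2)]) (use mem[OF v(1)] mem[OF v(2)] in \<open>auto simp: mult_free_right\<close>)
    also have "\<dots> = finprod E (\<lambda>b. act E (v b) (w b) \<otimes>\<^bsub>E\<^esub> act E (v' b) (w b)) ?T"
    proof (rule E.finprod_cong'[OF refl])
      show "(\<lambda>b. act E (v b) (w b) \<otimes>\<^bsub>E\<^esub> act E (v' b) (w b)) \<in> ?T \<rightarrow> carrier E"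
        by (intro funcsetI E.m_closed cl v subsetD[OF T(2)])
      show "act E (v b \<oplus>\<^bsub>R\<^esub> v' b) (w b) = act E (v b) (w b) \<otimes>\<^bsub>E\<^esub> act E (v' b) (w b)" if "b \<in> ?T" for b
        by (intro E.act_add mem(1) v w subsetD[OF T(2)] that)
    qed
    also have "\<dots> = finprod E (\<lambda>b. act E (v b) (w b)) ?T \<otimes>\<^bsub>E\<^esub> finprod E (\<lambda>b. act E (v' b) (w b)) ?T"
      by (rule E.finprod_multf) (intro funcsetI cl v subsetD[OF T(2)], assumption)+
    also have "\<dots> = comb R E w v \<otimes>\<^bsub>E\<^esub> comb R E w v'"
      using comb_superset[where E = E and R = R and w = w, OF E w v(1) T(1) _ T(2)]
        comb_superset[where E = E and R = R and w = w, OF E w v(2) T(1) _ T(2)] by auto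
    finally show "comb R E w (v \<otimes>\<^bsub>free_right R S\<^esub> v') = comb R E w v \<otimes>\<^bsub>E\<^esub> comb R E w v'" .
  qed
  moreover have "comb R E w (act (free_right R S) r v) = act E r (comb R E w v)"
    if r: "r \<in> carrier R" and v: "v \<in> carrier (free_right R S)" for r v
  proof -
    have rv: "act (free_right R S) r v \<in> carrier (free_right R S)" by (rule right_act_closed[OF F r v])
    have "comb R E w (act (free_right R S) r v) = finprod E (\<lambda>b. act E (v b \<otimes>\<^bsub>R\<^esub> r) (w b)) (?supp v)"
      by (subst comb_superset[OF E w rv mem(2)[OF v] _ mem(3)[OF v]]) (use r in \<open>auto simp: act_free_right\<close>)
    also have "\<dots> = finprod E (\<lambda>b. act E r (act E (v b) (w b))) (?supp v)"
    proof (rule E.finprod_cong'[OF refl])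
      show "(\<lambda>b. act E r (act E (v b) (w b))) \<in> ?supp v \<rightarrow> carrier E"
        by (intro funcsetI right_act_closed[OF E r] cl v subsetD[OF mem(3)[OF v]])
      show "act E (v b \<otimes>\<^bsub>R\<^esub> r) (w b) = act E r (act E (v b) (w b))" if "b \<in> ?supp v" for b
        by (intro E.act_mult mem(1) v w r subsetD[OF mem(3)[OF v]] that)
    qed
    also have "\<dots> = act E r (comb R E w v)"
      unfolding comb_def
      by (rule E.hom_finprod[OF E.act_hom[OF r], symmetric]) 
        (intro right_module_comm_group[OF E] funcsetI cl v subsetD[OF mem(3)[OF v]])+
    finally show ?thesis .
  qed
  ultimately show ?thesis by (simp add: mod_hom_def)
qed

lemma comb_map:
  assumes E: "right_module R E" and E': "right_module R E'" and h: "h \<in> mod_hom R E E'"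
    and w: "\<And>b. b \<in> S \<Longrightarrow> w b \<in> carrier E" and v: "v \<in> carrier (free_right R S)"
  shows "h (comb R E w v) = comb R E' (\<lambda>b. h (w b)) v"
proof -
  interpret E: comm_group E by (rule right_module_comm_group[OF E])
  interpret E': comm_group E' by (rule right_module_comm_group[OF E'])
  have vb: "v b \<in> carrier R" for b using v by (simp add: carrier_free_right)
  have bS: "b \<in> S" if "v b \<noteq> \<zero>\<^bsub>R\<^esub>" for b using v that by (auto simp: carrier_free_right)
  have "h (comb R E w v) = finprod E' (\<lambda>b. h (act E (v b) (w b))) {b. v b \<noteq> \<zero>\<^bsub>R\<^esub>}"
    unfolding comb_def
    by (rule E.hom_finprod[OF mod_hom_hom[OF h] E'.comm_group_axioms])
      (auto intro!: right_act_closed[OF E] vb w bS)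
  also have "\<dots> = comb R E' (\<lambda>b. h (w b)) v"
    unfolding comb_def
    by (rule E'.finprod_cong')
      (auto intro!: right_act_closed[OF E'] vb w bS mod_hom_closed[OF h] mod_hom_act[OF h])
  finally show ?thesis .
qed

lemma proj_right_module_right: "proj_right_module R P \<Longrightarrow> right_module R P"
  by (simp add: proj_right_module_def)

text \<open>The identity is lifted against the free module on all elements of \<open>P\<close>. The
  coordinates of \<open>\<sigma>\<close> together with the elements \<open>b\<close> are a dual
  basis in the sense of the dual basis lemma.\<close>

lemma proj_section:
  assumes P: "proj_right_module R P"
  obtains \<sigma> where "\<sigma> \<in> mod_hom R P (free_right R (carrier P))" "\<And>x. x \<in> carrier P \<Longrightarrow> comb R P (\<lambda>b. b) (\<sigma> x) = x"
proof -
  note PR = proj_right_module_right[OF P]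
  interpret P: right_module R P by (rule PR)
  let ?F = "free_right R (carrier P)"
  let ?q = "comb R P (\<lambda>b. b)"
  have q: "?q \<in> mod_hom R ?F P" by (rule comb_mod_hom[OF PR])
  have "?q ` carrier ?F = carrier P"
  proof (intro equalityI subsetI)
    fix x assume "x \<in> ?q ` carrier ?F" then show "x \<in> carrier P" using mod_hom_closed[OF q] by blast
  next
    fix x assume x: "x \<in> carrier P"
    \<comment> \<open>The basis vector at \<open>x\<close>, which \<open>comb\<close> evaluates to
      \<open>x\<close>.\<close>
    let ?d = "\<lambda>b. if b = x then \<one>\<^bsub>R\<^esub> else \<zero>\<^bsub>R\<^esub>"
    have d: "?d \<in> carrier ?F" by (rule free_right_closed[of _ _ "{x}"]) (use x in auto)
    have "?q ?d = finprod P (\<lambda>b. act P (?d b) b) {x}"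
      by (rule comb_superset[OF PR _ d]) (use x in auto)
    also have "\<dots> = x" using x P.act_one[OF x] by (simp add: P.finprod_singleton_swap)
    finally show "x \<in> ?q ` carrier ?F" using d by (metis imageI)
  qed
  moreover have "right_module R ?F" by (rule right_module_free_right[OF right_module_ring[OF PR]])
  ultimately have "\<exists>s\<in>mod_hom R P ?F. \<forall>x\<in>carrier P. ?q (s x) = x"
    using P PR q mod_hom_id[of R P] unfolding proj_right_module_def by blast
  then show ?thesis using that by blast
qed

lemma mod_hom_comp: "h \<in> mod_hom R A B \<Longrightarrow> k \<in> mod_hom R B D \<Longrightarrow> (\<lambda>x. k (h x)) \<in> mod_hom R A D"
  by (simp add: mod_hom_def hom_def Pi_iff)

text \<open>The definition of projectivity covers only modules with fixed element types. The section
  removes this restriction: preimages \<open>w\<close> of the values of \<open>u\<close> are chosen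
  on all of \<open>P\<close> without regard to linearity, and then combined linearly with the
  coordinates \<open>\<sigma>\<close>. Requiring the image of \<open>u\<close> to lie in that of
  \<open>d\<close> is the form in which exactness supplies it.\<close>

lemma proj_lift:
  assumes P: "proj_right_module R P" and E: "right_module R E" and B: "right_module R B"
    and d: "d \<in> mod_hom R B E" and u: "u \<in> mod_hom R P E"
    and im: "\<And>x. x \<in> carrier P \<Longrightarrow> u x \<in> d ` carrier B"
  obtains l where "l \<in> mod_hom R P B" "\<And>x. x \<in> carrier P \<Longrightarrow> d (l x) = u x"
proof -
  note PR = proj_right_module_right[OF P]
  obtain \<sigma> where \<sigma>: "\<sigma> \<in> mod_hom R P (free_right R (carrier P))"
    "\<And>x. x \<in> carrier P \<Longrightarrow> comb R P (\<lambda>b. b) (\<sigma> x) = x" using proj_section[OF P] by blast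
  have "\<forall>x\<in>carrier P. \<exists>w\<in>carrier B. d w = u x" using im by fastforce
  then obtain w where w: "\<And>x. x \<in> carrier P \<Longrightarrow> w x \<in> carrier B" "\<And>x. x \<in> carrier P \<Longrightarrow> d (w x) = u x"
    by metis
  show ?thesis
  proof
    show "(\<lambda>x. comb R B w (\<sigma> x)) \<in> mod_hom R P B"
      by (rule mod_hom_comp[OF \<sigma>(1) comb_mod_hom[OF B w(1)]])
    fix x assume x: "x \<in> carrier P"
    have sx: "\<sigma> x \<in> carrier (free_right R (carrier P))" by (rule mod_hom_closed[OF \<sigma>(1) x])
    have "d (comb R B w (\<sigma> x)) = comb R E (\<lambda>b. d (w b)) (\<sigma> x)" by (rule comb_map[OF B E d w(1) sx])
    also have "\<dots> = comb R E u (\<sigma> x)"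
    proof -
      interpret E: comm_group E by (rule right_module_comm_group[OF E])
      have "\<sigma> x b \<in> carrier R" for b using sx by (simp add: carrier_free_right)
      moreover have "b \<in> carrier P" if "\<sigma> x b \<noteq> \<zero>\<^bsub>R\<^esub>" for b using sx that by (auto simp: carrier_free_right)
      ultimately show ?thesis unfolding comb_def
        by (intro E.finprod_cong') (auto simp: w(2) intro!: right_act_closed[OF E] mod_hom_closed[OF u])
    qed
    also have "\<dots> = u (comb R P (\<lambda>b. b) (\<sigma> x))" by (rule comb_map[OF PR E u _ sx, symmetric])
    finally show "d (comb R B w (\<sigma> x)) = u x" by (simp add: \<sigma>(2) x)
  qed
qed

lemma mod_hom_div:
  assumes A: "right_module R A" and B: "right_module R B" and f: "f \<in> mod_hom R A B" and g: "g \<in> mod_hom R A B"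
  shows "(\<lambda>x. f x \<otimes>\<^bsub>B\<^esub> inv\<^bsub>B\<^esub> (g x)) \<in> mod_hom R A B"
proof -
  interpret B: right_module R B by (rule B)
  have "(\<lambda>x. f x \<otimes>\<^bsub>B\<^esub> inv\<^bsub>B\<^esub> (g x)) \<in> hom A B"
    by (rule homI) (simp_all add: mod_hom_closed[OF f] mod_hom_closed[OF g] hom_mult[OF mod_hom_hom[OF f]]
        hom_mult[OF mod_hom_hom[OF g]] B.inv_mult_group B.m_ac)
  moreover have "f (act A r x) \<otimes>\<^bsub>B\<^esub> inv\<^bsub>B\<^esub> (g (act A r x)) = act B r (f x \<otimes>\<^bsub>B\<^esub> inv\<^bsub>B\<^esub> (g x))"
    if "r \<in> carrier R" "x \<in> carrier A" for r x
    using hom_div[OF B.act_hom[OF that(1)] B.comm_group_axioms B.comm_group_axioms mod_hom_closed[OF f that(2)] mod_hom_closed[OF g that(2)]]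
    by (simp add: mod_hom_act[OF f] mod_hom_act[OF g] that)
  ultimately show ?thesis by (simp add: mod_hom_def)
qed

section \<open>Comparison of resolutions\<close>

text \<open>Used with two targets \<open>D\<close>: the resolution with scalars restricted along
  \<open>shift\<close>, to obtain \<open>\<mu>\<close>, and the resolution itself, to compare
  doubling with the identity.\<close>

locale proj_over_exact =
  fixes R :: "'r ring" and Q :: "nat \<Rightarrow> ('r, 'b) rmod" and dQ and D :: "nat \<Rightarrow> ('r, 'd) rmod" and dD
    and Z :: "('r, 'z) rmod" and eD
  assumes Q: "\<And>n. proj_right_module R (Q n)" and D: "\<And>n. right_module R (D n)" and Z: "right_module R Z"
    and dQ: "\<And>n. dQ n \<in> mod_hom R (Q (Suc n)) (Q n)"
    and dD: "\<And>n. dD n \<in> mod_hom R (D (Suc n)) (D n)"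
    and eD: "eD \<in> mod_hom R (D 0) Z"
    and dQ_dQ: "\<And>n x. x \<in> carrier (Q (Suc (Suc n))) \<Longrightarrow> dQ n (dQ (Suc n) x) = \<one>\<^bsub>Q n\<^esub>"
    and ex_0: "\<And>y. y \<in> carrier (D 0) \<Longrightarrow> eD y = \<one>\<^bsub>Z\<^esub> \<Longrightarrow> y \<in> dD 0 ` carrier (D (Suc 0))"
    and ex: "\<And>n y. y \<in> carrier (D (Suc n)) \<Longrightarrow> dD n y = \<one>\<^bsub>D n\<^esub> \<Longrightarrow> y \<in> dD (Suc n) ` carrier (D (Suc (Suc n)))"
begin

lemma QR: "right_module R (Q n)"
  by (rule proj_right_module_right[OF Q])

lemma Q_group: "comm_group (Q n)" and D_group: "comm_group (D n)"
  by (rule right_module_comm_group[OF QR], rule right_module_comm_group[OF D])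

lemma chain_lift:
  assumes eQ: "eQ \<in> mod_hom R (Q 0) Z"
    and im: "\<And>x. x \<in> carrier (Q 0) \<Longrightarrow> eQ x \<in> eD ` carrier (D 0)"
    and eQ_dQ: "\<And>x. x \<in> carrier (Q (Suc 0)) \<Longrightarrow> eQ (dQ 0 x) = \<one>\<^bsub>Z\<^esub>"
  obtains l where "\<And>n. l n \<in> mod_hom R (Q n) (D n)" "\<And>x. x \<in> carrier (Q 0) \<Longrightarrow> eD (l 0 x) = eQ x"
    "\<And>n x. x \<in> carrier (Q (Suc n)) \<Longrightarrow> l n (dQ n x) = dD n (l (Suc n) x)"
proof -
  \<comment> \<open>The second conjunct makes the next lift exist: \<open>l\<close> followed by
    nothing but exactness of \<open>D\<close> must accept everything coming from \<open>dQ\<close>.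
    It is the invariant that dependent choice carries along.\<close>
  define ok where "ok = (\<lambda>n l. l \<in> mod_hom R (Q n) (D n) \<and>
    (\<forall>x\<in>carrier (Q (Suc n)). l (dQ n x) \<in> dD n ` carrier (D (Suc n))) \<and>
    (n = 0 \<longrightarrow> (\<forall>x\<in>carrier (Q 0). eD (l x) = eQ x)))"
  have "\<exists>l. \<forall>n. ok n (l n) \<and> (\<forall>x\<in>carrier (Q (Suc n)). dD n (l (Suc n) x) = l n (dQ n x))"
  proof (rule dependent_nat_choice)
    obtain l where l: "l \<in> mod_hom R (Q 0) (D 0)" "\<And>x. x \<in> carrier (Q 0) \<Longrightarrow> eD (l x) = eQ x"
      using proj_lift[OF Q Z D eD eQ im] by blast
    have "l (dQ 0 x) \<in> dD 0 ` carrier (D (Suc 0))" if x: "x \<in> carrier (Q (Suc 0))" for x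
      using ex_0[OF mod_hom_closed[OF l(1) mod_hom_closed[OF dQ x]]] l(2)[OF mod_hom_closed[OF dQ x]] eQ_dQ[OF x] by simp
    then have "ok 0 l" using l by (simp add: ok_def)
    then show "\<exists>l. ok 0 l" by blast
  next
    fix l n assume "ok n l"
    then have l: "l \<in> mod_hom R (Q n) (D n)" "\<And>x. x \<in> carrier (Q (Suc n)) \<Longrightarrow> l (dQ n x) \<in> dD n ` carrier (D (Suc n))"
      by (simp_all add: ok_def)
    obtain m where m: "m \<in> mod_hom R (Q (Suc n)) (D (Suc n))" "\<And>x. x \<in> carrier (Q (Suc n)) \<Longrightarrow> dD n (m x) = l (dQ n x)"
      using proj_lift[OF Q D D dD mod_hom_comp[OF dQ l(1)] l(2)] by blast
    have "m (dQ (Suc n) x) \<in> dD (Suc n) ` carrier (D (Suc (Suc n)))" if x: "x \<in> carrier (Q (Suc (Suc n)))" for x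
    proof (rule ex)
      show "m (dQ (Suc n) x) \<in> carrier (D (Suc n))" by (rule mod_hom_closed[OF m(1) mod_hom_closed[OF dQ x]])
      show "dD n (m (dQ (Suc n) x)) = \<one>\<^bsub>D n\<^esub>"
        using m(2)[OF mod_hom_closed[OF dQ x]] dQ_dQ[OF x] hom_one_comm[OF mod_hom_hom[OF l(1)] Q_group D_group] by simp
    qed
    then show "\<exists>m. ok (Suc n) m \<and> (\<forall>x\<in>carrier (Q (Suc n)). dD n (m x) = l (dQ n x))"
      using m by (auto simp: ok_def)
  qed
  then obtain l where "\<forall>n. ok n (l n) \<and> (\<forall>x\<in>carrier (Q (Suc n)). dD n (l (Suc n) x) = l n (dQ n x))" by blast
  then show ?thesis using that[of l] by (simp add: ok_def)
qed

lemma null_homotopy: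
  assumes f: "\<And>n. f n \<in> mod_hom R (Q n) (D n)"
    and f_d: "\<And>n x. x \<in> carrier (Q (Suc n)) \<Longrightarrow> f n (dQ n x) = dD n (f (Suc n) x)"
    and eD_f: "\<And>x. x \<in> carrier (Q 0) \<Longrightarrow> eD (f 0 x) = \<one>\<^bsub>Z\<^esub>"
  obtains h where "\<And>n. h n \<in> mod_hom R (Q n) (D (Suc n))" "\<And>x. x \<in> carrier (Q 0) \<Longrightarrow> dD 0 (h 0 x) = f 0 x"
    "\<And>n x. x \<in> carrier (Q (Suc n)) \<Longrightarrow> f (Suc n) x = dD (Suc n) (h (Suc n) x) \<otimes>\<^bsub>D (Suc n)\<^esub> h n (dQ n x)"
proof -
  have f1: "f (Suc n) x \<in> carrier (D (Suc n))" if "x \<in> carrier (Q (Suc n))" for n x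
    by (rule mod_hom_closed[OF f that])
  \<comment> \<open>The second conjunct says that the defect of \<open>f\<close> against the
    previous homotopy lies in the image of \<open>dD\<close>, so that the next component exists by
    \<open>proj_lift\<close>. Degree 0 has no previous component and its equation is recorded
    separately.\<close>
  define ok where "ok = (\<lambda>n h. h \<in> mod_hom R (Q n) (D (Suc n)) \<and>
    (\<forall>x\<in>carrier (Q (Suc n)). f (Suc n) x \<otimes>\<^bsub>D (Suc n)\<^esub> inv\<^bsub>D (Suc n)\<^esub> (h (dQ n x)) \<in> dD (Suc n) ` carrier (D (Suc (Suc n)))) \<and>
    (n = 0 \<longrightarrow> (\<forall>x\<in>carrier (Q 0). dD 0 (h x) = f 0 x)))"
  have "\<exists>h. \<forall>n. ok n (h n) \<and>
    (\<forall>x\<in>carrier (Q (Suc n)). dD (Suc n) (h (Suc n) x) = f (Suc n) x \<otimes>\<^bsub>D (Suc n)\<^esub> inv\<^bsub>D (Suc n)\<^esub> (h n (dQ n x)))"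
  proof (rule dependent_nat_choice)
    have im0: "f 0 x \<in> dD 0 ` carrier (D (Suc 0))" if "x \<in> carrier (Q 0)" for x
      by (rule ex_0[OF mod_hom_closed[OF f that] eD_f[OF that]])
    obtain h where h: "h \<in> mod_hom R (Q 0) (D (Suc 0))" "\<And>x. x \<in> carrier (Q 0) \<Longrightarrow> dD 0 (h x) = f 0 x"
      using proj_lift[OF Q D D dD f im0] by blast
    have "f (Suc 0) x \<otimes>\<^bsub>D (Suc 0)\<^esub> inv\<^bsub>D (Suc 0)\<^esub> (h (dQ 0 x)) \<in> dD (Suc 0) ` carrier (D (Suc (Suc 0)))"
      if x: "x \<in> carrier (Q (Suc 0))" for x
    proof -
      interpret D0: comm_group "D 0" by (rule D_group)
      interpret D1: comm_group "D (Suc 0)" by (rule D_group)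
      have dx: "dQ 0 x \<in> carrier (Q 0)" by (rule mod_hom_closed[OF dQ x])
      have hx: "h (dQ 0 x) \<in> carrier (D (Suc 0))" by (rule mod_hom_closed[OF h(1) dx])
      show ?thesis
        by (rule ex)
          (simp_all add: f1[OF x] hx hom_div[OF mod_hom_hom[OF dD] D_group D_group] h(2)[OF dx] f_d[OF x, symmetric]
            mod_hom_closed[OF f dx])
    qed
    then have "ok 0 h" using h by (simp add: ok_def)
    then show "\<exists>h. ok 0 h" by blast
  next
    fix h n assume "ok n h"
    then have h: "h \<in> mod_hom R (Q n) (D (Suc n))"
      "\<And>x. x \<in> carrier (Q (Suc n)) \<Longrightarrow> f (Suc n) x \<otimes>\<^bsub>D (Suc n)\<^esub> inv\<^bsub>D (Suc n)\<^esub> (h (dQ n x)) \<in> dD (Suc n) ` carrier (D (Suc (Suc n)))"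
      by (simp_all add: ok_def)
    have u: "(\<lambda>x. f (Suc n) x \<otimes>\<^bsub>D (Suc n)\<^esub> inv\<^bsub>D (Suc n)\<^esub> (h (dQ n x))) \<in> mod_hom R (Q (Suc n)) (D (Suc n))"
      by (rule mod_hom_div[OF QR D f mod_hom_comp[OF dQ h(1)]])
    obtain k where k: "k \<in> mod_hom R (Q (Suc n)) (D (Suc (Suc n)))"
      "\<And>x. x \<in> carrier (Q (Suc n)) \<Longrightarrow> dD (Suc n) (k x) = f (Suc n) x \<otimes>\<^bsub>D (Suc n)\<^esub> inv\<^bsub>D (Suc n)\<^esub> (h (dQ n x))"
      using proj_lift[OF Q D D dD u h(2)] by blast
    have "f (Suc (Suc n)) x \<otimes>\<^bsub>D (Suc (Suc n))\<^esub> inv\<^bsub>D (Suc (Suc n))\<^esub> (k (dQ (Suc n) x)) \<in> dD (Suc (Suc n)) ` carrier (D (Suc (Suc (Suc n))))"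
      if x: "x \<in> carrier (Q (Suc (Suc n)))" for x
    proof -
      interpret D1: comm_group "D (Suc n)" by (rule D_group)
      interpret D2: comm_group "D (Suc (Suc n))" by (rule D_group)
      have dx: "dQ (Suc n) x \<in> carrier (Q (Suc n))" by (rule mod_hom_closed[OF dQ x])
      have kx: "k (dQ (Suc n) x) \<in> carrier (D (Suc (Suc n)))" by (rule mod_hom_closed[OF k(1) dx])
      \<comment> \<open>\<open>h\<close> meets the neutral element as the value of
        \<open>dQ n (dQ (Suc n) x)\<close>. So the earlier correction drops out, and
        \<open>dD\<close> maps the new defect to the quotient of \<open>f\<close> at
        \<open>dQ (Suc n) x\<close> by itself.\<close>
      have h1: "h \<one>\<^bsub>Q n\<^esub> = \<one>\<^bsub>D (Suc n)\<^esub>" by (rule hom_one_comm[OF mod_hom_hom[OF h(1)] Q_group D_group])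
      show ?thesis
        by (rule ex)
          (simp_all add: f1[OF x] kx hom_div[OF mod_hom_hom[OF dD] D_group D_group] k(2)[OF dx] f_d[OF x, symmetric]
            mod_hom_closed[OF f dx] dQ_dQ[OF x] h1)
    qed
    then show "\<exists>k. ok (Suc n) k \<and> (\<forall>x\<in>carrier (Q (Suc n)). dD (Suc n) (k x) = f (Suc n) x \<otimes>\<^bsub>D (Suc n)\<^esub> inv\<^bsub>D (Suc n)\<^esub> (h (dQ n x)))"
      using k by (auto simp: ok_def)
  qed
  then obtain h where h: "\<forall>n. ok n (h n) \<and>
    (\<forall>x\<in>carrier (Q (Suc n)). dD (Suc n) (h (Suc n) x) = f (Suc n) x \<otimes>\<^bsub>D (Suc n)\<^esub> inv\<^bsub>D (Suc n)\<^esub> (h n (dQ n x)))" by blast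
  show ?thesis
  proof
    show hn: "h n \<in> mod_hom R (Q n) (D (Suc n))" for n using h by (simp add: ok_def)
    show "dD 0 (h 0 x) = f 0 x" if "x \<in> carrier (Q 0)" for x using h that by (auto simp: ok_def)
    show "f (Suc n) x = dD (Suc n) (h (Suc n) x) \<otimes>\<^bsub>D (Suc n)\<^esub> h n (dQ n x)" if x: "x \<in> carrier (Q (Suc n))" for n x
    proof -
      interpret D1: comm_group "D (Suc n)" by (rule D_group)
      have "h n (dQ n x) \<in> carrier (D (Suc n))" by (rule mod_hom_closed[OF hn mod_hom_closed[OF dQ x]])
      moreover have "dD (Suc n) (h (Suc n) x) = f (Suc n) x \<otimes>\<^bsub>D (Suc n)\<^esub> inv\<^bsub>D (Suc n)\<^esub> (h n (dQ n x))"
        using h x by blast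
      ultimately show ?thesis using f1[OF x] by (simp only: D1.m_assoc D1.inv_closed D1.l_inv D1.r_one)
    qed
  qed
qed

end

section \<open>Flatness of projective modules\<close>

text \<open>For a free module these are the projections of the tensor product to the copies of
  \<open>N\<close>. Right linearity of \<open>\<sigma>\<close> is exactly what makes them
  balanced.\<close>

lemma tensor_coord:
  assumes T: "tensor_product R A N" and \<sigma>: "\<sigma> \<in> mod_hom R A (free_right R S)"
  obtains \<phi> where "\<And>b. \<phi> b \<in> hom (tensor R A N) N"
    "\<And>b a x. a \<in> carrier A \<Longrightarrow> x \<in> carrier N \<Longrightarrow> \<phi> b (tensor_product.tens R A N a x) = act N (\<sigma> a b) x"
proof -
  interpret T: tensor_product R A N by fact
  interpret N: left_module R N by (rule T.N)
  have \<sigma>c: "\<sigma> a b \<in> carrier R" if "a \<in> carrier A" for a b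
    using mod_hom_closed[OF \<sigma> that] by (simp add: carrier_free_right)
  have "\<exists>h. h \<in> hom (tensor R A N) N \<and> (\<forall>a\<in>carrier A. \<forall>x\<in>carrier N. h (T.tens a x) = act N (\<sigma> a b) x)" for b
  proof -
    have l: "act N (\<sigma> (a \<otimes>\<^bsub>A\<^esub> a') b) x = act N (\<sigma> a b) x \<otimes>\<^bsub>N\<^esub> act N (\<sigma> a' b) x"
      if "a \<in> carrier A" "a' \<in> carrier A" "x \<in> carrier N" for a a' x
      using that by (simp add: hom_mult[OF mod_hom_hom[OF \<sigma>]] mult_free_right N.act_add \<sigma>c)
    have r: "act N (\<sigma> a b) (x \<otimes>\<^bsub>N\<^esub> x') = act N (\<sigma> a b) x \<otimes>\<^bsub>N\<^esub> act N (\<sigma> a b) x'"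
      if "a \<in> carrier A" "x \<in> carrier N" "x' \<in> carrier N" for a x x'
      using that by (simp add: hom_mult[OF N.act_hom] \<sigma>c)
    have bal: "act N (\<sigma> (act A r a) b) x = act N (\<sigma> a b) (act N r x)"
      if "r \<in> carrier R" "a \<in> carrier A" "x \<in> carrier N" for r a x
      using that by (simp add: mod_hom_act[OF \<sigma>] act_free_right N.act_mult \<sigma>c)
    have cl: "act N (\<sigma> a b) x \<in> carrier N" if "a \<in> carrier A" "x \<in> carrier N" for a x
      by (rule left_act_closed[OF T.N \<sigma>c[OF that(1)] that(2)])
    obtain h where "h \<in> hom (tensor R A N) N"
      "\<And>a x. a \<in> carrier A \<Longrightarrow> x \<in> carrier N \<Longrightarrow> h (T.tens a x) = act N (\<sigma> a b) x"
      by (rule T.tensor_universal[where \<beta> = "\<lambda>a x. act N (\<sigma> a b) x", OF T.N_group cl l r bal])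
        (assumption | rule that)+
    then show ?thesis by blast
  qed
  then obtain \<phi> where "\<And>b. \<phi> b \<in> hom (tensor R A N) N \<and> (\<forall>a\<in>carrier A. \<forall>x\<in>carrier N. \<phi> b (T.tens a x) = act N (\<sigma> a b) x)"
    by metis
  then show ?thesis using that by blast
qed

text \<open>The element a is the sum of the b acted on by their coordinates, and the coordinates
  move across the tensor sign to the second factor.\<close>

lemma tensor_reconstruct:
  assumes T: "tensor_product R A N" and \<sigma>: "\<sigma> \<in> mod_hom R A (free_right R (carrier A))"
    and sec: "\<And>x. x \<in> carrier A \<Longrightarrow> comb R A (\<lambda>b. b) (\<sigma> x) = x"
    and \<phi>: "\<And>b. \<phi> b \<in> hom (tensor R A N) N"
      "\<And>b a x. a \<in> carrier A \<Longrightarrow> x \<in> carrier N \<Longrightarrow> \<phi> b (tensor_product.tens R A N a x) = act N (\<sigma> a b) x"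
    and z: "z \<in> carrier (tensor R A N)"
  shows "\<exists>S\<subseteq>carrier A. finite S \<and> z = finprod (tensor R A N) (\<lambda>b. tensor_product.tens R A N b (\<phi> b z)) S"
proof -
  interpret T: tensor_product R A N by fact
  interpret TT: comm_group "tensor R A N" by (rule T.comm_group_tensor)
  interpret A: right_module R A by (rule T.A)
  have \<phi>c: "\<phi> b z \<in> carrier N" if "z \<in> carrier (tensor R A N)" for b z
    by (rule hom_in_carrier[OF \<phi>(1) that])
  \<comment> \<open>The formula is asserted for every larger finite set too, so that two elements
    can be multiplied over the union of their index sets.\<close>
  have "\<exists>S. S \<subseteq> carrier A \<and> finite S \<and> (\<forall>S'. S \<subseteq> S' \<and> S' \<subseteq> carrier A \<and> finite S' \<longrightarrow>
     z = finprod (tensor R A N) (\<lambda>b. T.tens b (\<phi> b z)) S')"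
    using z
  proof (induction rule: T.tensor_induct)
    case (tens a x)
    have \<sigma>a: "\<sigma> a \<in> carrier (free_right R (carrier A))" by (rule mod_hom_closed[OF \<sigma> tens(1)])
    then have \<sigma>c: "\<sigma> a b \<in> carrier R" for b by (simp add: carrier_free_right)
    let ?S = "{b. \<sigma> a b \<noteq> \<zero>\<^bsub>R\<^esub>}"
    have "T.tens a x = finprod (tensor R A N) (\<lambda>b. T.tens b (\<phi> b (T.tens a x))) S'"
      if S': "?S \<subseteq> S'" "S' \<subseteq> carrier A" "finite S'" for S'
    proof -
      have ac: "act A (\<sigma> a b) b \<in> carrier A" if "b \<in> S'" for b
        using that S' by (intro right_act_closed[OF T.A \<sigma>c]) auto
      have "T.tens a x = T.tens (finprod A (\<lambda>b. act A (\<sigma> a b) b) S') x"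
        using comb_superset[OF T.A _ \<sigma>a S'(3,1,2), of "\<lambda>b. b"] sec[OF tens(1)] by simp
      also have "\<dots> = finprod (tensor R A N) (\<lambda>b. T.tens (act A (\<sigma> a b) b) x) S'"
        by (rule A.hom_finprod[OF T.tens_hom_left[OF tens(2)] T.comm_group_tensor]) (use ac in blast)
      also have "\<dots> = finprod (tensor R A N) (\<lambda>b. T.tens b (\<phi> b (T.tens a x))) S'"
      proof (rule TT.finprod_cong'[OF refl])
        show "(\<lambda>b. T.tens b (\<phi> b (T.tens a x))) \<in> S' \<rightarrow> carrier (tensor R A N)"
          using S' tens by (intro funcsetI T.tens_closed \<phi>c) auto
        fix b assume "b \<in> S'"
        then have "b \<in> carrier A" using S' by blast
        then show "T.tens (act A (\<sigma> a b) b) x = T.tens b (\<phi> b (T.tens a x))"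
          using T.tens_act[OF \<sigma>c] tens by (simp add: \<phi>(2))
      qed
      finally show ?thesis .
    qed
    then show ?case using \<sigma>a by (intro exI[of _ ?S]) (simp add: carrier_free_right)
  next
    case (mult u v)
    obtain S1 where S1: "S1 \<subseteq> carrier A \<and> finite S1 \<and> (\<forall>S'. S1 \<subseteq> S' \<and> S' \<subseteq> carrier A \<and> finite S' \<longrightarrow>
        u = finprod (tensor R A N) (\<lambda>b. T.tens b (\<phi> b u)) S')"
      using mult(3) by (rule exE)
    obtain S2 where S2: "S2 \<subseteq> carrier A \<and> finite S2 \<and> (\<forall>S'. S2 \<subseteq> S' \<and> S' \<subseteq> carrier A \<and> finite S' \<longrightarrow>
        v = finprod (tensor R A N) (\<lambda>b. T.tens b (\<phi> b v)) S')"
      using mult(4) by (rule exE)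
    have "u \<otimes>\<^bsub>tensor R A N\<^esub> v = finprod (tensor R A N) (\<lambda>b. T.tens b (\<phi> b (u \<otimes>\<^bsub>tensor R A N\<^esub> v))) S'"
      if S': "S1 \<union> S2 \<subseteq> S'" "S' \<subseteq> carrier A" "finite S'" for S'
    proof -
      have bA: "b \<in> carrier A" if "b \<in> S'" for b using that S' by blast
      have "finprod (tensor R A N) (\<lambda>b. T.tens b (\<phi> b (u \<otimes>\<^bsub>tensor R A N\<^esub> v))) S' =
         finprod (tensor R A N) (\<lambda>b. T.tens b (\<phi> b u) \<otimes>\<^bsub>tensor R A N\<^esub> T.tens b (\<phi> b v)) S'"
      proof (rule TT.finprod_cong'[OF refl])
        show "(\<lambda>b. T.tens b (\<phi> b u) \<otimes>\<^bsub>tensor R A N\<^esub> T.tens b (\<phi> b v)) \<in> S' \<rightarrow> carrier (tensor R A N)"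
          by (intro funcsetI TT.m_closed T.tens_closed \<phi>c mult(1,2) bA)
        show "T.tens b (\<phi> b (u \<otimes>\<^bsub>tensor R A N\<^esub> v)) = T.tens b (\<phi> b u) \<otimes>\<^bsub>tensor R A N\<^esub> T.tens b (\<phi> b v)" if "b \<in> S'" for b
          by (simp only: hom_mult[OF \<phi>(1) mult(1,2)] T.tens_mult_right[OF bA[OF that] \<phi>c[OF mult(1)] \<phi>c[OF mult(2)]])
      qed
      also have "\<dots> = finprod (tensor R A N) (\<lambda>b. T.tens b (\<phi> b u)) S' \<otimes>\<^bsub>tensor R A N\<^esub> finprod (tensor R A N) (\<lambda>b. T.tens b (\<phi> b v)) S'"
        by (rule TT.finprod_multf) (intro funcsetI T.tens_closed \<phi>c mult(1,2) bA, assumption)+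
      also have "\<dots> = u \<otimes>\<^bsub>tensor R A N\<^esub> v"
        using S1[THEN conjunct2, THEN conjunct2, THEN spec, of S', THEN mp, symmetric]
          S2[THEN conjunct2, THEN conjunct2, THEN spec, of S', THEN mp, symmetric] S' by simp
      finally show ?thesis by simp
    qed
    then show ?case using S1 S2 by (intro exI[of _ "S1 \<union> S2"] conjI allI impI) simp_all
  qed
  then show ?thesis by blast
qed

text \<open>Flatness by coordinates: each coordinate of \<open>z\<close> lies in the kernel of
  \<open>t\<close>, is lifted along \<open>s\<close> on its own, and the lifts are reassembled as
  \<open>tensor_reconstruct\<close> reassembles \<open>z\<close>.\<close>

lemma tensor_exact:
  assumes A: "proj_right_module R A" and N: "left_module R N1" "left_module R N2" "left_module R N3"
    and s: "s \<in> mod_hom R N1 N2" and t: "t \<in> mod_hom R N2 N3"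
    and ex: "\<And>y. y \<in> carrier N2 \<Longrightarrow> t y = \<one>\<^bsub>N3\<^esub> \<Longrightarrow> \<exists>w\<in>carrier N1. s w = y"
    and z: "z \<in> carrier (tensor R A N2)" "tensor_map R A N3 (\<lambda>a. a) t z = \<one>\<^bsub>tensor R A N3\<^esub>"
  shows "\<exists>w\<in>carrier (tensor R A N1). tensor_map R A N2 (\<lambda>a. a) s w = z"
proof -
  note AR = proj_right_module_right[OF A]
  interpret T1: tensor_product R A N1 by (intro tensor_product.intro AR N)
  interpret T2: tensor_product R A N2 by (intro tensor_product.intro AR N)
  interpret T3: tensor_product R A N3 by (intro tensor_product.intro AR N)
  note TP = T1.tensor_product_axioms T2.tensor_product_axioms T3.tensor_product_axioms
  interpret G1: comm_group "tensor R A N1" by (rule T1.comm_group_tensor)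
  interpret G2: comm_group "tensor R A N2" by (rule T2.comm_group_tensor)
  obtain \<sigma> where \<sigma>: "\<sigma> \<in> mod_hom R A (free_right R (carrier A))"
    "\<And>x. x \<in> carrier A \<Longrightarrow> comb R A (\<lambda>b. b) (\<sigma> x) = x" using proj_section[OF A] by blast
  obtain \<phi> where \<phi>: "\<And>b. \<phi> b \<in> hom (tensor R A N2) N2"
    "\<And>b a x. a \<in> carrier A \<Longrightarrow> x \<in> carrier N2 \<Longrightarrow> \<phi> b (T2.tens a x) = act N2 (\<sigma> a b) x"
    using tensor_coord[OF TP(2) \<sigma>(1)] by blast
  obtain \<psi> where \<psi>: "\<And>b. \<psi> b \<in> hom (tensor R A N3) N3"
    "\<And>b a x. a \<in> carrier A \<Longrightarrow> x \<in> carrier N3 \<Longrightarrow> \<psi> b (T3.tens a x) = act N3 (\<sigma> a b) x"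
    using tensor_coord[OF TP(3) \<sigma>(1)] by blast
  note tm = tensor_map_hom[OF TP(2,3) mod_hom_id t] tensor_map_tens[OF TP(2,3) mod_hom_id t]
  note sm = tensor_map_hom[OF TP(1,2) mod_hom_id s] tensor_map_tens[OF TP(1,2) mod_hom_id s]
  have \<sigma>c: "\<sigma> a b \<in> carrier R" if "a \<in> carrier A" for a b
    using mod_hom_closed[OF \<sigma>(1) that] by (simp add: carrier_free_right)
  \<comment> \<open>Taking coordinates commutes with maps in the second factor, because these are
    linear. Hence \<open>z\<close> in the kernel forces each coordinate into the kernel of
    \<open>t\<close>.\<close>
  have "t (\<phi> b z) = \<psi> b (tensor_map R A N3 (\<lambda>a. a) t z)" for b
    by (rule T2.tensor_hom_eq[OF _ _ _ z(1), where h = "\<lambda>z. t (\<phi> b z)" and k = "\<lambda>z. \<psi> b (tensor_map R A N3 (\<lambda>a. a) t z)"])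
      (use hom_compose[OF \<phi>(1) mod_hom_hom[OF t]] hom_compose[OF tm(1) \<psi>(1)] in
        \<open>simp_all add: comp_def \<phi>(2) \<psi>(2) tm(2) mod_hom_closed[OF t] mod_hom_act[OF t] \<sigma>c\<close>)
  then have "t (\<phi> b z) = \<one>\<^bsub>N3\<^esub>" for b
    using z(2) hom_one_comm[OF \<psi>(1) T3.comm_group_tensor T3.N_group] by simp
  then have "\<exists>w\<in>carrier N1. s w = \<phi> b z" for b by (intro ex hom_in_carrier[OF \<phi>(1) z(1)])
  then obtain w where w: "\<And>b. w b \<in> carrier N1" "\<And>b. s (w b) = \<phi> b z" by metis
  obtain S where S: "S \<subseteq> carrier A" "finite S" "z = finprod (tensor R A N2) (\<lambda>b. T2.tens b (\<phi> b z)) S"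
    using tensor_reconstruct[OF TP(2) \<sigma> \<phi> z(1)] by blast
  have wc: "(\<lambda>b. T1.tens b (w b)) \<in> S \<rightarrow> carrier (tensor R A N1)"
    using S(1) by (intro funcsetI T1.tens_closed w(1)) blast
  have "tensor_map R A N2 (\<lambda>a. a) s (finprod (tensor R A N1) (\<lambda>b. T1.tens b (w b)) S) =
     finprod (tensor R A N2) (\<lambda>b. tensor_map R A N2 (\<lambda>a. a) s (T1.tens b (w b))) S"
    by (rule G1.hom_finprod[OF sm(1) T2.comm_group_tensor wc])
  also have "\<dots> = finprod (tensor R A N2) (\<lambda>b. T2.tens b (\<phi> b z)) S"
  proof (rule G2.finprod_cong'[OF refl])
    show "(\<lambda>b. T2.tens b (\<phi> b z)) \<in> S \<rightarrow> carrier (tensor R A N2)"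
      using S(1) by (intro funcsetI T2.tens_closed hom_in_carrier[OF \<phi>(1) z(1)]) blast
    show "tensor_map R A N2 (\<lambda>a. a) s (T1.tens b (w b)) = T2.tens b (\<phi> b z)" if "b \<in> S" for b
      using that S(1) by (simp add: sm(2) w subset_iff)
  qed
  finally have "tensor_map R A N2 (\<lambda>a. a) s (finprod (tensor R A N1) (\<lambda>b. T1.tens b (w b)) S) = z"
    using S(3) by simp
  then show ?thesis using G1.finprod_closed[OF wc] by blast
qed

lemma tensor_surj:
  assumes A: "right_module R A" and N: "left_module R N1" "left_module R N2"
    and s: "s \<in> mod_hom R N1 N2" and sur: "\<And>y. y \<in> carrier N2 \<Longrightarrow> \<exists>w\<in>carrier N1. s w = y"
    and z: "z \<in> carrier (tensor R A N2)"
  shows "\<exists>w\<in>carrier (tensor R A N1). tensor_map R A N2 (\<lambda>a. a) s w = z"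
proof -
  interpret T1: tensor_product R A N1 by (intro tensor_product.intro A N)
  interpret T2: tensor_product R A N2 by (intro tensor_product.intro A N)
  note sm = tensor_map_hom[OF T1.tensor_product_axioms T2.tensor_product_axioms mod_hom_id s]
    tensor_map_tens[OF T1.tensor_product_axioms T2.tensor_product_axioms mod_hom_id s]
  interpret G1: comm_group "tensor R A N1" by (rule T1.comm_group_tensor)
  show ?thesis
    using z
  proof (induction rule: T2.tensor_induct)
    case (tens a x)
    obtain w where w: "w \<in> carrier N1" "s w = x" using sur[OF tens(2)] by blast
    show ?case by (rule bexI[of _ "T1.tens a w"]) (use tens w in \<open>simp_all add: sm(2) T1.tens_closed\<close>)
  next
    case (mult u v)
    then obtain w w' where "w \<in> carrier (tensor R A N1)" "tensor_map R A N2 (\<lambda>a. a) s w = u"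
      "w' \<in> carrier (tensor R A N1)" "tensor_map R A N2 (\<lambda>a. a) s w' = v" by blast
    then show ?case
      by (intro bexI[of _ "w \<otimes>\<^bsub>tensor R A N1\<^esub> w'"]) (simp_all add: hom_mult[OF sm(1)])
  qed
qed

section \<open>Projective functors\<close>

text \<open>A generator at \<open>c\<close> of the summand Z[C(c',-)] indexed by c' and x in P(c').
  The object c' need not be stored, being the source of \<open>g\<close>; pairs of this type are
  what \<open>proj_functor\<close> provides for.\<close>

definition free_gens :: "('o, 'm) cat \<Rightarrow> ('o, 'm, 'b) abfun \<Rightarrow> 'o \<Rightarrow> ('m \<times> 'b) set"
  where "free_gens C P c = {(g, x). g \<in> Ar C \<and> tgt C g = c \<and> x \<in> carrier (fob P (src C g))}"

definition free_functor :: "('o, 'm) cat \<Rightarrow> ('o, 'm, 'b) abfun \<Rightarrow> ('o, 'm, ('m \<times> 'b) \<Rightarrow>\<^sub>0 int) abfun"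
  where "free_functor C P = \<lparr>fob = (\<lambda>c. free_Abelian_group (free_gens C P c)),
    far = (\<lambda>f. frag_extend (\<lambda>(g, x). frag_of (cmp C f g, x)))\<rparr>"

lemma fob_free_functor: "fob (free_functor C P) c = free_Abelian_group (free_gens C P c)"
  and far_free_functor: "far (free_functor C P) f = frag_extend (\<lambda>(g, x). frag_of (cmp C f g, x))"
  by (simp_all add: free_functor_def)

lemma frag_extend_frag_extend: "frag_extend f (frag_extend g c) = frag_extend (\<lambda>x. frag_extend f (g x)) c"
  by (induction c rule: free_Abelian_group_induct[of _ UNIV]) (simp_all add: frag_extend_diff)

lemma frag_extend_cong:
  "(\<And>x. x \<in> Poly_Mapping.keys c \<Longrightarrow> f x = g x) \<Longrightarrow> frag_extend f c = frag_extend g c"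
  by (simp add: frag_extend_def)

lemma frag_extend_frag_of: "frag_extend frag_of c = c"
  by (induction c rule: free_Abelian_group_induct[of _ UNIV]) (simp_all add: frag_extend_diff)

context colim_functor
begin

lemma cmp_Ar: "f \<in> Ar C \<Longrightarrow> g \<in> Ar C \<Longrightarrow> tgt C f = src C g \<Longrightarrow>
    cmp C g f \<in> Ar C \<and> src C (cmp C g f) = src C f \<and> tgt C (cmp C g f) = tgt C g"
  using cat by (simp add: category_def)

lemma cmp_assoc: "f \<in> Ar C \<Longrightarrow> g \<in> Ar C \<Longrightarrow> h \<in> Ar C \<Longrightarrow> tgt C f = src C g \<Longrightarrow> tgt C g = src C h \<Longrightarrow>
    cmp C h (cmp C g f) = cmp C (cmp C h g) f"
  using cat unfolding category_def by blast

lemma cmp_idn: "f \<in> Ar C \<Longrightarrow> tgt C f = c \<Longrightarrow> cmp C (idn C c) f = f"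
  using cat by (auto simp: category_def)

lemma idn_Ar: "c \<in> Ob C \<Longrightarrow> idn C c \<in> Ar C \<and> src C (idn C c) = c \<and> tgt C (idn C c) = c"
  using cat by (simp add: category_def)

lemma free_gens_cmp:
  "f \<in> Ar C \<Longrightarrow> k \<in> free_gens C F (src C f) \<Longrightarrow> (case k of (g, x) \<Rightarrow> (cmp C f g, x)) \<in> free_gens C F (tgt C f)"
  using cmp_Ar by (auto simp: free_gens_def)

lemma ab_functor_free_functor: "ab_functor C (free_functor C F)"
  unfolding ab_functor_def fob_free_functor far_free_functor
proof (intro conjI ballI impI)
  fix c show "comm_group (free_Abelian_group (free_gens C F c))" by (rule abelian_free_Abelian_group)
next
  fix f assume f: "f \<in> Ar C"
  show "frag_extend (\<lambda>(g, x). frag_of (cmp C f g, x)) \<in>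
      hom (free_Abelian_group (free_gens C F (src C f))) (free_Abelian_group (free_gens C F (tgt C f)))"
  proof (rule homI)
    fix u assume "u \<in> carrier (free_Abelian_group (free_gens C F (src C f)))"
    then have u: "Poly_Mapping.keys u \<subseteq> free_gens C F (src C f)" by simp
    have "Poly_Mapping.keys (frag_extend (\<lambda>(g, x). frag_of (cmp C f g, x)) u) \<subseteq> free_gens C F (tgt C f)"
      by (rule keys_frag_extend_subset[OF u]) (use free_gens_cmp[OF f] in \<open>auto split: prod.splits\<close>)
    then show "frag_extend (\<lambda>(g, x). frag_of (cmp C f g, x)) u \<in> carrier (free_Abelian_group (free_gens C F (tgt C f)))"
      by simp
  qed (simp add: frag_extend_add)
next
  fix c u assume c: "c \<in> Ob C" and "u \<in> carrier (free_Abelian_group (free_gens C F c))"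
  then have "frag_extend (\<lambda>(g, x). frag_of (cmp C (idn C c) g, x)) u = frag_extend frag_of u"
    by (intro frag_extend_cong) (auto simp: free_gens_def subset_iff cmp_idn)
  then show "frag_extend (\<lambda>(g, x). frag_of (cmp C (idn C c) g, x)) u = u" by (simp add: frag_extend_frag_of)
next
  fix f g u assume fg: "f \<in> Ar C" "g \<in> Ar C" "tgt C f = src C g"
    and "u \<in> carrier (free_Abelian_group (free_gens C F (src C f)))"
  then show "frag_extend (\<lambda>(k, x). frag_of (cmp C (cmp C g f) k, x)) u =
      frag_extend (\<lambda>(k, x). frag_of (cmp C g k, x)) (frag_extend (\<lambda>(k, x). frag_of (cmp C f k, x)) u)"
    unfolding frag_extend_frag_extend
    by (intro frag_extend_cong) (auto simp: free_gens_def subset_iff cmp_assoc)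
qed

definition free_eval :: "'o \<Rightarrow> ('m \<times> 'a \<Rightarrow>\<^sub>0 int) \<Rightarrow> 'a"
  where "free_eval c = lin (fob F c) (\<lambda>(g, x). far F g x)"

lemma free_gens_far: "k \<in> free_gens C F c \<Longrightarrow> (case k of (g, x) \<Rightarrow> far F g x) \<in> carrier (fob F c)"
  using far_closed by (auto simp: free_gens_def)

lemma nat_trans_free_eval: "nat_trans C (free_functor C F) F free_eval"
  unfolding nat_trans_def fob_free_functor far_free_functor
proof (intro conjI ballI)
  fix c assume c: "c \<in> Ob C"
  interpret G: comm_group "fob F c" by (rule fob_comm_group[OF c])
  show "free_eval c \<in> hom (free_Abelian_group (free_gens C F c)) (fob F c)"
    unfolding free_eval_def by (rule G.lin_hom) (rule free_gens_far)
next
  fix f u assume f: "f \<in> Ar C" and "u \<in> carrier (free_Abelian_group (free_gens C F (src C f)))"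
  then have u: "Poly_Mapping.keys u \<subseteq> free_gens C F (src C f)" by simp
  interpret G: comm_group "fob F (src C f)" by (rule fob_comm_group[OF src_Ob[OF f]])
  interpret H: comm_group "fob F (tgt C f)" by (rule fob_comm_group[OF tgt_Ob[OF f]])
  have "free_eval (tgt C f) (frag_extend (\<lambda>(g, x). frag_of (cmp C f g, x)) u) =
      lin (fob F (tgt C f)) (\<lambda>k. free_eval (tgt C f) (case k of (g, x) \<Rightarrow> frag_of (cmp C f g, x))) u"
    unfolding free_eval_def
    by (rule H.lin_frag_extend[where T = "free_gens C F (tgt C f)"])
      (use u free_gens_cmp[OF f] free_gens_far in \<open>auto split: prod.splits\<close>)
  also have "\<dots> = lin (fob F (tgt C f)) (\<lambda>k. far F f (case k of (g, x) \<Rightarrow> far F g x)) u"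
  proof (rule H.lin_cong)
    fix k assume "k \<in> Poly_Mapping.keys u"
    then obtain g x where k: "k = (g, x)" "g \<in> Ar C" "tgt C g = src C f" "x \<in> carrier (fob F (src C g))"
      using u by (auto simp: free_gens_def)
    have c: "far F (cmp C f g) x \<in> carrier (fob F (tgt C f))"
      using far_closed[of "cmp C f g" x] cmp_Ar[OF k(2) f k(3)] k(4) by simp
    show "free_eval (tgt C f) (case k of (g, x) \<Rightarrow> frag_of (cmp C f g, x)) = far F f (case k of (g, x) \<Rightarrow> far F g x)"
      using c far_cmp[OF k(2) f k(3,4)] by (simp add: k(1) free_eval_def)
    show "free_eval (tgt C f) (case k of (g, x) \<Rightarrow> frag_of (cmp C f g, x)) \<in> carrier (fob F (tgt C f))"
      using c by (simp add: k(1) free_eval_def)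
  qed
  also have "\<dots> = far F f (free_eval (src C f) u)"
    unfolding free_eval_def
    by (rule G.hom_lin[OF far_hom[OF f] H.comm_group_axioms, symmetric]) (use u free_gens_far in blast)
  finally show "free_eval (tgt C f) (frag_extend (\<lambda>(g, x). frag_of (cmp C f g, x)) u) = far F f (free_eval (src C f) u)" .
qed

lemma free_eval_surj: "c \<in> Ob C \<Longrightarrow> free_eval c ` carrier (free_Abelian_group (free_gens C F c)) = carrier (fob F c)"
proof (intro equalityI subsetI)
  fix y assume c: "c \<in> Ob C" and "y \<in> free_eval c ` carrier (free_Abelian_group (free_gens C F c))"
  moreover have "free_eval c \<in> hom (free_Abelian_group (free_gens C F c)) (fob F c)"
    using nat_trans_free_eval c by (simp add: nat_trans_def fob_free_functor)
  ultimately show "y \<in> carrier (fob F c)" using hom_in_carrier[of "free_eval c"] by blast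
next
  fix x assume c: "c \<in> Ob C" and x: "x \<in> carrier (fob F c)"
  interpret G: comm_group "fob F c" by (rule fob_comm_group[OF c])
  have "free_eval c (frag_of (idn C c, x)) = x"
    using x far_idn[OF c x] by (simp add: free_eval_def)
  moreover have "frag_of (idn C c, x) \<in> carrier (free_Abelian_group (free_gens C F c))"
    using x idn_Ar[OF c] by (simp add: free_gens_def)
  ultimately show "x \<in> free_eval c ` carrier (free_Abelian_group (free_gens C F c))" by (metis imageI)
qed

text \<open>The identity is lifted against \<open>free_eval\<close>, the epimorphism for whose
  element types the lifting property is postulated.\<close>

lemma proj_functor_section:
  assumes P: "proj_functor C F"
  obtains s where "nat_trans C F (free_functor C F) s"
    "\<And>c x. c \<in> Ob C \<Longrightarrow> x \<in> carrier (fob F c) \<Longrightarrow> free_eval c (s c x) = x"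
proof -
  have id: "nat_trans C F F (\<lambda>c x. x)" by (simp add: nat_trans_def hom_def)
  have sur: "\<forall>c\<in>Ob C. free_eval c ` carrier (fob (free_functor C F) c) = carrier (fob F c)"
    using free_eval_surj by (simp add: fob_free_functor)
  have "\<exists>s. nat_trans C F (free_functor C F) s \<and> (\<forall>c\<in>Ob C. \<forall>x\<in>carrier (fob F c). free_eval c (s c x) = x)"
    using P fctr ab_functor_free_functor nat_trans_free_eval sur id unfolding proj_functor_def by blast
  then show ?thesis using that by blast
qed

end

section \<open>Doubling the positive integers\<close>

text \<open>\<open>shift\<close> embeds the monoid into itself by letting \<open>f\<close> act on the even numbers only, and \<open>dbl\<close>
  intertwines \<open>f\<close> with \<open>shift f\<close>. The odd numbers give room to extend \<open>2 g\<close>, for any injection \<open>g\<close> of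
  finite sets, to an element \<open>spread g\<close> on which \<open>shift\<close> acts as composition acts on \<open>g\<close>.\<close>

definition dbl :: "nat \<Rightarrow> nat"
  where "dbl = (\<lambda>i\<in>omega. 2 * i)"

definition shift :: "(nat \<Rightarrow> nat) \<Rightarrow> nat \<Rightarrow> nat"
  where "shift f = (\<lambda>i\<in>omega. if even i then 2 * f (i div 2) else i)"

definition spread :: "arrow \<Rightarrow> nat \<Rightarrow> nat"
  where "spread = (\<lambda>(n, u, m). \<lambda>i\<in>omega. if i \<le> n then 2 * u i else 2 * i + 1)"

lemma carrier_inj_monoidI:
  assumes "\<And>i. 1 \<le> i \<Longrightarrow> 1 \<le> f i" "\<And>i j. 1 \<le> i \<Longrightarrow> 1 \<le> j \<Longrightarrow> f i = f j \<Longrightarrow> i = j"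
  shows "restrict f omega \<in> carrier inj_monoid"
  using assms by (auto simp: carrier_inj_monoid omega_def inj_on_def)

lemma inj_monoid_inj: "f \<in> carrier inj_monoid \<Longrightarrow> 1 \<le> i \<Longrightarrow> 1 \<le> j \<Longrightarrow> f i = f j \<longleftrightarrow> i = j"
  by (auto simp: carrier_inj_monoid omega_def inj_on_def)

lemma dbl_closed: "dbl \<in> carrier inj_monoid"
  unfolding dbl_def by (rule carrier_inj_monoidI) auto

lemma even_div_2_ge: "1 \<le> i \<Longrightarrow> even i \<Longrightarrow> 1 \<le> i div 2" for i :: nat
  by (elim evenE) simp

lemma shift_closed:
  assumes f: "f \<in> carrier inj_monoid" shows "shift f \<in> carrier inj_monoid"
  unfolding shift_def
proof (rule carrier_inj_monoidI)
  fix i :: nat assume i: "1 \<le> i"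
  show "1 \<le> (if even i then 2 * f (i div 2) else i)"
    using i inj_monoid_ge_1[OF f even_div_2_ge[OF i]] by (cases "even i") simp_all
next
  fix i j :: nat assume ij: "1 \<le> i" "1 \<le> j"
    "(if even i then 2 * f (i div 2) else i) = (if even j then 2 * f (j div 2) else j)"
  then consider "even i" "even j" | "odd i" "odd j" by (metis even_mult_iff even_numeral)
  then show "i = j"
  proof cases
    case 1
    then have "i div 2 = j div 2"
      using ij inj_monoid_inj[OF f even_div_2_ge[OF ij(1)] even_div_2_ge[OF ij(2)]] by simp
    then show ?thesis using 1 by (metis even_two_times_div_two)
  qed (use ij in simp)
qed

lemma inj_monoid_mult_apply: "1 \<le> i \<Longrightarrow> (f \<otimes>\<^bsub>inj_monoid\<^esub> g) i = f (g i)"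
  by (simp add: inj_monoid_def compose_def omega_def)

lemma inj_monoid_eqI:
  assumes "f \<in> carrier inj_monoid" "g \<in> carrier inj_monoid" "\<And>i. 1 \<le> i \<Longrightarrow> f i = g i"
  shows "f = g"
proof (rule extensionalityI)
  show "f \<in> extensional omega" "g \<in> extensional omega" using assms by (auto simp: carrier_inj_monoid PiE_iff)
qed (use assms(3) in \<open>simp add: omega_def\<close>)

lemma shift_apply: "1 \<le> i \<Longrightarrow> shift f i = (if even i then 2 * f (i div 2) else i)"
  by (simp add: shift_def omega_def)

lemma inj_monoid_mult_closed:
  "f \<in> carrier inj_monoid \<Longrightarrow> g \<in> carrier inj_monoid \<Longrightarrow> f \<otimes>\<^bsub>inj_monoid\<^esub> g \<in> carrier inj_monoid"
  by (rule monoid.m_closed[OF monoid_inj_monoid])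

lemma shift_mult:
  assumes f: "f \<in> carrier inj_monoid" and g: "g \<in> carrier inj_monoid"
  shows "shift (f \<otimes>\<^bsub>inj_monoid\<^esub> g) = shift f \<otimes>\<^bsub>inj_monoid\<^esub> shift g"
proof (rule inj_monoid_eqI)
  fix i :: nat assume i: "1 \<le> i"
  show "shift (f \<otimes>\<^bsub>inj_monoid\<^esub> g) i = (shift f \<otimes>\<^bsub>inj_monoid\<^esub> shift g) i"
  proof (cases "even i")
    case True
    then show ?thesis
      using i inj_monoid_ge_1[OF g even_div_2_ge[OF i True]] even_div_2_ge[OF i True]
      by (simp add: shift_apply inj_monoid_mult_apply)
  qed (use i in \<open>simp add: shift_apply inj_monoid_mult_apply\<close>)
qed (intro shift_closed inj_monoid_mult_closed f g)+

lemma inj_monoid_one_closed: "\<one>\<^bsub>inj_monoid\<^esub> \<in> carrier inj_monoid"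
  by (rule monoid.one_closed[OF monoid_inj_monoid])

lemma inj_monoid_one_apply: "1 \<le> i \<Longrightarrow> \<one>\<^bsub>inj_monoid\<^esub> i = i"
  by (simp add: inj_monoid_def omega_def)

lemma shift_one: "shift \<one>\<^bsub>inj_monoid\<^esub> = \<one>\<^bsub>inj_monoid\<^esub>"
proof (rule inj_monoid_eqI[OF shift_closed[OF inj_monoid_one_closed] inj_monoid_one_closed])
  fix i :: nat assume i: "1 \<le> i"
  show "shift \<one>\<^bsub>inj_monoid\<^esub> i = \<one>\<^bsub>inj_monoid\<^esub> i"
    using i even_div_2_ge[OF i] by (auto simp: shift_apply inj_monoid_one_apply)
qed

text \<open>Both sides send i to twice \<open>f i\<close>. This is the naturality of
  \<open>dbl\<close>, and the reason why the doubling map on a right module resolution is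
  linear.\<close>

lemma shift_dbl:
  assumes f: "f \<in> carrier inj_monoid"
  shows "shift f \<otimes>\<^bsub>inj_monoid\<^esub> dbl = dbl \<otimes>\<^bsub>inj_monoid\<^esub> f"
proof (rule inj_monoid_eqI)
  fix i :: nat assume i: "1 \<le> i"
  then show "(shift f \<otimes>\<^bsub>inj_monoid\<^esub> dbl) i = (dbl \<otimes>\<^bsub>inj_monoid\<^esub> f) i"
    using inj_monoid_ge_1[OF f i] by (simp add: inj_monoid_mult_apply dbl_def omega_def shift_def)
qed (intro shift_closed inj_monoid_mult_closed f dbl_closed)+

lemma spread_apply: "1 \<le> i \<Longrightarrow> spread (n, u, m) i = (if i \<le> n then 2 * u i else 2 * i + 1)"
  by (simp add: spread_def omega_def)

lemma spread_closed:
  assumes "g \<in> Ar cat_I" shows "spread g \<in> carrier inj_monoid"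
proof -
  obtain n u m where g: "g = (n, u, m)" by (cases g)
  then have u: "u \<in> {1..n} \<rightarrow>\<^sub>E {1..m}" "inj_on u {1..n}" using assms by (simp_all add: Ar_cat_I)
  show ?thesis
    unfolding g spread_def prod.case
  proof (rule carrier_inj_monoidI)
    fix i :: nat assume "1 \<le> i"
    then show "1 \<le> (if i \<le> n then 2 * u i else 2 * i + 1)" using PiE_mem[OF u(1), of i] by auto
  next
    fix i j :: nat assume ij: "1 \<le> i" "1 \<le> j"
      "(if i \<le> n then 2 * u i else 2 * i + 1) = (if j \<le> n then 2 * u j else 2 * j + 1)"
    \<comment> \<open>Values on \<open>{1..n}\<close> are even and all others odd, so a collision
      can only happen within one branch.\<close>
    have "2 * a \<noteq> Suc (2 * b)" "Suc (2 * b) \<noteq> 2 * a" for a b :: nat by presburger+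
    then consider "i \<le> n" "j \<le> n" "u i = u j" | "i = j" using ij(3) by (auto split: if_splits)
    then show "i = j" using ij u(2) by cases (auto dest: inj_onD)
  qed
qed

text \<open>On the source of \<open>g\<close>, \<open>shift f\<close> turns twice a value into twice
  its image under \<open>f\<close>. Beyond it the values of \<open>spread\<close> are odd, and
  \<open>shift f\<close> fixes odd numbers.\<close>

lemma shift_spread:
  assumes f: "f \<in> carrier inj_monoid" and g: "g \<in> Ar cat_I" and m: "max_image f (tgt cat_I g) \<le> m"
  shows "shift f \<otimes>\<^bsub>inj_monoid\<^esub> spread g = spread (cmp cat_I (rst f (tgt cat_I g) m) g)"
proof (rule inj_monoid_eqI)
  obtain n u l where gg: "g = (n, u, l)" by (cases g)
  then have u: "u \<in> {1..n} \<rightarrow>\<^sub>E {1..l}" using g by (simp add: Ar_cat_I)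
  fix i :: nat assume i: "1 \<le> i"
  have "spread g i \<ge> 1" using inj_monoid_ge_1[OF spread_closed[OF g] i] .
  then show "(shift f \<otimes>\<^bsub>inj_monoid\<^esub> spread g) i = spread (cmp cat_I (rst f (tgt cat_I g) m) g) i"
    using i PiE_mem[OF u, of i]
    by (auto simp: gg inj_monoid_mult_apply spread_apply shift_apply cat_I_simps rst_def compose_def)
next
  show "shift f \<otimes>\<^bsub>inj_monoid\<^esub> spread g \<in> carrier inj_monoid"
    by (intro inj_monoid_mult_closed shift_closed spread_closed f g)
  have "cmp cat_I (rst f (tgt cat_I g) m) g \<in> Ar cat_I"
    using category_cat_I g rst_Ar[OF f m] unfolding category_def by simp
  then show "spread (cmp cat_I (rst f (tgt cat_I g) m) g) \<in> carrier inj_monoid" by (rule spread_closed)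
qed

text \<open>\<open>spread\<close> depends on the source and the values of an arrow but not on its
  target, so whatever is built from it descends to the colimit along the inclusions.\<close>

lemma spread_inc: "g \<in> Ar cat_I \<Longrightarrow> spread (cmp cat_I (inc (tgt cat_I g) m) g) = spread g"
  by (cases g) (auto simp: Ar_cat_I cat_I_simps inc_def spread_def compose_def PiE_iff omega_def intro!: restrict_ext)

text \<open>\<open>spread g\<close> extends twice \<open>g\<close>, so its restriction to the source
  of \<open>g\<close> is the composite of \<open>g\<close> with doubling. At stage
  \<open>2 * m\<close>, for \<open>m\<close> the target of \<open>g\<close>, both sides are classes
  of the same element.\<close>

lemma (in I_functor) inj_action_spread:
  assumes g: "g \<in> Ar cat_I" and x: "x \<in> carrier (fob F (src cat_I g))"
  shows "inj_action F (spread g) (cls (src cat_I g) x) = inj_action F dbl (cls (tgt cat_I g) (far F g x))"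
proof -
  obtain n u m where gg: "g = (n, u, m)" by (cases g)
  then have u: "u \<in> {1..n} \<rightarrow>\<^sub>E {1..m}" using g by (simp add: Ar_cat_I)
  have x': "x \<in> carrier (fob F n)" using x by (simp add: gg cat_I_simps)
  have gx: "far F g x \<in> carrier (fob F m)" using I.far_closed[OF g x] by (simp add: gg cat_I_simps)
  have d: "max_image dbl m \<le> 2 * m" by (rule max_image_le) (simp add: dbl_def omega_def)
  have e: "cmp cat_I (rst dbl m (2 * m)) g = rst (spread g) n (2 * m)"
    using u by (auto simp: gg rst_def cat_I_simps compose_def dbl_def spread_def omega_def PiE_iff intro!: restrict_ext)
  have s: "max_image (spread g) n \<le> 2 * m"
    by (rule max_image_le) (use u in \<open>auto simp: gg spread_apply PiE_iff\<close>)
  have "far F (cmp cat_I (rst dbl m (2 * m)) g) x = far F (rst dbl m (2 * m)) (far F g x)"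
    by (rule I.far_cmp[OF g rst_Ar[OF dbl_closed d] _ x]) (simp add: gg cat_I_simps)
  then have "far F (rst dbl m (2 * m)) (far F g x) = far F (rst (spread g) n (2 * m)) x" by (simp only: e)
  then show ?thesis
    using inj_action_cls[OF spread_closed[OF g] x' s] inj_action_cls[OF dbl_closed gx d]
    by (simp add: gg cat_I_simps)
qed

section \<open>Resolutions of the trivial module\<close>

lemma comm_group_act_update:
  assumes "comm_group A" shows "comm_group (A\<lparr>act := \<alpha>\<rparr>)"
proof -
  interpret comm_group A by fact
  show ?thesis
  proof (rule comm_groupI)
    fix x assume "x \<in> carrier (A\<lparr>act := \<alpha>\<rparr>)"
    then show "\<exists>y\<in>carrier (A\<lparr>act := \<alpha>\<rparr>). y \<otimes>\<^bsub>A\<lparr>act := \<alpha>\<rparr>\<^esub> x = \<one>\<^bsub>A\<lparr>act := \<alpha>\<rparr>\<^esub>"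
      by (intro bexI[of _ "m_inv A x"]) simp_all
  qed (simp_all add: m_ac)
qed

text \<open>Both sides are combinations over the support of \<open>c\<close>: on the left by
  \<open>monoid_ring_act_lin\<close>, on the right by definition. So balancedness over Z[M] need
  only be checked for single elements of M.\<close>

lemma monoid_balanced:
  assumes A: "right_module (monoid_ring M) A" and G: "comm_group G" and H: "comm_group H"
    and a: "\<And>f x. f \<in> carrier M \<Longrightarrow> x \<in> carrier G \<Longrightarrow> a f x \<in> carrier G"
    and l: "\<And>x. x \<in> carrier G \<Longrightarrow> (\<lambda>z. \<beta> z x) \<in> hom A H" and r: "\<And>z. z \<in> carrier A \<Longrightarrow> \<beta> z \<in> hom G H"
    and bal: "\<And>f z x. f \<in> carrier M \<Longrightarrow> z \<in> carrier A \<Longrightarrow> x \<in> carrier G \<Longrightarrow> \<beta> (act A (frag_of f) z) x = \<beta> z (a f x)"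
    and c: "c \<in> carrier (monoid_ring M)" and z: "z \<in> carrier A" and x: "x \<in> carrier G"
  shows "\<beta> (act A c z) x = \<beta> z (act (linearize G a) c x)"
proof -
  interpret A: comm_group A by (rule right_module_comm_group[OF A])
  interpret G: comm_group G by (rule G)
  interpret H: comm_group H by (rule H)
  have f: "f \<in> carrier M" if "f \<in> Poly_Mapping.keys c" for f using c that by (auto simp: carrier_monoid_ring)
  have az: "act A (frag_of f) z \<in> carrier A" if "f \<in> Poly_Mapping.keys c" for f
    by (rule right_act_closed[OF A frag_of_monoid_ring[OF f[OF that]] z])
  have ax: "a f x \<in> carrier G" if "f \<in> Poly_Mapping.keys c" for f by (rule a[OF f[OF that] x])
  have "\<beta> (act A c z) x = lin H (\<lambda>f. \<beta> (act A (frag_of f) z) x) c"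
    unfolding monoid_ring_act_lin[OF A c z] by (rule A.hom_lin[OF l[OF x] H az])
  also have "\<dots> = lin H (\<lambda>f. \<beta> z (a f x)) c"
  proof (rule H.lin_cong)
    show "\<beta> (act A (frag_of f) z) x \<in> carrier H" if "f \<in> Poly_Mapping.keys c" for f
      by (rule hom_in_carrier[OF l[OF x] az[OF that]])
    show "\<beta> (act A (frag_of f) z) x = \<beta> z (a f x)" if "f \<in> Poly_Mapping.keys c" for f
      by (rule bal[OF f[OF that] z x])
  qed
  also have "\<dots> = \<beta> z (act (linearize G a) c x)"
    unfolding act_linearize by (rule G.hom_lin[OF r[OF z] H ax, symmetric])
  finally show ?thesis .
qed

lemma frag_mult: "frag_of f \<otimes>\<^bsub>monoid_ring M\<^esub> frag_of g = frag_of (f \<otimes>\<^bsub>M\<^esub> g)"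
  by (simp add: mult_monoid_ring)

definition ring_shift :: "((nat \<Rightarrow> nat) \<Rightarrow>\<^sub>0 int) \<Rightarrow> (nat \<Rightarrow> nat) \<Rightarrow>\<^sub>0 int"
  where "ring_shift = frag_extend (\<lambda>f. frag_of (shift f))"

lemma ring_shift_frag [simp]: "ring_shift (frag_of f) = frag_of (shift f)"
  by (simp add: ring_shift_def)

lemma ring_shift_closed: "r \<in> carrier (monoid_ring inj_monoid) \<Longrightarrow> ring_shift r \<in> carrier (monoid_ring inj_monoid)"
  unfolding ring_shift_def carrier_monoid_ring by (rule keys_frag_extend_subset, assumption) (simp add: shift_closed)

lemma ring_shift_mult:
  assumes "r \<in> carrier (monoid_ring inj_monoid)" "s \<in> carrier (monoid_ring inj_monoid)"
  shows "ring_shift (r \<otimes>\<^bsub>monoid_ring inj_monoid\<^esub> s) = ring_shift r \<otimes>\<^bsub>monoid_ring inj_monoid\<^esub> ring_shift s"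
  unfolding mult_monoid_ring ring_shift_def frag_extend_frag_extend
  by (intro frag_extend_cong)
    (use assms in \<open>simp add: frag_extend_frag_extend carrier_monoid_ring subset_iff shift_mult cong: frag_extend_cong\<close>)

lemma ring_shift_dbl:
  assumes "r \<in> carrier (monoid_ring inj_monoid)"
  shows "ring_shift r \<otimes>\<^bsub>monoid_ring inj_monoid\<^esub> frag_of dbl = frag_of dbl \<otimes>\<^bsub>monoid_ring inj_monoid\<^esub> r"
  unfolding mult_monoid_ring ring_shift_def frag_extend_frag_extend
  by (simp, intro frag_extend_cong) (use assms in \<open>simp add: carrier_monoid_ring subset_iff shift_dbl\<close>)

text \<open>The trivial action sees only the sum of the coefficients, which is unchanged when
  \<open>shift\<close> renames the monoid elements.\<close>

lemma act_trivial_shift: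
  assumes "r \<in> carrier (monoid_ring inj_monoid)"
  shows "act trivial_module (ring_shift r) y = act trivial_module r y"
proof -
  interpret Z: comm_group integer_group by (rule abelian_integer_group)
  show ?thesis
    unfolding trivial_module_def act_linearize ring_shift_def
    by (subst Z.lin_frag_extend[where T = UNIV]) simp_all
qed

locale trivial_resolution =
  fixes Q :: "((nat \<Rightarrow> nat) \<Rightarrow>\<^sub>0 int, 'c, int) mod_res"
  assumes res: "proj_right_resolution (monoid_ring inj_monoid) trivial_module Q"
begin

abbreviation R :: "((nat \<Rightarrow> nat) \<Rightarrow>\<^sub>0 int) ring"
  where "R \<equiv> monoid_ring inj_monoid"

abbreviation zmod :: "((nat \<Rightarrow> nat) \<Rightarrow>\<^sub>0 int, int) rmod"
  where "zmod \<equiv> trivial_module"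

abbreviation q :: "nat \<Rightarrow> ((nat \<Rightarrow> nat) \<Rightarrow>\<^sub>0 int, 'c) rmod"
  where "q \<equiv> mres Q"

lemma proj: "proj_right_module R (q n)"
  and d: "mdiff Q n \<in> mod_hom R (q (Suc n)) (q n)"
  and eps: "maug Q \<in> mod_hom R (q 0) zmod"
  and triv: "right_module R zmod"
  using res by (simp_all add: proj_right_resolution_def)

lemma qR: "right_module R (q n)"
  by (rule proj_right_module_right[OF proj])

lemma q_group: "comm_group (q n)"
  by (rule right_module_comm_group[OF qR])

lemma eps_hom: "maug Q \<in> hom (q 0) integer_group"
  using mod_hom_hom[OF eps] by (simp add: hom_def trivial_module_def)

lemma eps_act: "f \<in> carrier inj_monoid \<Longrightarrow> x \<in> carrier (q 0) \<Longrightarrow> maug Q (act (q 0) (frag_of f) x) = maug Q x"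
  using mod_hom_act[OF eps frag_of_monoid_ring[of f inj_monoid], of x]
    comm_group.lin_frag_of[OF abelian_integer_group, of "\<lambda>_. maug Q x" f]
  by (simp add: trivial_module_def act_linearize)

lemma exact: "exact_augmented q (mdiff Q) zmod (maug Q)"
  using res unfolding proj_right_resolution_def by blast

lemma one_trivial: "\<one>\<^bsub>zmod\<^esub> = (0 :: int)"
  by (simp add: trivial_module_def)

lemma eps_surj: "\<exists>x\<in>carrier (q 0). maug Q x = i"
proof -
  have "maug Q ` carrier (q 0) = UNIV"
    using exact unfolding exact_augmented_def by (simp add: trivial_module_def)
  then show ?thesis by (metis UNIV_I imageE)
qed

lemma ker_eps: "kernel (q 0) zmod (maug Q) = mdiff Q 0 ` carrier (q (Suc 0))"
  and ker_d: "kernel (q (Suc n)) (q n) (mdiff Q n) = mdiff Q (Suc n) ` carrier (q (Suc (Suc n)))"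
  using exact unfolding exact_augmented_def One_nat_def by blast+

lemma d_closed: "x \<in> carrier (q (Suc n)) \<Longrightarrow> mdiff Q n x \<in> carrier (q n)"
  by (rule mod_hom_closed[OF d])

lemma d_d: "x \<in> carrier (q (Suc (Suc n))) \<Longrightarrow> mdiff Q n (mdiff Q (Suc n) x) = \<one>\<^bsub>q n\<^esub>"
  using ker_d[of n] by (auto simp: kernel_def)

lemma eps_d: "x \<in> carrier (q (Suc 0)) \<Longrightarrow> maug Q (mdiff Q 0 x) = 0"
  using ker_eps by (auto simp: kernel_def one_trivial)

lemma ex_0: "x \<in> carrier (q 0) \<Longrightarrow> maug Q x = 0 \<Longrightarrow> x \<in> mdiff Q 0 ` carrier (q (Suc 0))"
  unfolding ker_eps[symmetric] by (simp add: kernel_def one_trivial)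

lemma ex: "x \<in> carrier (q (Suc n)) \<Longrightarrow> mdiff Q n x = \<one>\<^bsub>q n\<^esub> \<Longrightarrow> x \<in> mdiff Q (Suc n) ` carrier (q (Suc (Suc n)))"
  unfolding ker_d[symmetric] by (simp add: kernel_def)

text \<open>Restriction of scalars along \<open>ring_shift\<close>. Linear maps into
  \<open>pull n\<close> are maps into \<open>q n\<close> that are semilinear along
  \<open>shift\<close>, so the lifting results for linear maps cover them.\<close>

definition pull :: "nat \<Rightarrow> ((nat \<Rightarrow> nat) \<Rightarrow>\<^sub>0 int, 'c) rmod"
  where "pull n = (q n)\<lparr>act := \<lambda>r. act (q n) (ring_shift r)\<rparr>"

lemma pull_simps [simp]: "carrier (pull n) = carrier (q n)" "monoid.mult (pull n) = monoid.mult (q n)"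
    "one (pull n) = one (q n)" "act (pull n) r = act (q n) (ring_shift r)"
  by (simp_all add: pull_def)

lemma right_module_pull: "right_module R (pull n)"
proof -
  interpret q: right_module R "q n" by (rule qR)
  have "right_module_axioms R (pull n)"
  proof (rule right_module_axioms.intro)
    fix r assume r: "r \<in> carrier R"
    show "act (pull n) r \<in> hom (pull n) (pull n)"
      using q.act_hom[OF ring_shift_closed[OF r]] by (simp add: hom_def)
    fix s x assume s: "s \<in> carrier R" and x: "x \<in> carrier (pull n)"
    show "act (pull n) (r \<oplus>\<^bsub>R\<^esub> s) x = act (pull n) r x \<otimes>\<^bsub>pull n\<^esub> act (pull n) s x"
      using q.act_add[OF ring_shift_closed[OF r] ring_shift_closed[OF s], of x] x
      by (simp add: add_monoid_ring ring_shift_def frag_extend_add)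
    show "act (pull n) (r \<otimes>\<^bsub>R\<^esub> s) x = act (pull n) s (act (pull n) r x)"
      using q.act_mult[OF ring_shift_closed[OF r] ring_shift_closed[OF s], of x] x
      by (simp add: ring_shift_mult r s)
  next
    fix x assume "x \<in> carrier (pull n)"
    then show "act (pull n) \<one>\<^bsub>R\<^esub> x = x"
      using q.act_one[of x] by (simp add: one_monoid_ring shift_one)
  qed
  then show ?thesis
    using comm_group_act_update[OF q_group[of n]] q.ring_axioms by (simp add: right_module_def pull_def)
qed

text \<open>The chain map \<open>q \<mapsto> \<mu>(q) dbl\<close> of \<open>Q\<close> into itself is linear, because \<open>shift f \<circ> dbl = dbl \<circ> f\<close>, and
  lifts the identity, hence is homotopic to the identity.\<close>

lemma doubling:
  obtains \<mu> h where
    "\<And>n. \<mu> n \<in> mod_hom R (q n) (pull n)"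
    "\<And>x. x \<in> carrier (q 0) \<Longrightarrow> maug Q (\<mu> 0 x) = maug Q x"
    "\<And>n x. x \<in> carrier (q (Suc n)) \<Longrightarrow> \<mu> n (mdiff Q n x) = mdiff Q n (\<mu> (Suc n) x)"
    "\<And>n. (\<lambda>x. act (q n) (frag_of dbl) (\<mu> n x)) \<in> mod_hom R (q n) (q n)"
    "\<And>n. h n \<in> mod_hom R (q n) (q (Suc n))"
    "\<And>x. x \<in> carrier (q 0) \<Longrightarrow> x = act (q 0) (frag_of dbl) (\<mu> 0 x) \<otimes>\<^bsub>q 0\<^esub> mdiff Q 0 (h 0 x)"
    "\<And>n x. x \<in> carrier (q (Suc n)) \<Longrightarrow> x = act (q (Suc n)) (frag_of dbl) (\<mu> (Suc n) x) \<otimes>\<^bsub>q (Suc n)\<^esub>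
        (mdiff Q (Suc n) (h (Suc n) x) \<otimes>\<^bsub>q (Suc n)\<^esub> h n (mdiff Q n x))"
proof -
  \<comment> \<open>Only the action changes in \<open>pull\<close>, so its exactness is that of
    \<open>q\<close>. The augmentation stays linear by \<open>act_trivial_shift\<close>.\<close>
  interpret L: proj_over_exact R q "mdiff Q" pull "mdiff Q" zmod "maug Q"
  proof (rule proj_over_exact.intro)
    show "mdiff Q n \<in> mod_hom R (pull (Suc n)) (pull n)" for n
      using d[of n] ring_shift_closed by (simp add: mod_hom_def hom_def)
    show "maug Q \<in> mod_hom R (pull 0) zmod"
      using eps ring_shift_closed by (simp add: mod_hom_def hom_def act_trivial_shift)
  qed (simp_all add: proj right_module_pull triv d d_d ex_0 ex one_trivial)
  obtain l where l: "\<And>n. l n \<in> mod_hom R (q n) (pull n)" "\<And>x. x \<in> carrier (q 0) \<Longrightarrow> maug Q (l 0 x) = maug Q x"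
    "\<And>n x. x \<in> carrier (q (Suc n)) \<Longrightarrow> l n (mdiff Q n x) = mdiff Q n (l (Suc n) x)"
  proof (rule L.chain_lift[OF eps])
    show "maug Q x \<in> maug Q ` carrier (pull 0)" if "x \<in> carrier (q 0)" for x using that by simp
    show "maug Q (mdiff Q 0 x) = \<one>\<^bsub>zmod\<^esub>" if "x \<in> carrier (q (Suc 0))" for x
      using eps_d[OF that] by (simp add: one_trivial)
  qed (assumption | rule that)+
  have lc: "l n x \<in> carrier (q n)" if "x \<in> carrier (q n)" for n x
    using mod_hom_closed[OF l(1) that] by simp
  note fd = frag_of_monoid_ring[OF dbl_closed]
  let ?t = "\<lambda>n x. act (q n) (frag_of dbl) (l n x)"
  have t: "?t n \<in> mod_hom R (q n) (q n)" for n
  proof -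
    interpret q: right_module R "q n" by (rule qR)
    have "?t n \<in> hom (q n) (q n)"
      by (rule homI) (simp_all add: lc right_act_closed[OF qR fd] hom_mult[OF mod_hom_hom[OF l(1)]] hom_mult[OF q.act_hom[OF fd]])
    \<comment> \<open>Both sides are \<open>l n x\<close> acted on by one ring element, the product
      of \<open>ring_shift r\<close> and \<open>dbl\<close> on the left and of \<open>dbl\<close>
      and \<open>r\<close> on the right; these agree by \<open>ring_shift_dbl\<close>.\<close>
    moreover have "?t n (act (q n) r x) = act (q n) r (?t n x)" if r: "r \<in> carrier R" and x: "x \<in> carrier (q n)" for r x
      using q.act_mult[OF ring_shift_closed[OF r] fd lc[OF x]] q.act_mult[OF fd r lc[OF x]]
      by (simp add: mod_hom_act[OF l(1)] r x ring_shift_dbl)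
    ultimately show ?thesis by (simp add: mod_hom_def)
  qed
  have tc: "?t n x \<in> carrier (q n)" if "x \<in> carrier (q n)" for n x by (rule mod_hom_closed[OF t that])
  interpret H: proj_over_exact R q "mdiff Q" q "mdiff Q" zmod "maug Q"
    by (rule proj_over_exact.intro) (simp_all add: proj qR triv d eps d_d ex_0 ex one_trivial)
  \<comment> \<open>The quotient of the identity by the doubling map is trivial under the
    augmentation: monoid elements preserve \<open>maug Q\<close>, and \<open>l\<close> covers the
    identity of the trivial module. Hence it is null-homotopic.\<close>
  obtain h where h: "\<And>n. h n \<in> mod_hom R (q n) (q (Suc n))"
    "\<And>x. x \<in> carrier (q 0) \<Longrightarrow> mdiff Q 0 (h 0 x) = x \<otimes>\<^bsub>q 0\<^esub> inv\<^bsub>q 0\<^esub> (?t 0 x)"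
    "\<And>n x. x \<in> carrier (q (Suc n)) \<Longrightarrow> x \<otimes>\<^bsub>q (Suc n)\<^esub> inv\<^bsub>q (Suc n)\<^esub> (?t (Suc n) x) =
      mdiff Q (Suc n) (h (Suc n) x) \<otimes>\<^bsub>q (Suc n)\<^esub> h n (mdiff Q n x)"
  proof (rule H.null_homotopy[where f = "\<lambda>n x. x \<otimes>\<^bsub>q n\<^esub> inv\<^bsub>q n\<^esub> (?t n x)"])
    show "(\<lambda>x. x \<otimes>\<^bsub>q n\<^esub> inv\<^bsub>q n\<^esub> (?t n x)) \<in> mod_hom R (q n) (q n)" for n
      by (rule mod_hom_div[OF qR qR mod_hom_id t])
    show "mdiff Q n x \<otimes>\<^bsub>q n\<^esub> inv\<^bsub>q n\<^esub> (?t n (mdiff Q n x)) = mdiff Q n (x \<otimes>\<^bsub>q (Suc n)\<^esub> inv\<^bsub>q (Suc n)\<^esub> (?t (Suc n) x))"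
      if x: "x \<in> carrier (q (Suc n))" for n x
      by (simp add: hom_div[OF mod_hom_hom[OF d] q_group q_group x tc[OF x]] l(3)[OF x] mod_hom_act[OF d fd lc[OF x]])
    show "maug Q (x \<otimes>\<^bsub>q 0\<^esub> inv\<^bsub>q 0\<^esub> (?t 0 x)) = \<one>\<^bsub>zmod\<^esub>" if x: "x \<in> carrier (q 0)" for x
      by (simp add: hom_div[OF eps_hom q_group abelian_integer_group x tc[OF x]] eps_act[OF dbl_closed lc[OF x]] l(2)[OF x] one_trivial)
  qed blast
  have split: "x = a \<otimes>\<^bsub>q n\<^esub> b" if "x \<otimes>\<^bsub>q n\<^esub> inv\<^bsub>q n\<^esub> a = b" "x \<in> carrier (q n)" "a \<in> carrier (q n)" for n x a b
  proof -
    interpret q: comm_group "q n" by (rule q_group)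
    show ?thesis using that(2,3) q.m_lcomm[of a x "inv\<^bsub>q n\<^esub> a"] by (simp add: that(1)[symmetric])
  qed
  show ?thesis
    by (rule that[OF l t h(1)])
      (use split[OF h(2)[symmetric]] split[OF h(3)] tc in blast)+
qed

end

section \<open>Exactness of the columns\<close>

lemma (in I_functor) left_module_colimN: "left_module (monoid_ring inj_monoid) (colim_N_module F)"
  unfolding colim_N_module_def
  by (rule left_module_linearize[OF monoid_inj_monoid N.comm_group_colim])
    (simp_all add: inj_action_hom inj_action_mult inj_action_one)

lemma carrier_colim_N_module [simp]: "carrier (colim_N_module F) = carrier (colim cat_N F)"
  and mult_colim_N_module [simp]: "monoid.mult (colim_N_module F) = monoid.mult (colim cat_N F)"
  and one_colim_N_module [simp]: "one (colim_N_module F) = one (colim cat_N F)"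
  by (simp_all add: colim_N_module_def)

lemma (in I_functor) act_frag_colimN:
  "f \<in> carrier inj_monoid \<Longrightarrow> z \<in> carrier colimN \<Longrightarrow> act (colim_N_module F) (frag_of f) z = inj_action F f z"
  unfolding colim_N_module_def act_linearize
  by (rule comm_group.lin_frag_of[OF N.comm_group_colim]) (rule hom_in_carrier[OF inj_action_hom])

context comm_group
begin

lemma lin_one: "lin G (\<lambda>_. \<one>) c = \<one>"
  unfolding lin_def by (rule finprod_one_eqI) simp

text \<open>Exchange of two finite sums; in \<open>reconstruct\<close> it moves the sum over labels
  inside the sum over the terms of a section value.\<close>

lemma finprod_lin:
  assumes "finite S" "\<And>l k. l \<in> S \<Longrightarrow> k \<in> Poly_Mapping.keys c \<Longrightarrow> \<phi> l k \<in> carrier G"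
  shows "finprod G (\<lambda>l. lin G (\<phi> l) c) S = lin G (\<lambda>k. finprod G (\<lambda>l. \<phi> l k) S) c"
  using assms
proof (induction S rule: finite_induct)
  case (insert a S)
  have "finprod G (\<lambda>l. lin G (\<phi> l) c) (insert a S) = lin G (\<phi> a) c \<otimes> lin G (\<lambda>k. finprod G (\<lambda>l. \<phi> l k) S) c"
    using insert by (subst finprod_insert) (auto intro!: lin_closed)
  also have "\<dots> = lin G (\<lambda>k. \<phi> a k \<otimes> finprod G (\<lambda>l. \<phi> l k) S) c"
    by (rule lin_mult[symmetric]) (use insert.prems in \<open>auto intro!: finprod_closed\<close>)
  also have "\<dots> = lin G (\<lambda>k. finprod G (\<lambda>l. \<phi> l k) (insert a S)) c"
    by (rule lin_cong) (use insert in \<open>auto intro!: finprod_closed simp: finprod_insert Pi_iff\<close>)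
  finally show ?case .
qed (simp add: lin_one)

end

section \<open>A single column: the resolution tensored with the colimit of one functor\<close>

locale resolution_functor = trivial_resolution Q + I_functor P
  for Q :: "((nat \<Rightarrow> nat) \<Rightarrow>\<^sub>0 int, 'c, int) mod_res" and P :: "(nat, arrow, 'b) abfun"
begin

abbreviation N :: "((nat \<Rightarrow> nat) \<Rightarrow>\<^sub>0 int, (nat \<Rightarrow> 'b) set) rmod"
  where "N \<equiv> colim_N_module P"

abbreviation T :: "nat \<Rightarrow> ('c \<times> (nat \<Rightarrow> 'b) set \<Rightarrow>\<^sub>0 int) set monoid"
  where "T s \<equiv> tensor R (q s) N"

lemma tp: "tensor_product R (q s) N"
  by (intro tensor_product.intro qR left_module_colimN)

abbreviation ten :: "nat \<Rightarrow> 'c \<Rightarrow> (nat \<Rightarrow> 'b) set \<Rightarrow> ('c \<times> (nat \<Rightarrow> 'b) set \<Rightarrow>\<^sub>0 int) set"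
  where "ten s \<equiv> tensor_product.tens R (q s) N"

lemma T_group: "comm_group (T s)"
  by (rule tensor_product.comm_group_tensor[OF tp])

text \<open>Every element of the second factor is a single class by \<open>colimN_rep\<close>, so
  only tensors with classes occur as generators.\<close>

lemma T_induct [consumes 1, case_names ten mult]:
  assumes z: "z \<in> carrier (T s)"
    and ten: "\<And>a n y. a \<in> carrier (q s) \<Longrightarrow> y \<in> carrier (fob P n) \<Longrightarrow> \<Phi> (ten s a (cls n y))"
    and mult: "\<And>u v. u \<in> carrier (T s) \<Longrightarrow> v \<in> carrier (T s) \<Longrightarrow> \<Phi> u \<Longrightarrow> \<Phi> v \<Longrightarrow> \<Phi> (u \<otimes>\<^bsub>T s\<^esub> v)"
  shows "\<Phi> z"
  using z
proof (induction rule: tensor_product.tensor_induct[OF tp, consumes 1, case_names ten mult])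
  case (ten a v)
  have v: "v \<in> carrier colimN" using ten(2) by simp
  obtain n y where "y \<in> carrier (fob P n)" "v = cls n y" by (rule colimN_rep[OF v])
  then show ?case using assms(2)[OF ten(1)] by simp
qed (rule mult)

lemma T_hom_eq:
  assumes h: "h \<in> hom (T s) H" and k: "k \<in> hom (T s) H"
    and eq: "\<And>a n y. a \<in> carrier (q s) \<Longrightarrow> y \<in> carrier (fob P n) \<Longrightarrow> h (ten s a (cls n y)) = k (ten s a (cls n y))"
    and z: "z \<in> carrier (T s)"
  shows "h z = k z"
  using z by (induction rule: T_induct) (simp_all add: eq hom_mult[OF h] hom_mult[OF k])

lemma cls_N: "y \<in> carrier (fob P n) \<Longrightarrow> cls n y \<in> carrier N"
  using cls_closed by simp

lemma ten_closed: "a \<in> carrier (q s) \<Longrightarrow> y \<in> carrier (fob P n) \<Longrightarrow> ten s a (cls n y) \<in> carrier (T s)"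
  by (rule tensor_product.tens_closed[OF tp _ cls_N])

lemma ten_one: "y \<in> carrier (fob P n) \<Longrightarrow> ten s \<one>\<^bsub>q s\<^esub> (cls n y) = \<one>\<^bsub>T s\<^esub>"
  by (rule hom_one_comm[OF tensor_product.tens_hom_left[OF tp cls_N] q_group T_group])

end

text \<open>For the columns, projectivity of \<open>P\<close> amounts to a natural section of the
  evaluation from the free functor. It expresses \<open>y\<close> functorially as a combination of
  elements P(g)(x).\<close>

locale column = resolution_functor Q P
  for Q :: "((nat \<Rightarrow> nat) \<Rightarrow>\<^sub>0 int, 'c, int) mod_res" and P :: "(nat, arrow, 'b) abfun" +
  fixes \<sigma> :: "nat \<Rightarrow> 'b \<Rightarrow> (arrow \<times> 'b) \<Rightarrow>\<^sub>0 int"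
  assumes \<sigma>_nat: "nat_trans cat_I P (free_functor cat_I P) \<sigma>"
    and \<sigma>_sec: "\<And>n y. y \<in> carrier (fob P n) \<Longrightarrow> I.free_eval n (\<sigma> n y) = y"
begin

lemma \<sigma>_hom: "\<sigma> n \<in> hom (fob P n) (free_Abelian_group (free_gens cat_I P n))"
  using \<sigma>_nat by (simp add: nat_trans_def fob_free_functor cat_I_simps)

lemma \<sigma>_keys: "y \<in> carrier (fob P n) \<Longrightarrow> Poly_Mapping.keys (\<sigma> n y) \<subseteq> free_gens cat_I P n"
  using hom_in_carrier[OF \<sigma>_hom] by simp

text \<open>\<open>\<sigma>\<close> is natural, and arrows act on the generators of the free functor
  by postcomposition.\<close>

lemma lin_\<sigma>_far:
  assumes H: "comm_group H" and u: "u \<in> Ar cat_I" and y: "y \<in> carrier (fob P (src cat_I u))"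
    and \<phi>: "\<And>k. k \<in> free_gens cat_I P (tgt cat_I u) \<Longrightarrow> \<phi> k \<in> carrier H"
  shows "lin H \<phi> (\<sigma> (tgt cat_I u) (far P u y)) = lin H (\<lambda>(g, x). \<phi> (cmp cat_I u g, x)) (\<sigma> (src cat_I u) y)"
proof -
  interpret H: comm_group H by fact
  have cm: "(case k of (g, x) \<Rightarrow> (cmp cat_I u g, x)) \<in> free_gens cat_I P (tgt cat_I u)"
    if "k \<in> Poly_Mapping.keys (\<sigma> (src cat_I u) y)" for k
    using I.free_gens_cmp[OF u] \<sigma>_keys[OF y] that by blast
  have "\<sigma> (tgt cat_I u) (far P u y) = frag_extend (\<lambda>(g, x). frag_of (cmp cat_I u g, x)) (\<sigma> (src cat_I u) y)"
    using \<sigma>_nat u y by (simp add: nat_trans_def far_free_functor)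
  then have "lin H \<phi> (\<sigma> (tgt cat_I u) (far P u y)) =
      lin H (\<lambda>k. lin H \<phi> (case k of (g, x) \<Rightarrow> frag_of (cmp cat_I u g, x))) (\<sigma> (src cat_I u) y)"
    by (simp only:) (rule H.lin_frag_extend[where T = "free_gens cat_I P (tgt cat_I u)"],
      use cm \<phi> in \<open>auto split: prod.splits\<close>)
  also have "\<dots> = lin H (\<lambda>(g, x). \<phi> (cmp cat_I u g, x)) (\<sigma> (src cat_I u) y)"
  proof (rule H.lin_cong)
    fix k assume k: "k \<in> Poly_Mapping.keys (\<sigma> (src cat_I u) y)"
    obtain g x where gx: "k = (g, x)" by (rule prod.exhaust)
    have "\<phi> (cmp cat_I u g, x) \<in> carrier H" using \<phi>[OF cm[OF k]] by (simp add: gx)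
    then show "lin H \<phi> (case k of (g, x) \<Rightarrow> frag_of (cmp cat_I u g, x)) = (case k of (g, x) \<Rightarrow> \<phi> (cmp cat_I u g, x))"
      "lin H \<phi> (case k of (g, x) \<Rightarrow> frag_of (cmp cat_I u g, x)) \<in> carrier H"
      by (simp_all add: gx)
  qed
  finally show ?thesis .
qed

lemma lin_\<sigma>_hom:
  assumes "comm_group H" "\<And>k. k \<in> free_gens cat_I P n \<Longrightarrow> \<phi> k \<in> carrier H"
  shows "(\<lambda>y. lin H \<phi> (\<sigma> n y)) \<in> hom (fob P n) H"
  using hom_compose[OF \<sigma>_hom comm_group.lin_hom[OF assms]] by (simp add: comp_def)

text \<open>Postcomposition leaves the source of \<open>g\<close> and the element x alone. The label
  (source of g, x) of a generator is thus constant along all arrows of I, so terms can be sorted by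
  label.\<close>

lemma far_cmp_gens:
  assumes "k \<in> free_gens cat_I P (src cat_I u)" "u \<in> Ar cat_I"
  obtains g x where "k = (g, x)" "g \<in> Ar cat_I" "tgt cat_I g = src cat_I u" "x \<in> carrier (fob P (src cat_I g))"
    "src cat_I (cmp cat_I u g) = src cat_I g" "(cmp cat_I u g, x) \<in> free_gens cat_I P (tgt cat_I u)"
  using assms I.cmp_Ar by (auto simp: free_gens_def)

text \<open>The component at \<open>(k, x)\<close>, for \<open>x \<in> P(k)\<close>, of the map \<open>z \<otimes> [y] \<mapsto> \<Sum> m \<mu>(z) spread(g)\<close> into the
  direct sum of copies of \<open>Q\<^sub>s\<close>, where the sum is over the terms \<open>m (g, x)\<close> of \<open>\<sigma>(y)\<close>.\<close>

definition weight :: "nat \<Rightarrow> ('c \<Rightarrow> 'c) \<Rightarrow> nat \<times> 'b \<Rightarrow> 'c \<Rightarrow> arrow \<times> 'b \<Rightarrow> 'c"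
  where "weight s \<mu> l z = (\<lambda>(g, x). if (src cat_I g, x) = l then act (q s) (frag_of (spread g)) (\<mu> z) else \<one>\<^bsub>q s\<^esub>)"

lemma weight_closed:
  assumes "\<mu> \<in> mod_hom R (q s) (pull s)" "z \<in> carrier (q s)" "k \<in> free_gens cat_I P n"
  shows "weight s \<mu> l z k \<in> carrier (q s)"
proof -
  interpret q: comm_group "q s" by (rule q_group)
  have "\<mu> z \<in> carrier (q s)" using mod_hom_closed[OF assms(1,2)] by simp
  then show ?thesis
    using assms(3) by (auto simp: weight_def free_gens_def intro!: right_act_closed[OF qR] frag_of_monoid_ring spread_closed)
qed

text \<open>Three points make the formula well defined on the tensor product: independence of the
  stage by \<open>spread_inc\<close>, additivity in \<open>z\<close>, and balancedness over M by
  \<open>shift_spread\<close> and the semilinearity of \<open>\<mu>\<close>.\<close>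

lemma coord:
  assumes \<mu>: "\<mu> \<in> mod_hom R (q s) (pull s)"
  obtains \<Phi> where "\<And>l. \<Phi> l \<in> hom (T s) (q s)"
    "\<And>l z n y. z \<in> carrier (q s) \<Longrightarrow> y \<in> carrier (fob P n) \<Longrightarrow>
      \<Phi> l (ten s z (cls n y)) = lin (q s) (weight s \<mu> l z) (\<sigma> n y)"
proof -
  interpret TP: tensor_product R "q s" N by (rule tp)
  interpret q: right_module R "q s" by (rule qR)
  note wc = weight_closed[OF \<mu>]
  have wck: "weight s \<mu> l z k \<in> carrier (q s)" if "z \<in> carrier (q s)" "y \<in> carrier (fob P n)" "k \<in> Poly_Mapping.keys (\<sigma> n y)" for l z n y k
    using wc[OF that(1)] \<sigma>_keys[OF that(2)] that(3) by blast
  have \<mu>c: "\<mu> z \<in> carrier (q s)" if "z \<in> carrier (q s)" for z using mod_hom_closed[OF \<mu> that] by simp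
  have "\<exists>\<psi>. \<psi> \<in> hom colimN (q s) \<and> (\<forall>n. \<forall>y\<in>carrier (fob P n). \<psi> (cls n y) = lin (q s) (weight s \<mu> l z) (\<sigma> n y))"
    if z: "z \<in> carrier (q s)" for l z
  proof -
    have k: "(\<lambda>y. lin (q s) (weight s \<mu> l z) (\<sigma> n y)) \<in> hom (fob P n) (q s)" for n
      by (rule lin_\<sigma>_hom[OF q_group wc[OF z]])
    \<comment> \<open>By naturality of \<open>\<sigma>\<close>, moving \<open>y\<close> up replaces
      each \<open>g\<close> by its composite with an inclusion, which changes neither its label nor
      its \<open>spread\<close>.\<close>
    have cocone: "lin (q s) (weight s \<mu> l z) (\<sigma> n (far P (inc m n) y)) = lin (q s) (weight s \<mu> l z) (\<sigma> m y)"
      if mn: "m \<le> n" and y: "y \<in> carrier (fob P m)" for m n y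
    proof -
      have "lin (q s) (weight s \<mu> l z) (\<sigma> n (far P (inc m n) y)) =
          lin (q s) (\<lambda>(g, x). weight s \<mu> l z (cmp cat_I (inc m n) g, x)) (\<sigma> m y)"
        using lin_\<sigma>_far[OF q_group inc_Ar_I[OF mn], of y "weight s \<mu> l z"] y wc[OF z] by simp
      also have "\<dots> = lin (q s) (weight s \<mu> l z) (\<sigma> m y)"
      proof (rule q.lin_cong)
        fix k assume k: "k \<in> Poly_Mapping.keys (\<sigma> m y)"
        then have "k \<in> free_gens cat_I P (src cat_I (inc m n))" using \<sigma>_keys[OF y] by auto
        then obtain g x where g: "k = (g, x)" "g \<in> Ar cat_I" "tgt cat_I g = m"
          "src cat_I (cmp cat_I (inc m n) g) = src cat_I g"
          by (rule far_cmp_gens[OF _ inc_Ar_I[OF mn]]) simp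
        show e: "(case k of (g, x) \<Rightarrow> weight s \<mu> l z (cmp cat_I (inc m n) g, x)) = weight s \<mu> l z k"
          using g spread_inc[OF g(2), of n] by (simp add: weight_def)
        show "(case k of (g, x) \<Rightarrow> weight s \<mu> l z (cmp cat_I (inc m n) g, x)) \<in> carrier (q s)"
          unfolding e by (rule wck[OF z y k])
      qed
      finally show ?thesis .
    qed
    obtain \<psi> where "\<psi> \<in> hom colimN (q s)"
      "\<And>n y. y \<in> carrier (fob P n) \<Longrightarrow> \<psi> (cls n y) = lin (q s) (weight s \<mu> l z) (\<sigma> n y)"
      by (rule colimN_universal[where k = "\<lambda>n y. lin (q s) (weight s \<mu> l z) (\<sigma> n y)", OF q_group k cocone])
        (assumption | rule that)+
    then show ?thesis by blast
  qed
  then have "\<forall>l z. \<exists>\<psi>. z \<in> carrier (q s) \<longrightarrow> \<psi> \<in> hom colimN (q s) \<and>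
     (\<forall>n. \<forall>y\<in>carrier (fob P n). \<psi> (cls n y) = lin (q s) (weight s \<mu> l z) (\<sigma> n y))" by blast
  then obtain \<beta> where \<beta>0: "\<forall>l z. z \<in> carrier (q s) \<longrightarrow> \<beta> l z \<in> hom colimN (q s) \<and>
     (\<forall>n. \<forall>y\<in>carrier (fob P n). \<beta> l z (cls n y) = lin (q s) (weight s \<mu> l z) (\<sigma> n y))" by metis
  have \<beta>h: "\<beta> l z \<in> hom colimN (q s)" if "z \<in> carrier (q s)" for l z
    by (rule conjunct1[OF mp[OF spec[OF spec[OF \<beta>0]] that]])
  have \<beta>: "\<beta> l z (cls n y) = lin (q s) (weight s \<mu> l z) (\<sigma> n y)"
    if "z \<in> carrier (q s)" "y \<in> carrier (fob P n)" for l z n y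
    by (rule bspec[OF spec[OF conjunct2[OF mp[OF spec[OF spec[OF \<beta>0]] that(1)]]] that(2)])
  have \<beta>l: "\<beta> l (z \<otimes>\<^bsub>q s\<^esub> z') v = \<beta> l z v \<otimes>\<^bsub>q s\<^esub> \<beta> l z' v"
    if z: "z \<in> carrier (q s)" "z' \<in> carrier (q s)" and v: "v \<in> carrier colimN" for l z z' v
  proof -
    obtain n y where y: "y \<in> carrier (fob P n)" "v = cls n y" by (rule colimN_rep[OF v])
    have "\<beta> l (z \<otimes>\<^bsub>q s\<^esub> z') v = lin (q s) (\<lambda>k. weight s \<mu> l z k \<otimes>\<^bsub>q s\<^esub> weight s \<mu> l z' k) (\<sigma> n y)"
      unfolding y(2) \<beta>[OF q.m_closed[OF z] y(1)]
    proof (rule q.lin_cong)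
      fix k assume k: "k \<in> Poly_Mapping.keys (\<sigma> n y)"
      show "weight s \<mu> l (z \<otimes>\<^bsub>q s\<^esub> z') k \<in> carrier (q s)" by (rule wck[OF q.m_closed[OF z] y(1) k])
      have "fst k \<in> Ar cat_I" using \<sigma>_keys[OF y(1)] k by (auto simp: free_gens_def)
      from hom_mult[OF q.act_hom[OF frag_of_monoid_ring[OF spread_closed[OF this]]]]
      show "weight s \<mu> l (z \<otimes>\<^bsub>q s\<^esub> z') k = weight s \<mu> l z k \<otimes>\<^bsub>q s\<^esub> weight s \<mu> l z' k"
        using z hom_mult[OF mod_hom_hom[OF \<mu>] z] by (auto simp: weight_def \<mu>c split: prod.splits)
    qed
    also have "\<dots> = \<beta> l z v \<otimes>\<^bsub>q s\<^esub> \<beta> l z' v"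
      unfolding y(2) \<beta>[OF z(1) y(1)] \<beta>[OF z(2) y(1)] by (rule q.lin_mult) (intro wck[OF _ y(1)] z, assumption)+
    finally show ?thesis .
  qed
  \<comment> \<open>Moving \<open>f\<close> to the right replaces \<open>g\<close> by its composite
    with \<open>f\<close>; moving it to the left replaces \<open>\<mu> z\<close> by its translate
    under \<open>shift f\<close>. \<open>shift_spread\<close> identifies the two.\<close>
  have bal: "\<beta> l (act (q s) (frag_of f) z) v = \<beta> l z (inj_action P f v)"
    if f: "f \<in> carrier inj_monoid" and z: "z \<in> carrier (q s)" and v: "v \<in> carrier colimN" for l f z v
  proof -
    obtain n y where y: "y \<in> carrier (fob P n)" "v = cls n y" by (rule colimN_rep[OF v])
    define m where "m = max_image f n"
    have m: "max_image f n \<le> m" by (simp add: m_def)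
    note u = rst_Ar[OF f m]
    have fR: "frag_of f \<in> carrier R" by (rule frag_of_monoid_ring[OF f])
    have fz: "act (q s) (frag_of f) z \<in> carrier (q s)" by (rule right_act_closed[OF qR fR z])
    have \<mu>f: "\<mu> (act (q s) (frag_of f) z) = act (q s) (frag_of (shift f)) (\<mu> z)"
      using mod_hom_act[OF \<mu> fR z] by simp
    have "\<beta> l z (inj_action P f v) = lin (q s) (weight s \<mu> l z) (\<sigma> m (far P (rst f n m) y))"
      unfolding y(2) inj_action_cls[OF f y(1) m] by (rule \<beta>[OF z rst_closed[OF f m y(1)]])
    also have "\<dots> = lin (q s) (\<lambda>(g, x). weight s \<mu> l z (cmp cat_I (rst f n m) g, x)) (\<sigma> n y)"
      using lin_\<sigma>_far[OF q_group u, of y "weight s \<mu> l z"] y wc[OF z] by simp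
    also have "\<dots> = lin (q s) (weight s \<mu> l (act (q s) (frag_of f) z)) (\<sigma> n y)"
    proof (rule q.lin_cong)
      fix k assume k: "k \<in> Poly_Mapping.keys (\<sigma> n y)"
      then have "k \<in> free_gens cat_I P (src cat_I (rst f n m))" using \<sigma>_keys[OF y(1)] by auto
      then obtain g x where g: "k = (g, x)" "g \<in> Ar cat_I" "tgt cat_I g = n"
        "src cat_I (cmp cat_I (rst f n m) g) = src cat_I g"
        by (rule far_cmp_gens[OF _ u]) simp
      have "spread (cmp cat_I (rst f n m) g) = shift f \<otimes>\<^bsub>inj_monoid\<^esub> spread g"
        using shift_spread[OF f g(2), of m] m g(3) by simp
      then have "act (q s) (frag_of (spread (cmp cat_I (rst f n m) g))) (\<mu> z) =
          act (q s) (frag_of (spread g)) (\<mu> (act (q s) (frag_of f) z))"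
        using q.act_mult[OF frag_of_monoid_ring[OF shift_closed[OF f]] frag_of_monoid_ring[OF spread_closed[OF g(2)]] \<mu>c[OF z]]
        by (simp add: frag_mult \<mu>f)
      then show e: "(case k of (g, x) \<Rightarrow> weight s \<mu> l z (cmp cat_I (rst f n m) g, x)) = weight s \<mu> l (act (q s) (frag_of f) z) k"
        using g by (simp add: weight_def)
      show "(case k of (g, x) \<Rightarrow> weight s \<mu> l z (cmp cat_I (rst f n m) g, x)) \<in> carrier (q s)"
        unfolding e by (rule wck[OF fz y(1) k])
    qed
    also have "\<dots> = \<beta> l (act (q s) (frag_of f) z) v" unfolding y(2) by (rule \<beta>[OF fz y(1), symmetric])
    finally show ?thesis by simp
  qed
  have \<beta>c: "\<beta> l z v \<in> carrier (q s)" if "z \<in> carrier (q s)" "v \<in> carrier colimN" for l z v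
    by (rule hom_in_carrier[OF \<beta>h[OF that(1)] that(2)])
  have \<beta>lh: "(\<lambda>z. \<beta> l z v) \<in> hom (q s) (q s)" if "v \<in> carrier colimN" for l v
    by (rule homI) (simp_all add: that \<beta>c \<beta>l)
  have ac: "inj_action P f v \<in> carrier colimN" if "f \<in> carrier inj_monoid" "v \<in> carrier colimN" for f v
    by (rule hom_in_carrier[OF inj_action_hom[OF that(1)] that(2)])
  have bal': "\<beta> l (act (q s) r z) v = \<beta> l z (act N r v)" if "r \<in> carrier R" "z \<in> carrier (q s)" "v \<in> carrier colimN" for l r z v
    unfolding colim_N_module_def
    by (rule monoid_balanced[OF qR N.comm_group_colim q_group ac \<beta>lh \<beta>h bal that])
  have "\<exists>h. h \<in> hom (T s) (q s) \<and> (\<forall>z\<in>carrier (q s). \<forall>v\<in>carrier colimN. h (ten s z v) = \<beta> l z v)" for l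
  proof -
    obtain h where "h \<in> hom (T s) (q s)" "\<And>z v. z \<in> carrier (q s) \<Longrightarrow> v \<in> carrier N \<Longrightarrow> h (ten s z v) = \<beta> l z v"
      by (rule TP.tensor_universal[where \<beta> = "\<beta> l", OF q_group[of s]])
        (assumption | rule that | simp add: \<beta>c \<beta>l hom_mult[OF \<beta>h] bal')+
    then show ?thesis by (intro exI[of _ h]) simp
  qed
  then obtain \<Phi> where "\<And>l. \<Phi> l \<in> hom (T s) (q s) \<and> (\<forall>z\<in>carrier (q s). \<forall>v\<in>carrier colimN. \<Phi> l (ten s z v) = \<beta> l z v)"
    by metis
  then show ?thesis using that[of \<Phi>] \<beta> cls_closed by simp
qed

text \<open>In z \<otimes> [y] the factor \<open>dbl\<close> moves across the tensor sign and acts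
  on [y], the combination of the P(g)(x). There it becomes \<open>spread g\<close> acting on [x],
  which moves back to \<open>\<mu> z\<close>. Collecting the terms by label gives the
  coordinates.\<close>

lemma reconstruct:
  assumes \<mu>: "\<mu> \<in> mod_hom R (q s) (pull s)"
    and t: "(\<lambda>x. act (q s) (frag_of dbl) (\<mu> x)) \<in> mod_hom R (q s) (q s)"
    and \<Phi>: "\<And>l. \<Phi> l \<in> hom (T s) (q s)"
      "\<And>l z n y. z \<in> carrier (q s) \<Longrightarrow> y \<in> carrier (fob P n) \<Longrightarrow>
        \<Phi> l (ten s z (cls n y)) = lin (q s) (weight s \<mu> l z) (\<sigma> n y)"
    and \<zeta>: "\<zeta> \<in> carrier (T s)"
  shows "\<exists>S. finite S \<and> (\<forall>(k, x)\<in>S. x \<in> carrier (fob P k)) \<and>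
    tensor_map R (q s) N (\<lambda>x. act (q s) (frag_of dbl) (\<mu> x)) (\<lambda>x. x) \<zeta> =
    finprod (T s) (\<lambda>l. ten s (\<Phi> l \<zeta>) (cls (fst l) (snd l))) S"
proof -
  interpret TP: tensor_product R "q s" N by (rule tp)
  interpret TT: comm_group "T s" by (rule TP.comm_group_tensor)
  interpret q: right_module R "q s" by (rule qR)
  let ?\<tau> = "tensor_map R (q s) N (\<lambda>x. act (q s) (frag_of dbl) (\<mu> x)) (\<lambda>x. x)"
  note tm = tensor_map_hom[OF tp tp t mod_hom_id] tensor_map_tens[OF tp tp t mod_hom_id]
  have \<mu>c: "\<mu> z \<in> carrier (q s)" if "z \<in> carrier (q s)" for z using mod_hom_closed[OF \<mu> that] by simp
  have \<Phi>c: "\<Phi> l \<zeta> \<in> carrier (q s)" if "\<zeta> \<in> carrier (T s)" for l \<zeta> by (rule hom_in_carrier[OF \<Phi>(1) that])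
  define L where "L = {(k, x). x \<in> carrier (fob P k)}"
  have L: "cls (fst l) (snd l) \<in> carrier N" if "l \<in> L" for l
    using that cls_closed by (auto simp: L_def)
  \<comment> \<open>As the formula is asserted for all larger finite label sets inside
    \<open>L\<close>, the sets of two factors may be merged.\<close>
  let ?good = "\<lambda>\<zeta> S. S \<subseteq> L \<and> finite S \<and> (\<forall>S'. S \<subseteq> S' \<and> S' \<subseteq> L \<and> finite S' \<longrightarrow>
      ?\<tau> \<zeta> = finprod (T s) (\<lambda>l. ten s (\<Phi> l \<zeta>) (cls (fst l) (snd l))) S')"
  have "\<exists>S. ?good \<zeta> S"
    using \<zeta>
  proof (induction rule: TP.tensor_induct)
    case (tens z v)
    have v: "v \<in> carrier colimN" using tens(2) by simp
    obtain n y where y: "y \<in> carrier (fob P n)" "v = cls n y" by (rule colimN_rep[OF v])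
    let ?c = "\<sigma> n y"
    \<comment> \<open>The labels of the terms of \<open>\<sigma> n y\<close>. Several terms may
      share a label; they differ in the arrow \<open>g\<close> and are added up in one
      coordinate.\<close>
    let ?S = "(\<lambda>(g, x). (src cat_I g, x)) ` Poly_Mapping.keys ?c"
    have key: "g \<in> Ar cat_I" "tgt cat_I g = n" "x \<in> carrier (fob P (src cat_I g))" if "(g, x) \<in> Poly_Mapping.keys ?c" for g x
      using \<sigma>_keys[OF y(1)] that by (auto simp: free_gens_def)
    have wc: "weight s \<mu> l z k \<in> carrier (q s)" if "k \<in> Poly_Mapping.keys ?c" for l k
      using weight_closed[OF \<mu> tens(1)] \<sigma>_keys[OF y(1)] that by blast
    have yN: "cls n y' \<in> carrier N" if "y' \<in> carrier (fob P n)" for y' using cls_closed[OF that] by simp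
    have "?\<tau> (ten s z v) = finprod (T s) (\<lambda>l. ten s (\<Phi> l (ten s z v)) (cls (fst l) (snd l))) S'"
      if S': "?S \<subseteq> S'" "S' \<subseteq> L" "finite S'" for S'
    proof -
      have Lc: "cls (fst l) (snd l) \<in> carrier N" if "l \<in> S'" for l using L that S'(2) by blast
      have wt: "ten s (weight s \<mu> l z k) (cls (fst l) (snd l)) \<in> carrier (T s)"
        if "l \<in> S'" "k \<in> Poly_Mapping.keys ?c" for l k
        by (rule TP.tens_closed[OF wc[OF that(2)] Lc[OF that(1)]])
      have dc: "inj_action P dbl w \<in> carrier N" if "w \<in> carrier colimN" for w
        using hom_in_carrier[OF inj_action_hom[OF dbl_closed] that] by simp
      have "finprod (T s) (\<lambda>l. ten s (\<Phi> l (ten s z v)) (cls (fst l) (snd l))) S' =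
          finprod (T s) (\<lambda>l. lin (T s) (\<lambda>k. ten s (weight s \<mu> l z k) (cls (fst l) (snd l))) ?c) S'"
      proof (rule TT.finprod_cong'[OF refl])
        show "(\<lambda>l. lin (T s) (\<lambda>k. ten s (weight s \<mu> l z k) (cls (fst l) (snd l))) ?c) \<in> S' \<rightarrow> carrier (T s)"
          by (intro funcsetI TT.lin_closed wt)
        show "ten s (\<Phi> l (ten s z v)) (cls (fst l) (snd l)) = lin (T s) (\<lambda>k. ten s (weight s \<mu> l z k) (cls (fst l) (snd l))) ?c"
          if l: "l \<in> S'" for l
          unfolding y(2) \<Phi>(2)[OF tens(1) y(1)]
          by (rule q.hom_lin[OF TP.tens_hom_left[OF Lc[OF l]] TP.comm_group_tensor wc])
      qed
      \<comment> \<open>After the exchange the inner sum runs over the labels for one fixed term,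
        and only the label of that term contributes.\<close>
      also have "\<dots> = lin (T s) (\<lambda>k. finprod (T s) (\<lambda>l. ten s (weight s \<mu> l z k) (cls (fst l) (snd l))) S') ?c"
        by (rule TT.finprod_lin[OF S'(3) wt])
      also have "\<dots> = lin (T s) (\<lambda>k. ten s (\<mu> z) (inj_action P dbl (cls n (case k of (g, x) \<Rightarrow> far P g x)))) ?c"
      proof (rule TT.lin_cong)
        fix k assume k: "k \<in> Poly_Mapping.keys ?c"
        obtain g x where gx: "k = (g, x)" by (rule prod.exhaust)
        note g = key[OF k[unfolded gx]]
        let ?l = "(src cat_I g, x)"
        have l: "?l \<in> S'" using S'(1) k gx by force
        have sx: "cls (src cat_I g) x \<in> carrier N" using cls_closed[OF g(3)] by simp
        have one: "ten s \<one>\<^bsub>q s\<^esub> (cls (fst l) (snd l)) = \<one>\<^bsub>T s\<^esub>" if "l \<in> S'" for l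
          by (rule hom_one_comm[OF TP.tens_hom_left[OF Lc[OF that]] q_group TP.comm_group_tensor])
        note fs = frag_of_monoid_ring[OF spread_closed[OF g(1)]]
        have "finprod (T s) (\<lambda>l. ten s (weight s \<mu> l z k) (cls (fst l) (snd l))) S' =
            finprod (T s) (\<lambda>l. if ?l = l then ten s (act (q s) (frag_of (spread g)) (\<mu> z)) (cls (fst l) (snd l)) else \<one>\<^bsub>T s\<^esub>) S'"
          by (rule TT.finprod_cong'[OF refl])
            (auto simp only: weight_def gx prod.case one if_True if_False split: if_split
              intro!: TP.tens_closed[OF right_act_closed[OF qR fs \<mu>c[OF tens(1)]] Lc] TT.one_closed)
        also have "\<dots> = ten s (act (q s) (frag_of (spread g)) (\<mu> z)) (cls (src cat_I g) x)"
          using TT.finprod_singleton[OF l S'(3), of "\<lambda>l. ten s (act (q s) (frag_of (spread g)) (\<mu> z)) (cls (fst l) (snd l))"]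
            TP.tens_closed[OF right_act_closed[OF qR fs \<mu>c[OF tens(1)]] Lc] by (simp add: Pi_iff)
        \<comment> \<open>\<open>spread g\<close> crosses the tensor sign and is then traded, by
          \<open>inj_action_spread\<close>, for \<open>dbl\<close> after P(g).\<close>
        also have "\<dots> = ten s (\<mu> z) (inj_action P (spread g) (cls (src cat_I g) x))"
          using TP.tens_act[OF fs \<mu>c[OF tens(1)] sx] act_frag_colimN[OF spread_closed[OF g(1)] cls_closed[OF g(3)]] by simp
        also have "\<dots> = ten s (\<mu> z) (inj_action P dbl (cls n (far P g x)))"
          using inj_action_spread[OF g(1,3)] g(2) by simp
        finally show "finprod (T s) (\<lambda>l. ten s (weight s \<mu> l z k) (cls (fst l) (snd l))) S' =
            ten s (\<mu> z) (inj_action P dbl (cls n (case k of (g, x) \<Rightarrow> far P g x)))" by (simp add: gx)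
        show "finprod (T s) (\<lambda>l. ten s (weight s \<mu> l z k) (cls (fst l) (snd l))) S' \<in> carrier (T s)"
          by (rule TT.finprod_closed) (intro funcsetI wt k)
      qed
      \<comment> \<open>The sum is collected in the second factor, where evaluating
        \<open>\<sigma> n y\<close> will return \<open>y\<close> by the section property.\<close>
      also have "\<dots> = ten s (\<mu> z) (inj_action P dbl (cls n (I.free_eval n ?c)))"
      proof -
        have far: "(case k of (g, x) \<Rightarrow> far P g x) \<in> carrier (fob P n)" if "k \<in> Poly_Mapping.keys ?c" for k
          using I.free_gens_far \<sigma>_keys[OF y(1)] that by blast
        have h: "(\<lambda>w. ten s (\<mu> z) (inj_action P dbl (cls n w))) \<in> hom (fob P n) (T s)"
        proof (rule homI)
          fix w w' assume w: "w \<in> carrier (fob P n)" "w' \<in> carrier (fob P n)"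
          show "ten s (\<mu> z) (inj_action P dbl (cls n (w \<otimes>\<^bsub>fob P n\<^esub> w'))) =
              ten s (\<mu> z) (inj_action P dbl (cls n w)) \<otimes>\<^bsub>T s\<^esub> ten s (\<mu> z) (inj_action P dbl (cls n w'))"
            using TP.tens_mult_right[OF \<mu>c[OF tens(1)] dc[OF cls_closed[OF w(1)]] dc[OF cls_closed[OF w(2)]]]
            by (simp add: hom_mult[OF cls_hom w] hom_mult[OF inj_action_hom[OF dbl_closed] cls_closed[OF w(1)] cls_closed[OF w(2)]])
        qed (intro TP.tens_closed \<mu>c tens(1) dc cls_closed)
        show ?thesis
          unfolding I.free_eval_def
          by (rule comm_group.hom_lin[OF grp h TP.comm_group_tensor far, symmetric])
      qed
      also have "\<dots> = ten s (act (q s) (frag_of dbl) (\<mu> z)) v"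
        using TP.tens_act[OF frag_of_monoid_ring[OF dbl_closed] \<mu>c[OF tens(1)] tens(2)] act_frag_colimN[OF dbl_closed v]
        by (simp add: \<sigma>_sec[OF y(1)] y(2))
      also have "\<dots> = ?\<tau> (ten s z v)" by (rule tm(2)[OF tens, symmetric])
      finally show ?thesis by simp
    qed
    moreover have "?S \<subseteq> L" using key by (auto simp: L_def)
    ultimately show ?case by (intro exI[of _ ?S]) simp
  next
    case (mult u v)
    obtain S1 where S1: "?good u S1" using mult(3) by (rule exE)
    obtain S2 where S2: "?good v S2" using mult(4) by (rule exE)
    have "?\<tau> (u \<otimes>\<^bsub>T s\<^esub> v) = finprod (T s) (\<lambda>l. ten s (\<Phi> l (u \<otimes>\<^bsub>T s\<^esub> v)) (cls (fst l) (snd l))) S'"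
      if S': "S1 \<union> S2 \<subseteq> S'" "S' \<subseteq> L" "finite S'" for S'
    proof -
      have Lc: "cls (fst l) (snd l) \<in> carrier N" if "l \<in> S'" for l using L that S'(2) by blast
      have "finprod (T s) (\<lambda>l. ten s (\<Phi> l (u \<otimes>\<^bsub>T s\<^esub> v)) (cls (fst l) (snd l))) S' =
         finprod (T s) (\<lambda>l. ten s (\<Phi> l u) (cls (fst l) (snd l)) \<otimes>\<^bsub>T s\<^esub> ten s (\<Phi> l v) (cls (fst l) (snd l))) S'"
      proof (rule TT.finprod_cong'[OF refl])
        show "(\<lambda>l. ten s (\<Phi> l u) (cls (fst l) (snd l)) \<otimes>\<^bsub>T s\<^esub> ten s (\<Phi> l v) (cls (fst l) (snd l))) \<in> S' \<rightarrow> carrier (T s)"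
          by (intro funcsetI TT.m_closed TP.tens_closed \<Phi>c mult(1,2) Lc)
        show "ten s (\<Phi> l (u \<otimes>\<^bsub>T s\<^esub> v)) (cls (fst l) (snd l)) =
            ten s (\<Phi> l u) (cls (fst l) (snd l)) \<otimes>\<^bsub>T s\<^esub> ten s (\<Phi> l v) (cls (fst l) (snd l))" if "l \<in> S'" for l
          by (simp only: hom_mult[OF \<Phi>(1) mult(1,2)] TP.tens_mult_left[OF \<Phi>c[OF mult(1)] \<Phi>c[OF mult(2)] Lc[OF that]])
      qed
      also have "\<dots> = finprod (T s) (\<lambda>l. ten s (\<Phi> l u) (cls (fst l) (snd l))) S' \<otimes>\<^bsub>T s\<^esub>
          finprod (T s) (\<lambda>l. ten s (\<Phi> l v) (cls (fst l) (snd l))) S'"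
        by (rule TT.finprod_multf) (intro funcsetI TP.tens_closed \<Phi>c mult(1,2) Lc, assumption)+
      also have "\<dots> = ?\<tau> u \<otimes>\<^bsub>T s\<^esub> ?\<tau> v"
        using S1[THEN conjunct2, THEN conjunct2, THEN spec, of S', THEN mp, symmetric]
          S2[THEN conjunct2, THEN conjunct2, THEN spec, of S', THEN mp, symmetric] S' by simp
      also have "\<dots> = ?\<tau> (u \<otimes>\<^bsub>T s\<^esub> v)" by (rule hom_mult[OF tm(1) mult(1,2), symmetric])
      finally show ?thesis by simp
    qed
    then show ?case using S1 S2 by (intro exI[of _ "S1 \<union> S2"] conjI allI impI) simp_all
  qed
  then obtain S where "?good \<zeta> S" by (rule exE)
  then show ?thesis by (intro exI[of _ S]) (auto simp: L_def)
qed

text \<open>Bounding elements \<open>w l\<close> are chosen for the coordinates separately. Their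
  tensors with the classes of the labels add up to an element bounding the doubled one, by
  \<open>reconstruct\<close>.\<close>

lemma doubled_boundary:
  assumes \<mu>: "\<mu> \<in> mod_hom R (q s) (pull s)"
    and t: "(\<lambda>x. act (q s) (frag_of dbl) (\<mu> x)) \<in> mod_hom R (q s) (q s)"
    and \<Phi>: "\<And>l. \<Phi> l \<in> hom (T s) (q s)"
      "\<And>l z n y. z \<in> carrier (q s) \<Longrightarrow> y \<in> carrier (fob P n) \<Longrightarrow>
        \<Phi> l (ten s z (cls n y)) = lin (q s) (weight s \<mu> l z) (\<sigma> n y)"
    and \<zeta>: "\<zeta> \<in> carrier (T s)" and im: "\<And>l. \<Phi> l \<zeta> \<in> mdiff Q s ` carrier (q (Suc s))"
  shows "\<exists>w\<in>carrier (T (Suc s)). tensor_map R (q s) N (mdiff Q s) (\<lambda>x. x) w =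
    tensor_map R (q s) N (\<lambda>x. act (q s) (frag_of dbl) (\<mu> x)) (\<lambda>x. x) \<zeta>"
proof -
  interpret TP: tensor_product R "q s" N by (rule tp)
  interpret TP': tensor_product R "q (Suc s)" N by (rule tp)
  interpret TT: comm_group "T s" by (rule TP.comm_group_tensor)
  interpret TT': comm_group "T (Suc s)" by (rule TP'.comm_group_tensor)
  note dm = tensor_map_hom[OF tp tp d mod_hom_id] tensor_map_tens[OF tp tp d mod_hom_id]
  have "\<forall>l. \<exists>w\<in>carrier (q (Suc s)). mdiff Q s w = \<Phi> l \<zeta>" using im by (metis imageE)
  then obtain w where w: "\<And>l. w l \<in> carrier (q (Suc s))" "\<And>l. mdiff Q s (w l) = \<Phi> l \<zeta>" by metis
  obtain S where S: "finite S" "\<forall>(k, x)\<in>S. x \<in> carrier (fob P k)"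
    "tensor_map R (q s) N (\<lambda>x. act (q s) (frag_of dbl) (\<mu> x)) (\<lambda>x. x) \<zeta> =
      finprod (T s) (\<lambda>l. ten s (\<Phi> l \<zeta>) (cls (fst l) (snd l))) S"
    using reconstruct[OF \<mu> t \<Phi> \<zeta>] by blast
  have Lc: "cls (fst l) (snd l) \<in> carrier N" if "l \<in> S" for l
    using that S(2) cls_closed by auto
  have wc: "(\<lambda>l. ten (Suc s) (w l) (cls (fst l) (snd l))) \<in> S \<rightarrow> carrier (T (Suc s))"
    by (intro funcsetI TP'.tens_closed w(1) Lc)
  have "tensor_map R (q s) N (mdiff Q s) (\<lambda>x. x) (finprod (T (Suc s)) (\<lambda>l. ten (Suc s) (w l) (cls (fst l) (snd l))) S) =
      finprod (T s) (\<lambda>l. tensor_map R (q s) N (mdiff Q s) (\<lambda>x. x) (ten (Suc s) (w l) (cls (fst l) (snd l)))) S"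
    by (rule TT'.hom_finprod[OF dm(1) TP.comm_group_tensor wc])
  also have "\<dots> = finprod (T s) (\<lambda>l. ten s (\<Phi> l \<zeta>) (cls (fst l) (snd l))) S"
  proof (rule TT.finprod_cong'[OF refl])
    show "(\<lambda>l. ten s (\<Phi> l \<zeta>) (cls (fst l) (snd l))) \<in> S \<rightarrow> carrier (T s)"
      by (intro funcsetI TP.tens_closed hom_in_carrier[OF \<Phi>(1) \<zeta>] Lc)
    show "tensor_map R (q s) N (mdiff Q s) (\<lambda>x. x) (ten (Suc s) (w l) (cls (fst l) (snd l))) = ten s (\<Phi> l \<zeta>) (cls (fst l) (snd l))"
      if "l \<in> S" for l
      using dm(2)[OF w(1) Lc[OF that]] by (simp add: w(2))
  qed
  finally show ?thesis using TT'.finprod_closed[OF wc] by (auto simp: S(3))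
qed

end

lemma tensor_map_left:
  assumes T: "tensor_product R A N" and T': "tensor_product R A' N" and h: "h \<in> mod_hom R A A'"
  shows "tensor_map R A' N h (\<lambda>x. x) \<in> hom (tensor R A N) (tensor R A' N)"
    "\<And>a x. a \<in> carrier A \<Longrightarrow> x \<in> carrier N \<Longrightarrow>
      tensor_map R A' N h (\<lambda>x. x) (tensor_product.tens R A N a x) = tensor_product.tens R A' N (h a) x"
  by (rule tensor_map_hom[OF T T' h mod_hom_id], rule tensor_map_tens[OF T T' h mod_hom_id])

section \<open>The vertical differential and the augmentation of a column\<close>

context resolution_functor
begin

abbreviation dT :: "nat \<Rightarrow> ('c \<times> (nat \<Rightarrow> 'b) set \<Rightarrow>\<^sub>0 int) set \<Rightarrow> ('c \<times> (nat \<Rightarrow> 'b) set \<Rightarrow>\<^sub>0 int) set"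
  where "dT s \<equiv> tensor_map R (q s) N (mdiff Q s) (\<lambda>x. x)"

lemmas dT_hom = tensor_map_left(1)[OF tp tp d]

lemma dT_ten: "a \<in> carrier (q (Suc s)) \<Longrightarrow> y \<in> carrier (fob P n) \<Longrightarrow>
    dT s (ten (Suc s) a (cls n y)) = ten s (mdiff Q s a) (cls n y)"
  by (rule tensor_map_left(2)[OF tp tp d _ cls_N])

text \<open>The augmentation \<open>Q\<^sub>0 \<otimes> colim\<^sub>N P \<rightarrow> \<int> \<otimes> colim\<^sub>N P = colim\<^sub>I P\<close>.\<close>

definition aug :: "('c \<times> (nat \<Rightarrow> 'b) set \<Rightarrow>\<^sub>0 int) set \<Rightarrow> (nat \<Rightarrow> 'b) set"
  where "aug = (SOME h. h \<in> hom (T 0) (colim cat_I P) \<and> (\<forall>z\<in>carrier (q 0). \<forall>n. \<forall>y\<in>carrier (fob P n).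
    h (ten 0 z (cls n y)) = colim_class cat_I P n y [^]\<^bsub>colim cat_I P\<^esub> maug Q z))"

lemma cls_I_closed: "y \<in> carrier (fob P n) \<Longrightarrow> colim_class cat_I P n y \<in> carrier (colim cat_I P)"
  by (rule I.colim_class_closed) (simp_all add: cat_I_simps)

text \<open>The pairing takes z and [y] to the multiple of the class of y in the colimit over I by
  the augmentation of z. It is balanced because M changes neither of the two.\<close>

lemma aug_exists:
  "\<exists>h. h \<in> hom (T 0) (colim cat_I P) \<and> (\<forall>z\<in>carrier (q 0). \<forall>n. \<forall>y\<in>carrier (fob P n).
    h (ten 0 z (cls n y)) = colim_class cat_I P n y [^]\<^bsub>colim cat_I P\<^esub> maug Q z)"
proof -
  let ?K = "colim cat_I P"
  interpret K: comm_group ?K by (rule I.comm_group_colim)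
  interpret TP: tensor_product R "q 0" N by (rule tp)
  have k: "colim_class cat_I P n \<in> hom (fob P n) ?K" for n
    by (rule I.colim_class_hom) (simp add: cat_I_simps)
  have cc: "colim_class cat_I P n (far P (inc m n) x) = colim_class cat_I P m x"
    if "m \<le> n" "x \<in> carrier (fob P m)" for m n x
    using I.colim_class_far[OF inc_Ar_I[OF that(1)], of x] that by simp
  obtain j where j: "j \<in> hom colimN ?K" "\<And>n x. x \<in> carrier (fob P n) \<Longrightarrow> j (cls n x) = colim_class cat_I P n x"
    by (rule colimN_universal[where k = "\<lambda>n. colim_class cat_I P n", OF K.comm_group_axioms k cc]) (assumption | rule that)+
  have jc: "j v \<in> carrier ?K" if "v \<in> carrier colimN" for v by (rule hom_in_carrier[OF j(1) that])
  \<comment> \<open>\<open>rst f n ?m\<close> is an arrow of I, though in general not one of N, so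
    the colimit over I identifies the class of y with its translate under \<open>f\<close>.\<close>
  have j_act: "j (inj_action P f v) = j v" if f: "f \<in> carrier inj_monoid" and v: "v \<in> carrier colimN" for f v
  proof -
    obtain n y where y: "y \<in> carrier (fob P n)" "v = cls n y" by (rule colimN_rep[OF v])
    let ?m = "max_image f n"
    show ?thesis
      using I.colim_class_far[OF rst_Ar[OF f order_refl[of ?m]], of y] y rst_closed[OF f order_refl[of ?m] y(1)]
      by (simp add: inj_action_cls[OF f y(1) order_refl] j(2))
  qed
  let ?\<beta> = "\<lambda>z v. j v [^]\<^bsub>?K\<^esub> maug Q z"
  have l: "(\<lambda>z. ?\<beta> z v) \<in> hom (q 0) ?K" if "v \<in> carrier colimN" for v
    using hom_compose[OF eps_hom K.hom_integer_group_pow[OF jc[OF that]]] by (simp add: comp_def)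
  have r: "?\<beta> z \<in> hom colimN ?K" for z
    by (rule homI) (simp_all add: jc hom_mult[OF j(1)] K.int_pow_mult_distrib K.m_comm)
  have ac: "inj_action P f v \<in> carrier colimN" if "f \<in> carrier inj_monoid" "v \<in> carrier colimN" for f v
    by (rule hom_in_carrier[OF inj_action_hom[OF that(1)] that(2)])
  have b: "?\<beta> (act (q 0) (frag_of f) z) v = ?\<beta> z (inj_action P f v)"
    if "f \<in> carrier inj_monoid" "z \<in> carrier (q 0)" "v \<in> carrier colimN" for f z v
    by (simp add: eps_act j_act that)
  have bal: "?\<beta> (act (q 0) c z) v = ?\<beta> z (act N c v)"
    if "c \<in> carrier R" "z \<in> carrier (q 0)" "v \<in> carrier colimN" for c z v
    unfolding colim_N_module_def
    by (rule monoid_balanced[where \<beta> = ?\<beta>, OF qR N.comm_group_colim K.comm_group_axioms ac l r b that])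
  obtain h where h: "h \<in> hom (T 0) ?K" "\<And>z v. z \<in> carrier (q 0) \<Longrightarrow> v \<in> carrier N \<Longrightarrow> h (ten 0 z v) = ?\<beta> z v"
    by (rule TP.tensor_universal[where \<beta> = ?\<beta>, OF K.comm_group_axioms])
      (assumption | rule that | simp add: jc hom_mult[OF l] hom_mult[OF r] bal)+
  have "h (ten 0 z (cls n y)) = colim_class cat_I P n y [^]\<^bsub>?K\<^esub> maug Q z"
    if "z \<in> carrier (q 0)" "y \<in> carrier (fob P n)" for z n y
    using h(2)[OF that(1) cls_N[OF that(2)]] j(2)[OF that(2)] by simp
  then show ?thesis using h(1) by blast
qed

lemma aug_hom: "aug \<in> hom (T 0) (colim cat_I P)"
  using someI_ex[OF aug_exists] unfolding aug_def by (rule conjunct1)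

lemma aug_ten: "z \<in> carrier (q 0) \<Longrightarrow> y \<in> carrier (fob P n) \<Longrightarrow>
    aug (ten 0 z (cls n y)) = colim_class cat_I P n y [^]\<^bsub>colim cat_I P\<^esub> maug Q z"
  using someI_ex[OF aug_exists, folded aug_def] by blast

lemma aug_surj:
  assumes "v \<in> carrier (colim cat_I P)" shows "\<exists>z\<in>carrier (T 0). aug z = v"
proof -
  interpret K: comm_group "colim cat_I P" by (rule I.comm_group_colim)
  interpret T0: comm_group "T 0" by (rule T_group)
  obtain z where z: "z \<in> carrier (q 0)" "maug Q z = 1" using eps_surj by blast
  show ?thesis
    using assms
  proof (induction rule: I.colim_induct)
    case (cls n y)
    then show ?case
      using aug_ten[OF z(1) cls(2)] z(2) cls_I_closed[OF cls(2)] ten_closed[OF z(1) cls(2)] by force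
  next
    case (mult u v)
    then obtain a b where "a \<in> carrier (T 0)" "aug a = u" "b \<in> carrier (T 0)" "aug b = v" by blast
    then show ?case by (intro bexI[of _ "a \<otimes>\<^bsub>T 0\<^esub> b"]) (simp_all add: hom_mult[OF aug_hom])
  qed (simp add: cat_I_simps)
qed

lemma trivial_hom: "comm_group H \<Longrightarrow> (\<lambda>_. \<one>\<^bsub>H\<^esub>) \<in> hom G H"
  by (rule homI) (simp_all add: comm_groupD monoid.one_closed)

lemma aug_dT: "z \<in> carrier (T (Suc 0)) \<Longrightarrow> aug (dT 0 z) = \<one>\<^bsub>colim cat_I P\<^esub>"
  by (rule T_hom_eq[where h = "\<lambda>z. aug (dT 0 z)" and H = "colim cat_I P"])
    (use hom_compose[OF dT_hom aug_hom] trivial_hom[OF I.comm_group_colim] in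
      \<open>simp_all add: comp_def dT_ten aug_ten d_closed eps_d\<close>)

lemma dT_dT: "z \<in> carrier (T (Suc (Suc s))) \<Longrightarrow> dT s (dT (Suc s) z) = \<one>\<^bsub>T s\<^esub>"
  by (rule T_hom_eq[where h = "\<lambda>z. dT s (dT (Suc s) z)" and H = "T s"])
    (use hom_compose[OF dT_hom dT_hom] trivial_hom[OF T_group] in
      \<open>simp_all add: comp_def dT_ten d_closed d_d ten_one\<close>)

end

section \<open>Exactness of a column in positive degrees and at its augmentation\<close>

context column
begin

text \<open>\<open>\<mu>\<close> commutes with the differential, and the differential is linear,
  hence commutes with the action of \<open>spread g\<close>. Coordinates therefore take cycles of
  the column to cycles of \<open>Q\<close>.\<close>

lemma coord_chain:
  assumes \<mu>: "\<And>n. \<mu> n \<in> mod_hom R (q n) (pull n)"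
    and \<mu>d: "\<And>n x. x \<in> carrier (q (Suc n)) \<Longrightarrow> \<mu> n (mdiff Q n x) = mdiff Q n (\<mu> (Suc n) x)"
    and \<Phi>: "\<Phi> \<in> hom (T s) (q s)"
      "\<And>z n y. z \<in> carrier (q s) \<Longrightarrow> y \<in> carrier (fob P n) \<Longrightarrow> \<Phi> (ten s z (cls n y)) = lin (q s) (weight s (\<mu> s) l z) (\<sigma> n y)"
    and \<Phi>': "\<Phi>' \<in> hom (T (Suc s)) (q (Suc s))"
      "\<And>z n y. z \<in> carrier (q (Suc s)) \<Longrightarrow> y \<in> carrier (fob P n) \<Longrightarrow>
        \<Phi>' (ten (Suc s) z (cls n y)) = lin (q (Suc s)) (weight (Suc s) (\<mu> (Suc s)) l z) (\<sigma> n y)"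
    and z: "z \<in> carrier (T (Suc s))"
  shows "\<Phi> (dT s z) = mdiff Q s (\<Phi>' z)"
proof (rule T_hom_eq[OF _ _ _ z, where h = "\<lambda>z. \<Phi> (dT s z)" and k = "\<lambda>z. mdiff Q s (\<Phi>' z)"])
  show "(\<lambda>z. \<Phi> (dT s z)) \<in> hom (T (Suc s)) (q s)"
    using hom_compose[OF dT_hom \<Phi>(1)] by (simp add: comp_def)
  show "(\<lambda>z. mdiff Q s (\<Phi>' z)) \<in> hom (T (Suc s)) (q s)"
    using hom_compose[OF \<Phi>'(1) mod_hom_hom[OF d]] by (simp add: comp_def)
  fix z n y assume z: "z \<in> carrier (q (Suc s))" and y: "y \<in> carrier (fob P n)"
  interpret q0: comm_group "q s" by (rule q_group)
  interpret q1: comm_group "q (Suc s)" by (rule q_group)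
  have wc: "weight (Suc s) (\<mu> (Suc s)) l z k \<in> carrier (q (Suc s))" if "k \<in> Poly_Mapping.keys (\<sigma> n y)" for k
    using weight_closed[OF \<mu> z] \<sigma>_keys[OF y] that by blast
  have \<mu>z: "\<mu> (Suc s) z \<in> carrier (q (Suc s))" using mod_hom_closed[OF \<mu> z] by simp
  have "mdiff Q s (\<Phi>' (ten (Suc s) z (cls n y))) = lin (q s) (\<lambda>k. mdiff Q s (weight (Suc s) (\<mu> (Suc s)) l z k)) (\<sigma> n y)"
    unfolding \<Phi>'(2)[OF z y] by (rule q1.hom_lin[OF mod_hom_hom[OF d] q_group wc])
  also have "\<dots> = lin (q s) (weight s (\<mu> s) l (mdiff Q s z)) (\<sigma> n y)"
  proof (rule q0.lin_cong)
    fix k assume k: "k \<in> Poly_Mapping.keys (\<sigma> n y)"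
    show "mdiff Q s (weight (Suc s) (\<mu> (Suc s)) l z k) \<in> carrier (q s)" by (rule d_closed[OF wc[OF k]])
    obtain g x where gx: "k = (g, x)" by (rule prod.exhaust)
    have g: "g \<in> Ar cat_I" using \<sigma>_keys[OF y] k gx by (auto simp: free_gens_def)
    show "mdiff Q s (weight (Suc s) (\<mu> (Suc s)) l z k) = weight s (\<mu> s) l (mdiff Q s z) k"
      using mod_hom_act[OF d frag_of_monoid_ring[OF spread_closed[OF g]] \<mu>z] hom_one_comm[OF mod_hom_hom[OF d] q_group q_group]
      by (simp add: weight_def gx \<mu>d[OF z])
  qed
  also have "\<dots> = \<Phi> (dT s (ten (Suc s) z (cls n y)))"
    unfolding dT_ten[OF z y] by (rule \<Phi>(2)[OF d_closed[OF z] y, symmetric])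
  finally show "\<Phi> (dT s (ten (Suc s) z (cls n y))) = mdiff Q s (\<Phi>' (ten (Suc s) z (cls n y)))" by simp
qed

text \<open>The coordinates of a cycle are cycles of the exact complex \<open>Q\<close>, so they
  bound, and with them the doubled cycle. The homotopy from doubling to the identity transfers this
  to the cycle itself.\<close>

lemma column_exact:
  assumes \<zeta>: "\<zeta> \<in> carrier (T (Suc s))" and d\<zeta>: "dT s \<zeta> = \<one>\<^bsub>T s\<^esub>"
  shows "\<exists>w\<in>carrier (T (Suc (Suc s))). dT (Suc s) w = \<zeta>"
proof -
  interpret T1: comm_group "T (Suc s)" by (rule T_group)
  interpret T2: comm_group "T (Suc (Suc s))" by (rule T_group)
  obtain \<mu> h where \<mu>: "\<And>n. \<mu> n \<in> mod_hom R (q n) (pull n)"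
    and \<mu>d: "\<And>n x. x \<in> carrier (q (Suc n)) \<Longrightarrow> \<mu> n (mdiff Q n x) = mdiff Q n (\<mu> (Suc n) x)"
    and t: "\<And>n. (\<lambda>x. act (q n) (frag_of dbl) (\<mu> n x)) \<in> mod_hom R (q n) (q n)"
    and h: "\<And>n. h n \<in> mod_hom R (q n) (q (Suc n))"
    and split: "\<And>n x. x \<in> carrier (q (Suc n)) \<Longrightarrow> x = act (q (Suc n)) (frag_of dbl) (\<mu> (Suc n) x) \<otimes>\<^bsub>q (Suc n)\<^esub>
        (mdiff Q (Suc n) (h (Suc n) x) \<otimes>\<^bsub>q (Suc n)\<^esub> h n (mdiff Q n x))"
    by (rule doubling) (assumption | rule that)+
  obtain \<Phi> where \<Phi>: "\<And>l. \<Phi> l \<in> hom (T s) (q s)"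
    "\<And>l z n y. z \<in> carrier (q s) \<Longrightarrow> y \<in> carrier (fob P n) \<Longrightarrow> \<Phi> l (ten s z (cls n y)) = lin (q s) (weight s (\<mu> s) l z) (\<sigma> n y)"
    by (rule coord[OF \<mu>[of s]]) (assumption | rule that)+
  obtain \<Phi>' where \<Phi>': "\<And>l. \<Phi>' l \<in> hom (T (Suc s)) (q (Suc s))"
    "\<And>l z n y. z \<in> carrier (q (Suc s)) \<Longrightarrow> y \<in> carrier (fob P n) \<Longrightarrow>
      \<Phi>' l (ten (Suc s) z (cls n y)) = lin (q (Suc s)) (weight (Suc s) (\<mu> (Suc s)) l z) (\<sigma> n y)"
    by (rule coord[OF \<mu>[of "Suc s"]]) (assumption | rule that)+
  have im: "\<Phi>' l \<zeta> \<in> mdiff Q (Suc s) ` carrier (q (Suc (Suc s)))" for l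
  proof (rule ex)
    show "\<Phi>' l \<zeta> \<in> carrier (q (Suc s))" by (rule hom_in_carrier[OF \<Phi>'(1) \<zeta>])
    have "mdiff Q s (\<Phi>' l \<zeta>) = \<Phi> l (dT s \<zeta>)" by (rule coord_chain[OF \<mu> \<mu>d \<Phi> \<Phi>' \<zeta>, symmetric])
    also have "\<dots> = \<one>\<^bsub>q s\<^esub>" unfolding d\<zeta> by (rule hom_one_comm[OF \<Phi>(1) T_group q_group])
    finally show "mdiff Q s (\<Phi>' l \<zeta>) = \<one>\<^bsub>q s\<^esub>" .
  qed
  let ?\<tau> = "tensor_map R (q (Suc s)) N (\<lambda>x. act (q (Suc s)) (frag_of dbl) (\<mu> (Suc s) x)) (\<lambda>x. x)"
  let ?h0 = "tensor_map R (q (Suc s)) N (h s) (\<lambda>x. x)"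
  let ?h1 = "tensor_map R (q (Suc (Suc s))) N (h (Suc s)) (\<lambda>x. x)"
  obtain w where w: "w \<in> carrier (T (Suc (Suc s)))" "dT (Suc s) w = ?\<tau> \<zeta>"
    using doubled_boundary[OF \<mu> t \<Phi>' \<zeta> im] by blast
  note \<tau>h = tensor_map_left[OF tp tp t] and h0 = tensor_map_left[OF tp tp h[of s]] and h1 = tensor_map_left[OF tp tp h[of "Suc s"]]
  note cl = hom_in_carrier[OF \<tau>h(1)] hom_in_carrier[OF h0(1)] hom_in_carrier[OF h1(1)] hom_in_carrier[OF dT_hom]
  \<comment> \<open>The homotopy on \<open>Q\<close> supplied by \<open>doubling\<close>, tensored
    with \<open>N\<close>.\<close>
  have "\<zeta> = ?\<tau> \<zeta> \<otimes>\<^bsub>T (Suc s)\<^esub> (dT (Suc s) (?h1 \<zeta>) \<otimes>\<^bsub>T (Suc s)\<^esub> ?h0 (dT s \<zeta>))"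
    using \<zeta>
  proof (induction rule: T_induct)
    case (ten a n y)
    note y = cls_N[OF ten(2)]
    interpret TP: tensor_product R "q (Suc s)" N by (rule tp)
    interpret q1: comm_group "q (Suc s)" by (rule q_group)
    have c: "act (q (Suc s)) (frag_of dbl) (\<mu> (Suc s) a) \<in> carrier (q (Suc s))"
      "mdiff Q (Suc s) (h (Suc s) a) \<in> carrier (q (Suc s))" "h s (mdiff Q s a) \<in> carrier (q (Suc s))"
      using mod_hom_closed[OF t ten(1)] mod_hom_closed[OF h] ten(1) d_closed by auto
    have "ten (Suc s) a (cls n y) = ten (Suc s) (act (q (Suc s)) (frag_of dbl) (\<mu> (Suc s) a) \<otimes>\<^bsub>q (Suc s)\<^esub>
        (mdiff Q (Suc s) (h (Suc s) a) \<otimes>\<^bsub>q (Suc s)\<^esub> h s (mdiff Q s a))) (cls n y)"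
      using split[OF ten(1)] by (rule arg_cong)
    note eq = this[unfolded TP.tens_mult_left[OF c(1) q1.m_closed[OF c(2,3)] y] TP.tens_mult_left[OF c(2,3) y]]
    show ?case
      unfolding \<tau>h(2)[OF ten(1) y] h1(2)[OF ten(1) y] dT_ten[OF mod_hom_closed[OF h ten(1)] ten(2)] dT_ten[OF ten]
        h0(2)[OF d_closed[OF ten(1)] y] by (rule eq)
  next
    case (mult u v)
    have "u \<otimes>\<^bsub>T (Suc s)\<^esub> v = (?\<tau> u \<otimes>\<^bsub>T (Suc s)\<^esub> (dT (Suc s) (?h1 u) \<otimes>\<^bsub>T (Suc s)\<^esub> ?h0 (dT s u))) \<otimes>\<^bsub>T (Suc s)\<^esub>
        (?\<tau> v \<otimes>\<^bsub>T (Suc s)\<^esub> (dT (Suc s) (?h1 v) \<otimes>\<^bsub>T (Suc s)\<^esub> ?h0 (dT s v)))"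
      using mult(3,4) by simp
    also have "\<dots> = ?\<tau> (u \<otimes>\<^bsub>T (Suc s)\<^esub> v) \<otimes>\<^bsub>T (Suc s)\<^esub>
        (dT (Suc s) (?h1 (u \<otimes>\<^bsub>T (Suc s)\<^esub> v)) \<otimes>\<^bsub>T (Suc s)\<^esub> ?h0 (dT s (u \<otimes>\<^bsub>T (Suc s)\<^esub> v)))"
      using mult(1,2)
      by (simp add: hom_mult[OF \<tau>h(1)] hom_mult[OF h0(1)] hom_mult[OF h1(1)] hom_mult[OF dT_hom] cl T1.m_ac)
    finally show ?case .
  qed
  \<comment> \<open>Here the cycle condition enters: the term of the homotopy through
    \<open>dT s \<zeta>\<close> vanishes.\<close>
  also have "\<dots> = ?\<tau> \<zeta> \<otimes>\<^bsub>T (Suc s)\<^esub> dT (Suc s) (?h1 \<zeta>)"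
    using hom_one_comm[OF h0(1) T_group T_group] \<zeta> by (simp add: d\<zeta> cl)
  also have "\<dots> = dT (Suc s) (w \<otimes>\<^bsub>T (Suc (Suc s))\<^esub> ?h1 \<zeta>)"
    using w \<zeta> by (simp add: hom_mult[OF dT_hom] cl)
  finally have "\<zeta> = dT (Suc s) (w \<otimes>\<^bsub>T (Suc (Suc s))\<^esub> ?h1 \<zeta>)" .
  then show ?thesis using w(1) \<zeta> cl(3) by (metis T2.m_closed)
qed

text \<open>In degree 0 the coordinates bound only if they are killed by \<open>maug Q\<close>.
  Their augmentations turn out to be functions of \<open>aug \<zeta>\<close> alone, and this is how
  the colimit over I comes in.\<close>

lemma column_exact_0:
  assumes \<zeta>: "\<zeta> \<in> carrier (T 0)" and aug\<zeta>: "aug \<zeta> = \<one>\<^bsub>colim cat_I P\<^esub>"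
  shows "\<exists>w\<in>carrier (T (Suc 0)). dT 0 w = \<zeta>"
proof -
  interpret T0: comm_group "T 0" by (rule T_group)
  interpret T1: comm_group "T (Suc 0)" by (rule T_group)
  interpret Z: comm_group integer_group by (rule abelian_integer_group)
  interpret K: comm_group "colim cat_I P" by (rule I.comm_group_colim)
  interpret q0: comm_group "q 0" by (rule q_group)
  obtain \<mu> h where \<mu>: "\<And>n. \<mu> n \<in> mod_hom R (q n) (pull n)"
    and \<mu>e: "\<And>x. x \<in> carrier (q 0) \<Longrightarrow> maug Q (\<mu> 0 x) = maug Q x"
    and t: "\<And>n. (\<lambda>x. act (q n) (frag_of dbl) (\<mu> n x)) \<in> mod_hom R (q n) (q n)"
    and h: "\<And>n. h n \<in> mod_hom R (q n) (q (Suc n))"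
    and split: "\<And>x. x \<in> carrier (q 0) \<Longrightarrow> x = act (q 0) (frag_of dbl) (\<mu> 0 x) \<otimes>\<^bsub>q 0\<^esub> mdiff Q 0 (h 0 x)"
    by (rule doubling) (assumption | rule that)+
  obtain \<Phi> where \<Phi>: "\<And>l. \<Phi> l \<in> hom (T 0) (q 0)"
    "\<And>l z n y. z \<in> carrier (q 0) \<Longrightarrow> y \<in> carrier (fob P n) \<Longrightarrow> \<Phi> l (ten 0 z (cls n y)) = lin (q 0) (weight 0 (\<mu> 0) l z) (\<sigma> n y)"
    by (rule coord[OF \<mu>[of 0]]) (assumption | rule that)+
  have im: "\<Phi> l \<zeta> \<in> mdiff Q 0 ` carrier (q (Suc 0))" for l
  proof (rule ex_0)
    show "\<Phi> l \<zeta> \<in> carrier (q 0)" by (rule hom_in_carrier[OF \<Phi>(1) \<zeta>])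
    \<comment> \<open>Extended linearly, it adds up the coefficients of the terms with label
      \<open>l\<close>. Labels are constant along arrows, so this sum is a cocone and defines
      \<open>\<kappa>\<close> on the colimit over I.\<close>
    let ?\<delta> = "\<lambda>(g, x). if (src cat_I g, x) = l then 1 else (0 :: int)"
    have k: "(\<lambda>y. lin integer_group ?\<delta> (\<sigma> n y)) \<in> hom (fob P n) integer_group" for n
      by (rule lin_\<sigma>_hom[OF abelian_integer_group]) simp
    have cc: "lin integer_group ?\<delta> (\<sigma> (tgt cat_I u) (far P u y)) = lin integer_group ?\<delta> (\<sigma> (src cat_I u) y)"
      if u: "u \<in> Ar cat_I" and y: "y \<in> carrier (fob P (src cat_I u))" for u y
    proof -
      have "lin integer_group ?\<delta> (\<sigma> (tgt cat_I u) (far P u y)) = lin integer_group (\<lambda>(g, x). ?\<delta> (cmp cat_I u g, x)) (\<sigma> (src cat_I u) y)"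
        by (rule lin_\<sigma>_far[OF abelian_integer_group u y]) simp
      also have "\<dots> = lin integer_group ?\<delta> (\<sigma> (src cat_I u) y)"
      proof (rule Z.lin_cong)
        fix k assume "k \<in> Poly_Mapping.keys (\<sigma> (src cat_I u) y)"
        then have "k \<in> free_gens cat_I P (src cat_I u)" using \<sigma>_keys[OF y] by blast
        then obtain g x where "k = (g, x)" "src cat_I (cmp cat_I u g) = src cat_I g"
          by (rule far_cmp_gens[OF _ u]) simp
        then show "(case k of (g, x) \<Rightarrow> ?\<delta> (cmp cat_I u g, x)) = ?\<delta> k" by simp
      qed simp
      finally show ?thesis .
    qed
    obtain \<kappa> where \<kappa>: "\<kappa> \<in> hom (colim cat_I P) integer_group"
      "\<And>n y. n \<in> Ob cat_I \<Longrightarrow> y \<in> carrier (fob P n) \<Longrightarrow> \<kappa> (colim_class cat_I P n y) = lin integer_group ?\<delta> (\<sigma> n y)"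
      by (rule I.colim_universal[where k = "\<lambda>n y. lin integer_group ?\<delta> (\<sigma> n y)", OF abelian_integer_group k cc])
        (assumption | rule that)+
    \<comment> \<open>On z \<otimes> [y] both sides are the augmentation of z times the sum of the
      coefficients with label \<open>l\<close>, since \<open>\<mu>\<close> and the action of
      \<open>spread g\<close> preserve augmentations.\<close>
    have "maug Q (\<Phi> l \<zeta>) = \<kappa> (aug \<zeta>)"
    proof (rule T_hom_eq[OF _ _ _ \<zeta>, where h = "\<lambda>z. maug Q (\<Phi> l z)" and k = "\<lambda>z. \<kappa> (aug z)"])
      show "(\<lambda>z. maug Q (\<Phi> l z)) \<in> hom (T 0) integer_group"
        using hom_compose[OF \<Phi>(1) eps_hom] by (simp add: comp_def)
      show "(\<lambda>z. \<kappa> (aug z)) \<in> hom (T 0) integer_group"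
        using hom_compose[OF aug_hom \<kappa>(1)] by (simp add: comp_def)
      fix z n y assume z: "z \<in> carrier (q 0)" and y: "y \<in> carrier (fob P n)"
      have wc: "weight 0 (\<mu> 0) l z k \<in> carrier (q 0)" if "k \<in> Poly_Mapping.keys (\<sigma> n y)" for k
        using weight_closed[OF \<mu> z] \<sigma>_keys[OF y] that by blast
      have \<mu>z: "\<mu> 0 z \<in> carrier (q 0)" using mod_hom_closed[OF \<mu> z] by simp
      have "maug Q (\<Phi> l (ten 0 z (cls n y))) = lin integer_group (\<lambda>k. maug Q (weight 0 (\<mu> 0) l z k)) (\<sigma> n y)"
        unfolding \<Phi>(2)[OF z y] by (rule q0.hom_lin[OF eps_hom abelian_integer_group wc])
      also have "\<dots> = lin integer_group (\<lambda>k. maug Q z * ?\<delta> k) (\<sigma> n y)"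
      proof (rule Z.lin_cong)
        fix k assume k: "k \<in> Poly_Mapping.keys (\<sigma> n y)"
        obtain g x where gx: "k = (g, x)" by (rule prod.exhaust)
        have g: "g \<in> Ar cat_I" using \<sigma>_keys[OF y] k gx by (auto simp: free_gens_def)
        show "maug Q (weight 0 (\<mu> 0) l z k) = maug Q z * ?\<delta> k"
          using eps_act[OF spread_closed[OF g] \<mu>z] hom_one_comm[OF eps_hom q_group abelian_integer_group]
          by (simp add: weight_def gx \<mu>e[OF z])
      qed simp
      also have "\<dots> = maug Q z * lin integer_group ?\<delta> (\<sigma> n y)"
        by (rule Z.hom_lin[where h = "\<lambda>i. maug Q z * i", symmetric]) (simp_all add: hom_def abelian_integer_group algebra_simps)
      also have "\<dots> = \<kappa> (aug (ten 0 z (cls n y)))"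
        using hom_int_pow[OF \<kappa>(1) cls_I_closed[OF y] K.is_group group_integer_group, of "maug Q z"] \<kappa>(2)[OF _ y]
        by (simp add: aug_ten[OF z y] cat_I_simps)
      finally show "maug Q (\<Phi> l (ten 0 z (cls n y))) = \<kappa> (aug (ten 0 z (cls n y)))" .
    qed
    also have "\<dots> = 0" using hom_one_comm[OF \<kappa>(1) I.comm_group_colim abelian_integer_group] by (simp add: aug\<zeta>)
    finally show "maug Q (\<Phi> l \<zeta>) = 0" .
  qed
  let ?\<tau> = "tensor_map R (q 0) N (\<lambda>x. act (q 0) (frag_of dbl) (\<mu> 0 x)) (\<lambda>x. x)"
  let ?h0 = "tensor_map R (q (Suc 0)) N (h 0) (\<lambda>x. x)"
  obtain w where w: "w \<in> carrier (T (Suc 0))" "dT 0 w = ?\<tau> \<zeta>"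
    using doubled_boundary[OF \<mu> t \<Phi> \<zeta> im] by blast
  note \<tau>h = tensor_map_left[OF tp tp t] and h0 = tensor_map_left[OF tp tp h[of 0]]
  note cl = hom_in_carrier[OF \<tau>h(1)] hom_in_carrier[OF h0(1)] hom_in_carrier[OF dT_hom]
  have "\<zeta> = ?\<tau> \<zeta> \<otimes>\<^bsub>T 0\<^esub> dT 0 (?h0 \<zeta>)"
    using \<zeta>
  proof (induction rule: T_induct)
    case (ten a n y)
    note y = cls_N[OF ten(2)]
    interpret TP: tensor_product R "q 0" N by (rule tp)
    have c: "act (q 0) (frag_of dbl) (\<mu> 0 a) \<in> carrier (q 0)" "mdiff Q 0 (h 0 a) \<in> carrier (q 0)"
      using mod_hom_closed[OF t ten(1)] mod_hom_closed[OF h] ten(1) d_closed by auto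
    have "ten 0 a (cls n y) = ten 0 (act (q 0) (frag_of dbl) (\<mu> 0 a) \<otimes>\<^bsub>q 0\<^esub> mdiff Q 0 (h 0 a)) (cls n y)"
      using split[OF ten(1)] by (rule arg_cong)
    note eq = this[unfolded TP.tens_mult_left[OF c y]]
    show ?case
      unfolding \<tau>h(2)[OF ten(1) y] h0(2)[OF ten(1) y] dT_ten[OF mod_hom_closed[OF h ten(1)] ten(2)] by (rule eq)
  next
    case (mult u v)
    have "u \<otimes>\<^bsub>T 0\<^esub> v = (?\<tau> u \<otimes>\<^bsub>T 0\<^esub> dT 0 (?h0 u)) \<otimes>\<^bsub>T 0\<^esub> (?\<tau> v \<otimes>\<^bsub>T 0\<^esub> dT 0 (?h0 v))"
      using mult(3,4) by simp
    also have "\<dots> = ?\<tau> (u \<otimes>\<^bsub>T 0\<^esub> v) \<otimes>\<^bsub>T 0\<^esub> dT 0 (?h0 (u \<otimes>\<^bsub>T 0\<^esub> v))"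
      using mult(1,2) by (simp add: hom_mult[OF \<tau>h(1)] hom_mult[OF h0(1)] hom_mult[OF dT_hom] cl T0.m_ac)
    finally show ?case .
  qed
  also have "\<dots> = dT 0 (w \<otimes>\<^bsub>T (Suc 0)\<^esub> ?h0 \<zeta>)"
    using w \<zeta> by (simp add: hom_mult[OF dT_hom] cl)
  finally have "\<zeta> = dT 0 (w \<otimes>\<^bsub>T (Suc 0)\<^esub> ?h0 \<zeta>)" .
  then show ?thesis using w(1) \<zeta> cl(2) by (metis T1.m_closed)
qed

end

section \<open>The bicomplex of two resolutions\<close>

lemma mod_hom_linearize:
  assumes G: "comm_group G" and H: "comm_group H" and h: "h \<in> hom G H"
    and a: "\<And>f x. f \<in> carrier M \<Longrightarrow> x \<in> carrier G \<Longrightarrow> a f x \<in> carrier G"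
    and eq: "\<And>f x. f \<in> carrier M \<Longrightarrow> x \<in> carrier G \<Longrightarrow> h (a f x) = b f (h x)"
  shows "h \<in> mod_hom (monoid_ring M) (linearize G a) (linearize H b)"
proof -
  interpret G: comm_group G by fact
  interpret H: comm_group H by fact
  have "h (lin G (\<lambda>f. a f x) c) = lin H (\<lambda>f. b f (h x)) c" if c: "c \<in> carrier (monoid_ring M)" and x: "x \<in> carrier G" for c x
  proof -
    have k: "f \<in> carrier M" if "f \<in> Poly_Mapping.keys c" for f using c that by (auto simp: carrier_monoid_ring)
    have "h (lin G (\<lambda>f. a f x) c) = lin H (\<lambda>f. h (a f x)) c"
      by (rule G.hom_lin[OF h H a[OF k x]])
    also have "\<dots> = lin H (\<lambda>f. b f (h x)) c"
      by (rule H.lin_cong) (use k x in \<open>simp_all add: eq[symmetric] hom_in_carrier[OF h] a\<close>)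
    finally show ?thesis .
  qed
  moreover have "h \<in> hom (linearize G a) (linearize H b)" using h by (simp add: hom_def)
  ultimately show ?thesis by (simp add: mod_hom_def act_linearize)
qed

lemma mod_hom_colim_map:
  assumes A: "I_functor A" and B: "I_functor B" and t: "nat_trans cat_I A B t"
  shows "colim_map cat_N B t \<in> mod_hom (monoid_ring inj_monoid) (colim_N_module A) (colim_N_module B)"
proof -
  interpret A: I_functor A by fact
  interpret B: I_functor B by fact
  show ?thesis
    unfolding colim_N_module_def
  proof (rule mod_hom_linearize)
    show "colim_map cat_N B t \<in> hom A.colimN B.colimN"
      by (rule colim_map_hom[OF category_cat_N A.N.fctr B.N.fctr nat_trans_cat_N[OF t]])
    show "inj_action A f x \<in> carrier A.colimN" if "f \<in> carrier inj_monoid" "x \<in> carrier A.colimN" for f x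
      by (rule hom_in_carrier[OF A.inj_action_hom[OF that(1)] that(2)])
    show "colim_map cat_N B t (inj_action A f x) = inj_action B f (colim_map cat_N B t x)"
      if "f \<in> carrier inj_monoid" "x \<in> carrier A.colimN" for f x
      by (rule colim_map_inj_action[OF A B t that])
  qed (rule A.N.comm_group_colim B.N.comm_group_colim)+
qed

lemma colim_map_cls:
  assumes "I_functor A" "I_functor B" "nat_trans cat_I A B t" "y \<in> carrier (fob A n)"
  shows "colim_map cat_N B t (colim_class cat_N A n y) = colim_class cat_N B n (t n y)"
    "colim_map cat_I B t (colim_class cat_I A n y) = colim_class cat_I B n (t n y)"
  using assms colim_map_class[OF category_cat_N, of A B t n y] colim_map_class[OF category_cat_I, of A B t n y]
  by (simp_all add: I_functor_def ab_functor_cat_N nat_trans_cat_N cat_I_simps)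

lemma nat_trans_closed:
  "nat_trans cat_I A B t \<Longrightarrow> y \<in> carrier (fob A n) \<Longrightarrow> t n y \<in> carrier (fob B n)"
  by (auto simp: nat_trans_def cat_I_simps intro: hom_in_carrier)

section \<open>Maps of columns induced by natural transformations\<close>

context trivial_resolution
begin

text \<open>Horizontal differentials, row augmentations and the comparison maps in the naturality
  proof are all of this form, so one set of commutation lemmas serves them all.\<close>

definition hT where "hT s B t = tensor_map R (q s) (colim_N_module B) (\<lambda>x. x) (colim_map cat_N B t)"

lemma resolution_functorI: "I_functor A \<Longrightarrow> resolution_functor Q A"
  by (intro resolution_functor.intro trivial_resolution_axioms)

lemma hT_hom:
  assumes "I_functor A" "I_functor B" "nat_trans cat_I A B t"
  shows "hT s B t \<in> hom (tensor R (q s) (colim_N_module A)) (tensor R (q s) (colim_N_module B))"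
  unfolding hT_def
  by (rule tensor_map_hom[OF resolution_functor.tp[OF resolution_functorI[OF assms(1)]]
        resolution_functor.tp[OF resolution_functorI[OF assms(2)]] mod_hom_id mod_hom_colim_map[OF assms]])

lemma hT_ten:
  assumes "I_functor A" "I_functor B" "nat_trans cat_I A B t" and a: "a \<in> carrier (q s)" and y: "y \<in> carrier (fob A n)"
  shows "hT s B t (tensor_product.tens R (q s) (colim_N_module A) a (colim_class cat_N A n y)) =
    tensor_product.tens R (q s) (colim_N_module B) a (colim_class cat_N B n (t n y))"
  unfolding hT_def
  using tensor_map_tens[OF resolution_functor.tp[OF resolution_functorI[OF assms(1)]]
        resolution_functor.tp[OF resolution_functorI[OF assms(2)]] mod_hom_id mod_hom_colim_map[OF assms(1-3)] a
        resolution_functor.cls_N[OF resolution_functorI[OF assms(1)] y]]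
  by (simp add: colim_map_cls[OF assms(1-3) y])

lemma hT_dT:
  assumes A: "I_functor A" and B: "I_functor B" and t: "nat_trans cat_I A B t"
    and z: "z \<in> carrier (tensor R (q (Suc s)) (colim_N_module A))"
  shows "hT s B t (tensor_map R (q s) (colim_N_module A) (mdiff Q s) (\<lambda>x. x) z) =
    tensor_map R (q s) (colim_N_module B) (mdiff Q s) (\<lambda>x. x) (hT (Suc s) B t z)"
proof -
  interpret A: resolution_functor Q A by (rule resolution_functorI[OF A])
  interpret B: resolution_functor Q B by (rule resolution_functorI[OF B])
  show ?thesis
    by (rule A.T_hom_eq[OF _ _ _ z, where h = "\<lambda>z. hT s B t (A.dT s z)" and k = "\<lambda>z. B.dT s (hT (Suc s) B t z)"])
      (use hom_compose[OF A.dT_hom hT_hom[OF A B t]] hom_compose[OF hT_hom[OF A B t] B.dT_hom] in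
        \<open>simp_all add: comp_def A.dT_ten B.dT_ten hT_ten[OF A B t] d_closed nat_trans_closed[OF t]\<close>)
qed

lemma hT_aug:
  assumes A: "I_functor A" and B: "I_functor B" and t: "nat_trans cat_I A B t"
    and z: "z \<in> carrier (tensor R (q 0) (colim_N_module A))"
  shows "resolution_functor.aug Q B (hT 0 B t z) = colim_map cat_I B t (resolution_functor.aug Q A z)"
proof -
  interpret A: resolution_functor Q A by (rule resolution_functorI[OF A])
  interpret B: resolution_functor Q B by (rule resolution_functorI[OF B])
  interpret KA: comm_group "colim cat_I A" by (rule A.I.comm_group_colim)
  interpret KB: comm_group "colim cat_I B" by (rule B.I.comm_group_colim)
  note c = colim_map_hom[OF category_cat_I A.I.fctr B.I.fctr t]
  show ?thesis
    by (rule A.T_hom_eq[OF _ _ _ z, where h = "\<lambda>z. B.aug (hT 0 B t z)" and k = "\<lambda>z. colim_map cat_I B t (A.aug z)"])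
      (use hom_compose[OF A.aug_hom c] hom_compose[OF hT_hom[OF A B t] B.aug_hom] in
        \<open>simp_all add: comp_def A.aug_ten B.aug_ten hT_ten[OF A B t] nat_trans_closed[OF t]
          hom_int_pow[OF c A.cls_I_closed KA.is_group KB.is_group] colim_map_cls[OF A B t]\<close>)
qed

text \<open>Stated for a square with two different middle functors, because the naturality proof
  needs the squares of a chain map and of the augmentations. It is checked on tensors with
  classes.\<close>

lemma hT_comp:
  assumes A: "I_functor A" and B: "I_functor B" and D: "I_functor D"
    and t: "nat_trans cat_I A B t" and u: "nat_trans cat_I B D u"
    and B': "I_functor B'" and t': "nat_trans cat_I A B' t'" and u': "nat_trans cat_I B' D u'"
    and eq: "\<And>n y. y \<in> carrier (fob A n) \<Longrightarrow> u n (t n y) = u' n (t' n y)"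
    and z: "z \<in> carrier (tensor R (q s) (colim_N_module A))"
  shows "hT s D u (hT s B t z) = hT s D u' (hT s B' t' z)"
proof -
  interpret A: resolution_functor Q A by (rule resolution_functorI[OF A])
  show ?thesis
    by (rule A.T_hom_eq[OF _ _ _ z, where h = "\<lambda>z. hT s D u (hT s B t z)" and k = "\<lambda>z. hT s D u' (hT s B' t' z)"])
      (use hom_compose[OF hT_hom[OF A B t] hT_hom[OF B D u]] hom_compose[OF hT_hom[OF A B' t'] hT_hom[OF B' D u']] in
        \<open>simp_all add: comp_def hT_ten[OF A B t] hT_ten[OF B D u] hT_ten[OF A B' t'] hT_ten[OF B' D u']
          nat_trans_closed[OF t] nat_trans_closed[OF t'] eq\<close>)
qed

lemma hT_null:
  assumes A: "I_functor A" and B: "I_functor B" and D: "I_functor D"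
    and t: "nat_trans cat_I A B t" and u: "nat_trans cat_I B D u"
    and eq: "\<And>n y. y \<in> carrier (fob A n) \<Longrightarrow> u n (t n y) = \<one>\<^bsub>fob D n\<^esub>"
    and z: "z \<in> carrier (tensor R (q s) (colim_N_module A))"
  shows "hT s D u (hT s B t z) = \<one>\<^bsub>tensor R (q s) (colim_N_module D)\<^esub>"
proof -
  interpret A: resolution_functor Q A by (rule resolution_functorI[OF A])
  interpret D: resolution_functor Q D by (rule resolution_functorI[OF D])
  have one: "D.ten s a (D.cls n \<one>\<^bsub>fob D n\<^esub>) = \<one>\<^bsub>D.T s\<^esub>" if a: "a \<in> carrier (q s)" for a n
    using hom_one_comm[OF D.cls_hom D.grp D.N.comm_group_colim, of n]
      hom_one_comm[OF tensor_product.tens_hom_right[OF D.tp a] left_module_comm_group[OF D.left_module_colimN] D.T_group] by simp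
  show ?thesis
    by (rule A.T_hom_eq[OF _ _ _ z, where h = "\<lambda>z. hT s D u (hT s B t z)" and H = "D.T s"])
      (use hom_compose[OF hT_hom[OF A B t] hT_hom[OF B D u]] D.trivial_hom[OF D.T_group] in
        \<open>simp_all add: comp_def hT_ten[OF A B t] hT_ten[OF B D u] nat_trans_closed[OF t] eq one\<close>)
qed

end

section \<open>The bicomplex of a resolution of F and one of the trivial module\<close>

locale resolved = trivial_resolution Q
  for Q :: "((nat \<Rightarrow> nat) \<Rightarrow>\<^sub>0 int, 'c, int) mod_res" +
  fixes F :: "(nat, arrow, 'a) abfun" and P :: "(nat, arrow, 'b, 'a) fun_res"
  assumes F: "ab_functor cat_I F" and P: "proj_resolution cat_I F P"
begin

lemma IF: "I_functor F"
  by (rule I_functor.intro[OF F])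

lemma proj_P: "proj_functor cat_I (fres P n)"
  and fdiff: "nat_trans cat_I (fres P (Suc n)) (fres P n) (fdiff P n)"
  and faug: "nat_trans cat_I (fres P 0) F (faug P)"
  using P by (simp_all add: proj_resolution_def)

lemma IP: "I_functor (fres P n)"
  using proj_P[of n] by (intro I_functor.intro) (simp add: proj_functor_def)

lemma pointwise_exact:
  "exact_augmented (\<lambda>n. fob (fres P n) c) (\<lambda>n. fdiff P n c) (fob F c) (faug P c)"
  using P by (simp add: proj_resolution_def cat_I_simps)

lemma faug_surj: "x \<in> carrier (fob F c) \<Longrightarrow> \<exists>y\<in>carrier (fob (fres P 0) c). faug P c y = x"
  using pointwise_exact[of c] unfolding exact_augmented_def by (metis imageE)

lemma ker_faug: "kernel (fob (fres P 0) c) (fob F c) (faug P c) = fdiff P 0 c ` carrier (fob (fres P (Suc 0)) c)"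
  and ker_fdiff: "kernel (fob (fres P (Suc n)) c) (fob (fres P n) c) (fdiff P n c) =
    fdiff P (Suc n) c ` carrier (fob (fres P (Suc (Suc n))) c)"
  using pointwise_exact[of c] unfolding exact_augmented_def One_nat_def by blast+

lemma faug_exact:
  "y \<in> carrier (fob (fres P 0) c) \<Longrightarrow> faug P c y = \<one>\<^bsub>fob F c\<^esub> \<Longrightarrow> \<exists>w\<in>carrier (fob (fres P (Suc 0)) c). fdiff P 0 c w = y"
  using eqset_imp_iff[OF ker_faug[of c], of y] by (auto simp: kernel_def)

lemma fdiff_exact:
  "y \<in> carrier (fob (fres P (Suc n)) c) \<Longrightarrow> fdiff P n c y = \<one>\<^bsub>fob (fres P n) c\<^esub> \<Longrightarrow>
    \<exists>w\<in>carrier (fob (fres P (Suc (Suc n))) c). fdiff P (Suc n) c w = y"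
  using eqset_imp_iff[OF ker_fdiff[of n c], of y] by (auto simp: kernel_def)

lemma faug_fdiff: "y \<in> carrier (fob (fres P (Suc 0)) c) \<Longrightarrow> faug P c (fdiff P 0 c y) = \<one>\<^bsub>fob F c\<^esub>"
  using ker_faug[of c] by (auto simp: kernel_def)

lemma fdiff_fdiff: "y \<in> carrier (fob (fres P (Suc (Suc n))) c) \<Longrightarrow> fdiff P n c (fdiff P (Suc n) c y) = \<one>\<^bsub>fob (fres P n) c\<^esub>"
  using ker_fdiff[of n c] by (auto simp: kernel_def)

abbreviation C :: "nat \<Rightarrow> nat \<Rightarrow> ('c \<times> (nat \<Rightarrow> 'b) set \<Rightarrow>\<^sub>0 int) set monoid"
  where "C s t \<equiv> tensor R (q s) (colim_N_module (fres P t))"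

abbreviation dv :: "nat \<Rightarrow> nat \<Rightarrow> ('c \<times> (nat \<Rightarrow> 'b) set \<Rightarrow>\<^sub>0 int) set \<Rightarrow> ('c \<times> (nat \<Rightarrow> 'b) set \<Rightarrow>\<^sub>0 int) set"
  where "dv s t \<equiv> tensor_map R (q s) (colim_N_module (fres P t)) (mdiff Q s) (\<lambda>x. x)"

abbreviation dh :: "nat \<Rightarrow> nat \<Rightarrow> ('c \<times> (nat \<Rightarrow> 'b) set \<Rightarrow>\<^sub>0 int) set \<Rightarrow> ('c \<times> (nat \<Rightarrow> 'b) set \<Rightarrow>\<^sub>0 int) set"
  where "dh s t \<equiv> hT s (fres P t) (fdiff P t)"

text \<open>The two edges are by definition the complexes whose homology is
  \<open>derived_colim\<close> and \<open>Tor\<close>. The rows need the projectivity of the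
  \<open>q s\<close> and the exactness of the colimit along N; the lifting property of the
  \<open>fres P t\<close> is needed for the columns.\<close>

sublocale bicomplex "colim_cx cat_I P" "colim_diff cat_I P"
  "tensor_cx R Q (colim_N_module F)" "tensor_diff R Q (colim_N_module F)"
  C dv dh "\<lambda>t. resolution_functor.aug Q (fres P t)" "\<lambda>s. hT s F (faug P)"
proof -
  note RP = resolution_functorI[OF IP]
  interpret F: resolution_functor Q F by (rule resolution_functorI[OF IF])
  have cd: "colim_diff cat_I P n \<in> hom (colim cat_I (fres P (Suc n))) (colim cat_I (fres P n))" for n
    unfolding colim_diff_def
    by (rule colim_map_hom[OF category_cat_I I_functor.fctr_I[OF IP] I_functor.fctr_I[OF IP] fdiff])
  have cc: "colim_diff cat_I P n (colim_class cat_I (fres P (Suc n)) c x) = colim_class cat_I (fres P n) c (fdiff P n c x)"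
    if "x \<in> carrier (fob (fres P (Suc n)) c)" for n c x
    unfolding colim_diff_def by (rule colim_map_cls(2)[OF IP IP fdiff that])
  have kg: "comm_group (colim cat_I (fres P n))" for n
  proof -
    interpret P: I_functor "fres P n" by (rule IP)
    show ?thesis by (rule P.I.comm_group_colim)
  qed
  have cX: "chain_complex (colim_cx cat_I P) (colim_diff cat_I P)"
    unfolding colim_cx_def
  proof (rule chain_complex.intro)
    fix n x assume x: "x \<in> carrier (colim cat_I (fres P (Suc (Suc n))))"
    interpret P2: I_functor "fres P (Suc (Suc n))" by (rule IP)
    interpret P0: I_functor "fres P n" by (rule IP)
    have one: "colim_class cat_I (fres P n) c \<one>\<^bsub>fob (fres P n) c\<^esub> = \<one>\<^bsub>colim cat_I (fres P n)\<^esub>" for c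
      by (rule hom_one_comm[OF P0.I.colim_class_hom P0.grp P0.I.comm_group_colim]) (simp add: cat_I_simps)
    show "colim_diff cat_I P n (colim_diff cat_I P (Suc n) x) = \<one>\<^bsub>colim cat_I (fres P n)\<^esub>"
      by (rule P2.I.colim_hom_eq[OF _ _ _ _ x, where h = "\<lambda>x. colim_diff cat_I P n (colim_diff cat_I P (Suc n) x)"
            and H = "colim cat_I (fres P n)"])
        (use hom_compose[OF cd cd] F.trivial_hom[OF kg] in
          \<open>simp_all add: comp_def cat_I_simps cc nat_trans_closed[OF fdiff] fdiff_fdiff one\<close>)
  qed (rule kg cd)+
  have cY: "chain_complex (tensor_cx R Q (colim_N_module F)) (tensor_diff R Q (colim_N_module F))"
    unfolding tensor_cx_def tensor_diff_def
    by (rule chain_complex.intro) (simp_all add: F.T_group F.dT_hom F.dT_dT)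
  have "bicomplex_axioms (colim_cx cat_I P) (colim_diff cat_I P)
    (tensor_cx R Q (colim_N_module F)) (tensor_diff R Q (colim_N_module F))
    C dv dh (\<lambda>t. resolution_functor.aug Q (fres P t)) (\<lambda>s. hT s F (faug P))"
    unfolding colim_cx_def tensor_cx_def tensor_diff_def
  proof (rule bicomplex_axioms.intro)
    show "comm_group (C s t)" for s t by (rule resolution_functor.T_group[OF RP])
    show "dv s t \<in> hom (C (Suc s) t) (C s t)" for s t by (rule resolution_functor.dT_hom[OF RP])
    show "dh s t \<in> hom (C s (Suc t)) (C s t)" for s t by (rule hT_hom[OF IP IP fdiff])
    show "resolution_functor.aug Q (fres P t) \<in> hom (C 0 t) (colim cat_I (fres P t))" for t
      by (rule resolution_functor.aug_hom[OF RP])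
    show "hT s F (faug P) \<in> hom (C s 0) (F.T s)" for s by (rule hT_hom[OF IP IF faug])
    show "dv s t (dh (Suc s) t z) = dh s t (dv s (Suc t) z)" if "z \<in> carrier (C (Suc s) (Suc t))" for s t z
      by (rule hT_dT[OF IP IP fdiff that, symmetric])
    show "resolution_functor.aug Q (fres P t) (dh 0 t z) = colim_diff cat_I P t (resolution_functor.aug Q (fres P (Suc t)) z)"
      if "z \<in> carrier (C 0 (Suc t))" for t z
      unfolding colim_diff_def by (rule hT_aug[OF IP IP fdiff that])
    show "hT s F (faug P) (dv s 0 z) = F.dT s (hT (Suc s) F (faug P) z)" if "z \<in> carrier (C (Suc s) 0)" for s z
      by (rule hT_dT[OF IP IF faug that])
    show "dv s t (dv (Suc s) t z) = \<one>\<^bsub>C s t\<^esub>" if "z \<in> carrier (C (Suc (Suc s)) t)" for s t z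
      by (rule resolution_functor.dT_dT[OF RP that])
    show "dh s t (dh s (Suc t) z) = \<one>\<^bsub>C s t\<^esub>" if "z \<in> carrier (C s (Suc (Suc t)))" for s t z
      by (rule hT_null[OF IP IP IP fdiff fdiff fdiff_fdiff that])
    show "resolution_functor.aug Q (fres P t) (dv 0 t z) = \<one>\<^bsub>colim cat_I (fres P t)\<^esub>" if "z \<in> carrier (C (Suc 0) t)" for t z
      by (rule resolution_functor.aug_dT[OF RP that])
    show "hT s F (faug P) (dh s 0 z) = \<one>\<^bsub>F.T s\<^esub>" if "z \<in> carrier (C s (Suc 0))" for s z
      by (rule hT_null[OF IP IP IF fdiff faug faug_fdiff that])
    show "\<exists>z\<in>carrier (C 0 t). resolution_functor.aug Q (fres P t) z = x" if "x \<in> carrier (colim cat_I (fres P t))" for t x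
      by (rule resolution_functor.aug_surj[OF RP that])
    show "\<exists>z\<in>carrier (C s 0). hT s F (faug P) z = y" if y: "y \<in> carrier (F.T s)" for s y
      unfolding hT_def
    proof (rule tensor_surj[OF qR I_functor.left_module_colimN[OF IP] F.left_module_colimN mod_hom_colim_map[OF IP IF faug] _ y])
      fix v assume "v \<in> carrier (colim_N_module F)"
      then show "\<exists>w\<in>carrier (colim_N_module (fres P 0)). colim_map cat_N F (faug P) w = v"
        using colimN_surj[OF IP IF faug faug_surj] by simp
    qed
    show "\<exists>w\<in>carrier (C (Suc 0) t). dv 0 t w = z"
      if z: "z \<in> carrier (C 0 t)" "resolution_functor.aug Q (fres P t) z = \<one>\<^bsub>colim cat_I (fres P t)\<^esub>" for t z
    proof -
      interpret P: resolution_functor Q "fres P t" by (rule RP)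
      \<comment> \<open>The section comes from the projectivity of \<open>fres P t\<close> and turns
        this functor into an instance of \<open>column\<close>.\<close>
      obtain \<sigma> where \<sigma>: "nat_trans cat_I (fres P t) (free_functor cat_I (fres P t)) \<sigma>"
        "\<And>c x. c \<in> Ob cat_I \<Longrightarrow> x \<in> carrier (fob (fres P t) c) \<Longrightarrow> P.I.free_eval c (\<sigma> c x) = x"
        by (rule P.I.proj_functor_section[OF proj_P]) (assumption | rule that)+
      interpret column Q "fres P t" \<sigma> by unfold_locales (use \<sigma> in \<open>simp_all add: cat_I_simps\<close>)
      show ?thesis by (rule column_exact_0[OF z])
    qed
    show "\<exists>w\<in>carrier (C (Suc (Suc s)) t). dv (Suc s) t w = z"
      if z: "z \<in> carrier (C (Suc s) t)" "dv s t z = \<one>\<^bsub>C s t\<^esub>" for s t z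
    proof -
      interpret P: resolution_functor Q "fres P t" by (rule RP)
      obtain \<sigma> where \<sigma>: "nat_trans cat_I (fres P t) (free_functor cat_I (fres P t)) \<sigma>"
        "\<And>c x. c \<in> Ob cat_I \<Longrightarrow> x \<in> carrier (fob (fres P t) c) \<Longrightarrow> P.I.free_eval c (\<sigma> c x) = x"
        by (rule P.I.proj_functor_section[OF proj_P]) (assumption | rule that)+
      interpret column Q "fres P t" \<sigma> by unfold_locales (use \<sigma> in \<open>simp_all add: cat_I_simps\<close>)
      show ?thesis by (rule column_exact[OF z])
    qed
    show "\<exists>w\<in>carrier (C s (Suc 0)). dh s 0 w = z"
      if z: "z \<in> carrier (C s 0)" "hT s F (faug P) z = \<one>\<^bsub>F.T s\<^esub>" for s z
      unfolding hT_def
    proof (rule tensor_exact[OF proj I_functor.left_module_colimN[OF IP] I_functor.left_module_colimN[OF IP] F.left_module_colimN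
          mod_hom_colim_map[OF IP IP fdiff] mod_hom_colim_map[OF IP IF faug] _ z[unfolded hT_def]])
      fix v assume "v \<in> carrier (colim_N_module (fres P 0))" "colim_map cat_N F (faug P) v = \<one>\<^bsub>colim_N_module F\<^esub>"
      then show "\<exists>w\<in>carrier (colim_N_module (fres P (Suc 0))). colim_map cat_N (fres P 0) (fdiff P 0) w = v"
        using colimN_exact[OF IP IP IF fdiff faug faug_exact] by simp
    qed
    show "\<exists>w\<in>carrier (C s (Suc (Suc t))). dh s (Suc t) w = z"
      if z: "z \<in> carrier (C s (Suc t))" "dh s t z = \<one>\<^bsub>C s t\<^esub>" for s t z
      unfolding hT_def
    proof (rule tensor_exact[OF proj I_functor.left_module_colimN[OF IP] I_functor.left_module_colimN[OF IP]
          I_functor.left_module_colimN[OF IP] mod_hom_colim_map[OF IP IP fdiff] mod_hom_colim_map[OF IP IP fdiff] _ z[unfolded hT_def]])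
      fix v assume "v \<in> carrier (colim_N_module (fres P (Suc t)))"
        "colim_map cat_N (fres P t) (fdiff P t) v = \<one>\<^bsub>colim_N_module (fres P t)\<^esub>"
      then show "\<exists>w\<in>carrier (colim_N_module (fres P (Suc (Suc t)))). colim_map cat_N (fres P (Suc t)) (fdiff P (Suc t)) w = v"
        using colimN_exact[OF IP IP IP fdiff fdiff fdiff_exact] by simp
    qed
  qed
  then show "bicomplex (colim_cx cat_I P) (colim_diff cat_I P)
    (tensor_cx R Q (colim_N_module F)) (tensor_diff R Q (colim_N_module F))
    C dv dh (\<lambda>t. resolution_functor.aug Q (fres P t)) (\<lambda>s. hT s F (faug P))"
    using cX cY by (simp add: bicomplex_def)
qed

definition derived_iso :: "nat \<Rightarrow> (nat \<Rightarrow> 'b) set set \<Rightarrow> ('c \<times> (nat \<Rightarrow> 'a) set \<Rightarrow>\<^sub>0 int) set set"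
  where "derived_iso p = zigzag_map p"

lemma derived_iso:
  "derived_iso p \<in> iso (derived_colim cat_I P p) (Tor R Q (colim_N_module F) p)"
  unfolding derived_colim_def Tor_def derived_iso_def by (rule zigzag_map_iso)

end

text \<open>The lift \<open>t\<close> induces a map of bicomplexes that restricts to the map of
  \<open>t\<close> on one edge and to that of \<open>u\<close> on the other. Its horizontal squares
  are the chain map condition, and its square at the row augmentation says that \<open>t\<close>
  covers \<open>u\<close>.\<close>

lemma (in trivial_resolution) derived_iso_res_lift:
  assumes P: "resolved Q F P" and P': "resolved Q G P'"
    and u: "nat_trans cat_I F G u" and t: "res_lift cat_I F P P' u t"
    and z: "z \<in> carrier (derived_colim cat_I P p)"
  shows "resolved.derived_iso Q G P' p (derived_colim_map cat_I P' t p z) =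
    Tor_map R Q (colim_N_module G) (colim_map cat_N G u) p (resolved.derived_iso Q F P p z)"
proof -
  interpret P: resolved Q F P by fact
  interpret P': resolved Q G P' by fact
  interpret F: resolution_functor Q F by (rule resolution_functorI[OF P.IF])
  have tn: "nat_trans cat_I (fres P n) (fres P' n) (t n)" for n using t by (simp add: res_lift_def)
  have td: "t n c (fdiff P n c x) = fdiff P' n c (t (Suc n) c x)" if "x \<in> carrier (fob (fres P (Suc n)) c)" for n c x
    using t that by (simp add: res_lift_def cat_I_simps)
  have tu: "faug P' c (t 0 c x) = u c (faug P c x)" if "x \<in> carrier (fob (fres P 0) c)" for c x
    using t that by (simp add: res_lift_def cat_I_simps)
  have ch: "colim_map cat_I (fres P' n) (t n) \<in> hom (colim cat_I (fres P n)) (colim cat_I (fres P' n))" for n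
    by (rule colim_map_hom[OF category_cat_I I_functor.fctr_I[OF P.IP] I_functor.fctr_I[OF P'.IP] tn])
  have cd: "colim_diff cat_I P n \<in> hom (colim cat_I (fres P (Suc n))) (colim cat_I (fres P n))"
    "colim_diff cat_I P' n \<in> hom (colim cat_I (fres P' (Suc n))) (colim cat_I (fres P' n))" for n
    using P.L.diff_hom[of n] P'.L.diff_hom[of n] by (simp_all add: colim_cx_def)
  show ?thesis
    unfolding derived_colim_map_def Tor_map_def P.derived_iso_def P'.derived_iso_def
  proof (rule zigzag_map_natural[OF P.bicomplex_axioms P'.bicomplex_axioms,
        where T = "\<lambda>s k. hT s (fres P' k) (t k)"])
    show "hT s (fres P' k) (t k) z \<in> carrier (P'.C s k)" if "z \<in> carrier (P.C s k)" for s k z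
      by (rule hom_in_carrier[OF hT_hom[OF P.IP P'.IP tn] that])
    show "hT s (fres P' k) (t k) (P.dv s k z) = P'.dv s k (hT (Suc s) (fres P' k) (t k) z)"
      if "z \<in> carrier (P.C (Suc s) k)" for s k z
      by (rule hT_dT[OF P.IP P'.IP tn that])
    show "hT s (fres P' k) (t k) (P.dh s k z) = P'.dh s k (hT s (fres P' (Suc k)) (t (Suc k)) z)"
      if "z \<in> carrier (P.C s (Suc k))" for s k z
      by (rule hT_comp[OF P.IP P.IP P'.IP P.fdiff tn P'.IP tn P'.fdiff td that])
    show "colim_map cat_I (fres P' k) (t k) (resolution_functor.aug Q (fres P k) z) =
        resolution_functor.aug Q (fres P' k) (hT 0 (fres P' k) (t k) z)" if "z \<in> carrier (P.C 0 k)" for k z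
      by (rule hT_aug[OF P.IP P'.IP tn that, symmetric])
    show "tensor_map R (q s) (colim_N_module G) (\<lambda>a. a) (colim_map cat_N G u) (hT s F (faug P) z) =
        hT s G (faug P') (hT s (fres P' 0) (t 0) z)" if "z \<in> carrier (P.C s 0)" for s z
      by (rule hT_comp[OF P.IP P.IF P'.IF P.faug u P'.IP tn P'.faug tu[symmetric] that, unfolded hT_def[of s G u]])
    show "colim_map cat_I (fres P' n) (t n) \<in> hom (colim_cx cat_I P n) (colim_cx cat_I P' n)" for n
      unfolding colim_cx_def by (rule ch)
    show "colim_map cat_I (fres P' n) (t n) (colim_diff cat_I P n x) =
        colim_diff cat_I P' n (colim_map cat_I (fres P' (Suc n)) (t (Suc n)) x)"
      if x: "x \<in> carrier (colim_cx cat_I P (Suc n))" for n x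
    proof -
      interpret P1: I_functor "fres P (Suc n)" by (rule P.IP)
      have x': "x \<in> carrier (colim cat_I (fres P (Suc n)))" using x by (simp add: colim_cx_def)
      show ?thesis
        by (rule P1.I.colim_hom_eq[OF _ _ _ _ x', where h = "\<lambda>x. colim_map cat_I (fres P' n) (t n) (colim_diff cat_I P n x)"
            and k = "\<lambda>x. colim_diff cat_I P' n (colim_map cat_I (fres P' (Suc n)) (t (Suc n)) x)"])
          (use hom_compose[OF cd(1) ch] hom_compose[OF ch cd(2)] in
            \<open>simp_all add: comp_def cat_I_simps colim_diff_def colim_map_cls[OF P.IP P.IP P.fdiff] colim_map_cls[OF P.IP P'.IP tn]
              colim_map_cls[OF P'.IP P'.IP P'.fdiff] nat_trans_closed[OF P.fdiff] nat_trans_closed[OF tn] td\<close>)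
    qed
    show "tensor_map R (q n) (colim_N_module G) (\<lambda>a. a) (colim_map cat_N G u) \<in>
        hom (tensor_cx R Q (colim_N_module F) n) (tensor_cx R Q (colim_N_module G) n)" for n
      unfolding tensor_cx_def by (rule hT_hom[OF P.IF P'.IF u, unfolded hT_def])
    show "tensor_map R (q n) (colim_N_module G) (\<lambda>a. a) (colim_map cat_N G u) (tensor_diff R Q (colim_N_module F) n x) =
        tensor_diff R Q (colim_N_module G) n (tensor_map R (q (Suc n)) (colim_N_module G) (\<lambda>a. a) (colim_map cat_N G u) x)"
      if "x \<in> carrier (tensor_cx R Q (colim_N_module F) (Suc n))" for n x
      unfolding tensor_diff_def
      by (rule hT_dT[OF P.IF P'.IF u that[unfolded tensor_cx_def], unfolded hT_def])
    show "z \<in> carrier (homology (colim_cx cat_I P) (colim_diff cat_I P) p)" using z by (simp add: derived_colim_def)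
  qed
qed

text \<open>The family \<open>\<theta>\<close> is chosen before F and its resolution, which is what
  gives naturality a meaning. Taking both functors equal and \<open>u\<close> the identity, the
  second clause also compares two resolutions of one functor.\<close>

theorem proposition5p4:
  fixes Q :: "((nat \<Rightarrow> nat) \<Rightarrow>\<^sub>0 int, 'c, int) mod_res"
    and p :: nat
  assumes "proj_right_resolution (monoid_ring inj_monoid) trivial_module Q"
  shows "\<exists>\<theta> :: (nat, arrow, 'a) abfun \<Rightarrow> (nat, arrow, 'b, 'a) fun_res \<Rightarrow>
             (nat \<Rightarrow> 'b) set set \<Rightarrow> ('c \<times> (nat \<Rightarrow> 'a) set \<Rightarrow>\<^sub>0 int) set set.
    (\<forall>F P. ab_functor cat_I F \<and> proj_resolution cat_I F P \<longrightarrow>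
       \<theta> F P \<in> iso (derived_colim cat_I P p)
                   (Tor (monoid_ring inj_monoid) Q (colim_N_module F) p)) \<and>
    (\<forall>F G P P' u t.
       ab_functor cat_I F \<and> proj_resolution cat_I F P \<and>
       ab_functor cat_I G \<and> proj_resolution cat_I G P' \<and>
       nat_trans cat_I F G u \<and> res_lift cat_I F P P' u t \<longrightarrow>
       (\<forall>z\<in>carrier (derived_colim cat_I P p).
          \<theta> G P' (derived_colim_map cat_I P' t p z) =
          Tor_map (monoid_ring inj_monoid) Q (colim_N_module G) (colim_map cat_N G u) p
            (\<theta> F P z)))"
proof -
  interpret trivial_resolution Q by (rule trivial_resolution.intro[OF assms])
  have res: "resolved Q F P" if "ab_functor cat_I F" "proj_resolution cat_I F P"
    for F :: "(nat, arrow, 'a) abfun" and P :: "(nat, arrow, 'b, 'a) fun_res"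
    by (intro resolved.intro resolved_axioms.intro trivial_resolution_axioms that)
  show ?thesis
  proof (intro exI[of _ "\<lambda>F P. resolved.derived_iso Q F P p"] conjI allI impI ballI; (elim conjE)?)
    show "resolved.derived_iso Q F P p \<in> iso (derived_colim cat_I P p) (Tor R Q (colim_N_module F) p)"
      if "ab_functor cat_I F" "proj_resolution cat_I F P"
      for F :: "(nat, arrow, 'a) abfun" and P :: "(nat, arrow, 'b, 'a) fun_res"
      by (rule resolved.derived_iso[OF res[OF that]])
  qed (rule derived_iso_res_lift[OF res res], assumption+)
qed

end
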